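(* Let $\alpha\ge0$ be a real number. There is a constant $C_1$ depending only on $\alpha$ such that, for every $c>0$, every $f\in L^2(\mathbb R)$ that is $\epsilon_\Omega$-band-limited in $\Omega=[-c,c]$, and every positive integer $N\ge\frac{2c}{\pi}$, we have $$\left(\int_{-1}^1|f(t)-S_Nf(t)|^2\,\omega_\alpha(t)\,dt\right)^{1/2}\le\epsilon_\Omega+C_1\sqrt{\lambda_N^{(\alpha)}(c)}\,(\chi_N(c))^{(1+\alpha)/2}\,\|f\|_{L^2(\mathbb R)} ,$$ where $S_N(f)(x)=\sum_{k=0}^N\langle f,\psi_{k,c}^{(\alpha)}\rangle_{L^2(I,\omega_\alpha)}\,\psi_{k,c}^{(\alpha)}(x)$.
   Context: Let $I=[-1,1]$, $\omega_\alpha(y)=(1-y^2)^\alpha$, $\langle f,g\rangle_{L^2(I,\omega_\alpha)}=\int_{-1}^1f\,\overline g\,\omega_\alpha\,dx$, and $\widehat f(\xi)=\int_{\mathbb R}e^{-ix\xi}f(x)\,dx$ (in the $L^2$ sense). For $\Omega=[-c,c]$, a function $f$ is said to be $\epsilon_\Omega$-band-limited in $\Omega$ if $\frac1{2\pi}\int_{|\xi|>c}|\widehat f(\xi)|^2\,d\xi\le\epsilon_\Omega^2$ (with $\epsilon_\Omega\ge0$). The weighted finite Fourier transform on $L^2(I,\omega_\alpha)$ is $\mathcal F_c^{(\alpha)}f(x)=\int_{-1}^1e^{icxy}f(y)\omega_\alpha(y)\,dy$. It commutes with $\mathcal L_c^{(\alpha,\alpha)}\varphi(x)=(1-x^2)\varphi''(x)-(2\alpha+2)x\varphi'(x)-c^2x^2\varphi(x)$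 on $C^2([-1,1])$. The GPSWFs $\psi_{n,c}^{(\alpha)}$, $n\ge0$, are the real-valued $C^2([-1,1])$ eigenfunctions of $-\mathcal L_c^{(\alpha,\alpha)}$, with eigenvalues $\chi_0(c)<\chi_1(c)<\cdots$, normalized by $\int_{-1}^1(\psi_{n,c}^{(\alpha)})^2\omega_\alpha\,dt=1$. One has $\mathcal F_c^{(\alpha)}\psi_{n,c}^{(\alpha)}=\mu_n^{(\alpha)}(c)\psi_{n,c}^{(\alpha)}$ and sets $\lambda_n^{(\alpha)}(c)=\frac{c}{2\pi}|\mu_n^{(\alpha)}(c)|^2$. *)

theory Defs
  imports "HOL-Analysis.Analysis"
begin

definition L2_line :: "(real \<Rightarrow> complex) \<Rightarrow> bool" where
  "L2_line f \<longleftrightarrow> f \<in> borel_measurable lebesgue \<and> integrable lebesgue (\<lambda>x. (cmod (f x))\<^sup>2)"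

definition L2_line_norm :: "(real \<Rightarrow> complex) \<Rightarrow> real" where
  "L2_line_norm f = sqrt (LINT x|lebesgue. (cmod (f x))\<^sup>2)"

text \<open>
  \<open>is_L2_fourier f g\<close>: the function \<open>g\<close> represents the transform of \<open>f\<close>, that is, \<open>g\<close> is the
  \<open>L\<^sup>2\<close>-limit, as \<open>R\<close> tends to infinity, of the transforms of the (integrable) truncations of \<open>f\<close>
  to \<open>[-R, R]\<close>. Such a \<open>g\<close> is determined up to a null set. The convergence is expressed by a
  nonnegative integral because a Bochner integral would be \<open>0\<close> for a non-integrable function.
\<close>

definition truncated_fourier :: "real \<Rightarrow> (real \<Rightarrow> complex) \<Rightarrow> real \<Rightarrow> complex" where
  "truncated_fourier R f \<xi> =
     (LINT x:{-R..R}|lebesgue. exp (- (\<i> * complex_of_real (x * \<xi>))) * f x)"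

definition is_L2_fourier :: "(real \<Rightarrow> complex) \<Rightarrow> (real \<Rightarrow> complex) \<Rightarrow> bool" where
  "is_L2_fourier f g \<longleftrightarrow> L2_line f \<and> L2_line g \<and>
     ((\<lambda>R. \<integral>\<^sup>+ \<xi>. ennreal ((cmod (truncated_fourier R f \<xi> - g \<xi>))\<^sup>2) \<partial>lebesgue) \<longlongrightarrow> 0) at_top"

definition eps_band_limited :: "real \<Rightarrow> real \<Rightarrow> (real \<Rightarrow> complex) \<Rightarrow> bool" where
  "eps_band_limited \<epsilon> c f \<longleftrightarrow>
     (\<exists>g. is_L2_fourier f g \<and>
          1 / (2 * pi) * (LINT \<xi>:{\<xi>. \<bar>\<xi>\<bar> > c}|lebesgue. (cmod (g \<xi>))\<^sup>2) \<le> \<epsilon>\<^sup>2)"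

text \<open>
  For \<open>\<alpha> = 0\<close> this is \<open>0\<close> instead of \<open>1\<close> at the two endpoints, since \<open>0 powr 0 = 0\<close>; the weight
  is only used under integrals.
\<close>

definition weight :: "real \<Rightarrow> real \<Rightarrow> real" where
  "weight \<alpha> y = (1 - y\<^sup>2) powr \<alpha>"

definition weighted_inner :: "real \<Rightarrow> (real \<Rightarrow> complex) \<Rightarrow> (real \<Rightarrow> complex) \<Rightarrow> complex" where
  "weighted_inner \<alpha> f g =
     (LINT x:{-1..1}|lebesgue. f x * cnj (g x) * complex_of_real (weight \<alpha> x))"

definition weighted_norm :: "real \<Rightarrow> (real \<Rightarrow> complex) \<Rightarrow> real" where
  "weighted_norm \<alpha> f = sqrt (LINT x:{-1..1}|lebesgue. (cmod (f x))\<^sup>2 * weight \<alpha> x)"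

definition weighted_finite_fourier ::
  "real \<Rightarrow> real \<Rightarrow> (real \<Rightarrow> complex) \<Rightarrow> real \<Rightarrow> complex" where
  "weighted_finite_fourier \<alpha> c f x =
     (LINT y:{-1..1}|lebesgue.
        exp (\<i> * complex_of_real (c * x * y)) * f y * complex_of_real (weight \<alpha> y))"

text \<open>Derivatives on \<open>[-1, 1]\<close> are one-sided at the endpoints.\<close>

definition deriv_I :: "(real \<Rightarrow> real) \<Rightarrow> real \<Rightarrow> real" where
  "deriv_I \<phi> x = vector_derivative \<phi> (at x within {-1..1})"

definition C2_I :: "(real \<Rightarrow> real) \<Rightarrow> bool" where
  "C2_I \<phi> \<longleftrightarrow> \<phi> differentiable_on {-1..1} \<and> deriv_I \<phi> differentiable_on {-1..1} \<and>
     continuous_on {-1..1} (deriv_I (deriv_I \<phi>))"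

definition prolate_op :: "real \<Rightarrow> real \<Rightarrow> (real \<Rightarrow> real) \<Rightarrow> real \<Rightarrow> real" where
  "prolate_op \<alpha> c \<phi> x =
     (1 - x\<^sup>2) * deriv_I (deriv_I \<phi>) x - (2 * \<alpha> + 2) * x * deriv_I \<phi> x - c\<^sup>2 * x\<^sup>2 * \<phi> x"

definition prolate_eigenpair :: "real \<Rightarrow> real \<Rightarrow> real \<Rightarrow> (real \<Rightarrow> real) \<Rightarrow> bool" where
  "prolate_eigenpair \<alpha> c \<kappa> \<phi> \<longleftrightarrow>
     C2_I \<phi> \<and> (\<exists>x\<in>{-1..1}. \<phi> x \<noteq> 0) \<and> (\<forall>x\<in>{-1..1}. - prolate_op \<alpha> c \<phi> x = \<kappa> * \<phi> x)"

text \<open>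
  \<open>ev\<close> lists all eigenvalues in increasing order, and \<open>\<psi> n\<close> is a normalized eigenfunction for
  \<open>ev n\<close>. Each \<open>\<psi> n\<close> is determined on \<open>[-1, 1]\<close> up to sign.
\<close>

definition gpswf_system :: "real \<Rightarrow> real \<Rightarrow> (nat \<Rightarrow> real) \<Rightarrow> (nat \<Rightarrow> real \<Rightarrow> real) \<Rightarrow> bool" where
  "gpswf_system \<alpha> c ev \<psi> \<longleftrightarrow>
     strict_mono ev \<and>
     (\<forall>n. prolate_eigenpair \<alpha> c (ev n) (\<psi> n)) \<and>
     (\<forall>\<kappa> \<phi>. prolate_eigenpair \<alpha> c \<kappa> \<phi> \<longrightarrow> \<kappa> \<in> range ev) \<and>
     (\<forall>n. (LINT t:{-1..1}|lebesgue. (\<psi> n t)\<^sup>2 * weight \<alpha> t) = 1)"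

definition fourier_eigenvalue :: "real \<Rightarrow> real \<Rightarrow> (real \<Rightarrow> real) \<Rightarrow> complex" where
  "fourier_eigenvalue \<alpha> c \<phi> =
     (THE m. \<forall>x\<in>{-1..1}.
        weighted_finite_fourier \<alpha> c (\<lambda>y. complex_of_real (\<phi> y)) x = m * complex_of_real (\<phi> x))"

definition concentration_eigenvalue :: "real \<Rightarrow> real \<Rightarrow> (real \<Rightarrow> real) \<Rightarrow> real" where
  "concentration_eigenvalue \<alpha> c \<phi> = c / (2 * pi) * (cmod (fourier_eigenvalue \<alpha> c \<phi>))\<^sup>2"

definition gpswf_partial_sum ::
  "real \<Rightarrow> (nat \<Rightarrow> real \<Rightarrow> real) \<Rightarrow> nat \<Rightarrow> (real \<Rightarrow> complex) \<Rightarrow> real \<Rightarrow> complex" where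
  "gpswf_partial_sum \<alpha> \<psi> N f x =
     (\<Sum>k=0..N. weighted_inner \<alpha> f (\<lambda>y. complex_of_real (\<psi> k y)) * complex_of_real (\<psi> k x))"

end

(*
  Put T = F* F for the finite Fourier transform F; it commutes with the prolate operator, so
  T psi_k = lambda_k psi_k with lambda_k = |mu_k|^2. The entire extension of psi_k solves the prolate
  equation also for x > 1, where a Bessel-type asymptotic shows that the amplitude of
  psi_k / psi_k(1) at infinity is const(alpha, c) / lambda_k. Comparing the solutions for two
  eigenvalues on (1, infinity) (Liouville normal form, energy and convexity estimates) therefore gives
  the decay lambda_k (chi_k / chi_N)^(alpha + 1) <= C chi_N lambda_N for k > N, as soon as chi_N dominates
  1 and c^2. Picone's identity yields chi_N >= N^2 / (4 pi^2), so this applies for N >= 2 c / pi.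

  By Plancherel the part of f with frequencies outside [-c, c] contributes at most epsilon. For the
  band-limited part f_c and h = (1 - S_N) f_c, the norm ||h||^2 = <h, f_c> is at most
  (c / 2 pi)^(1/2) ||f|| ||F h|| with the unweighted norm of F h on [-1, 1]. Splitting h dyadically
  according to the size of chi_k and using ||H||^2_dy <= C Lambda^alpha ||H||^2_alpha for
  combinations H of the psi_k with chi_k <= Lambda, the decay estimate bounds ||F h|| by a convergent
  geometric series. The tail of h is controlled by the completeness of the psi_k, which follows from
  the compactness of T: every eigenspace of T is invariant under the differential operator.
*)

theory Submission
  imports Defs "HOL-Probability.Probability" "HOL-Complex_Analysis.Complex_Analysis"
begin


section \<open>The prolate equation beyond the interval\<close>

text \<open>The exponents fit as follows. Passing from the weighted to the unweighted norm costs
  \<open>Lam powr al\<close> on a block of eigenvalues up to \<open>Lam\<close>, while the decay of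
  \<open>lam\<close> gains the power \<open>al + 1\<close> of \<open>ev k / ev N\<close>. One full
  power is left over, so the blocks sum geometrically. What remains is \<open>ev N powr al\<close>
  from the norm times \<open>ev N\<close> from the decay estimate, and the square root of the
  product is the factor in the claim. All constants must be independent of \<open>c\<close>, which
  rules out asymptotics for fixed \<open>c\<close>. Amplitudes suit this purpose: a small
  \<open>lam\<close> means a large amplitude, so a lower bound for the amplitude of \<open>k\<close>
  and an upper bound for that of \<open>N\<close> suffice. The obstacle is the turning point
  sqrt(ev)/c: when it is close to the singular point 1, or below it, no convexity argument starts
  there and the potential need not be monotone. The comparison is therefore split at ev N - c^2 =
  2c. Above this threshold convexity and monotone energies work; below it the potential is replaced
  by a majorant whose logarithm has bounded increase.\<close>

notation tendsto (infixr "--->" 55)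
notation LIMSEQ ("((_)/ ----> (_))" [60, 60] 60)

abbreviation "cor \<equiv> complex_of_real"
abbreviation "cexp t \<equiv> exp (\<i> * cor t)"
abbreviation "cexq t \<equiv> exp (- (\<i> * cor t))"
abbreviation "II \<equiv> {-1..1::real}"
abbreviation leb :: "'a::euclidean_space measure" where "leb \<equiv> lebesgue"
abbreviation leb2 :: "('a::euclidean_space \<times> 'b::euclidean_space) measure" where "leb2 \<equiv> leb \<Otimes>\<^sub>M leb"
abbreviation Lmeas :: "('a::euclidean_space => 'b::topological_space) set" where "Lmeas \<equiv> borel_measurable leb"
abbreviation Lmeas2 :: "('a::euclidean_space \<times> 'b::euclidean_space => 'c::topological_space) set" where "Lmeas2 \<equiv> borel_measurable leb2"
abbreviation Lint :: "('a::euclidean_space => 'b::{banach, second_countable_topology}) => bool" where "Lint \<equiv> integrable leb"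
abbreviation chi :: "real => 'a::zero_neq_one" where "chi \<equiv> indicator II"
abbreviation contI :: "(real => 'a::topological_space) => bool" where "contI \<equiv> continuous_on II"

abbreviation "nsq M f \<equiv> LINT x|M. (norm (f x))^2"
abbreviation "isq M f \<equiv> integrable M (%x. (norm (f x))^2)"

lemmas integrable_dominated = Bochner_Integration.integrable_bound
lemmas integral_eqI = Bochner_Integration.integral_cong

text \<open>Continuity is asked for on the closed interval but the derivative only inside. This
  matters at the singular points 1 and -1, where the fluxes are continuous without being known to be
  differentiable.\<close>

lemma nondecreasing_from_deriv:
 fixes f :: "real => real"
 assumes "a <= b" "continuous_on {a..b} f"
  and "!!x. a < x ==> x < b ==> DERIV f x :> f' x"
  and "!!x. a < x ==> x < b ==> f' x >= 0"
 shows "f a <= f b"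
proof (cases "a = b")
 case False
 with assms(1) have "a < b" by simp
 obtain l z where z: "a < z" "z < b" "DERIV f z :> l" "f b - f a = (b - a) * l"
  using MVT[OF `a < b` assms(2)] assms(3) real_differentiable_def by blast
 have "l = f' z" using z assms(3) DERIV_unique by blast
 with z assms(4)[of z] have "(b - a) * l >= 0" using `a < b` by simp
 with z show ?thesis by simp
qed simp

lemma nonincreasing_from_deriv:
 fixes f :: "real => real"
 assumes "a <= b" "continuous_on {a..b} f"
  and "!!x. a < x ==> x < b ==> DERIV f x :> f' x"
  and "!!x. a < x ==> x < b ==> f' x <= 0"
 shows "f b <= f a"
proof -
 have "- f a <= - f b"
  by (rule nondecreasing_from_deriv[where f' = "%x. - f' x", OF assms(1)])
    (use assms in "auto intro!: continuous_intros derivative_eq_intros")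
 thus ?thesis by simp
qed

section \<open>Liouville normal form of the prolate equation on (1, infinity)\<close>

definition liouville_pot :: "real => real => real => real => real" where
 "liouville_pot al c ka x =
   c^2 - (ka - c^2 + al^2 + al) / (x^2 - 1) + (1 - al^2) / (x^2 - 1)^2"

text \<open>The power removes the first-order term of the prolate equation: for a solution
  \<open>U\<close>, the function v = \<open>liouville al U\<close> satisfies v'' = - Q v with Q =
  \<open>liouville_pot\<close>. Since Q tends to c^2, v oscillates at infinity with frequency
  c.\<close>

definition liouville :: "real => (real => real) => real => real" where
 "liouville al U x = (x^2 - 1) powr ((al + 1) / 2) * U x"

definition liouville_deriv ::
 "real => (real => real) => (real => real) => real => real" where
 "liouville_deriv al U U' x =
   (x^2 - 1) powr ((al + 1) / 2) * (U' x + (al + 1) * x / (x^2 - 1) * U x)"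

text \<open>A solution that is regular at the singular point 1 and normalized there.
  \<open>amp\<close> is the squared amplitude of its normal form at infinity. Its existence is
  assumed here; for the eigenfunctions it comes from an explicit integral kernel, with a value
  proportional to 1 / \<open>lam n\<close>.\<close>

locale outer_sol =
 fixes al c ka :: real and U U' :: "real => real" and amp :: real
 assumes alpha: "al >= 0" and c: "c > 0" and U1: "U 1 = 1"
  and dU: "!!x. 1 <= x ==> DERIV U x :> U' x"
  and contU': "continuous_on {1..} U'"
  and dU': "!!x. 1 < x ==> (U' has_real_derivative
     ((ka - c^2 * x^2) * U x - (2 * al + 2) * x * U' x) / (x^2 - 1)) (at x)"
  and amp: "((%x. (liouville al U x)^2 + (liouville_deriv al U U' x)^2 / c^2) ---> amp) at_top"
begin

abbreviation "v \<equiv> liouville al U"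
abbreviation "v' \<equiv> liouville_deriv al U U'"
abbreviation "Q \<equiv> liouville_pot al c ka"
text \<open>The flux in the divergence form ((x^2 - 1)^(al + 1) U')' = (x^2 - 1)^al (ka - c^2 x^2)
  U. It vanishes at the singular point 1, which takes the place of an initial value for U'.\<close>

definition "pU x = (x^2 - 1) powr (al + 1) * U' x"

lemma contU: "S \<subseteq> {1..} ==> continuous_on S U"
 using dU by (meson DERIV_isCont atLeast_iff continuous_at_imp_continuous_on subsetD)

lemma contU'_sub: "S \<subseteq> {1..} ==> continuous_on S U'"
 using contU' continuous_on_subset by blast

lemma s_pos: "1 < x ==> 0 < x^2 - (1::real)"
 using power_strict_mono[of 1 x 2] by simp

lemma ds: "DERIV (%x. x^2 - 1) (x::real) :> 2 * x"
 by (auto intro!: derivative_eq_intros)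

lemma dspow: assumes "1 < x"
 shows "DERIV (%x. (x^2 - 1) powr r) (x::real) :> 2 * r * x / (x^2 - 1) * (x^2 - 1) powr r"
 using DERIV_fun_powr[OF ds s_pos[OF assms], of r] s_pos[OF assms]
 by (simp add: powr_diff mult_ac)

lemma dspow_half: assumes "1 < x"
 shows "DERIV (%x. (x^2 - 1) powr ((al + 1) / 2)) (x::real) :> (al + 1) * x / (x^2 - 1) * (x^2 - 1) powr ((al + 1) / 2)"
proof -
 have "2 * ((al + 1) / 2) = al + 1" by simp
 thus ?thesis using dspow[OF assms, of "(al + 1) / 2"] by (simp only:)
qed

lemma dpU: assumes "1 < x"
 shows "DERIV pU x :> (x^2 - 1) powr al * (ka - c^2 * x^2) * U x"
proof -
 let ?A = "%x. ka - c^2 * x^2"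
 have s: "x^2 - 1 > 0" using s_pos assms by simp
 have e: "(x^2 - 1) powr (al + 1) = (x^2 - 1) powr al * (x^2 - 1)"
  using s by (simp add: powr_add)
 have "((%x. (x^2 - 1) powr (al + 1) * U' x) has_real_derivative
   (x^2 - 1) powr al * (?A x) * U x) (at x)"
 proof (rule DERIV_cong[OF DERIV_mult[OF dspow[OF assms] dU'[OF assms]]])
  have "2 * (al + 1) * x / t * (P * t) * u' + ((?A x) * u - (2 * al + 2) * x * u') / t * (P * t)
   = P * (?A x) * u" if "t > 0" for t P u u' :: real
   using that by (simp add: field_simps)
  from this[OF s, of "(x^2 - 1) powr al" "U' x" "U x"]
  show "2 * (al + 1) * x / (x^2 - 1) * (x^2 - 1) powr (al + 1) * U' x +
   ((?A x) * U x - (2 * al + 2) * x * U' x) / (x^2 - 1) * (x^2 - 1) powr (al + 1) =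
   (x^2 - 1) powr al * (?A x) * U x" unfolding e .
 qed
 thus ?thesis unfolding pU_def[abs_def] .
qed

lemma pU1: "pU 1 = 0" by (simp add: pU_def)

lemma contpU: "S \<subseteq> {1..} ==> continuous_on S pU"
 unfolding pU_def using alpha
 by (intro continuous_intros contU'_sub continuous_on_powr')
   (auto simp: subset_iff)

lemma dv: assumes "1 < x" shows "DERIV v x :> v' x"
proof -
 have "DERIV (%x. (x^2 - 1) powr ((al + 1)/2) * U x) x :> v' x"
  unfolding liouville_deriv_def
  using assms by (intro DERIV_cong[OF DERIV_mult[OF dspow_half[OF assms] dU]]) (simp_all add: algebra_simps)
 thus ?thesis unfolding liouville_def[abs_def] .
qed

text \<open>All powers of x are expressed through t = x^2 - 1; the coefficients of 1, 1/t and 1/t^2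
  are then those of \<open>liouville_pot\<close>.\<close>

lemma dv': assumes "1 < x" shows "DERIV v' x :> - Q x * v x"
proof -
 let ?A = "%t x u u'. (((al + 1) * 1) * t - (al + 1) * x * (2 * x)) / (t * t) * u + u' * ((al + 1) * x / t)"
 let ?B = "%t. c^2 - (ka - c^2 + al^2 + al) / t + (1 - al^2) / t^2"
 have s: "x^2 - 1 > 0" using s_pos assms by simp
 have alg: "((al + 1) * x / t * P) * (u' + (al + 1) * x / t * u)
   + (((ka - c^2 * (x * x)) * u - (2 * al + 2) * x * u') / t
    + (?A t x u u')) * P
   = - (?B t) * (P * u)"
  if t: "t > 0" "x * x = t + 1" for t P u u' :: real
 proof -
  have "((al + 1) * x / t * P) * (u' + (al + 1) * x / t * u)
   + (((ka - c^2 * (x * x)) * u - (2 * al + 2) * x * u') / t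
    + (?A t x u u')) * P
   = P * u * ((al + 1)^2 * (x * x) / (t * t) + (al + 1) / t - 2 * (al + 1) * (x * x) / (t * t)
    + (ka - c^2 * (x * x)) / t)"
   using t(1) by (simp add: divide_simps) (simp add: algebra_simps power2_eq_square)
  also have "... = - (?B t) * (P * u)"
   unfolding t(2) using t(1) by (simp add: divide_simps) (simp add: algebra_simps power2_eq_square)
  finally show ?thesis .
 qed
 have "DERIV (%x. (x^2 - 1) powr ((al + 1)/2) * (U' x + (al + 1) * x / (x^2 - 1) * U x)) x :> - Q x * v x"
  apply (rule DERIV_cong[OF DERIV_mult[OF dspow_half[OF assms] DERIV_add[OF dU'[OF assms]
   DERIV_mult[OF DERIV_divide[OF DERIV_cmult[OF DERIV_ident] ds] dU]]]])
   apply (use s in simp)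
   apply (use assms in simp)
  using alg[OF s, of "(x^2 - 1) powr ((al + 1)/2)" "U' x" "U x"]
  apply (simp add: liouville_pot_def liouville_def power2_eq_square)
  done
 thus ?thesis unfolding liouville_deriv_def[abs_def] .
qed

lemma dQ: assumes "1 < x"
 shows "DERIV Q x :> 2 * x * ((ka - c^2 + al^2 + al) * (x^2 - 1) - 2 * (1 - al^2)) / (x^2 - 1) ^ 3"
proof -
 let ?A = "%t m x. 0 * t^2 - m * (of_nat 2 * (2 * x * t ^ (2 - Suc 0)))"
 have s: "x^2 - 1 > 0" using s_pos assms by simp
 have "((%x. c^2 - B / (x^2 - 1) + m / (x^2 - 1)^2) has_real_derivative
   2 * x * (B * (x^2 - 1) - 2 * m) / (x^2 - 1) ^ 3) (at x)" for B m
 proof (rule DERIV_cong[OF DERIV_add[OF DERIV_diff[OF DERIV_const DERIV_divide[OF DERIV_const ds]]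
   DERIV_divide[OF DERIV_const DERIV_power[OF ds]]]])
  have alg: "0 - (0 * t - B * (2 * x)) / (t * t) + (?A t m x) / (t^2 * t^2) = 2 * x * (B * t - 2 * m) / t ^ 3"
   if "t > 0" for t :: real
   using that by (simp add: divide_simps) (simp add: algebra_simps power2_eq_square power3_eq_cube power4_eq_xxxx)
  show "0 - (0 * (x^2 - 1) - B * (2 * x)) / ((x^2 - 1) * (x^2 - 1)) + (?A (x^2 - 1) m x) / ((x^2 - 1)^2 * (x^2 - 1)^2) = 2 * x * (B * (x^2 - 1) - 2 * m) / (x^2 - 1) ^ 3"
   using alg[OF s] .
 qed (use s in auto)
 thus ?thesis unfolding liouville_pot_def[abs_def] .
qed

text \<open>As long as c^2 x^2 <= ka, the derivative of U * pU is a sum of two nonnegative terms,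
  and the product vanishes at 1. Hence U U' >= 0, so U^2 increases from the value 1 and U cannot
  change sign.\<close>

lemma below_turning:
 assumes "1 <= x" "c^2 * x^2 <= ka"
 shows "U x >= 1" "x > 1 ==> U' x >= 0"
proof -
 have bd: "c^2 * y^2 <= ka" if "1 <= y" "y <= x" for y
 proof -
  have "y^2 <= x^2" using that by (simp add: power_mono)
  hence "c^2 * y^2 <= c^2 * x^2" by (intro mult_left_mono) auto
  thus ?thesis using assms(2) by linarith
 qed
 have pos: "U y * pU y >= 0" if "1 <= y" "y <= x" for y
 proof -
  have "U 1 * pU 1 <= U y * pU y"
  proof (rule nondecreasing_from_deriv[where f = "%z. U z * pU z" and f' = "%z. (z^2 - 1) powr al * (ka - c^2 * z^2) * (U z)^2
     + (z^2 - 1) powr (al + 1) * (U' z)^2"])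
   fix z assume z: "1 < z" "z < y"
   show "DERIV (%x. U x * pU x) z :> (z^2 - 1) powr al * (ka - c^2 * z^2) * (U z)^2
     + (z^2 - 1) powr (al + 1) * (U' z)^2"
    unfolding power2_eq_square[of "U z"] power2_eq_square[of "U' z"]
    by (rule DERIV_cong[OF DERIV_mult[OF dU[of z] dpU[of z]]])
      (use z in "simp_all add: pU_def")
   show "0 <= (z^2 - 1) powr al * (ka - c^2 * z^2) * (U z)^2 + (z^2 - 1) powr (al + 1) * (U' z)^2"
    using bd[of z] z that by simp
  qed (use that in "auto intro!: continuous_intros contU contpU")
  thus ?thesis by (simp add: pU1)
 qed
 have pos': "U y * U' y >= 0" if "1 < y" "y <= x" for y
 proof -
  have "(y^2 - 1) powr (al + 1) > 0" using s_pos[OF that(1)] by simp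
  moreover have "U y * pU y = (y^2 - 1) powr (al + 1) * (U y * U' y)" by (simp add: pU_def)
  ultimately show ?thesis using pos[of y] that zero_le_mult_iff[of "(y^2 - 1) powr (al + 1)" "U y * U' y"] by linarith
 qed
 have sq: "(U y)^2 >= 1" if "1 <= y" "y <= x" for y
 proof -
  have "(U 1)^2 <= (U y)^2"
  proof (rule nondecreasing_from_deriv[where f = "%z. (U z)^2" and f' = "%z. 2 * (U z * U' z)"])
   fix z assume z: "1 < z" "z < y"
   show "DERIV (%x. (U x)^2) z :> 2 * (U z * U' z)"
    apply (rule derivative_eq_intros dU refl)+
    using z by (simp_all)
  qed (use that pos' in "auto intro!: continuous_intros contU")
  thus ?thesis by (simp add: U1)
 qed
 have Upos: "U y > 0" if "1 <= y" "y <= x" for y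
 proof (rule ccontr)
  assume "\<not> U y > 0"
  hence "EX z. 1 <= z & z <= y & U z = 0"
   using IVT2'[of U y 0 1] that contU[of "{1..y}"] by (auto simp: U1)
  then obtain z where "1 <= z" "z <= y" "U z = 0" by blast
  thus False using sq[of z] that by simp
 qed
 show "U x >= 1" using sq[of x] Upos[of x] assms(1)
  by (smt (verit, best) one_power2 power_mono_iff zero_less_numeral power2_le_imp_le)
 show "U' x >= 0" if "x > 1" using pos'[of x] Upos[of x] that by (simp add: zero_le_mult_iff)
qed

text \<open>v' is the sum of (x^2 - 1)^((al + 1)/2) U' and (al + 1) x / (x^2 - 1) v. Below the
  turning point both summands are nonnegative, so each of them is a lower bound.\<close>

lemma v_nonneg_below: assumes "1 < x" "c^2 * x^2 <= ka"
 shows "v x >= (x^2 - 1) powr ((al + 1) / 2)" "v' x >= (al + 1) * x / (x^2 - 1) * v x"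
  "v' x >= (x^2 - 1) powr ((al + 1) / 2) * U' x" "v' x >= 0" "v x > 0"
proof -
 note s = s_pos[OF assms(1)]
 note b = below_turning[OF _ assms(2)]
 have U: "U x >= 1" "U' x >= 0" using b assms by auto
 show 1: "v x >= (x^2 - 1) powr ((al + 1) / 2)" unfolding liouville_def
  using U mult_left_mono[of 1 "U x" "(x^2 - 1) powr ((al + 1) / 2)"] by simp
 show "v x > 0" using 1 s by (smt (verit) powr_gt_zero)
 have e: "v' x = (x^2 - 1) powr ((al + 1) / 2) * U' x + (al + 1) * x / (x^2 - 1) * v x"
  unfolding liouville_def liouville_deriv_def by (simp add: algebra_simps)
 have n: "(al + 1) * x / (x^2 - 1) * v x >= 0" using `v x > 0` s alpha assms by simp
 have m: "(x^2 - 1) powr ((al + 1) / 2) * U' x >= 0" using U by simp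
 show "v' x >= (al + 1) * x / (x^2 - 1) * v x" "v' x >= (x^2 - 1) powr ((al + 1) / 2) * U' x" "v' x >= 0"
  using e n m by linarith+
qed

section \<open>Monotonicity of the potential and energy bounds for the amplitude\<close>

lemma contv: "S \<subseteq> {1<..} ==> continuous_on S v"
 using dv by (meson DERIV_isCont greaterThan_iff continuous_at_imp_continuous_on subsetD)
lemma contv': "S \<subseteq> {1<..} ==> continuous_on S v'"
 using dv' by (meson DERIV_isCont greaterThan_iff continuous_at_imp_continuous_on subsetD)
lemma contQ: "S \<subseteq> {1<..} ==> continuous_on S Q"
 using dQ by (meson DERIV_isCont greaterThan_iff continuous_at_imp_continuous_on subsetD)

text \<open>The sign of Q' is that of B (x^2 - 1) - 2 (1 - al^2) with B = ka - c^2 + al^2 + al. For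
  B > 0 this increases with x, so one inequality at x0 settles all later points.\<close>

lemma Q_mono:
 assumes "1 < x0" "(ka - c^2 + al^2 + al) > 0" "(ka - c^2 + al^2 + al) * (x0^2 - 1) > 2 * (1 - al^2)"
  and "x0 <= x" "x < y"
 shows "Q x < Q y"
proof (rule DERIV_pos_imp_increasing[OF assms(5)])
 let ?A = "ka - c^2 + al^2 + al"
 fix z assume z: "x <= z" "z <= y"
 hence z1: "1 < z" using assms by simp
 have "x0^2 - 1 <= z^2 - 1" using z assms by (simp add: power_mono)
 hence "?A * (x0^2 - 1) <= ?A * (z^2 - 1)"
  using assms(2) by (intro mult_left_mono) auto
 hence "?A * (z^2 - 1) - 2 * (1 - al^2) > 0" using assms(3) by linarith
 hence "2 * z * (?A * (z^2 - 1) - 2 * (1 - al^2)) / (z^2 - 1) ^ 3 > 0"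
  using s_pos[OF z1] z1 by simp
 thus "EX d. DERIV Q z :> d & 0 < d" using dQ[OF z1] by blast
qed

lemma Q_le:
 assumes "1 < x" "(ka - c^2 + al^2 + al) > 0" "(ka - c^2 + al^2 + al) * (x^2 - 1) > 2 * (1 - al^2)"
 shows "Q x <= c^2"
proof -
 let ?A = "ka - c^2 + al^2 + al"
 note s = s_pos[OF assms(1)]
 have "(1 - al^2) / (x^2 - 1)^2 <= ?A / (x^2 - 1)"
 proof -
  have "1 - al^2 <= ?A * (x^2 - 1)"
  proof -
   have "m <= X" if "2 * m < X" "0 < X" for m X :: real using that by linarith
   thus ?thesis using assms(3) mult_pos_pos[OF assms(2) s] by blast
  qed
  hence "(1 - al^2) / (x^2 - 1)^2 <= ?A * (x^2 - 1) / (x^2 - 1)^2"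
   by (rule divide_right_mono) simp
  thus ?thesis using s by (simp add: power2_eq_square)
 qed
 thus ?thesis unfolding liouville_pot_def by linarith
qed

lemma Q_mono_hyp:
 assumes "1 < x0" "(ka - c^2 + al^2 + al) > 0" "(ka - c^2 + al^2 + al) * (x0^2 - 1) > 2 * (1 - al^2)" "x0 <= x"
 shows "(ka - c^2 + al^2 + al) * (x^2 - 1) > 2 * (1 - al^2)"
proof -
 have "x0^2 - 1 <= x^2 - 1" using assms by (simp add: power_mono)
 hence "(ka - c^2 + al^2 + al) * (x0^2 - 1) <= (ka - c^2 + al^2 + al) * (x^2 - 1)"
  using assms(2) by (intro mult_left_mono) auto
 thus ?thesis using assms(3) by linarith
qed

text \<open>The energy v'^2 + Q v^2 has derivative Q' v^2 >= 0, and it stays below c^2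
  \<open>amp\<close> because Q <= c^2. This settles the case Q(x0) >= 0. If Q(x0) < 0, then v v' >=
  0 and v'' = - Q v make v'^2 increase up to the zero of Q, where the energy takes over.\<close>

lemma amp_lower:
 assumes x0: "1 < x0" and B: "(ka - c^2 + al^2 + al) > 0"
  and Bs: "(ka - c^2 + al^2 + al) * (x0^2 - 1) > 2 * (1 - al^2)"
  and vv: "v x0 * v' x0 >= 0"
 shows "c^2 * amp >= (v' x0)^2"
proof -
 let ?A = "%x. (ka - c^2 + al^2 + al) * (x^2 - 1) - 2 * (1 - al^2)"
 have c2: "c^2 > 0" using c by simp
 have lim: "((%x. (v' x)^2 + c^2 * (v x)^2) ---> c^2 * amp) at_top"
  using tendsto_mult_left[OF amp, of "c^2"] c2 by (simp add: algebra_simps)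
 have step: "(v' z)^2 + Q z * (v z)^2 <= c^2 * amp" if z: "x0 <= z" for z
 proof (rule tendsto_lowerbound[OF lim])
  show "\<forall>\<^sub>F x in at_top. (v' z)^2 + Q z * (v z)^2 <= (v' x)^2 + c^2 * (v x)^2"
  proof (rule eventually_at_top_linorderI)
   fix x assume x: "z <= x"
   have "(v' z)^2 + Q z * (v z)^2 <= (v' x)^2 + Q x * (v x)^2"
   proof (rule nondecreasing_from_deriv[where f' = "%x. 2 * x * (?A x) / (x^2 - 1) ^ 3 * (v x)^2", OF x])
    fix y assume y: "z < y" "y < x"
    have y1: "1 < y" using y z x0 by simp
    show "DERIV (%x. (v' x)^2 + Q x * (v x)^2) y :> 2 * y * (?A y) / (y^2 - 1) ^ 3 * (v y)^2"
     apply (rule derivative_eq_intros dv[OF y1] dv'[OF y1] dQ[OF y1] refl)+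
     by (simp add: algebra_simps)
    show "0 <= 2 * y * (?A y) / (y^2 - 1) ^ 3 * (v y)^2"
     using Q_mono_hyp[OF x0 B Bs, of y] y z s_pos[OF y1] y1 by simp
   qed (use z x0 in "auto intro!: continuous_intros contv contv' contQ")
   moreover have "Q x * (v x)^2 <= c^2 * (v x)^2"
    using Q_le[OF _ B Q_mono_hyp[OF x0 B Bs, of x]] x z x0 by (intro mult_right_mono) auto
   ultimately show "(v' z)^2 + Q z * (v z)^2 <= (v' x)^2 + c^2 * (v x)^2" by linarith
  qed
 qed simp
 show ?thesis
 proof (cases "Q x0 >= 0")
  case True
  hence "Q x0 * (v x0)^2 >= 0" by simp
  with step[of x0] show ?thesis by linarith
 next
  case False
  have "EX z>=x0. Q z = 0"
  proof -
   have "(Q ---> c^2) at_top" unfolding liouville_pot_def by real_asymp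
   hence "\<forall>\<^sub>F x in at_top. Q x > 0" using c2 by (rule order_tendstoD)
   then obtain w where w: "ALL x>=w. Q x > 0" by (auto simp: eventually_at_top_linorder)
   have "Q (max w x0) > 0" using w by simp
   moreover have "continuous_on {x0..max w x0} Q" by (intro contQ) (use x0 in auto)
   ultimately have "EX z. x0 <= z & z <= max w x0 & Q z = 0"
    using False by (intro IVT') auto
   thus ?thesis by blast
  qed
  then obtain z where z: "z >= x0" "Q z = 0" by blast
  have Qn: "Q y <= 0" if "x0 <= y" "y < z" for y
   using Q_mono[OF x0 B Bs, of y z] that z by simp
  have vvn: "v y * v' y >= 0" if "x0 <= y" "y <= z" for y
  proof -
   have "v x0 * v' x0 <= v y * v' y"
   proof (rule nondecreasing_from_deriv[where f' = "%x. (v' x)^2 + (- Q x) * (v x)^2", OF that(1)])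
    fix x assume x: "x0 < x" "x < y"
    hence x1: "1 < x" using x0 by simp
    show "DERIV (%x. v x * v' x) x :> (v' x)^2 + - Q x * (v x)^2"
     apply (rule derivative_eq_intros dv[OF x1] dv'[OF x1] refl)+
     by (simp add: algebra_simps power2_eq_square)
    show "0 <= (v' x)^2 + - Q x * (v x)^2"
     using Qn[of x] x that by (intro add_nonneg_nonneg mult_nonneg_nonneg) auto
   qed (use x0 in "auto intro!: continuous_intros contv contv'")
   thus ?thesis using vv by linarith
  qed
  have "(v' x0)^2 <= (v' z)^2"
  proof (rule nondecreasing_from_deriv[where f' = "%x. 2 * ((- Q x) * (v x * v' x))", OF z(1)])
   fix x assume x: "x0 < x" "x < z"
   hence x1: "1 < x" using x0 by simp
   show "DERIV (%x. (v' x)^2) x :> 2 * (- Q x * (v x * v' x))"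
    apply (rule derivative_eq_intros dv'[OF x1] refl)+
    by (simp add: algebra_simps power2_eq_square)
   have "- Q x * (v x * v' x) >= 0"
    using Qn[of x] vvn[of x] x mult_nonneg_nonneg[of "- Q x" "v x * v' x"] by linarith
   thus "0 <= 2 * (- Q x * (v x * v' x))" by linarith
  qed (use x0 in "auto intro!: continuous_intros contv'")
  also have "... <= c^2 * amp" using step[OF z(1)] z(2) by simp
  finally show ?thesis .
 qed
qed

end

lemma power_mult_eq: "i + j = k ==> x ^ i * x ^ j = (x::real) ^ k"
 by (metis power_add)

text \<open>Comparison with the Euler equation x^2 y'' = be (be - 1) y, solved by x^be and x^(1 -
  be). Only a nonnegative initial slope is known, so part of the initial value may go into the
  decaying solution; the factor 1/3 accounts for this.\<close>

lemma power_growth: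
 fixes f f1 G :: "real => real" and be :: nat
 assumes y: "0 < y0" "y0 <= y1" and b: "be >= 2"
  and df: "!!x. y0 <= x ==> x <= y1 ==> DERIV f x :> f1 x"
  and df1: "!!x. y0 <= x ==> x <= y1 ==> DERIV f1 x :> G x * f x"
  and G: "!!x. y0 <= x ==> x <= y1 ==> G x * x^2 >= real be * (real be - 1)"
  and f: "!!x. y0 <= x ==> x <= y1 ==> f x >= 0" and f10: "f1 y0 >= 0"
 shows "f y1 >= f y0 * (y1 / y0) ^ be / 3"
proof -
 let ?A = "%x m a. 0 * x ^ (2*m+3) - a * (real (2*m+3) * x ^ (2*m+2))"
 let ?B = "%G x be. G x * x^2 - real be * (real be - 1)"
 let ?C = "%be. 2 * real be - 1"
 define m where "m = be - 2"
 have be: "be = m + 2" using b by (simp add: m_def)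
 \<comment> \<open>The Wronskian of f with x^be, where be = m + 2. The lower bound for G makes it
   nondecreasing.\<close>
 define g where "g x = x ^ (m+2) * f1 x - real be * (x ^ (m+1) * f x)" for x
 have dg: "DERIV g x :> x ^ m * f x * (?B G x be)"
  if x: "y0 <= x" "x <= y1" for x
  unfolding g_def[abs_def]
  apply (rule DERIV_cong[OF DERIV_diff[OF DERIV_mult[OF DERIV_pow df1] DERIV_cmult[OF DERIV_mult[OF DERIV_pow df]]]])
  using x apply (simp_all only:)
  apply (simp add: be algebra_simps power2_eq_square)
  done
 have g: "g x >= - real be * y0 ^ (m+1) * f y0" if x: "y0 <= x" "x <= y1" for x
 proof -
  have "g y0 <= g x"
  proof (rule nondecreasing_from_deriv[where f = g and f' = "%x. x ^ m * f x * (?B G x be)"])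
   show "continuous_on {y0..x} g"
    by (rule DERIV_atLeastAtMost_imp_continuous_on, rule exI, rule dg) (use x in linarith)+
   fix z assume z: "y0 < z" "z < x"
   show "DERIV g z :> z ^ m * f z * (?B G z be)"
    using dg z x by simp
   show "0 <= z ^ m * f z * (?B G z be)"
    using z x y f[of z] G[of z] by (intro mult_nonneg_nonneg) auto
  qed (use x in auto)
  moreover have "g y0 >= - real be * y0 ^ (m+1) * f y0"
   using f10 y by (simp add: g_def)
  ultimately show ?thesis by linarith
 qed
 define a where "a = real be / (?C be) * y0 ^ (m+1) * f y0"
 have a: "a >= 0" using y f[of y0] b by (simp add: a_def)
 \<comment> \<open>The quotient f / x^be has derivative g / x^(2 be). The term with \<open>a\<close>
   adds just enough to compensate the lower bound of g, so that k is nondecreasing. In terms of m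
   the exponents are 2 be - 1 = 2m + 3 and 2 be = 2m + 4.\<close>
 define k where "k x = f x / x ^ (m+2) - a / x ^ (2*m+3)" for x
 have dk: "DERIV k x :> (g x + real be * y0 ^ (m+1) * f y0) / x ^ (2*m+4)"
  if x: "y0 <= x" "x <= y1" for x
 proof -
  have x0: "x > 0" using x y by simp
  have "DERIV k x :> (f1 x * x ^ (m+2) - f x * (real (m+2) * x ^ (m+1))) / (x ^ (m+2) * x ^ (m+2))
    - (?A x m a) / (x ^ (2*m+3) * x ^ (2*m+3))"
  proof -
   have nz: "x ^ (m + 2) ~= 0" "x ^ (2 * m + 3) ~= 0" using x0 by simp_all
   have p1: "DERIV (%x. x ^ (m + 2)) x :> real (m + 2) * x ^ (m + 1)"
    using DERIV_pow[of "m + 2" x UNIV] by simp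
   have p2: "DERIV (%x. x ^ (2 * m + 3)) x :> real (2 * m + 3) * x ^ (2 * m + 2)"
    by (rule DERIV_cong[OF DERIV_pow]) simp
   have p3: "DERIV (%x::real. a) x :> 0" by simp
   show ?thesis unfolding k_def[abs_def]
    by (rule DERIV_diff[OF DERIV_divide[OF df[OF x] p1 nz(1)] DERIV_divide[OF p3 p2 nz(2)]])
  qed
  moreover have "(f1 x * x ^ (m+2) - f x * (real (m+2) * x ^ (m+1))) / (x ^ (m+2) * x ^ (m+2)) = g x / x ^ (2*m+4)"
  proof -
   have "x ^ (m+2) * x ^ (m+2) = x ^ (2*m+4)" by (rule power_mult_eq) simp
   moreover have "f1 x * x ^ (m+2) - f x * (real (m+2) * x ^ (m+1)) = g x"
    unfolding g_def be by simp
   ultimately show ?thesis by simp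
  qed
  moreover have "- ((?A x m a) / (x ^ (2*m+3) * x ^ (2*m+3)))
    = (real be * y0 ^ (m+1) * f y0) / x ^ (2*m+4)"
  proof -
   have "2 * real be - 1 = real (2*m+3)" by (simp add: be)
   moreover have "real (2*m+3) ~= 0" by simp
   moreover have "e / q * u * w * q = e * u * w" if "q ~= 0" for e q u w :: real using that by simp
   ultimately have aa: "a * real (2*m+3) = real be * y0 ^ (m+1) * f y0"
    unfolding a_def by metis
   have pp: "x ^ (2*m+3) * x ^ (2*m+3) = x ^ (2*m+2) * x ^ (2*m+4)"
   proof -
    have "(2*m+3) + (2*m+3) = (2*m+2) + (2*m+4)" by simp
    thus ?thesis by (simp only: power_add[symmetric])
   qed
   have "- ((?A x m a) / (x ^ (2*m+3) * x ^ (2*m+3)))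
    = (a * real (2*m+3)) * x ^ (2*m+2) / (x ^ (2*m+2) * x ^ (2*m+4))"
    unfolding pp by (simp only: mult_zero_left diff_0 minus_divide_left minus_minus mult.assoc)
   also have "... = (a * real (2*m+3)) / x ^ (2*m+4)" using x0 by simp
   finally show ?thesis unfolding aa .
  qed
  ultimately show ?thesis by (simp only: add_divide_distrib diff_conv_add_uminus)
 qed
 have k1: "k y0 <= k y1"
 proof (rule nondecreasing_from_deriv[OF y(2), where f = k])
  show "continuous_on {y0..y1} k"
   by (rule DERIV_atLeastAtMost_imp_continuous_on, rule exI, rule dk)
  fix z assume z: "y0 < z" "z < y1"
  show "DERIV k z :> (g z + real be * y0 ^ (m+1) * f y0) / z ^ (2*m+4)"
   using dk z by simp
  show "0 <= (g z + real be * y0 ^ (m+1) * f y0) / z ^ (2*m+4)"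
   using g[of z] z y by simp
 qed
 have k2: "k y1 <= f y1 / y1 ^ (m+2)" unfolding k_def using a y by simp
 have k3: "k y0 = f y0 / y0 ^ (m+2) * ((real be - 1) / (?C be))"
 proof -
  have A: "a / y0 ^ (2*m+3) = real be / (?C be) * (f y0 / y0 ^ (m+2))"
  proof -
   have "y0 ^ (2*m+3) = y0 ^ (m+1) * y0 ^ (m+2)" by (rule power_mult_eq[symmetric]) simp
   thus ?thesis using y by (simp add: a_def)
  qed
  have B: "(real be - 1) / (?C be) = 1 - real be / (?C be)"
   using b by (simp add: field_simps)
  have "h - e * h = h * (1 - e)" for h e :: real by (simp add: algebra_simps)
  thus ?thesis unfolding k_def A B .
 qed
 \<comment> \<open>The fraction (be - 1) / (2 be - 1) is at least 1/3 exactly when be >= 2.\<close>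
 have k4: "f y0 / y0 ^ (m+2) * ((real be - 1) / (?C be)) >= f y0 / y0 ^ (m+2) * (1/3)"
 proof (intro mult_left_mono)
  show "1/3 <= (real be - 1) / (?C be)" using b by (simp add: divide_simps)
  show "0 <= f y0 / y0 ^ (m+2)" using y f[of y0] by simp
 qed
 have "f y0 / y0 ^ (m+2) * (1/3) <= f y1 / y1 ^ (m+2)"
  by (rule order_trans[OF k4[folded k3] order_trans[OF k1 k2]])
 hence "f y0 / y0 ^ (m+2) * (1/3) * y1 ^ (m+2) <= f y1" using y by (simp add: pos_le_divide_eq)
 thus ?thesis by (simp add: be power_divide)
qed

text \<open>The zero is the infimum of the closed set where f <= 0; a negative value there would
  produce an earlier zero by the intermediate value theorem.\<close>

lemma first_nonpos:
 fixes f :: "real => real"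
 assumes "a <= b" "continuous_on {a..b} f" "f a > 0"
 obtains "!!x. a <= x ==> x <= b ==> f x > 0"
 | z where "a < z" "z <= b" "f z = 0" "!!x. a <= x ==> x < z ==> f x > 0"
proof (cases "ALL x:{a..b}. f x > 0")
 case False
 define S where "S = {x\<in>{a..b}. f x <= 0}"
 have ne: "S ~= {}" using False by (force simp: S_def)
 have "closed S" unfolding S_def
  using continuous_closed_preimage[OF assms(2), of "{..0}"] by (simp add: vimage_def Int_def)
 hence "Inf S : S" using ne by (intro closed_contains_Inf) (auto simp: S_def intro: bdd_belowI[of _ a])
 define z where "z = Inf S"
 have zS: "z : S" using `Inf S : S` z_def by simp
 have bef: "f x > 0" if "a <= x" "x < z" for x
 proof (rule ccontr)
  assume "\<not> f x > 0"
  hence "x : S" using that zS by (auto simp: S_def)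
  hence "z <= x" unfolding z_def by (intro cInf_lower) (auto simp: S_def intro: bdd_belowI[of _ a])
  thus False using that by simp
 qed
 have "f z = 0"
 proof (rule ccontr)
  assume "f z ~= 0"
  hence "f z < 0" using zS by (auto simp: S_def)
  hence "EX x. a <= x & x <= z & f x = 0"
   using assms zS by (intro IVT2') (auto simp: S_def intro: continuous_on_subset)
  then obtain x where "a <= x" "x <= z" "f x = 0" by blast
  thus False using bef[of x] `f z < 0` by (cases "x = z") auto
 qed
 moreover have "a < z" using zS assms(3) `f z = 0` by (cases "a = z") (auto simp: S_def)
 ultimately show ?thesis using that(2)[of z] bef zS by (auto simp: S_def)
qed (use that in auto)

context outer_sol begin

text \<open>Counterpart of \<open>amp_lower\<close>: normalized as v^2 + v'^2 / Q, the energy has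
  derivative - Q' v'^2 / Q^2 <= 0, so every point with Q > 0 yields an upper bound. That the limit
  at infinity is bounded by this energy uses Q <= c^2.\<close>

lemma amp_le_energy:
 assumes x0: "1 < x0" and B: "(ka - c^2 + al^2 + al) > 0"
  and Bs: "(ka - c^2 + al^2 + al) * (x0^2 - 1) > 2 * (1 - al^2)"
  and z: "x0 <= z" "Q z > 0"
 shows "amp <= (v z)^2 + (v' z)^2 / Q z"
proof (rule tendsto_upperbound[OF amp])
 let ?A = "%y. 2 * y * ((ka - c^2 + al^2 + al) * (y^2 - 1) - 2 * (1 - al^2)) / (y^2 - 1) ^ 3"
 have c2: "c^2 > 0" using c by simp
 show "\<forall>\<^sub>F x in at_top. (v x)^2 + (v' x)^2 / c^2 <= (v z)^2 + (v' z)^2 / Q z"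
 proof (rule eventually_at_top_linorderI)
  fix x assume x: "z <= x"
  have Qp: "Q y > 0" if "z <= y" for y
   using Q_mono[OF x0 B Bs, of z y] z that by (cases "z = y") auto
  have "(v x)^2 + (v' x)^2 / Q x <= (v z)^2 + (v' z)^2 / Q z"
  proof (rule nonincreasing_from_deriv[where f' = "%y. - (?A y) * (v' y)^2 / (Q y)^2", OF x])
   show "continuous_on {z..x} (%x. (v x)^2 + (v' x)^2 / Q x)"
   proof -
    have "continuous_on {z..x} v" "continuous_on {z..x} v'" "continuous_on {z..x} Q"
     using z x0 by (auto intro!: contv contv' contQ)
    thus ?thesis using Qp by (intro continuous_intros) force+
   qed
   fix y assume y: "z < y" "y < x"
   have y1: "1 < y" using y z x0 by simp
   have q: "Q y > 0" using Qp y by simp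
   show "DERIV (%x. (v x)^2 + (v' x)^2 / Q x) y :> - (?A y) * (v' y)^2 / (Q y)^2"
    apply (rule DERIV_cong[OF DERIV_add[OF DERIV_power[OF dv[OF y1]] DERIV_divide[OF DERIV_power[OF dv'[OF y1]] dQ[OF y1]]]])
    using q apply simp
    apply (simp only: power2_eq_square[of "Q y"])
    using q apply (simp add: divide_simps algebra_simps power2_eq_square)
    done
   show "- (?A y) * (v' y)^2 / (Q y)^2 <= 0"
   proof -
    have "2 * y * ((ka - c^2 + al^2 + al) * (y^2 - 1) - 2 * (1 - al^2)) / (y^2 - 1) ^ 3 >= 0"
     using Q_mono_hyp[OF x0 B Bs, of y] y z s_pos[OF y1] y1 by simp
    thus ?thesis by (intro divide_nonpos_nonneg mult_nonpos_nonneg zero_le_power2) linarith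
   qed
  qed
  moreover have "(v' x)^2 / c^2 <= (v' x)^2 / Q x"
   using Q_le[OF _ B Q_mono_hyp[OF x0 B Bs, of x]] x z x0 Qp[OF x]
   by (intro divide_left_mono mult_pos_pos c2) auto
  ultimately show "(v x)^2 + (v' x)^2 / c^2 <= (v z)^2 + (v' z)^2 / Q z" by linarith
 qed
qed simp

text \<open>If Q z = 0, the term v'^2 / Q has the form 0/0 at z. To the right of z the mean value
  theorem and the monotonicity of Q give |v'| <= (x - z) Q(x) max |v|, so v'^2 / Q tends to 0 and
  \<open>amp_le_energy\<close> passes to the limit.\<close>

lemma amp_le_critical:
 assumes x0: "1 < x0" and B: "(ka - c^2 + al^2 + al) > 0"
  and Bs: "(ka - c^2 + al^2 + al) * (x0^2 - 1) > 2 * (1 - al^2)"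
  and z: "x0 <= z" "Q z >= 0" "v' z = 0"
 shows "amp <= (v z)^2"
proof -
 have z1: "1 < z" using x0 z by simp
 have cv: "continuous_on {z..z+1} v" using z1 by (intro contv) auto
 obtain M where M: "!!x. x : {z..z+1} ==> (abs (v x)) <= M"
  using compact_imp_bounded[OF compact_continuous_image[OF cv compact_Icc]]
  by (force simp: bounded_iff)
 have M0: "M >= 0" using M[of z] by simp
 have bd: "amp <= (v x)^2 + c^2 * (x - z)^2 * M^2" if x: "z < x" "x < z + 1" for x
 proof -
  have Qx: "Q x > 0" using Q_mono[OF x0 B Bs, of z x] z x by simp
  obtain om where xi: "z < om" "om < x" "v' x - v' z = (x - z) * (- Q om * v om)"
   using MVT2[OF x(1), of v' "%x. - Q x * v x"] dv' z1 by auto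
  have Qxi: "0 <= Q om" "Q om <= Q x"
   using Q_mono[OF x0 B Bs, of z om] Q_mono[OF x0 B Bs, of om x] xi z by auto
  have "abs (v' x) = (x - z) * (Q om * abs (v om))" using xi z Qxi x by (simp add: abs_mult)
  also have "... <= (x - z) * (Q x * M)"
   using x Qxi M[of om] xi M0 by (intro mult_left_mono mult_mono) auto
  finally have "abs (v' x) <= (x - z) * (Q x * M)" .
  hence "(v' x)^2 <= ((x - z) * (Q x * M))^2" by (rule abs_le_square_iff[THEN iffD1, OF order_trans[OF _ abs_ge_self]])
  hence "(v' x)^2 <= Q x * ((x - z)^2 * M^2) * Q x"
   by (simp only: power_mult_distrib power2_eq_square[of "Q x"] mult_ac)
  hence "(v' x)^2 / Q x <= Q x * ((x - z)^2 * M^2)" using Qx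
   by (simp only: pos_divide_le_eq)
  also have "... <= c^2 * ((x - z)^2 * M^2)"
   using Q_le[OF _ B Q_mono_hyp[OF x0 B Bs, of x]] x z x0 by (intro mult_right_mono) auto
  finally show ?thesis using amp_le_energy[OF x0 B Bs, of x] Qx x z by simp
 qed
 have "((%x. (v x)^2 + c^2 * (x - z)^2 * M^2) ---> (v z)^2 + c^2 * (z - z)^2 * M^2) (at_right z)"
  using DERIV_isCont[OF dv[OF z1], unfolded isCont_def, THEN tendsto_mono[OF at_le[OF subset_UNIV]]]
  by (intro tendsto_intros)
 moreover have "\<forall>\<^sub>F x in at_right z. amp <= (v x)^2 + c^2 * (x - z)^2 * M^2"
  using eventually_at_right_real[of z "z+1"] by (rule eventually_mono) (auto intro!: bd)
 ultimately have "amp <= (v z)^2 + c^2 * (z - z)^2 * M^2"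
  by (rule tendsto_lowerbound) simp
 thus ?thesis by simp
qed

text \<open>Beyond the turning point x0 the flux \<open>pU\<close> decreases as long as U > 0, so U'
  <= U'(x0) and v is under control up to x3, where x^2 - 1 is only C0 times larger and Q >= c^2 / 2.
  If v' stays positive up to x3, the energy is evaluated there; otherwise v' has a first zero, and
  \<open>amp_le_critical\<close> applies at it.\<close>

lemma amp_upper:
 assumes x0: "1 < x0" "c^2 * x0^2 = ka" and B: "(ka - c^2 + al^2 + al) > 0"
  and Bs: "(ka - c^2 + al^2 + al) * (x0^2 - 1) > 2 * (1 - al^2)"
  and C0: "C0 >= 1" and x3: "x3 > 0" "x3^2 - 1 = C0 * (x0^2 - 1)" "Q x3 >= c^2 / 2"
  and M: "M = C0 powr ((al + 1) / 2) * (1 + C0 / 2)" "M' = C0 powr ((al + 1) / 2) + (al + 1) * M"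
 shows "amp <= 2 * M'^2 * ((x0^2 - 1)^2 / x0^2 + 1 / c^2) * (v' x0)^2"
proof -
 let ?A = "%M s0 v'. M * (s0 / x0) * v' x0"
 let ?B = "%x. ka - c^2 * x^2"
 define b where "b = (al + 1) / 2"
 define s0 where "s0 = x0^2 - 1"
 have b0: "b > 0" using alpha by (simp add: b_def)
 have s0: "s0 > 0" using s_pos x0 by (simp add: s0_def)
 have x03: "x0 <= x3"
 proof -
  have "x0^2 - 1 <= x3^2 - 1" using x3(2) C0 s0 mult_right_mono[of 1 C0 s0] by (simp add: s0_def)
  thus ?thesis using x3(1) power2_le_imp_le[of x0 x3] by simp
 qed
 note vb = v_nonneg_below[OF x0(1), unfolded x0(2), OF order_refl]
 note ub = below_turning[OF less_imp_le[OF x0(1)], unfolded x0(2), OF order_refl]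
 have U'0: "U' x0 >= 0" using ub x0 by simp
 have v'0: "v' x0 > 0"
 proof -
  have "(al + 1) * x0 / (x0^2 - 1) * v x0 > 0" using vb s0 alpha x0 by (simp add: s0_def)
  thus ?thesis using vb(2) by linarith
 qed
 have v0: "v x0 <= s0 / x0 * v' x0"
 proof -
  have "1 * (x0 / s0 * v x0) <= (al + 1) * (x0 / s0 * v x0)"
   using vb s0 x0 alpha by (intro mult_right_mono) auto
  hence "x0 / s0 * v x0 <= v' x0" using vb(2) by (simp add: s0_def)
  thus ?thesis using s0 x0 by (simp add: field_simps)
 qed
 have M'M: "M' >= M" "M >= 0" "M' >= 0"
 proof -
  show "M >= 0" using C0 by (simp add: M)
  moreover have "0 <= C0 powr ((al + 1) / 2)" by simp
  ultimately show "M' >= M" using alpha mult_right_mono[of 1 "al + 1" M] unfolding M(2) by linarith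
  thus "M' >= 0" using `M >= 0` by simp
 qed
 \<comment> \<open>The assumption that v' is positive before x makes v, hence U, positive; this
   gives the sign of the derivative of \<open>pU\<close>.\<close>
 have est: "v x <= M * (s0 / x0) * v' x0" "U' x <= U' x0" "v x > 0"
  if x: "x0 <= x" "x <= x3" and pos: "!!y. x0 <= y ==> y < x ==> v' y > 0" for x
 proof -
  have vpos: "v y > 0" if y: "x0 <= y" "y <= x" for y
  proof -
   have "v x0 <= v y"
    by (rule nondecreasing_from_deriv[OF y(1), where f = v and f' = v'])
      (use y x0(1) pos in "auto intro!: contv dv less_imp_le[of 0]")
   thus ?thesis using vb by linarith
  qed
  show "v x > 0" using vpos x by simp
  have Upos: "U y > 0" if y: "x0 <= y" "y <= x" for y
   using vpos[OF y] by (simp add: liouville_def zero_less_mult_iff not_less[symmetric])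
  have U'le: "U' y <= U' x0" if y: "x0 <= y" "y <= x" for y
  proof -
   have sy: "s0 <= y^2 - 1" using y x0 by (simp add: s0_def power_mono)
   have "pU y <= pU x0"
   proof (rule nonincreasing_from_deriv[OF y(1), where f = pU and f' = "%x. (x^2 - 1) powr al * (?B x) * U x"])
    fix z assume z: "x0 < z" "z < y"
    show "DERIV pU z :> (z^2 - 1) powr al * (?B z) * U z"
     using dpU z x0 by simp
    have "x0^2 <= z^2" using z x0 by (simp add: power_mono)
    hence "c^2 * x0^2 <= c^2 * z^2" by (intro mult_left_mono) auto
    hence "(z^2 - 1) powr al * (?B z) <= 0" using x0 by (intro mult_nonneg_nonpos) auto
    thus "(z^2 - 1) powr al * (?B z) * U z <= 0"
     using mult_nonpos_nonneg[OF _ less_imp_le[OF Upos[of z]], of "(z^2 - 1) powr al * (?B z)"] z y by simp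
   qed (rule contpU, use x0(1) in force)
   also have "pU x0 <= (y^2 - 1) powr (al + 1) * U' x0"
    unfolding pU_def using sy s0 alpha U'0
    by (intro mult_right_mono powr_mono2) (auto simp: s0_def)
   finally have "(y^2 - 1) powr (al + 1) * U' y <= (y^2 - 1) powr (al + 1) * U' x0" unfolding pU_def .
   thus ?thesis using sy s0 by simp
  qed
  show "U' x <= U' x0" using U'le x by simp
  have "U x - U' x0 * x <= U x0 - U' x0 * x0"
  proof (rule nonincreasing_from_deriv[OF x(1), where f' = "%y. U' y - U' x0"])
   fix z assume z: "x0 < z" "z < x"
   show "DERIV (%x. U x - U' x0 * x) z :> U' z - U' x0"
    using z x0 by (auto intro!: derivative_eq_intros dU)
   show "U' z - U' x0 <= 0" using U'le[of z] z by simp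
  qed (use x0(1) in "auto intro!: continuous_intros contU")
  hence Ux: "U x <= U x0 + U' x0 * (x - x0)" by (simp add: algebra_simps)
  have sx: "0 < x^2 - 1" "x^2 - 1 <= C0 * s0"
  proof -
   show "0 < x^2 - 1" using s_pos x x0 by simp
   have "x^2 <= x3^2" using x x0 by (simp add: power_mono)
   thus "x^2 - 1 <= C0 * s0" using x3 by (simp add: s0_def)
  qed
  have dx: "x - x0 <= C0 / 2 * (s0 / x0)"
  proof -
   have "2 * x0 * (x - x0) <= (x + x0) * (x - x0)" using x x0 by (intro mult_right_mono) auto
   also have "... = (x^2 - 1) - s0" by (simp add: s0_def power2_eq_square algebra_simps)
   also have "... <= C0 * s0" using sx s0 by simp
   finally show ?thesis using x0 by (simp add: field_simps)
  qed
  have "v x = (x^2 - 1) powr b * U x" by (simp add: liouville_def b_def)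
  also have "... <= (C0 * s0) powr b * (U x0 + U' x0 * (x - x0))"
   using Ux sx b0 Upos[of x] x by (intro mult_mono powr_mono2) auto
  also have "... = C0 powr b * (v x0 + s0 powr b * U' x0 * (x - x0))"
  proof -
   have "(C0 * s0) powr b = C0 powr b * s0 powr b" using C0 s0 by (simp add: powr_mult)
   thus ?thesis unfolding liouville_def b_def[symmetric] s0_def[symmetric] by (simp add: algebra_simps)
  qed
  also have "... <= C0 powr b * (s0 / x0 * v' x0 + v' x0 * (C0 / 2 * (s0 / x0)))"
  proof -
   have "s0 powr b * U' x0 * (x - x0) <= v' x0 * (C0 / 2 * (s0 / x0))"
    using vb(3) v'0 dx x(1) by (intro mult_mono) (auto simp: b_def s0_def)
   thus ?thesis using v0 by (intro mult_left_mono add_mono) auto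
  qed
  also have "... = M * (s0 / x0) * v' x0" by (simp add: M b_def algebra_simps)
  finally show "v x <= M * (s0 / x0) * v' x0" .
 qed
 have goal: "2 * M'^2 * ((x0^2 - 1)^2 / x0^2 + 1 / c^2) * (v' x0)^2
   = 2 * (?A M' s0 v')^2 + (M' * v' x0)^2 / (c^2 / 2)"
  unfolding s0_def[symmetric] using c by (simp add: power_mult_distrib power_divide algebra_simps)
 have Mle: "(?A M s0 v')^2 <= (?A M' s0 v')^2"
  using M'M s0 x0(1) v'0 by (intro power_mono mult_right_mono mult_nonneg_nonneg) (auto intro: less_imp_le)
 have cv': "continuous_on {x0..x3} v'" by (rule contv') (use x0(1) in auto)
 consider "!!x. x0 <= x ==> x <= x3 ==> v' x > 0"
  | z where "x0 < z" "z <= x3" "v' z = 0" "!!x. x0 <= x ==> x < z ==> v' x > 0"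
  using first_nonpos[OF x03 cv' v'0] by blast
 thus ?thesis
 proof cases
  case 1
  have e: "v x3 <= M * (s0 / x0) * v' x0" "U' x3 <= U' x0" "v x3 > 0"
   using est[of x3] 1 x03 by auto
  have s3: "x3^2 - 1 = C0 * s0" using x3 by (simp add: s0_def)
  have ratio: "x3 / (x3^2 - 1) * (s0 / x0) <= 1"
  proof -
   have "x3^2 <= (C0 * x0)^2"
   proof -
    have "x3^2 = 1 + C0 * s0" using s3 by simp
    also have "... <= C0 * (1 + s0)" using C0 by (simp add: algebra_simps)
    also have "... = C0 * x0^2" by (simp add: s0_def)
    also have "... <= C0^2 * x0^2" using C0 by (intro mult_right_mono) (auto simp: power2_eq_square)
    finally show ?thesis by (simp add: power_mult_distrib)
   qed
   hence "x3 <= C0 * x0" by (rule power2_le_imp_le) (use C0 x0(1) in auto)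
   thus ?thesis unfolding s3 using s0 C0 x0(1) by (simp add: divide_le_eq)
  qed
  have "v' x3 = (x3^2 - 1) powr b * U' x3 + (al + 1) * (x3 / (x3^2 - 1) * v x3)"
   unfolding liouville_def liouville_deriv_def b_def by (simp add: algebra_simps)
  also have "... <= C0 powr b * v' x0 + (al + 1) * (M * v' x0)"
  proof (intro add_mono mult_left_mono)
   have "(x3^2 - 1) powr b * U' x3 <= (x3^2 - 1) powr b * U' x0" using e by (intro mult_left_mono) auto
   also have "... = C0 powr b * (s0 powr b * U' x0)" using C0 s0 by (simp add: s3 powr_mult)
   also have "... <= C0 powr b * v' x0" using vb(3) by (intro mult_left_mono) (auto simp: b_def s0_def)
   finally show "(x3^2 - 1) powr b * U' x3 <= C0 powr b * v' x0" .
   have "x3 / (x3^2 - 1) * v x3 <= x3 / (x3^2 - 1) * (?A M s0 v')"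
    using e s3 s0 C0 x3 by (intro mult_left_mono) auto
   also have "... = (x3 / (x3^2 - 1) * (s0 / x0)) * (M * v' x0)" by simp
   also have "... <= 1 * (M * v' x0)" using ratio M'M v'0 by (intro mult_right_mono) auto
   finally show "x3 / (x3^2 - 1) * v x3 <= M * v' x0" by simp
  qed (use alpha in auto)
  also have "... = M' * v' x0" by (simp add: M(2) b_def algebra_simps)
  finally have v3: "v' x3 <= M' * v' x0" .
  have "amp <= (v x3)^2 + (v' x3)^2 / Q x3"
   using c x3 x03 by (intro amp_le_energy[OF x0(1) B Bs]) (auto intro: less_le_trans[of 0 "c^2/2"])
  also have "... <= (?A M s0 v')^2 + (M' * v' x0)^2 / (c^2 / 2)"
   using e v3 1[of x3] x03 c x3 by (intro add_mono frac_le power_mono) auto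
  also have "... <= 2 * (?A M' s0 v')^2 + (M' * v' x0)^2 / (c^2 / 2)"
   using Mle zero_le_power2[of "M' * (s0 / x0) * v' x0"] by linarith
  finally show ?thesis unfolding goal .
 next
  case (2 z)
  have e: "v z <= M * (s0 / x0) * v' x0" "v z > 0"
   using est[of z] 2 by auto
  \<comment> \<open>If Q z < 0, then Q < 0 on [x0, z] by monotonicity, so v'' = - Q v >= 0 there and
    v' could not come down to 0.\<close>
  have "Q z >= 0"
  proof (rule ccontr)
   assume n: "\<not> Q z >= 0"
   have "v' x0 <= v' z"
   proof (rule nondecreasing_from_deriv[where f = v' and f' = "%y. - Q y * v y"])
    fix y assume y: "x0 < y" "y < z"
    show "DERIV v' y :> - Q y * v y" using dv' y x0(1) by simp
    have "Q y <= 0" using Q_mono[OF x0(1) B Bs, of y z] y n by simp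
    moreover have "v y > 0" using est(3)[of y] y 2 by auto
    ultimately show "0 <= - Q y * v y" by (simp add: mult_nonpos_nonneg)
   qed (use 2 x0(1) in "auto intro!: contv'")
   thus False using 2 v'0 by simp
  qed
  hence "amp <= (v z)^2" using 2 by (intro amp_le_critical[OF x0(1) B Bs]) auto
  also have "... <= (?A M s0 v')^2" using e by (intro power_mono) auto
  also have "... <= 2 * (?A M' s0 v')^2 + (M' * v' x0)^2 / (c^2 / 2)"
   proof -
   have "(M' * v' x0)^2 / (c^2 / 2) >= 0" by simp
   thus ?thesis using Mle zero_le_power2[of "M' * (s0 / x0) * v' x0"] by linarith
  qed
  finally show ?thesis unfolding goal .
 qed
qed

end

section \<open>Eigenvalue parameters with ka - c^2 at most 2c\<close>

context outer_sol begin

text \<open>D bounds |ka - c^2 x^2| on the range (x^2 - 1) D <= 1. With M the maximum of |U|,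
  integrating the divergence form from 1, where \<open>pU\<close> vanishes, gives |U'| <= D M / 2
  and then |U - 1| <= M / 4. This forces M <= 4/3.\<close>

lemma near_one:
 assumes D: "D = c + abs (ka - c^2)" and x: "1 <= x" "(x^2 - 1) * D <= 1"
 shows "2/3 <= U x" "U x <= 4/3" "1 < x ==> (abs (U' x)) <= 2/3 * D"
proof -
 let ?A = "%y. 2 * (al + 1) * y / (y^2 - 1) * (y^2 - 1) powr (al + 1)"
 let ?B = "%y. ka - c^2 * y^2"
 have D0: "D > 0" "c <= D" using c by (auto simp: D)
 have "EX y:{1..x}. ALL z:{1..x}. (abs (U z)) <= abs (U y)"
  using x by (intro continuous_attains_sup continuous_intros contU) auto
 then obtain y0 where y0: "1 <= y0" "y0 <= x" and max: "!!z. 1 <= z ==> z <= x ==> (abs (U z)) <= abs (U y0)"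
  by auto
 define M where "M = abs (U y0)"
 have M0: "M >= 0" by (simp add: M_def)
 have coef: "abs (?B y) <= D" if "1 <= y" "y <= x" for y
 proof -
  have s: "0 <= y^2 - 1" "y^2 - 1 <= x^2 - 1" using that by (auto simp: power_mono)
  have "(y^2 - 1) * c <= (x^2 - 1) * D" using s D0 c by (intro mult_mono) auto
  hence "c * ((y^2 - 1) * c) <= c * 1" using x c by (intro mult_left_mono) auto
  moreover have "ka - c^2 * y^2 = (ka - c^2) - c * ((y^2 - 1) * c)" by (simp add: algebra_simps power2_eq_square)
  moreover have "c * ((y^2 - 1) * c) >= 0" using s c by simp
  ultimately show ?thesis unfolding D by linarith
 qed
 \<comment> \<open>With this k, the function k (y^2 - 1)^(al + 1) has derivative D M y (y^2 - 1)^al;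
   the extra factor y >= 1 is what makes it an explicit antiderivative.\<close>
 define k where "k = D * M / (2 * (al + 1))"
 have k: "0 <= k" "k <= D * M / 2"
  using D0 M0 alpha divide_left_mono[of 2 "2 * (al + 1)" "D * M"] by (auto simp: k_def)
 have contk: "continuous_on {1..y} (%x. (x^2 - 1) powr (al + 1))" for y :: real
  using alpha by (intro continuous_on_powr' continuous_intros) auto
 have rhs: "abs ((y^2 - 1) powr al * (?B y) * U y) <= k * (?A y)"
  if "1 < y" "y <= x" for y
 proof -
  have s: "y^2 - 1 > 0" using s_pos that by simp
  have "abs ((y^2 - 1) powr al * (?B y) * U y) <= (y^2 - 1) powr al * D * M"
   unfolding abs_mult using coef[of y] max[of y] that D0 M0
   by (intro mult_mono) (auto simp: M_def)
  also have "... <= (y^2 - 1) powr al * D * M * y"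
   using that D0 M0 mult_left_mono[of 1 y "(y^2 - 1) powr al * D * M"] by simp
  also have "... = k * (?A y)"
   using s alpha by (simp add: k_def powr_add)
  finally show ?thesis .
 qed
 have U'bd: "abs (U' y) <= D * M / 2" if y: "1 < y" "y <= x" for y
 proof -
  have s: "y^2 - 1 > 0" using s_pos y by simp
  have "pU y - k * (y^2 - 1) powr (al + 1) <= pU 1 - k * (1^2 - 1) powr (al + 1)"
  proof (rule nonincreasing_from_deriv[where f = "%x. pU x - k * (x^2 - 1) powr (al + 1)"])
   fix z assume z: "1 < z" "z < y"
   show "((%x. pU x - k * (x^2 - 1) powr (al + 1)) has_real_derivative
    (z^2 - 1) powr al * (?B z) * U z - k * (?A z)) (at z)"
    by (rule DERIV_diff[OF dpU DERIV_cmult[OF dspow]]) (use z in auto)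
   show "(z^2 - 1) powr al * (?B z) * U z - k * (?A z) <= 0"
    using rhs[of z] z y by linarith
  qed (use y in "auto intro!: continuous_intros contpU contk")
  moreover have "pU 1 + k * (1^2 - 1) powr (al + 1) <= pU y + k * (y^2 - 1) powr (al + 1)"
  proof (rule nondecreasing_from_deriv[where f = "%x. pU x + k * (x^2 - 1) powr (al + 1)"])
   fix z assume z: "1 < z" "z < y"
   show "((%x. pU x + k * (x^2 - 1) powr (al + 1)) has_real_derivative
    (z^2 - 1) powr al * (?B z) * U z + k * (?A z)) (at z)"
    by (rule DERIV_add[OF dpU DERIV_cmult[OF dspow]]) (use z in auto)
   show "(z^2 - 1) powr al * (?B z) * U z + k * (?A z) >= 0"
    using rhs[of z] z y by linarith
  qed (use y in "auto intro!: continuous_intros contpU contk")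
  ultimately have "abs (pU y) <= k * (y^2 - 1) powr (al + 1)" by (simp add: pU1)
  hence "(y^2 - 1) powr (al + 1) * abs (U' y) <= (y^2 - 1) powr (al + 1) * k" by (simp add: pU_def abs_mult mult.commute)
  hence "abs (U' y) <= k" using s by simp
  thus ?thesis using k by linarith
 qed
 have close: "abs (U y - 1) <= M / 4" if y: "1 <= y" "y <= x" for y
 proof (cases "y = 1")
  case False
  hence y1: "1 < y" using y by simp
  obtain om where xi: "1 < om" "om < y" "U y - U 1 = (y - 1) * U' om"
   using MVT2[OF y1, of U U'] dU by auto
  have "abs (U y - 1) = (y - 1) * abs (U' om)" using xi y by (simp add: U1 abs_mult)
  also have "... <= (y - 1) * (D * M / 2)" using U'bd[of om] xi y by (intro mult_left_mono) auto
  also have "... <= M / 4"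
  proof -
   have "2 * (y - 1) <= (y + 1) * (y - 1)" using y by (intro mult_right_mono) auto
   also have "... = y^2 - 1" by (simp add: power2_eq_square algebra_simps)
   also have "... <= x^2 - 1" using y by (simp add: power_mono)
   finally have "2 * (y - 1) * D <= (x^2 - 1) * D" using D0 by (intro mult_right_mono) auto
   hence "2 * (y - 1) * D <= 1" using x by simp
   hence "2 * (y - 1) * D * (M / 4) <= 1 * (M / 4)" using M0 by (intro mult_right_mono) auto
   thus ?thesis by (simp add: algebra_simps)
  qed
  finally show ?thesis .
 qed (use M0 in "simp add: U1")
 have M43: "M <= 4/3" using close[OF y0] unfolding M_def by argo
 show "2/3 <= U x" "U x <= 4/3" using close[OF x(1) order_refl] M43 by argo+
 show "abs (U' x) <= 2/3 * D" if "1 < x"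
 proof -
  have "D * M / 2 <= D * (4/3) / 2" using D0 M43 by (intro divide_right_mono mult_left_mono) auto
  thus ?thesis using U'bd[of x] that by simp
 qed
qed

text \<open>A positive majorant of the potential whose logarithmic increase, and whose distance from the
  potential relative to its square root, are integrable uniformly in the parameters.\<close>

definition P where "P x = c^2 - (ka - c^2) / (x^2 - 1) + 4 / (x^2 - 1)^2"

text \<open>Arithmetic-geometric mean: with s = x^2 - 1 one has 4c / s <= c^2 + 4 / s^2, so a term
  (ka - c^2) / s <= 2c / s consumes at most half of the other two. This explains both the constant 4
  in \<open>P\<close> and the threshold 2c.\<close>

lemma P_bounds:
 assumes x: "1 < x" and B: "ka - c^2 <= 2 * c" and D: "D = c + abs (ka - c^2)"
 shows "P x >= (c^2 + 4 / (x^2 - 1)^2) / 2" "P x >= D / (2 * (x^2 - 1))" "P x >= c^2 / 2" "P x > 0"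
proof -
 define s where "s = x^2 - 1"
 have s: "s > 0" using s_pos x by (simp add: s_def)
 have am: "4 * c / s <= c^2 + 4 / s^2"
 proof -
  have "0 <= (c - 2 / s)^2" by simp
  also have "... = c^2 + 4 / s^2 - 4 * c / s" using s by (simp add: power2_eq_square field_simps)
  finally show ?thesis by simp
 qed
 have "(ka - c^2) / s <= 2 * c / s" using B s by (intro divide_right_mono) auto
 thus 1: "P x >= (c^2 + 4 / (x^2 - 1)^2) / 2" using am unfolding P_def s_def[symmetric] by argo
 thus 2: "P x >= c^2 / 2" using divide_nonneg_nonneg[of 4 "(x^2 - 1)^2"] zero_le_power2[of "x^2 - 1"] by argo
 show "P x > 0" using 2 zero_less_power[OF c, of 2] by linarith
 show "P x >= D / (2 * (x^2 - 1))"
 proof (cases "ka - c^2 >= 0")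
  case True
  hence "D <= 3 * c" using B by (simp add: D)
  hence "D / (2 * s) <= 3 * c / (2 * s)" using s by (intro divide_right_mono) auto
  also have "... <= (4 * c / s) / 2" using s c by (simp add: field_simps)
  finally show ?thesis using 1 am by (simp add: s_def[symmetric])
 next
  case False
  have "D / (2 * s) <= D / s" using s c by (intro divide_left_mono) (auto simp: D)
  also have "... = c / s - (ka - c^2) / s" using False by (simp add: D diff_divide_distrib add_divide_distrib)
  also have "... <= 4 * c / s - (ka - c^2) / s" using s c by (intro diff_mono divide_right_mono) auto
  finally show ?thesis using am by (simp add: P_def s_def[symmetric])
 qed
qed

lemma dP: assumes "1 < x"
 shows "DERIV P x :> 2 * x * ((ka - c^2) * (x^2 - 1) - 8) / (x^2 - 1) ^ 3"
proof -
 have s: "x^2 - 1 > 0" using s_pos assms by simp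
 have alg: "0 - (0 * t - B * (2 * x)) / (t * t) + (0 * t^2 - 4 * (of_nat 2 * (2 * x * t ^ (2 - Suc 0)))) / (t^2 * t^2) = 2 * x * (B * t - 8) / t ^ 3"
  if "t > 0" for t B :: real
  using that by (simp add: divide_simps) (simp add: algebra_simps power2_eq_square power3_eq_cube power4_eq_xxxx)
 show ?thesis unfolding P_def[abs_def]
  by (rule DERIV_cong[OF DERIV_add[OF DERIV_diff[OF DERIV_const DERIV_divide[OF DERIV_const ds]]
   DERIV_divide[OF DERIV_const DERIV_power[OF ds]]] alg[OF s]]) (use s in auto)
qed

text \<open>An antiderivative of a bound for the logarithmic growth rate of the energies: the
  arctangent controls P' / P, the other term controls (P - Q) / sqrt P. Both stay bounded on (x^2 -
  1) D >= 1, whence a growth factor of at most exp (pi + C).\<close>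

definition phase :: "real => real => real => real" where
 "phase C D x = 2 * arctan (c * (x^2 - 1) / 2) - C / sqrt D * (x^2 - 1) powr (-1/2)"

lemma dphase: assumes "1 < x"
 shows "(phase C D has_real_derivative 2 * x * (4 * c / (c^2 * (x^2 - 1)^2 + 4))
   + C / sqrt D * (x / (x^2 - 1) * (x^2 - 1) powr (-1/2))) (at x)"
proof -
 have alg: "2 * (inverse (1 + (c * t / 2)^2) * (c * (2 * x) / 2)) = 2 * x * (4 * c / (c^2 * t^2 + 4))"
  for t :: real
 proof -
  have "1 + (c * t / 2)^2 = (c^2 * t^2 + 4) / 4" by (simp add: power_divide power_mult_distrib)
  moreover have "c^2 * t^2 + 4 > 0" by (simp add: add_nonneg_pos)
  ultimately show ?thesis by (simp only:) simp
 qed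
 have d1: "DERIV (%x. 2 * arctan (c * (x^2 - 1) / 2)) x :> 2 * x * (4 * c / (c^2 * (x^2 - 1)^2 + 4))"
  by (rule DERIV_cong[OF DERIV_cmult[OF DERIV_chain2[OF DERIV_arctan DERIV_cdivide[OF DERIV_cmult[OF ds]]]] alg])
 have d2: "DERIV (%x. C / sqrt D * (x^2 - 1) powr (-1/2)) x :> - (C / sqrt D * (x / (x^2 - 1) * (x^2 - 1) powr (-1/2)))"
  by (rule DERIV_cong[OF DERIV_cmult[OF dspow[OF assms]]]) simp
 show ?thesis unfolding phase_def[abs_def]
  by (rule DERIV_cong[OF DERIV_diff[OF d1 d2]]) simp
qed

lemma phase_bounds:
 assumes "1 < x" "(x^2 - 1) * D >= 1" "D > 0" "C >= 0"
 shows "- C <= phase C D x" "phase C D x <= pi"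
proof -
 have s: "x^2 - 1 > 0" using s_pos assms by simp
 have "arctan (c * (x^2 - 1) / 2) >= 0" "arctan (c * (x^2 - 1) / 2) < pi / 2"
  using s c arctan_ubound by (auto simp: zero_le_arctan_iff)
 moreover have e: "(x^2 - 1) powr (-1/2) = 1 / sqrt (x^2 - 1)"
  using s by (simp add: powr_minus_divide powr_half_sqrt[symmetric])
 have "C / sqrt D * (x^2 - 1) powr (-1/2) = C / sqrt ((x^2 - 1) * D)"
  unfolding e by (simp add: real_sqrt_mult)
 moreover have "C / sqrt ((x^2 - 1) * D) <= C / 1"
  using assms by (intro divide_left_mono) auto
 moreover have "C / sqrt ((x^2 - 1) * D) >= 0" using assms s by simp
 ultimately show "- C <= phase C D x" "phase C D x <= pi" unfolding phase_def by linarith+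
qed

text \<open>The first rate compares 2c / s^2 with P >= (c^2 + 4 / s^2) / 2. For the last one, P - Q
  equals (al^2 + al) / s + (3 + al^2) / s^2; the first summand is absorbed by P >= c^2 / 2 together
  with D <= Cd c^2, the second one by P >= D / (2s). These are the two parts of C.\<close>

lemma rate_bound:
 assumes x: "1 < x" and B: "ka - c^2 <= 2 * c" and D: "D = c + abs (ka - c^2)" and Cd: "D <= Cd * c^2"
  and C: "C = (al^2 + al) * sqrt (2 * Cd) + (3 + al^2) * sqrt 2"
 shows "2 * x * ((ka - c^2) * (x^2 - 1) - 8) / (x^2 - 1) ^ 3 <= 2 * x * (4 * c / (c^2 * (x^2 - 1)^2 + 4)) * P x" (is ?A)
  and "P x - Q x >= 0" (is ?B)
  and "P x - Q x <= C / sqrt D * (x / (x^2 - 1) * (x^2 - 1) powr (-1/2)) * sqrt (P x)" (is ?C)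
proof -
 let ?D = "%s. 4 * c / (c^2 * s^2 + 4)"
 define s where "s = x^2 - 1"
 have s: "s > 0" using s_pos x by (simp add: s_def)
 have D0: "D > 0" using c by (simp add: D)
 note Pb = P_bounds[OF x B D, folded s_def]
 show ?A
 proof -
  have "((ka - c^2) * s - 8) / s ^ 3 <= 2 * c / s^2"
  proof -
   have "(ka - c^2) * s - 8 <= 2 * c * s" using mult_right_mono[OF B, of s] s by linarith
   hence "((ka - c^2) * s - 8) / s ^ 3 <= 2 * c * s / s ^ 3" using s by (intro divide_right_mono) auto
   thus ?thesis using s by (simp add: power3_eq_cube power2_eq_square)
  qed
  also have "2 * c / s^2 = (?D s) * ((c^2 + 4 / s^2) / 2)"
  proof -
   have p: "c^2 * s^2 + 4 > 0" by (simp add: add_nonneg_pos)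
   have "(c^2 + 4 / s^2) = (c^2 * s^2 + 4) / s^2" using s by (simp add: field_simps)
   thus ?thesis using p s by simp
  qed
  also have "... <= (?D s) * P x"
   using Pb c by (intro mult_left_mono) auto
  finally have "2 * x * (((ka - c^2) * s - 8) / s ^ 3) <= 2 * x * ((?D s) * P x)"
   using x by (intro mult_left_mono) auto
  thus ?thesis by (simp add: s_def mult.assoc)
 qed
 have PQ: "P x - Q x = (al^2 + al) / s + (3 + al^2) / s^2"
  by (simp add: P_def liouville_pot_def s_def[symmetric] add_divide_distrib diff_divide_distrib)
 show ?B unfolding PQ using s alpha by simp
 show ?C
 proof -
  define r where "r = sqrt (P x)"
  have r0: "r > 0" using Pb by (simp add: r_def)
  have xs: "sqrt s <= x" using x by (intro real_le_lsqrt) (auto simp: s_def)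
  have e: "s powr (-1/2) = 1 / sqrt s"
   using s by (simp add: powr_minus_divide powr_half_sqrt[symmetric])
  have a1: "c <= sqrt 2 * r"
   by (rule power2_le_imp_le) (use Pb(3) Pb(4) r0 in "simp_all add: power_mult_distrib r_def")
  have a2: "sqrt D <= sqrt Cd * c"
  proof -
   have "sqrt D <= sqrt (Cd * c^2)" using Cd by simp
   thus ?thesis using c by (simp add: real_sqrt_mult)
  qed
  have a3: "sqrt D <= sqrt 2 * sqrt s * r"
  proof -
   have "D <= 2 * s * P x" using Pb(2) s by (simp add: field_simps)
   hence "sqrt D <= sqrt (2 * s * P x)" by simp
   thus ?thesis by (simp add: real_sqrt_mult r_def)
  qed
  have Cd0: "Cd >= 0"
  proof (rule ccontr)
   assume "\<not> Cd >= 0"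
   hence "Cd * c^2 <= 0" by (simp add: mult_nonpos_nonneg)
   thus False using Cd D0 by simp
  qed
  have "sqrt D <= sqrt Cd * (sqrt 2 * r)"
   using a2 a1 by (meson Cd0 mult_left_mono order_trans real_sqrt_ge_zero)
  hence "sqrt D * sqrt s <= sqrt Cd * (sqrt 2 * r) * x"
   using xs r0 Cd0 s by (intro mult_mono) auto
  hence t1: "(al^2 + al) * (sqrt D * sqrt s) <= (al^2 + al) * (sqrt (2 * Cd) * r * x)"
   using alpha by (intro mult_left_mono) (auto simp: real_sqrt_mult mult_ac)
  have "sqrt D <= sqrt 2 * sqrt s * r * x"
  proof -
   have "sqrt 2 * sqrt s * r * 1 <= sqrt 2 * sqrt s * r * x" using x r0 s by (intro mult_left_mono) auto
   thus ?thesis using a3 by linarith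
  qed
  hence t2: "(3 + al^2) * sqrt D <= (3 + al^2) * (sqrt 2 * sqrt s * r * x)"
   by (intro mult_left_mono) auto
  have "(P x - Q x) * (sqrt D * (s * sqrt s))
    = (al^2 + al) * (sqrt D * sqrt s) + (3 + al^2) * sqrt D * (sqrt s / s)"
   unfolding PQ using s by (simp add: field_simps power2_eq_square)
  also have "... <= (al^2 + al) * (sqrt (2 * Cd) * r * x) + (3 + al^2) * (sqrt 2 * sqrt s * r * x) * (sqrt s / s)"
   using t1 t2 s by (intro add_mono mult_right_mono) auto
  also have "... = C * x * r"
  proof -
   have "k * (q * z * r * x) * (z / s) = k * q * (r * x) * (z * z / s)" for k q z :: real by simp
   hence "(3 + al^2) * (sqrt 2 * sqrt s * r * x) * (sqrt s / s) = (3 + al^2) * sqrt 2 * (r * x) * (sqrt s * sqrt s / s)" .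
   also have "sqrt s * sqrt s / s = 1" using s by (simp only: real_sqrt_mult_self) simp
   finally show ?thesis by (simp add: C algebra_simps)
  qed
  finally have "P x - Q x <= C * x * r / (sqrt D * (s * sqrt s))"
   using s D0 by (simp add: pos_le_divide_eq)
  thus ?thesis unfolding s_def[symmetric] e by (simp add: r_def mult_ac)
 qed
qed

end

context outer_sol begin

text \<open>Two energies as before, with the positive majorant P in place of Q. They are no longer
  monotone, but the increase of P and the error term (P - Q) v v' are dominated by the derivative of
  \<open>phase\<close>. So exp(- ph) H is nonincreasing and exp(ph) W nondecreasing, which bounds
  the change between xb and infinity in the two directions.\<close>

lemma amp_two_sided:
 assumes B: "ka - c^2 <= 2 * c" and D: "D = c + abs (ka - c^2)" and Cd: "D <= Cd * c^2"
  and C: "C = (al^2 + al) * sqrt (2 * Cd) + (3 + al^2) * sqrt 2" and C0: "C >= 0"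
  and xb: "1 < xb" "(xb^2 - 1) * D = 1"
 shows "c^2 * amp <= exp (pi + C) * ((v' xb)^2 + P xb * (v xb)^2)"
  and "(v xb)^2 <= exp (pi + C) * amp"
proof -
 let ?A = "%x. 1 + abs (c^2 / P x - 1)"
 let ?B = "%x. 2 * (P x - Q x) * (v x * v' x)"
 let ?C = "%x. (P x - Q x) / P x"
 let ?D = "%y P' j1 j2 W. 2 * (v y * v' y) * (?C y) - P' y * (v' y)^2 / (P y * P y) + (j1 y + j2 y) * W y"
 let ?E = "%K. %x. K + abs (c^2 - P x) * (K / (c^2 / 2))"
 have D0: "D > 0" using c by (simp add: D)
 have c2: "c^2 > 0" using c by simp
 define H where "H x = (v' x)^2 + P x * (v x)^2" for x
 define W where "W x = (v x)^2 + (v' x)^2 / P x" for x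
 define j1 where "j1 x = 2 * x * (4 * c / (c^2 * (x^2 - 1)^2 + 4))" for x
 define j2 where "j2 x = C / sqrt D * (x / (x^2 - 1) * (x^2 - 1) powr (-1/2))" for x
 define P' where "P' x = 2 * x * ((ka - c^2) * (x^2 - 1) - 8) / (x^2 - 1) ^ 3" for x
 define ph where "ph = phase C D"
 have Pp: "P x > 0" "P x >= c^2 / 2" if "1 < x" for x using P_bounds[OF that B D] by auto
 have r1: "P' x <= j1 x * P x" and r2: "P x - Q x >= 0" and r3: "P x - Q x <= j2 x * sqrt (P x)" if "1 < x" for x
  using rate_bound[OF that B D Cd C] by (simp_all add: P'_def j1_def j2_def)
 have j1p: "j1 x >= 0" and j2p: "j2 x >= 0" if "1 < x" for x
  using that c s_pos[OF that] C0 D0 by (auto simp: j1_def j2_def)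
 have dph: "DERIV ph x :> (j1 x + j2 x)" if "1 < x" for x
  using dphase[OF that] by (simp add: ph_def j1_def j2_def)
 have dP2: "DERIV P x :> P' x" if "1 < x" for x
  using dP[OF that] by (simp add: P'_def)
 have dH: "DERIV H x :> P' x * (v x)^2 + 2 * (P x - Q x) * (v x * v' x)" if "1 < x" for x
  unfolding H_def[abs_def]
  by (rule DERIV_cong[OF DERIV_add[OF DERIV_power[OF dv'[OF that]] DERIV_mult[OF dP2[OF that] DERIV_power[OF dv[OF that]]]]])
    (simp add: algebra_simps)
 have dW: "DERIV W x :> 2 * (v x * v' x) * (?C x) - P' x * (v' x)^2 / (P x * P x)" if "1 < x" for x
  unfolding W_def[abs_def]
  apply (rule DERIV_cong[OF DERIV_add[OF DERIV_power[OF dv[OF that]] DERIV_divide[OF DERIV_power[OF dv'[OF that]] dP2[OF that]]]])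
  using Pp(1)[OF that] by (simp_all add: field_simps)
 have cH: "continuous_on {xb..x} H" and cW: "continuous_on {xb..x} W" and cph: "continuous_on {xb..x} ph" for x
  by (rule DERIV_atLeastAtMost_imp_continuous_on, rule exI, rule dH dW dph, use xb(1) in linarith)+
 have amg: "2 * (a * b) <= a^2 + b^2" for a b :: real using sum_squares_bound[of a b] by simp
 have k1: "abs (?B x) <= j2 x * H x" if "1 < x" for x
 proof -
  have "abs (?B x) = (P x - Q x) * (2 * (abs (v x) * abs (v' x)))" using r2[OF that] by (simp add: abs_mult)
  also have "... <= (j2 x * sqrt (P x)) * (2 * (abs (v x) * abs (v' x)))" using r3[OF that] by (intro mult_right_mono) auto
  also have "... = j2 x * (2 * ((sqrt (P x) * abs (v x)) * abs (v' x)))" by simp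
  also have "... <= j2 x * ((sqrt (P x) * abs (v x))^2 + (abs (v' x))^2)" using j2p[OF that] by (intro mult_left_mono amg) auto
  also have "... = j2 x * H x" using Pp[OF that] by (simp add: H_def power_mult_distrib)
  finally show ?thesis .
 qed
 have HW: "H x = P x * W x" if "1 < x" for x using Pp[OF that] by (simp add: H_def W_def algebra_simps)
 have H0: "H x >= 0" and W0: "W x >= 0" if "1 < x" for x using Pp[OF that] by (auto simp: H_def W_def)
 have phb: "ph x <= pi" "- C <= ph x" if "xb <= x" for x
 proof -
  have x1: "1 < x" using that xb by simp
  have "(xb^2 - 1) * D <= (x^2 - 1) * D" using that xb D0 by (intro mult_right_mono) (auto simp: power_mono)
  thus "ph x <= pi" "- C <= ph x" using phase_bounds[OF x1 _ D0 C0] xb by (auto simp: ph_def)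
 qed
 have up: "H x <= exp (pi + C) * H xb" if x: "xb <= x" for x
 proof -
  have "exp (- ph x) * H x <= exp (- ph xb) * H xb"
  proof (rule nonincreasing_from_deriv[where f = "%x. exp (- ph x) * H x", OF x])
   show "continuous_on {xb..x} (%x. exp (- ph x) * H x)" by (intro continuous_intros cH cph)
   fix y assume y: "xb < y" "y < x"
   hence y1: "1 < y" using xb by simp
   show "DERIV (%x. exp (- ph x) * H x) y :> exp (- ph y) * (P' y * (v y)^2 + 2 * (P y - Q y) * (v y * v' y) - (j1 y + j2 y) * H y)"
    by (rule DERIV_cong[OF DERIV_mult[OF DERIV_chain2[OF DERIV_exp DERIV_minus[OF dph[OF y1]]] dH[OF y1]]])
      (simp add: algebra_simps)
   have "P' y * (v y)^2 <= j1 y * P y * (v y)^2" using r1[OF y1] by (intro mult_right_mono) auto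
   also have "... <= j1 y * H y" unfolding mult.assoc using j1p[OF y1] by (intro mult_left_mono) (auto simp: H_def)
   finally have "P' y * (v y)^2 + 2 * (P y - Q y) * (v y * v' y) - (j1 y + j2 y) * H y <= 0"
    using k1[OF y1] by (simp add: algebra_simps)
   thus "exp (- ph y) * (P' y * (v y)^2 + 2 * (P y - Q y) * (v y * v' y) - (j1 y + j2 y) * H y) <= 0"
    by (simp add: mult_nonneg_nonpos)
  qed
  hence "exp (ph x) * (exp (- ph x) * H x) <= exp (ph x) * (exp (- ph xb) * H xb)" by (intro mult_left_mono) auto
  hence "H x <= exp (ph x - ph xb) * H xb" by (simp add: mult.assoc[symmetric] exp_add[symmetric])
  also have "... <= exp (pi + C) * H xb" using phb[OF x] phb[of xb] H0 xb by (intro mult_right_mono) auto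
  finally show ?thesis .
 qed
 have lo: "W xb <= exp (pi + C) * W x" if x: "xb <= x" for x
 proof -
  have "exp (ph xb) * W xb <= exp (ph x) * W x"
  proof (rule nondecreasing_from_deriv[where f = "%x. exp (ph x) * W x", OF x])
   show "continuous_on {xb..x} (%x. exp (ph x) * W x)" by (intro continuous_intros cW cph)
   fix y assume y: "xb < y" "y < x"
   hence y1: "1 < y" using xb by simp
   note Py = Pp(1)[OF y1]
   show "DERIV (%x. exp (ph x) * W x) y :> exp (ph y) * (?D y P' j1 j2 W)"
    by (rule DERIV_cong[OF DERIV_mult[OF DERIV_chain2[OF DERIV_exp dph[OF y1]] dW[OF y1]]])
      (simp add: algebra_simps)
   have "P' y * (v' y)^2 / (P y * P y) <= j1 y * P y * (v' y)^2 / (P y * P y)"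
    using r1[OF y1] Py by (intro divide_right_mono mult_right_mono) auto
   also have "... = j1 y * ((v' y)^2 / P y)" using Py by simp
   also have "... <= j1 y * W y" using j1p[OF y1] by (intro mult_left_mono) (auto simp: W_def)
   finally have a1: "P' y * (v' y)^2 / (P y * P y) <= j1 y * W y" .
   have "abs (?B y) / P y <= j2 y * H y / P y" using k1[OF y1] Py by (intro divide_right_mono) auto
   moreover have "abs (2 * (v y * v' y) * (?C y)) = abs (?B y) / P y"
   proof -
    have "2 * (v y * v' y) * (?C y) = (?B y) / P y" by simp
    thus ?thesis using Py by (simp only: abs_divide abs_of_pos)
   qed
   moreover have "j2 y * H y / P y = j2 y * W y" using HW[OF y1] Py by simp
   ultimately have "abs (2 * (v y * v' y) * (?C y)) <= j2 y * W y" by linarith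
   with a1 have "2 * (v y * v' y) * (?C y) - P' y * (v' y)^2 / (P y * P y) + (j1 y + j2 y) * W y >= 0"
    unfolding distrib_right by linarith
   thus "0 <= exp (ph y) * (?D y P' j1 j2 W)"
    by simp
  qed
  hence "exp (- ph xb) * (exp (ph xb) * W xb) <= exp (- ph xb) * (exp (ph x) * W x)" by (intro mult_left_mono) auto
  hence "W xb <= exp (ph x - ph xb) * W x" by (simp add: mult.assoc[symmetric] exp_add[symmetric] add.commute)
  also have "... <= exp (pi + C) * W x" using phb[OF x] phb[of xb] W0[of x] xb x by (intro mult_right_mono) auto
  finally show ?thesis .
 qed
 define E where "E x = (v x)^2 + (v' x)^2 / c^2" for x
 have limE: "(E ---> amp) at_top" using amp by (simp add: E_def[abs_def])
 have limP: "(P ---> c^2) at_top" unfolding P_def by real_asymp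
 define K where "K = exp (pi + C) * H xb"
 \<comment> \<open>P agrees with c^2 only in the limit. The difference contributes |c^2 - P| times a
   bound for v^2, which tends to 0.\<close>
 have "c^2 * amp <= K"
 proof (rule tendsto_le[OF _ _ tendsto_mult_left[OF limE, of "c^2"]])
  have "((?E K) ---> K + abs (c^2 - c^2) * (K / (c^2 / 2))) at_top"
   by (intro tendsto_intros limP)
  thus "((?E K) ---> K) at_top" by simp
  show "\<forall>\<^sub>F x in at_top. c^2 * E x <= K + abs (c^2 - P x) * (K / (c^2 / 2))"
  proof (rule eventually_at_top_linorderI)
   fix x assume x: "xb <= x"
   hence x1: "1 < x" using xb by simp
   have "(v x)^2 * (c^2 / 2) <= (v x)^2 * P x" using Pp[OF x1] by (intro mult_left_mono) auto
   also have "... <= H x" by (simp add: H_def)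
   also have "... <= K" using up[OF x] by (simp add: K_def)
   finally have "(v x)^2 <= K / (c^2 / 2)" using c2 by (simp add: pos_le_divide_eq)
   hence "abs (c^2 - P x) * (v x)^2 <= abs (c^2 - P x) * (K / (c^2 / 2))" by (intro mult_left_mono) auto
   moreover have "(c^2 - P x) * (v x)^2 <= abs (c^2 - P x) * (v x)^2" by (intro mult_right_mono) auto
   moreover have "c^2 * E x = H x + (c^2 - P x) * (v x)^2" using c2 by (simp add: E_def H_def algebra_simps)
   ultimately show "c^2 * E x <= K + abs (c^2 - P x) * (K / (c^2 / 2))" using up[OF x] by (simp add: K_def)
  qed
 qed auto
 thus "c^2 * amp <= exp (pi + C) * ((v' xb)^2 + P xb * (v xb)^2)" by (simp add: K_def H_def)
 have "W xb <= exp (pi + C) * amp"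
 proof (rule tendsto_lowerbound)
  have "((%x. exp (pi + C) * (E x * (?A x))) ---> exp (pi + C) * (amp * (1 + abs (c^2 / c^2 - 1)))) at_top"
   using c2 by (intro tendsto_intros limP limE) auto
  thus "((%x. exp (pi + C) * (E x * (?A x))) ---> exp (pi + C) * amp) at_top" using c2 by simp
  show "\<forall>\<^sub>F x in at_top. W xb <= exp (pi + C) * (E x * (?A x))"
  proof (rule eventually_at_top_linorderI)
   fix x assume x: "xb <= x"
   hence x1: "1 < x" using xb by simp
   have "(v' x)^2 / P x = (v' x)^2 / c^2 * (c^2 / P x)" using c2 by simp
   also have "... <= (v' x)^2 / c^2 * (?A x)" by (intro mult_left_mono) auto
   finally have i: "(v' x)^2 / P x <= (v' x)^2 / c^2 * (?A x)" .
   have "(v x)^2 * 1 <= (v x)^2 * (?A x)" by (intro mult_left_mono) auto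
   with i have "W x <= E x * (?A x)" unfolding W_def E_def distrib_right by linarith
   hence "exp (pi + C) * W x <= exp (pi + C) * (E x * (?A x))" by (intro mult_left_mono) auto
   thus "W xb <= exp (pi + C) * (E x * (?A x))" using lo[OF x] by linarith
  qed
 qed simp
 moreover have "(v xb)^2 <= W xb" using Pp(1)[OF xb(1)] by (simp add: W_def)
 ultimately show "(v xb)^2 <= exp (pi + C) * amp" by linarith
qed

text \<open>At the point xb with (xb^2 - 1) D = 1 the solution is still comparable to 1 by
  \<open>near_one\<close>. Hence everything is an explicit power of D there: v^2 is comparable to
  D^(-(al + 1)), while v'^2 and P v^2 are at most a constant times D^(1 - al). The lower bound for c
  keeps xb bounded.\<close>

lemma amp_near_critical:
 assumes B: "ka - c^2 <= 2 * c" and D: "D = c + abs (ka - c^2)" and Cd: "D <= Cd * c^2"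
  and C: "C = (al^2 + al) * sqrt (2 * Cd) + (3 + al^2) * sqrt 2" and C0: "C >= 0" and c1: "c >= c1" "c1 > 0"
 shows "c^2 * amp <= exp (pi + C) * (4 * (al + 1)^2 * (1 + 1 / c1) + 11) * D powr (1 - al)"
  and "D powr (- (al + 1)) <= 9/4 * exp (pi + C) * amp"
proof -
 let ?A = "%xb D. U' xb + (al + 1) * xb * D * U xb"
 let ?B = "%D. D powr (- (al + 1)) * D^2"
 have D0: "D > 0" "c <= D" using c by (auto simp: D)
 define xb where "xb = sqrt (1 + 1 / D)"
 have xb2: "xb^2 = 1 + 1 / D" using D0 by (simp add: xb_def add_nonneg_nonneg)
 have xb1: "1 < xb" using D0 by (simp add: xb_def)
 have xbD: "(xb^2 - 1) * D = 1" using D0 by (simp add: xb2)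
 note ts = amp_two_sided[OF B D Cd C C0 xb1 xbD]
 note n1 = near_one[OF D less_imp_le[OF xb1] eq_refl[OF xbD]]
 define b where "b = (al + 1) / 2"
 have s: "xb^2 - 1 = 1 / D" by (simp add: xb2)
 have pw: "(xb^2 - 1) powr b = D powr (- b)" unfolding s using D0 by (simp add: powr_minus_divide powr_divide)
 have vb: "v xb = D powr (- b) * U xb" unfolding liouville_def b_def[symmetric] pw ..
 have vsq: "(v xb)^2 = D powr (- (al + 1)) * (U xb)^2"
  unfolding vb power_mult_distrib using D0 by (simp add: power2_eq_square powr_add[symmetric] b_def)
 have Usq: "4/9 <= (U xb)^2" "(U xb)^2 <= 16/9"
  using n1(1,2) power_mono[of "2/3" "U xb" 2] power_mono[of "U xb" "4/3" 2] by (auto simp: power_divide)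
 have "D powr (- (al + 1)) * (4/9) <= (v xb)^2" unfolding vsq using Usq by (intro mult_left_mono) auto
 thus "D powr (- (al + 1)) <= 9/4 * exp (pi + C) * amp" using ts(2) by simp
 have xbb: "xb^2 <= 1 + 1 / c1" using c1 D0 by (simp add: xb2 frac_le)
 have v'abs: "abs (v' xb) <= D powr (- b) * (2 * (al + 1) * xb * D)"
 proof -
  have "v' xb = D powr (- b) * (?A xb D)"
   unfolding liouville_deriv_def using pw D0 by (simp add: b_def s)
  hence "abs (v' xb) = D powr (- b) * abs (?A xb D)" by (simp add: abs_mult)
  also have "... <= D powr (- b) * (2 * (al + 1) * xb * D)"
  proof (intro mult_left_mono)
   have p: "(al + 1) * xb * D >= D" using alpha xb1 D0
    by (simp add: mult_ge1_I)
   have "abs (?A xb D) <= 2/3 * D + (al + 1) * xb * D * (4/3)"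
    using n1(3)[OF xb1] n1(1,2) alpha xb1 D0
    by (intro order_trans[OF abs_triangle_ineq] add_mono) (auto simp: abs_mult)
   thus "abs (?A xb D) <= 2 * (al + 1) * xb * D" using p by linarith
  qed simp
  finally show ?thesis .
 qed
 have Dp: "D powr (- (al + 1)) * D^2 = D powr (1 - al)"
 proof -
  have "D powr (- (al + 1)) * D powr 2 = D powr (1 - al)" by (simp add: powr_add[symmetric])
  thus ?thesis using D0 by simp
 qed
 have A1: "(v' xb)^2 <= 4 * (al + 1)^2 * (1 + 1 / c1) * D powr (1 - al)"
 proof -
  have "(v' xb)^2 <= (D powr (- b) * (2 * (al + 1) * xb * D))^2"
   using v'abs by (rule abs_le_square_iff[THEN iffD1, OF order_trans[OF _ abs_ge_self]])
  also have "... = 4 * (al + 1)^2 * xb^2 * ((D powr (- b))^2 * D^2)" unfolding power_mult_distrib by simp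
  also have "(D powr (- b))^2 = D powr (- (al + 1))" by (simp add: power2_eq_square powr_add[symmetric] b_def)
  also have "4 * (al + 1)^2 * xb^2 * (?B D) <= 4 * (al + 1)^2 * (1 + 1 / c1) * (?B D)"
   using xbb by (intro mult_right_mono mult_left_mono) auto
  finally show ?thesis unfolding Dp .
 qed
 have A2: "P xb * (v xb)^2 <= 11 * D powr (1 - al)"
 proof -
  have "P xb = c^2 - (ka - c^2) * D + 4 * D^2" by (simp add: P_def s power_divide)
  also have "... <= D^2 + D * D + 4 * D^2"
  proof (intro add_mono order_refl)
   have "- (ka - c^2) * D <= D * D" using D0 c by (intro mult_right_mono) (auto simp: D)
   moreover have "c^2 <= D^2" using D0 c by (intro power_mono) auto
   ultimately show "c^2 - (ka - c^2) * D <= D^2 + D * D" by linarith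
  qed
  also have "... = 6 * D^2" by (simp add: power2_eq_square)
  finally have "P xb * (v xb)^2 <= 6 * D^2 * (D powr (- (al + 1)) * (16/9))"
   unfolding vsq using Usq by (intro mult_mono) auto
  also have "... = 6 * 16 / 9 * (?B D)" by simp
  also have "... <= 11 * (?B D)" by (intro mult_right_mono) auto
  finally show ?thesis unfolding Dp .
 qed
 have "c^2 * amp <= exp (pi + C) * (4 * (al + 1)^2 * (1 + 1 / c1) * D powr (1 - al) + 11 * D powr (1 - al))"
  by (rule order_trans[OF ts(1)], intro mult_left_mono add_mono A1 A2) auto
 thus "c^2 * amp <= exp (pi + C) * (4 * (al + 1)^2 * (1 + 1 / c1) + 11) * D powr (1 - al)"
  by (simp add: algebra_simps)
qed

text \<open>Well below the turning point the barrier is strong: - Q (x^2 - 1) >= ka / 2 >= be^2, so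
  \<open>power_growth\<close> applies with exponent be. The hypothesis on y0 controls the term of Q
  in 1 / (x^2 - 1)^2, which is dangerous near 1.\<close>

lemma barrier_growth:
 fixes be :: nat
 assumes y: "1 < y0" "y0 <= y1" "c^2 * y1^2 <= ka / 4" and s: "1 / (y0^2 - 1) <= ka / 8" and c16: "c^2 <= ka / 16"
  and b: "be >= 2" "2 * (real be)^2 <= ka"
 shows "v y1 >= v y0 * (y1 / y0) ^ be / 3" "v' y1 >= v y1 / y1"
  "v y1 >= v y0 + v' y0 * (y1 - y0)"
proof -
 have kap: "ka > 0"
 proof -
  have "(real be)^2 > 0" using b by simp
  thus ?thesis using b by linarith
 qed
 have below: "c^2 * x^2 <= ka / 4" if "y0 <= x" "x <= y1" for x
 proof -
  have "c^2 * x^2 <= c^2 * y1^2" using that y by (intro mult_left_mono power_mono) auto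
  thus ?thesis using y by linarith
 qed
 have bel: "c^2 * x^2 <= ka" if "y0 <= x" "x <= y1" for x using below[OF that] kap by linarith
 have G: "- Q x * (x^2 - 1) >= ka / 2" if x: "y0 <= x" "x <= y1" for x
 proof -
  have sx: "x^2 - 1 > 0" "y0^2 - 1 > 0" "y0^2 - 1 <= x^2 - 1" using s_pos x y by (auto simp: power_mono)
  have "1 / (x^2 - 1) <= 1 / (y0^2 - 1)" using sx by (intro divide_left_mono) auto
  hence i: "1 / (x^2 - 1) <= ka / 8" using s by simp
  have "(1 - al^2) / (x^2 - 1) <= 1 / (x^2 - 1)" using sx by (intro divide_right_mono) auto
  hence ii: "(1 - al^2) / (x^2 - 1) <= ka / 8" using i by linarith
  have "- Q x * (x^2 - 1) = - c\<^sup>2 * (x^2 - 1) + (ka - c^2 + al^2 + al) - (1 - al^2) / (x^2 - 1)"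
  proof -
   have "- (k - e / t + m / t^2) * t = - k * t + e - m / t" if "t > 0" for t k e m :: real
    using that by (simp add: field_simps power2_eq_square)
   from this[OF sx(1)] show ?thesis unfolding liouville_pot_def .
  qed
  moreover have "c^2 * (x^2 - 1) <= ka / 4" using below[OF x] by (simp add: algebra_simps add_increasing2)
  moreover have "al^2 + al >= 0" using alpha by simp
  ultimately show ?thesis using ii c16 kap by linarith
 qed
 have G2: "- Q x * x^2 >= real be * (real be - 1)" "- Q x >= 0" if x: "y0 <= x" "x <= y1" for x
 proof -
  have sx: "x^2 - 1 > 0" using s_pos x y by auto
  have "- Q x * (x^2 - 1) > 0" using G[OF x] kap by simp
  thus q: "- Q x >= 0" using sx by (simp add: zero_less_mult_iff mult_less_0_iff)
  have "real be * (real be - 1) <= (real be)^2" by (simp add: power2_eq_square algebra_simps)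
  also have "... <= - Q x * (x^2 - 1)" using G[OF x] b by linarith
  also have "... <= - Q x * x^2" using q by (intro mult_left_mono) auto
  finally show "- Q x * x^2 >= real be * (real be - 1)" .
 qed
 have vp: "v x > 0" "v' x >= 0" if "y0 <= x" "x <= y1" for x
  using v_nonneg_below[OF _ bel[OF that]] that y by auto
 show "v y1 >= v y0 * (y1 / y0) ^ be / 3"
  by (rule power_growth[where ?f1.0 = v' and G = "%x. - Q x"])
    (use y b dv dv' G2 vp in "auto intro: less_imp_le")
 show "v' y1 >= v y1 / y1"
 proof -
  have y11: "1 < y1" "y1^2 - 1 > 0" using y s_pos[of y1] by auto
  have "v y1 / y1 <= 1 * (y1 / (y1^2 - 1) * v y1)"
  proof -
   have "1 / y1 <= y1 / (y1^2 - 1)" using y11 by (simp add: field_simps power2_eq_square)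
   thus ?thesis using vp[of y1] y mult_right_mono[of "1 / y1" "y1 / (y1^2 - 1)" "v y1"] by simp
  qed
  also have "... <= (al + 1) * (y1 / (y1^2 - 1) * v y1)" using alpha y11 vp[of y1] y by (intro mult_right_mono) auto
  also have "... <= v' y1" using v_nonneg_below(2)[OF y11(1) bel[of y1]] y by simp
  finally show ?thesis .
 qed
 have v'm: "v' y0 <= v' x" if "y0 <= x" "x <= y1" for x
  by (rule nondecreasing_from_deriv[where f = v' and f' = "%x. - Q x * v x", OF that(1)])
    (use y that dv' G2(2) vp in "auto intro!: contv' mult_nonpos_nonneg intro: less_imp_le")
 have "v y0 - v' y0 * y0 <= v y1 - v' y0 * y1"
  by (rule nondecreasing_from_deriv[where f = "%x. v x - v' y0 * x" and f' = "%x. v' x - v' y0", OF y(2)])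
    (use y v'm in "auto intro!: continuous_intros contv derivative_eq_intros dv")
 thus "v y1 >= v y0 + v' y0 * (y1 - y0)" by (simp add: algebra_simps)
qed

end

section \<open>Comparison of the amplitudes for two eigenvalue parameters\<close>

lemma compare_below_turning:
 assumes 1: "outer_sol al c ka1 U1 U1' a1" and 2: "outer_sol al c ka2 U2 U2' a2"
  and k: "ka2 < ka1" and x: "1 < x0" "c^2 * x0^2 <= ka2"
 shows "liouville_deriv al U1 U1' x0 >= liouville_deriv al U2 U2' x0"
proof -
 let ?A = "%x. U1' x * U2 x - U1 x * U2' x"
 interpret A: outer_sol al c ka1 U1 U1' a1 by fact
 interpret B: outer_sol al c ka2 U2 U2' a2 by fact
 have t2: "c^2 * x^2 <= ka2" if "1 <= x" "x <= x0" for x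
 proof -
  have "c^2 * x^2 <= c^2 * x0^2" using that x by (intro mult_left_mono power_mono) auto
  thus ?thesis using x by simp
 qed
 have t1: "c^2 * x^2 <= ka1" if "1 <= x" "x <= x0" for x using t2[OF that] k by simp
 note b1 = A.below_turning[OF _ t1] and b2 = B.below_turning[OF _ t2]
 \<comment> \<open>Sturm comparison: the Wronskian formed with the fluxes vanishes at 1 and has
   derivative (x^2 - 1)^al (ka1 - ka2) U1 U2 >= 0. Hence U1 / U2 increases from 1, and then U and U'
   are ordered at x0.\<close>
 have W: "U1' x * U2 x - U1 x * U2' x >= 0" if "1 < x" "x <= x0" for x
 proof -
  have s: "x^2 - 1 > 0" using A.s_pos that by simp
  have "A.pU 1 * U2 1 - U1 1 * B.pU 1 <= A.pU x * U2 x - U1 x * B.pU x"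
  proof (rule nondecreasing_from_deriv[where f = "%x. A.pU x * U2 x - U1 x * B.pU x"
     and f' = "%x. (x^2 - 1) powr al * (ka1 - ka2) * (U1 x * U2 x)"])
   show "continuous_on {1..x} (%x. A.pU x * U2 x - U1 x * B.pU x)"
    by (intro continuous_intros A.contpU B.contpU A.contU B.contU) auto
   fix z assume z: "1 < z" "z < x"
   show "DERIV (%x. A.pU x * U2 x - U1 x * B.pU x) z :> (z^2 - 1) powr al * (ka1 - ka2) * (U1 z * U2 z)"
    by (rule DERIV_cong[OF DERIV_diff[OF DERIV_mult[OF A.dpU B.dU] DERIV_mult[OF A.dU B.dpU]]])
      (use z in "simp_all add: A.pU_def B.pU_def algebra_simps")
   have "U1 z >= 1" "U2 z >= 1" using b1(1)[of z] b2(1)[of z] z that by auto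
   thus "0 <= (z^2 - 1) powr al * (ka1 - ka2) * (U1 z * U2 z)" using k by simp
  qed (use that in auto)
  hence "0 <= (x^2 - 1) powr (al + 1) * (?A x)"
   unfolding A.pU1 B.pU1 by (simp add: A.pU_def B.pU_def algebra_simps)
  thus ?thesis using s by (simp add: zero_le_mult_iff)
 qed
 have ge: "U1 x0 >= U2 x0"
 proof -
  have "U1 1 / U2 1 <= U1 x0 / U2 x0"
  proof (rule nondecreasing_from_deriv[where f = "%x. U1 x / U2 x" and f' = "%x. (?A x) / (U2 x * U2 x)"])
   show "continuous_on {1..x0} (%x. U1 x / U2 x)"
    using b2(1) by (intro continuous_intros A.contU B.contU) force+
   fix z assume z: "1 < z" "z < x0"
   have "U2 z >= 1" using b2(1)[of z] z by auto
   thus "DERIV (%x. U1 x / U2 x) z :> (?A z) / (U2 z * U2 z)"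
    using z by (intro DERIV_divide A.dU B.dU) auto
   show "0 <= (?A z) / (U2 z * U2 z)" using W[of z] z by simp
  qed (use x in auto)
  thus ?thesis using A.U1 B.U1 b2(1)[of x0] x by (simp add: pos_le_divide_eq)
 qed
 have U2p: "U2 x0 >= 1" "U2' x0 >= 0" using b2[of x0] x by auto
 have ge': "U1' x0 >= U2' x0"
 proof -
  have "U2 x0 * U2' x0 <= U1 x0 * U2' x0" using ge U2p by (intro mult_right_mono) auto
  also have "... <= U1' x0 * U2 x0" using W[of x0] x by simp
  finally show ?thesis using U2p by (simp add: mult.commute)
 qed
 show ?thesis unfolding liouville_deriv_def
  using ge ge' A.s_pos[OF x(1)] A.alpha x(1)
  by (intro mult_left_mono add_mono) auto
qed

lemma powr_le_power:
 fixes R :: real assumes "R >= 1" "a <= real n" shows "R powr a <= R ^ n"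
proof -
 have "R powr a <= R powr real n" using assms by (intro powr_mono) auto
 thus ?thesis using assms by (simp add: powr_realpow)
qed

text \<open>Let x0 be the turning point of ka2 and V the value of v' for the second solution there.
  Then c^2 a2 <= CA ka2 V^2 by \<open>amp_upper\<close>, and V^2 <= c^2 a1 by
  \<open>compare_below_turning\<close> and \<open>amp_lower\<close>. For bounded ka1 / ka2 this is
  enough. For a large ratio the first solution is still far below its own turning point at x0 and
  keeps growing like a high power, which pays for (ka1 / ka2)^(al + 1).\<close>

lemma amp_ratio_supercritical:
 fixes al c0 :: real
 assumes a: "al >= 0" and c0: "0 < c0" "c0 <= 1"
 obtains C where "C > 0" "!!c ka1 ka2 U1 U1' a1 U2 U2' a2.
   outer_sol al c ka1 U1 U1' a1 ==> outer_sol al c ka2 U2 U2' a2 ==> ka2 < ka1 ==>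
   c0 <= ka2 ==> ka2 - c^2 >= 2 * c ==>
   a2 * (ka1 / ka2) powr (al + 1) <= C * ka2 * a1"
proof -
 let ?A = "%X. 36 * 4 powr (al + 1) + X powr (al + 1)"
 let ?B = "%ka2 c. ka2 - c^2 + al^2 + al"
 define m0 where "m0 = c0 / 2"
 \<comment> \<open>Chosen such that at x^2 - 1 = C0 (x0^2 - 1) each of the three terms subtracted
   from c^2 in Q is at most c^2 / 8. The number m0 is a lower bound for ka2 - c^2.\<close>
 define C0 where "C0 = 8 * (1 + (al^2 + al) / m0 + al^2)"
 define M where "M = C0 powr ((al + 1) / 2) * (1 + C0 / 2)"
 define M' where "M' = C0 powr ((al + 1) / 2) + (al + 1) * M"
 define CA where "CA = 2 * M'^2 * (1 + 1 / c0)"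
 define n :: nat where "n = nat \<lceil>al\<rceil> + 2"
 \<comment> \<open>For R >= 2 one has (2R/3)^5 >= R^2. So the exponent 5n yields the factor R^(2n)
   even though the growth is only counted from 3/2 x0 on.\<close>
 define be where "be = 5 * n"
 \<comment> \<open>From this ratio on the growth argument works: 16 gives R >= 2, and the other
   entry gives 2 be^2 <= ka1, as required by \<open>barrier_growth\<close>.\<close>
 define X where "X = max 16 (2 * (real be)^2 / c0)"
 define C where "C = CA * (?A X) + 1"
 have m0: "m0 > 0" using c0 by (simp add: m0_def)
 have C08: "C0 >= 8" "C0 >= 8 * ((al^2 + al) / m0)" "C0 >= 8 * al^2"
  using a m0 by (auto simp: C0_def)
 have CA0: "CA >= 0" using c0 by (simp add: CA_def)
 have n2: "2 * al + 2 <= real (4 * n - 2)" "n >= 2" using a by (auto simp: n_def of_nat_diff) linarith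
 show ?thesis
 proof (rule that[of C])
  show "C > 0" using CA0 by (simp add: C_def add_nonneg_pos)
  fix c ka1 ka2 U1 U1' a1 U2 U2' a2
  assume o1: "outer_sol al c ka1 U1 U1' a1" and o2: "outer_sol al c ka2 U2 U2' a2"
   and k: "ka2 < ka1" and kc: "c0 <= ka2" and B2: "ka2 - c^2 >= 2 * c"
  interpret A: outer_sol al c ka1 U1 U1' a1 by fact
  interpret B: outer_sol al c ka2 U2 U2' a2 by fact
  note c = A.c
  have c2: "c^2 > 0" using c by simp
  define b where "b = ka2 - c^2"
  have b2c: "b >= 2 * c" "b > 0" using B2 c by (auto simp: b_def)
  have bm: "b >= m0"
  proof (cases "c >= c0 / 4")
   case False
   have "c^2 <= (c0 / 4)^2" using False c by (intro power_mono) auto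
   also have "... <= c0 / 2" using c0 mult_left_mono[of c0 1 c0] by (simp add: power2_eq_square)
   finally show ?thesis using kc by (simp add: b_def m0_def)
  qed (use b2c in "simp add: m0_def")
  define x0 where "x0 = sqrt ka2 / c"
  have k2p: "ka2 > 0" using kc c0 by simp
  have x0sq: "x0^2 = ka2 / c^2" using k2p by (simp add: x0_def power_divide)
  have x0s: "x0^2 - 1 = b / c^2" using c by (simp add: x0sq b_def diff_divide_distrib)
  have x0p: "x0 > 0" using k2p c by (simp add: x0_def)
  have x01: "1 < x0"
  proof -
   have "1^2 < x0^2" using x0s divide_pos_pos[OF b2c(2) c2] by simp
   thus ?thesis using x0p power_less_imp_less_base[of 1 2 x0] by simp
  qed
  have x0t: "c^2 * x0^2 = ka2" using c by (simp add: x0sq)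
  have aa: "al^2 + al >= 0" using a by simp
  have Bs: "(?B ka2 c) > 0" "(?B ka2 c) * (x0^2 - 1) > 2 * (1 - al^2)"
  proof -
   show "(?B ka2 c) > 0" using b2c aa by (simp add: b_def)
   have "2 * (1 - t) < 4" if "t >= 0" for t :: real using that by simp
   hence "2 * (1 - al^2) < 4" using zero_le_power2 by blast
   also have "4 = (2 * c) * ((2 * c) / c^2)" using c by (simp add: power2_eq_square)
   also have "... <= b * (b / c^2)" using b2c c by (intro mult_mono divide_right_mono) auto
   also have "... <= (?B ka2 c) * (b / c^2)" using aa b2c by (intro mult_right_mono) (auto simp: b_def)
   finally show "(?B ka2 c) * (x0^2 - 1) > 2 * (1 - al^2)" by (simp add: x0s)
  qed
  have Bs1: "(?B ka1 c) > 0" "(?B ka1 c) * (x0^2 - 1) > 2 * (1 - al^2)"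
  proof -
   show "(?B ka1 c) > 0" using Bs(1) k by simp
   have "(?B ka2 c) * (x0^2 - 1) <= (?B ka1 c) * (x0^2 - 1)"
    using k A.s_pos[OF x01] by (intro mult_right_mono) auto
   thus "(?B ka1 c) * (x0^2 - 1) > 2 * (1 - al^2)" using Bs(2) by linarith
  qed
  define x3 where "x3 = sqrt (1 + C0 * (b / c^2))"
  have x3s: "x3^2 - 1 = C0 * (b / c^2)" "x3 > 0"
   using C08 b2c c2 by (auto simp: x3_def add_nonneg_nonneg intro!: add_pos_nonneg)
  have Q3: "B.Q x3 >= c^2 / 2"
  proof -
   define s where "s = C0 * (b / c^2)"
   have s: "s > 0" using C08 b2c c2 by (simp add: s_def)
   have t1: "b / s <= c^2 / 8"
    using C08 b2c c2 by (simp add: s_def field_simps)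
   have t2: "(al^2 + al) / s <= c^2 / 8"
   proof -
    have "8 * (al^2 + al) <= C0 * m0" using C08(2) m0 by (simp add: field_simps)
    also have "... <= C0 * b" using bm C08 by (intro mult_left_mono) auto
    also have "C0 * b = c^2 * s" using c by (simp add: s_def)
    finally show ?thesis using s by (simp add: pos_divide_le_eq)
   qed
   have t3: "al^2 / s^2 <= c^2 / 8"
   proof -
    have "8 * al^2 <= C0^2"
    proof -
     have "8 * al^2 <= C0" by (rule C08(3))
     also have "... <= C0^2" using C08(1) by (simp add: power2_eq_square)
     finally show ?thesis .
    qed
    moreover have "1 <= (b / c)^2" using b2c c by (simp add: field_simps power_divide)
    ultimately have "8 * al^2 * 1 <= C0^2 * (b / c)^2" by (intro mult_mono) auto
    also have "... = c^2 * s^2" using c by (simp add: s_def field_simps power2_eq_square)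
    finally show ?thesis using s by (simp add: field_simps)
   qed
   have "B.Q x3 = c^2 - b / s - (al^2 + al) / s + 1 / s^2 - al^2 / s^2"
   proof -
    have e: "x3^2 - 1 = s" "ka2 - c^2 + al^2 + al = b + (al^2 + al)" by (simp_all add: x3s s_def b_def)
    show ?thesis unfolding liouville_pot_def e by (simp add: add_divide_distrib diff_divide_distrib)
   qed
   moreover have "1 / s^2 >= 0" by simp
   ultimately show ?thesis using t1 t2 t3 c2 by linarith
  qed
  define V where "V = B.v' x0"
  have V0: "V >= 0" unfolding V_def using B.v_nonneg_below(4)[OF x01] x0t by simp
  have up: "c^2 * a2 <= CA * ka2 * V^2"
  proof -
   have "a2 <= 2 * M'^2 * ((x0^2 - 1)^2 / x0^2 + 1 / c^2) * V^2" unfolding V_def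
    by (rule B.amp_upper[OF x01 x0t Bs _ x3s(2) _ Q3 M_def M'_def]) (use C08 x3s x0s in auto)
   hence "c^2 * a2 <= c^2 * (2 * M'^2 * ((x0^2 - 1)^2 / x0^2 + 1 / c^2) * V^2)" by (intro mult_left_mono) auto
   also have "... = 2 * M'^2 * (c^2 * ((x0^2 - 1)^2 / x0^2) + 1) * V^2" using c by (simp add: field_simps)
   also have "... <= 2 * M'^2 * (ka2 + ka2 / c0) * V^2"
   proof (intro mult_right_mono mult_left_mono add_mono)
    have "(x0^2 - 1)^2 <= x0^2 * x0^2" using A.s_pos[OF x01] unfolding power2_eq_square[of "x0^2 - 1"] by (intro mult_mono) auto
    hence "(x0^2 - 1)^2 / x0^2 <= x0^2" using x0p by (simp add: pos_divide_le_eq)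
    thus "c^2 * ((x0^2 - 1)^2 / x0^2) <= ka2" unfolding x0t[symmetric] by (intro mult_left_mono) auto
    show "1 <= ka2 / c0" using kc c0 by simp
   qed auto
   also have "... = CA * ka2 * V^2" using c0 by (simp add: CA_def field_simps)
   finally show ?thesis .
  qed
  have VV: "A.v' x0 >= V" unfolding V_def using compare_below_turning[OF o1 o2 k x01] x0t by simp
  have vA: "A.v x0 > 0" "A.v' x0 >= 0" using A.v_nonneg_below[OF x01] x0t k by auto
  have lo: "V^2 <= c^2 * a1"
  proof -
   have "V^2 <= (A.v' x0)^2" using VV V0 by (intro power_mono) auto
   also have "... <= c^2 * a1" using vA by (intro A.amp_lower[OF x01 Bs1]) auto
   finally show ?thesis .
  qed
  have a10: "c^2 * a1 >= 0" using lo zero_le_power2[of V] by linarith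
  have CAk: "CA * ka2 >= 0" using CA0 k2p by simp
  have fin: "a2 * (ka1 / ka2) powr (al + 1) <= C * ka2 * a1"
   if "V^2 * (ka1 / ka2) powr (al + 1) <= (?A X) * (c^2 * a1)"
  proof -
   have "c^2 * (a2 * (ka1 / ka2) powr (al + 1)) <= CA * ka2 * V^2 * (ka1 / ka2) powr (al + 1)"
    using mult_right_mono[OF up, of "(ka1 / ka2) powr (al + 1)"] by (simp add: mult.assoc)
   also have "... <= CA * ka2 * ((?A X) * (c^2 * a1))"
    using mult_left_mono[OF that CAk] by (simp add: mult.assoc)
   also have "... <= c^2 * (C * ka2 * a1)"
   proof -
    have "0 <= ka2 * (c^2 * a1)" using k2p a10 by simp
    thus ?thesis unfolding C_def by (simp add: algebra_simps)
   qed
   finally show ?thesis using c2 by simp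
  qed
  show "a2 * (ka1 / ka2) powr (al + 1) <= C * ka2 * a1"
  proof (rule fin, cases "ka1 < X * ka2")
   case True
   have "(ka1 / ka2) powr (al + 1) <= X powr (al + 1)"
    using True k k2p a by (intro powr_mono2) (auto simp: field_simps)
   hence "V^2 * (ka1 / ka2) powr (al + 1) <= (c^2 * a1) * X powr (al + 1)" using lo a10 by (intro mult_mono) auto
   also have "... <= (?A X) * (c^2 * a1)" using a10 by (simp add: distrib_right)
   finally show "V^2 * (ka1 / ka2) powr (al + 1) <= (?A X) * (c^2 * a1)" .
  next
   case False
   have "16 * ka2 <= X * ka2" "2 * (real be)^2 / c0 * ka2 <= X * ka2"
    using k2p by (intro mult_right_mono, simp add: X_def, simp)+
   hence k16: "16 * ka2 <= ka1" "2 * (real be)^2 / c0 * ka2 <= ka1"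
    using False by linarith+
   have beta: "2 * (real be)^2 <= ka1"
   proof -
    have "2 * (real be)^2 = 2 * (real be)^2 / c0 * c0" using c0 by simp
    also have "... <= 2 * (real be)^2 / c0 * ka2" using kc c0 by (intro mult_left_mono) auto
    finally show ?thesis using k16 by simp
   qed
   have beta2: "be >= 2" using n2 by (simp add: be_def)
   have k1p: "ka1 > 0" using k k2p by simp
   have k11: "ka1 >= 1"
   proof -
    have "(real be)^2 >= 2^2" using beta2 by (intro power_mono) auto
    thus ?thesis using beta by simp
   qed
   have c16: "c^2 <= ka1 / 16" using B2 c k16 by simp
   define R where "R = sqrt (ka1 / ka2) / 2"
   have R2: "R >= 2"
   proof -
    have "sqrt 16 <= sqrt (ka1 / ka2)" using k16 k2p by (intro real_sqrt_le_mono) (simp add: field_simps)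
    thus ?thesis by (simp add: R_def)
   qed
   define xg where "xg = x0 * R"
   have xg: "c^2 * xg^2 = ka1 / 4" using x0t k2p k1p
    by (simp add: xg_def R_def power_mult_distrib power_divide)
      (metis (no_types, lifting) mult.assoc nonzero_mult_div_cancel_left order_less_irrefl times_divide_eq_right)
   \<comment> \<open>At x0 only the slope of the first solution is bounded below. Convexity on
     [x0, xm] turns it into the value V x0 / 2, from which \<open>power_growth\<close> can start.
     The end point xg is half the turning point of ka1.\<close>
   define xm where "xm = 3/2 * x0"
   have xms: "1 < xm" "x0 <= xm" "xm <= xg" "x0 <= xg"
   proof -
    have "x0 * (3/2) <= x0 * R" using R2 x0p by (intro mult_left_mono) auto
    thus "xm <= xg" by (simp add: xm_def xg_def)
    thus "1 < xm" "x0 <= xm" "x0 <= xg" using x01 by (auto simp: xm_def)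
   qed
   have s8: "1 / (x0^2 - 1) <= ka1 / 8"
   proof -
    have "1 / (x0^2 - 1) = c^2 / b" by (simp add: x0s)
    also have "... <= c^2 / (2 * c)" using b2c c by (intro divide_left_mono) auto
    also have "... = c / 2" using c by (simp add: power2_eq_square)
    also have "c <= sqrt (ka1 / 16)" using c16 by (intro real_le_rsqrt)
    also have "sqrt (ka1 / 16) = sqrt ka1 / 4" by (simp add: real_sqrt_divide)
    also have "sqrt ka1 <= ka1" using k11 by (intro real_le_lsqrt) (auto simp: power2_eq_square)
    finally show ?thesis by simp
   qed
   have s8m: "1 / (xm^2 - 1) <= ka1 / 8"
   proof -
    have "x0^2 - 1 <= xm^2 - 1" using xms x01 by (simp add: power_mono)
    hence "1 / (xm^2 - 1) <= 1 / (x0^2 - 1)" using A.s_pos[OF x01] by (intro divide_left_mono) auto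
    thus ?thesis using s8 by simp
   qed
   have cm: "c^2 * xm^2 <= ka1 / 4"
   proof -
    have "c^2 * xm^2 <= c^2 * xg^2" using xms by (intro mult_left_mono power_mono) auto
    thus ?thesis using xg by simp
   qed
   note g1 = A.barrier_growth[OF x01 xms(2) cm s8 c16 beta2 beta]
   note g2 = A.barrier_growth[OF xms(1) xms(3) eq_refl[OF xg] s8m c16 beta2 beta]
   have "V * (x0 / 2) <= A.v xm"
   proof -
    have "V * (x0 / 2) <= A.v' x0 * (x0 / 2)" using VV x0p by (intro mult_right_mono) auto
    thus ?thesis using g1(3) vA by (simp add: xm_def)
   qed
   hence "V * (x0 / 2) * (xg / xm) ^ be / 3 <= A.v xm * (xg / xm) ^ be / 3"
    using xms x01 by (intro divide_right_mono mult_right_mono) auto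
   also have "... <= A.v xg" using g2(1) .
   finally have "V * (x0 / 2) * (xg / xm) ^ be / 3 / xg <= A.v xg / xg" using xms x01 by (intro divide_right_mono) auto
   also have "... <= A.v' xg" using g2(2) .
   also have "V * (x0 / 2) * (xg / xm) ^ be / 3 / xg = V * (R / (3/2)) ^ be / (6 * R)"
    using x0p R2 by (simp add: xg_def xm_def field_simps)
   finally have h1: "V * (R / (3/2)) ^ be / (6 * R) <= A.v' xg" .
   have pw: "R ^ (2 * n) <= (R / (3/2)) ^ be"
   proof -
    have "R ^ 2 * (243 / 32) <= R ^ 2 * R ^ 3"
    proof (intro mult_left_mono)
     have "(2::real) ^ 3 <= R ^ 3" using R2 by (intro power_mono) auto
     thus "243 / 32 <= R ^ 3" by simp
    qed auto
    also have "... = R ^ 5" by (simp add: power_add[symmetric])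
    finally have "R ^ 2 <= (R / (3/2)) ^ 5" by (simp add: power_divide power_mult_distrib field_simps)
    hence "(R ^ 2) ^ n <= ((R / (3/2)) ^ 5) ^ n" by (intro power_mono) auto
    thus ?thesis by (simp add: power_mult be_def)
   qed
   have h2: "V * R ^ (2 * n - 1) / 6 <= A.v' xg"
   proof -
    have "V * R ^ (2 * n) / (6 * R) <= V * (R / (3/2)) ^ be / (6 * R)"
     using pw V0 R2 by (intro divide_right_mono mult_left_mono) auto
    moreover have "R ^ (2 * n) = R ^ (2 * n - 1) * R" using n2 by (simp flip: power_Suc2)
    ultimately show ?thesis using h1 R2 by simp
   qed
   have x1g: "1 < xg" using xms by simp
   have "(V * R ^ (2 * n - 1) / 6)^2 <= (A.v' xg)^2" using h2 V0 R2 by (intro power_mono) auto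
   also have "... <= c^2 * a1"
   proof (rule A.amp_lower[OF x1g Bs1(1) A.Q_mono_hyp[OF x01 Bs1 xms(4)]])
    have "c^2 * xg^2 <= ka1" using xg k1p by simp
    thus "0 <= A.v xg * A.v' xg" using A.v_nonneg_below[OF x1g] by (intro mult_nonneg_nonneg) (auto intro: less_imp_le)
   qed
   finally have h3: "V^2 * R ^ (4 * n - 2) <= 36 * (c^2 * a1)"
   proof -
    assume *: "(V * R ^ (2 * n - 1) / 6)^2 <= c^2 * a1"
    have "(V * R ^ (2 * n - 1) / 6)^2 = V^2 * R ^ (4 * n - 2) / 36"
     by (simp add: power_mult_distrib power_divide diff_mult_distrib flip: power_mult)
    thus ?thesis using * by simp
   qed
   have "(ka1 / ka2) powr (al + 1) = 4 powr (al + 1) * R powr (2 * al + 2)"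
   proof -
    have "ka1 / ka2 = 4 * R^2" using k1p k2p by (simp add: R_def power_divide)
    hence "(ka1 / ka2) powr (al + 1) = 4 powr (al + 1) * (R powr 2) powr (al + 1)" using R2 by (simp add: powr_mult)
    thus ?thesis by (simp add: powr_powr algebra_simps)
   qed
   also have "... <= 4 powr (al + 1) * R ^ (4 * n - 2)"
    using R2 n2 by (intro mult_left_mono powr_le_power) auto
   finally have "V^2 * (ka1 / ka2) powr (al + 1) <= V^2 * (4 powr (al + 1) * R ^ (4 * n - 2))" by (intro mult_left_mono) auto
   also have "... = 4 powr (al + 1) * (V^2 * R ^ (4 * n - 2))" by simp
   also have "... <= 4 powr (al + 1) * (36 * (c^2 * a1))" using h3 by (intro mult_left_mono) auto
   also have "... <= (?A X) * (c^2 * a1)" using a10 by (simp add: distrib_right)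
   finally show "V^2 * (ka1 / ka2) powr (al + 1) <= (?A X) * (c^2 * a1)" .
  qed
 qed
qed

text \<open>Here \<open>amp_near_critical\<close> bounds the amplitude for ka2. Three cases for ka1
  contribute one constant each: \<open>Ka\<close> when ka1 is below the threshold as well,
  \<open>Kb\<close> when it is above and ka1 / ka2 is bounded, \<open>Kc\<close> when the ratio is
  large and growth below the turning point comes into play.\<close>

lemma amp_ratio_subcritical:
 fixes al c0 :: real
 assumes a: "al >= 0" and c0: "0 < c0" "c0 <= 1"
 obtains C where "C > 0" "!!c ka1 ka2 U1 U1' a1 U2 U2' a2.
   outer_sol al c ka1 U1 U1' a1 ==> outer_sol al c ka2 U2 U2' a2 ==> ka2 < ka1 ==>
   c0 <= ka2 ==> c0 * c^2 <= ka2 ==> ka2 - c^2 < 2 * c ==>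
   a2 * (ka1 / ka2) powr (al + 1) <= C * ka2 * a1"
proof -
 let ?A = "%L a1. 3 powr (al + 1) * (L * a1)"
 let ?B = "%n. 2 * (real n)^2"
 \<comment> \<open>For c below c1 this regime is empty, because then ka2 < c^2 + 2c would be less
   than c0. Thus c may be treated as bounded below.\<close>
 define c1 where "c1 = c0 / 3"
 define Cd where "Cd = 1 + 3 / c1"
 define E where "E = (al^2 + al) * sqrt (2 * Cd) + (3 + al^2) * sqrt 2"
 define K where "K = exp (pi + E) * (4 * (al + 1)^2 * (1 + 1 / c1) + 11)"
 define L where "L = 9/4 * exp (pi + E)"
 define n :: nat where "n = nat \<lceil>al\<rceil> + 2"
 define X where "X = max (32 / c0) (max (?B n) 8 / c0)"
 define X1 where "X1 = (1 + 2 / c1) / c0"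
 define Ka where "Ka = K * Cd^2 / c0 * 3 powr (al + 1) * L * X1 powr (al + 1)"
 define Kb where "Kb = K * (2 * Cd / c1 / c0) * X powr (al + 1)"
 define Kc where "Kc = K * (c1 powr (- al) * Cd / c0) * (8 / c0) powr (al + 1) * 18"
 define C where "C = Ka + Kb + Kc + 1"
 have c1: "c1 > 0" "c1 <= 1/3" using c0 by (auto simp: c1_def)
 have Cd0: "Cd > 1" using c1 by (simp add: Cd_def)
 have E0: "E >= 0" using a Cd0 by (simp add: E_def)
 have K0: "K > 0" "L > 0" using c1 a by (auto simp: K_def L_def intro!: mult_pos_pos add_nonneg_pos)
 have KK: "Ka >= 0" "Kb >= 0" "Kc >= 0" using K0 c1 c0 Cd0 by (auto simp: Ka_def Kb_def Kc_def)
 show ?thesis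
 proof (rule that[of C])
  show "C > 0" using KK by (simp add: C_def)
  fix c ka1 ka2 U1 U1' a1 U2 U2' a2
  assume o1: "outer_sol al c ka1 U1 U1' a1" and o2: "outer_sol al c ka2 U2 U2' a2"
   and k: "ka2 < ka1" and kc: "c0 <= ka2" and kcc: "c0 * c^2 <= ka2" and B2: "ka2 - c^2 < 2 * c"
  interpret A: outer_sol al c ka1 U1 U1' a1 by fact
  interpret B: outer_sol al c ka2 U2 U2' a2 by fact
  note c = A.c
  have c2: "c^2 > 0" using c by simp
  have k2p: "ka2 > 0" using kc c0 by simp
  have cc1: "c >= c1"
  proof (rule ccontr)
   assume "\<not> c >= c1"
   hence cl: "c <= c1" by simp
   have "c^2 <= c1 * (1/3)" using cl c c1 unfolding power2_eq_square by (intro mult_mono) auto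
   hence "ka2 < c1 * (1/3) + 2 * c1" using B2 cl by linarith
   also have "... <= c0" using c1 by (simp add: c1_def)
   finally show False using kc by simp
  qed
  have ccs: "c <= c^2 / c1"
   using cc1 c c1 by (simp add: field_simps power2_eq_square)
  define D where "D = c + abs (ka2 - c^2)"
  have D0: "D > 0" "c <= D" using c by (auto simp: D_def)
  have DCd: "D <= Cd * c^2"
  proof -
   have "abs (ka2 - c^2) <= c^2 + 2 * c" using B2 k2p c c2 by arith
   hence "D <= c^2 + 3 * c" by (simp add: D_def)
   also have "... <= c^2 + 3 * (c^2 / c1)" using ccs by simp
   finally show ?thesis by (simp add: Cd_def distrib_right)
  qed
  have c2k: "c^2 <= ka2 / c0" using kcc c0 by (simp add: field_simps)
  have Dk: "D <= Cd / c0 * ka2"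
  proof -
   have "Cd * c^2 <= Cd * (ka2 / c0)" using c2k Cd0 by (intro mult_left_mono) auto
   thus ?thesis using DCd by simp
  qed
  have up: "c^2 * a2 <= K * D powr (1 - al)"
   unfolding K_def by (rule B.amp_near_critical(1)[OF _ D_def DCd E_def E0 cc1 c1(1)]) (use B2 in simp)
  have goal: "a2 * (ka1 / ka2) powr (al + 1) <= C * ka2 * a1"
   if "a2 * (ka1 / ka2) powr (al + 1) <= T * ka2 * a1" "T <= C" "a1 >= 0" for T
  proof -
   have "T * (ka2 * a1) <= C * (ka2 * a1)" using that k2p by (intro mult_right_mono) auto
   thus ?thesis using that(1) by (simp add: mult.assoc)
  qed
  show "a2 * (ka1 / ka2) powr (al + 1) <= C * ka2 * a1"
  proof (cases "ka1 - c^2 <= 2 * c")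
   case True
   define D1 where "D1 = c + abs (ka1 - c^2)"
   have D13: "D1 <= 3 * D" using True k c by (auto simp: D1_def D_def abs_if)
   have D1p: "D1 > 0" using c by (simp add: D1_def)
   have D1Cd: "D1 <= Cd * c^2"
   proof -
    have "abs (ka1 - c^2) <= c^2 + 2 * c" using True k k2p c c2 by arith
    hence "D1 <= c^2 + 3 * c" by (simp add: D1_def)
    also have "... <= c^2 + 3 * (c^2 / c1)" using ccs by simp
    finally show ?thesis by (simp add: Cd_def distrib_right)
   qed
   have lo: "D1 powr (- (al + 1)) <= L * a1"
    unfolding L_def by (rule A.amp_near_critical(2)[OF True D1_def D1Cd E_def E0 cc1 c1(1)])
   have La: "L * a1 >= 0" using order_trans[OF powr_ge_zero lo] .
   hence a10: "a1 >= 0" using K0 by (simp add: zero_le_mult_iff)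
   have "D powr (1 - al) = D^2 * D powr (- (al + 1))"
   proof -
    have "D powr (1 - al) = D powr 2 * D powr (- (al + 1))" by (simp add: powr_add[symmetric])
    thus ?thesis using D0 by simp
   qed
   also have "... <= D^2 * (3 powr (al + 1) * D1 powr (- (al + 1)))"
   proof (intro mult_left_mono)
    have "D1 powr (al + 1) <= (3 * D) powr (al + 1)" using D13 D1p a by (intro powr_mono2) auto
    hence "D1 powr (al + 1) <= 3 powr (al + 1) * D powr (al + 1)" using D0 by (simp add: powr_mult)
    thus "D powr (- (al + 1)) <= 3 powr (al + 1) * D1 powr (- (al + 1))"
     using D0 D1p unfolding powr_minus_divide by (simp add: field_simps)
   qed auto
   also have "... <= D^2 * (?A L a1)" using lo by (intro mult_left_mono) auto
   finally have "c^2 * a2 <= K * (D^2 * (?A L a1))"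
    using up K0 by (meson less_imp_le mult_left_mono order_trans)
   also have "... <= K * ((c^2 * (Cd^2 / c0 * ka2)) * (?A L a1))"
   proof (intro mult_left_mono mult_right_mono)
    have "D^2 <= (Cd * c^2) * (Cd / c0 * ka2)" unfolding power2_eq_square[of D]
     using DCd Dk D0 Cd0 by (intro mult_mono) auto
    thus "D^2 <= c^2 * (Cd^2 / c0 * ka2)" by (simp add: power2_eq_square mult_ac)
   qed (use K0 La in auto)
   finally have "c^2 * a2 <= c^2 * (K * (Cd^2 / c0 * ka2) * (?A L a1))" by (simp add: mult_ac)
   hence A2: "a2 <= K * (Cd^2 / c0 * ka2) * (?A L a1)" using c2 mult_le_cancel_left_pos by blast
   have ratio: "(ka1 / ka2) powr (al + 1) <= X1 powr (al + 1)"
   proof (intro powr_mono2)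
    have "ka1 <= c^2 + 2 * (c^2 / c1)" using True ccs by linarith
    also have "... = (1 + 2 / c1) * c^2" by (simp add: distrib_right)
    also have "... <= (1 + 2 / c1) * (ka2 / c0)" using c2k c1 by (intro mult_left_mono) auto
    finally show "ka1 / ka2 <= X1" using k2p by (simp add: X1_def pos_divide_le_eq)
   qed (use a k k2p in auto)
   have "a2 * (ka1 / ka2) powr (al + 1) <= K * (Cd^2 / c0 * ka2) * (?A L a1) * X1 powr (al + 1)"
    using A2 ratio K0 La c0 k2p by (intro mult_mono) auto
   also have "... = Ka * ka2 * a1" by (simp add: Ka_def mult_ac)
   finally show ?thesis by (rule goal) (use KK a10 in "auto simp: C_def")
  next
   case False
   hence B1: "ka1 - c^2 > 2 * c" by simp
   have aa: "al^2 + al >= 0" using a by simp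
   have Bp: "ka1 - c^2 + al^2 + al > 0" using B1 c aa by simp
   have k1p: "ka1 > 0" using k k2p by simp
   \<comment> \<open>At this point c^2 (x^2 - 1) = 2c, so it lies below the turning point of ka1.
     There v >= (2 / c)^((al + 1) / 2), and the lower bound for v' / v turns this into the lower
     bound (c / 2)^(1 - al) for v'^2.\<close>
   define xs where "xs = sqrt (1 + 2 / c)"
   have xs: "xs^2 - 1 = 2 / c" "1 < xs" "0 < xs" using c by (auto simp: xs_def add_pos_pos intro!: add_nonneg_nonneg)
   have xst: "c^2 * xs^2 <= ka1"
   proof -
    have "xs^2 = 1 + 2 / c" using xs(1) by linarith
    hence "c^2 * xs^2 = c^2 + 2 * c" using c by (simp add: power2_eq_square distrib_left)
    thus ?thesis using B1 by simp
   qed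
   have Bs: "(ka1 - c^2 + al^2 + al) * (xs^2 - 1) > 2 * (1 - al^2)"
   proof -
    have "2 * (1 - t) < 4" if "t >= 0" for t :: real using that by simp
    hence "2 * (1 - al^2) < 4" using zero_le_power2 by blast
    also have "4 = 2 * c * (2 / c)" using c by simp
    also have "... <= (ka1 - c^2 + al^2 + al) * (2 / c)" using B1 aa c by (intro mult_right_mono) auto
    finally show ?thesis by (simp add: xs(1))
   qed
   note vs = A.v_nonneg_below[OF xs(2) xst]
   have lo: "(c / 2) powr (1 - al) <= c^2 * a1"
   proof -
    have "(c / 2) powr ((1 - al) / 2) <= A.v' xs"
    proof -
     have e: "c / 2 = 1 / (2 / c)" by simp
     have pp: "(2 / c) powr ((al - 1) / 2) = (c / 2) powr ((1 - al) / 2)"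
      unfolding e using c powr_minus_divide[of "2 / c" "(1 - al) / 2"]
      by (subst powr_divide) (auto simp: minus_divide_left)
     have "(c / 2) powr ((1 - al) / 2) = (2 / c) powr ((al + 1) / 2) / (2 / c)"
     proof -
      have "(2 / c) powr ((al - 1) / 2) = (2 / c) powr ((al + 1) / 2 - 1)" by (simp add: field_simps)
      also have "... = (2 / c) powr ((al + 1) / 2) / (2 / c)" using c by (subst powr_diff) auto
      finally show ?thesis using pp by simp
     qed
     also have "... <= A.v xs / (2 / c)" using vs(1) c unfolding xs(1) by (intro divide_right_mono) auto
     also have "... <= (al + 1) * xs * (A.v xs / (2 / c))"
     proof -
      have "1 * 1 <= (al + 1) * xs" using a xs by (intro mult_mono) auto
      thus ?thesis using vs(5) c mult_right_mono[of 1 "(al + 1) * xs" "A.v xs / (2 / c)"] by simp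
     qed
     also have "... = (al + 1) * xs / (2 / c) * A.v xs" by simp
     also have "... <= A.v' xs" using vs(2) unfolding xs(1) .
     finally show ?thesis .
    qed
    hence "((c / 2) powr ((1 - al) / 2))^2 <= (A.v' xs)^2" by (intro power_mono) auto
    also have "... <= c^2 * a1" using vs by (intro A.amp_lower[OF xs(2) Bp Bs]) auto
    also have "((c / 2) powr ((1 - al) / 2))^2 = (c / 2) powr (1 - al)"
     by (simp add: power2_eq_square powr_add[symmetric])
    finally show ?thesis .
   qed
   have ca0: "c^2 * a1 >= 0" using order_trans[OF powr_ge_zero lo] .
   hence a10: "a1 >= 0" using c2 by (simp add: zero_le_mult_iff)
   \<comment> \<open>The exponent 1 - al may have either sign. Writing D = y c / 2 with y >= 1, the
     estimate y^(1 - al) <= y covers both.\<close>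
   have Dpow: "D powr (1 - al) <= (2 * Cd / c1 / c0 * ka2) * (c / 2) powr (1 - al)"
   proof -
    define y where "y = D / (c / 2)"
    have y: "y >= 1" using D0 c by (simp add: y_def field_simps)
    have "D powr (1 - al) = (y * (c / 2)) powr (1 - al)" using c by (simp add: y_def)
    also have "... = y powr (1 - al) * (c / 2) powr (1 - al)" by (rule powr_mult)
    also have "... <= y powr 1 * (c / 2) powr (1 - al)" using y a by (intro mult_right_mono powr_mono) auto
    also have "... <= (2 * Cd / c1 / c0 * ka2) * (c / 2) powr (1 - al)"
    proof (intro mult_right_mono)
     have "D / c <= Cd * c^2 / c" using DCd c by (intro divide_right_mono) auto
     also have "... = Cd * c" using c by (simp add: power2_eq_square)
     also have "... <= Cd * (c^2 / c1)" using ccs Cd0 by (intro mult_left_mono) auto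
     also have "... <= Cd * (ka2 / c0 / c1)" using c2k Cd0 c1 by (intro mult_left_mono divide_right_mono) auto
     finally have "2 * (D / c) <= 2 * (Cd * (ka2 / c0 / c1))" by linarith
     moreover have "y powr 1 = 2 * (D / c)" using D0 c by (simp add: y_def)
     moreover have "2 * (Cd * (ka2 / c0 / c1)) = 2 * Cd / c1 / c0 * ka2" by (simp add: mult_ac)
     ultimately show "y powr 1 <= 2 * Cd / c1 / c0 * ka2" by simp
    qed auto
    finally show ?thesis .
   qed
   show ?thesis
   proof (cases "ka1 <= X * ka2")
    case True
    have "c^2 * a2 <= K * ((2 * Cd / c1 / c0 * ka2) * (c^2 * a1))"
    proof -
     have "K * D powr (1 - al) <= K * ((2 * Cd / c1 / c0 * ka2) * (c / 2) powr (1 - al))"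
      using Dpow K0 by (intro mult_left_mono) auto
     also have "... <= K * ((2 * Cd / c1 / c0 * ka2) * (c^2 * a1))"
      using lo K0 Cd0 c1 c0 k2p by (intro mult_left_mono) auto
     finally show ?thesis using up by linarith
    qed
    hence "c^2 * a2 <= c^2 * (K * (2 * Cd / c1 / c0 * ka2) * a1)" by (simp add: mult_ac)
    hence A2: "a2 <= K * (2 * Cd / c1 / c0 * ka2) * a1" using c2 mult_le_cancel_left_pos by blast
    have "(ka1 / ka2) powr (al + 1) <= X powr (al + 1)"
     using True k k2p a by (intro powr_mono2) (auto simp: field_simps)
    hence "a2 * (ka1 / ka2) powr (al + 1) <= K * (2 * Cd / c1 / c0 * ka2) * a1 * X powr (al + 1)"
     using A2 K0 a10 Cd0 c1 c0 k2p by (intro mult_mono) auto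
    also have "... = Kb * ka2 * a1" by (simp add: Kb_def mult_ac)
    finally show ?thesis by (rule goal) (use KK a10 in "auto simp: C_def")
   next
    case False
    have "32 / c0 * ka2 <= X * ka2" "max (?B n) 8 / c0 * ka2 <= X * ka2"
     using k2p by (intro mult_right_mono, simp add: X_def, simp)+
    hence big: "32 * (ka2 / c0) <= ka1" "max (?B n) 8 * (ka2 / c0) <= ka1"
     using False by simp_all
    have "max (?B n) 8 * 1 <= max (?B n) 8 * (ka2 / c0)"
     using kc c0 by (intro mult_left_mono) auto
    hence nn: "2 * (real n)^2 <= ka1" "8 <= ka1" using big by simp_all
    have c32: "32 * c^2 <= ka1" using c2k big by simp
    \<comment> \<open>Growth is counted from sqrt 2, where x^2 - 1 = 1 and hence v >= 1, up to sqrt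
      2 * R, which is chosen such that c^2 x^2 = ka1 / 4.\<close>
    define R where "R = sqrt (ka1 / (8 * c^2))"
    have R2: "R >= 2"
    proof -
     have "sqrt 4 <= R" unfolding R_def using c32 c2 by (intro real_sqrt_le_mono) (simp add: field_simps)
     thus ?thesis by simp
    qed
    have Rsq: "R^2 = ka1 / (8 * c^2)" using k1p by (simp add: R_def)
    define xg where "xg = sqrt 2 * R"
    have s2: "1 < sqrt 2" "sqrt 2 <= xg" "(sqrt 2)^2 - (1::real) = 1" using R2 by (auto simp: xg_def)
    have xgs: "c^2 * xg^2 <= ka1 / 4" using c by (simp add: xg_def power_mult_distrib Rsq)
    have n2: "n >= 2" "2 * al + 2 <= real (2 * n - 2)" using a by (auto simp: n_def of_nat_diff)
    note g = A.barrier_growth[OF s2(1,2) xgs _ _ n2(1) nn(1)]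
    have "c^2 * (sqrt 2)^2 <= c^2 * xg^2" using s2 by (intro mult_left_mono power_mono) auto
    hence st: "c^2 * (sqrt 2)^2 <= ka1" using xgs k1p by simp
    have v1: "A.v (sqrt 2) >= 1" using A.v_nonneg_below(1)[OF s2(1) st] by simp
    have xg1: "1 < xg" using s2 by linarith
    have h: "R ^ n / 3 / xg <= A.v' xg"
    proof -
     have "1 * R ^ n / 3 <= A.v (sqrt 2) * R ^ n / 3" using v1 R2 by (intro divide_right_mono mult_right_mono) auto
     also have "... <= A.v xg" using g(1) nn c32 R2 by (simp add: xg_def)
     finally have "R ^ n / 3 / xg <= A.v xg / xg" using xg1 by (intro divide_right_mono) auto
     also have "... <= A.v' xg" using g(2) nn c32 by simp
     finally show ?thesis .
    qed
    have Bsg: "(ka1 - c^2 + al^2 + al) * (xg^2 - 1) > 2 * (1 - al^2)"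
    proof -
     have "2 * (1 - al^2) <= 2" by simp
     also have "2 < (ka1 - c^2) * 1" using c32 nn c2 by simp
     also have "... <= (ka1 - c^2 + al^2 + al) * (xg^2 - 1)"
     proof (intro mult_mono)
      have "(sqrt 2)^2 <= xg^2" using s2 by (intro power_mono) auto
      thus "1 <= xg^2 - 1" by simp
     qed (use aa Bp in auto)
     finally show ?thesis .
    qed
    have "(R ^ n / 3 / xg)^2 <= (A.v' xg)^2" using h R2 xg1 by (intro power_mono) auto
    also have "... <= c^2 * a1"
    proof (rule A.amp_lower[OF xg1 Bp Bsg])
     have "c^2 * xg^2 <= ka1" using xgs k1p by simp
     thus "0 <= A.v xg * A.v' xg" using A.v_nonneg_below[OF xg1] by (intro mult_nonneg_nonneg) (auto intro: less_imp_le)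
    qed
    finally have h2: "R ^ (2 * n - 2) <= 18 * (c^2 * a1)"
    proof -
     assume *: "(R ^ n / 3 / xg)^2 <= c^2 * a1"
     have "R ^ n * R ^ n = R ^ (2 * n)" by (rule power_mult_eq) simp
     also have "... = R ^ (2 * n - 2) * R^2" by (rule power_mult_eq[symmetric]) (use n2(1) in simp)
     finally have "R ^ n * R ^ n = R ^ (2 * n - 2) * R^2" .
     hence "(R ^ n / 3 / xg)^2 = R ^ (2 * n - 2) / 18"
      using R2 by (simp add: xg_def power_divide power_mult_distrib) (simp add: power2_eq_square)
     thus ?thesis using * by simp
    qed
    have kr: "ka1 / ka2 <= 8 / c0 * R^2"
    proof -
     have "ka1 = 8 * c^2 * R^2" using c by (simp add: Rsq)
     also have "... <= 8 * (ka2 / c0) * R^2" using c2k by (intro mult_right_mono mult_left_mono) auto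
     also have "... = 8 / c0 * R^2 * ka2" by simp
     finally show ?thesis using k2p by (simp only: pos_divide_le_eq)
    qed
    have "(ka1 / ka2) powr (al + 1) <= (8 / c0 * R^2) powr (al + 1)"
     using kr k1p k2p a by (intro powr_mono2) auto
    also have "... = (8 / c0) powr (al + 1) * R powr (2 * al + 2)"
    proof -
     have "(8 / c0 * R^2) powr (al + 1) = (8 / c0) powr (al + 1) * (R powr 2) powr (al + 1)"
      unfolding powr_mult using R2 by simp
     thus ?thesis by (simp add: powr_powr algebra_simps)
    qed
    also have "... <= (8 / c0) powr (al + 1) * R ^ (2 * n - 2)"
     using R2 n2 by (intro mult_left_mono powr_le_power) auto
    also have "... <= (8 / c0) powr (al + 1) * (18 * (c^2 * a1))" using h2 by (intro mult_left_mono) auto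
    finally have kk: "(ka1 / ka2) powr (al + 1) <= (8 / c0) powr (al + 1) * (18 * (c^2 * a1))" .
    have Dp: "D powr (1 - al) <= c1 powr (- al) * Cd / c0 * ka2"
    proof -
     define y where "y = D / c1"
     have y: "y >= 1" using D0 cc1 c1 by (simp add: y_def)
     have "D powr (1 - al) = (y * c1) powr (1 - al)" using c1 by (simp add: y_def)
     also have "... = y powr (1 - al) * c1 powr (1 - al)" using y c1 by (simp add: powr_mult)
     also have "... <= y powr 1 * c1 powr (1 - al)" using y a by (intro mult_right_mono powr_mono) auto
     also have "... = D * c1 powr (- al)"
     proof -
      have "c1 powr (1 - al) = c1 * c1 powr (- al)" using c1 by (simp add: powr_diff powr_minus_divide)
      thus ?thesis using y c1 by (simp add: y_def)
     qed
     also have "... <= (Cd / c0 * ka2) * c1 powr (- al)" using Dk by (intro mult_right_mono) auto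
     finally show ?thesis by (simp add: mult_ac)
    qed
    have "c^2 * (a2 * (ka1 / ka2) powr (al + 1)) <= K * D powr (1 - al) * (ka1 / ka2) powr (al + 1)"
     using mult_right_mono[OF up, of "(ka1 / ka2) powr (al + 1)"] by (simp add: mult.assoc)
    also have "... <= K * (c1 powr (- al) * Cd / c0 * ka2) * ((8 / c0) powr (al + 1) * (18 * (c^2 * a1)))"
     using Dp kk K0 Cd0 c0 k2p by (intro mult_mono mult_left_mono) auto
    also have "... = c^2 * (Kc * ka2 * a1)" by (simp add: Kc_def mult_ac)
    finally have "a2 * (ka1 / ka2) powr (al + 1) <= Kc * ka2 * a1" using c2 mult_le_cancel_left_pos by blast
    thus ?thesis by (rule goal) (use KK a10 in "auto simp: C_def")
   qed
  qed
 qed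
qed

lemma amp_ratio:
 fixes al c0 :: real
 assumes a: "al >= 0" and c0: "0 < c0"
 obtains C where "C > 0" "!!c ka1 ka2 U1 U1' a1 U2 U2' a2.
   outer_sol al c ka1 U1 U1' a1 ==> outer_sol al c ka2 U2 U2' a2 ==> ka2 < ka1 ==>
   c0 <= ka2 ==> c0 * c^2 <= ka2 ==> a1 >= 0 ==>
   a2 * (ka1 / ka2) powr (al + 1) <= C * ka2 * a1"
proof -
 define d where "d = min c0 1"
 have d: "0 < d" "d <= 1" "d <= c0" using c0 by (auto simp: d_def)
 obtain C1 where C1: "C1 > 0" "!!c ka1 ka2 U1 U1' a1 U2 U2' a2.
   outer_sol al c ka1 U1 U1' a1 ==> outer_sol al c ka2 U2 U2' a2 ==> ka2 < ka1 ==>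
   d <= ka2 ==> ka2 - c^2 >= 2 * c ==>
   a2 * (ka1 / ka2) powr (al + 1) <= C1 * ka2 * a1" by (rule amp_ratio_supercritical[OF a d(1,2)]) blast
 obtain C2 where C2: "C2 > 0" "!!c ka1 ka2 U1 U1' a1 U2 U2' a2.
   outer_sol al c ka1 U1 U1' a1 ==> outer_sol al c ka2 U2 U2' a2 ==> ka2 < ka1 ==>
   d <= ka2 ==> d * c^2 <= ka2 ==> ka2 - c^2 < 2 * c ==>
   a2 * (ka1 / ka2) powr (al + 1) <= C2 * ka2 * a1" by (rule amp_ratio_subcritical[OF a d(1,2)]) blast
 show ?thesis
 proof (rule that[of "C1 + C2"])
  show "C1 + C2 > 0" using C1 C2 by simp
  fix c ka1 ka2 U1 U1' a1 U2 U2' a2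
  assume *: "outer_sol al c ka1 U1 U1' a1" "outer_sol al c ka2 U2 U2' a2" "ka2 < ka1"
   "c0 <= ka2" "c0 * c^2 <= ka2" "a1 >= 0"
  have dc: "d <= ka2" "d * c^2 <= ka2" using * d mult_right_mono[of d c0 "c^2"] by auto
  have "0 <= ka2 * a1" using * dc d by simp
  hence p: "C1 * ka2 * a1 <= (C1 + C2) * ka2 * a1" "C2 * ka2 * a1 <= (C1 + C2) * ka2 * a1"
   using C1(1) C2(1) by (auto simp: distrib_right mult.assoc)
  show "a2 * (ka1 / ka2) powr (al + 1) <= (C1 + C2) * ka2 * a1"
  proof (cases "ka2 - c^2 >= 2 * c")
   case True
   thus ?thesis using C1(2)[OF *(1,2,3) dc(1)] p by linarith
  next
   case False
   thus ?thesis using C2(2)[OF *(1,2,3) dc] p by linarith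
  qed
 qed
qed

section \<open>The weighted space\<close>

text \<open>The source of the Cauchy-Schwarz inequalities below: for \<open>ip\<close>, for the
  defect form in \<open>near_maximizer\<close> and for complex square-integrable functions. Only the
  values of a quadratic polynomial enter.\<close>

lemma discriminant_nonneg:
 fixes A B C :: real
 assumes "!!t. 0 <= A + 2 * t * B + t^2 * C"
 shows "B^2 <= A * C"
proof (cases "C = 0")
 case True
 have "B = 0"
 proof (rule ccontr)
  assume "B ~= 0"
  have "0 <= A + 2 * (- (A + 1) / (2 * B)) * B + (- (A + 1) / (2 * B))^2 * C" by (rule assms)
  thus False using True `B ~= 0` by (simp add: field_simps)
 qed
 thus ?thesis using True by simp
next
 case False
 have A0: "0 <= A" using assms[of 0] by simp
 have "C > 0"
 proof (rule ccontr)
  assume "\<not> C > 0"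
  hence C: "C < 0" using False by simp
  define t where "t = (1 + A + abs (2 * B)) / (- C) + 1"
  have t1: "t >= 1" using C A0 by (simp add: t_def divide_nonneg_neg field_simps)
  have "t * C = - (1 + A + abs (2 * B)) + C" using C by (simp add: t_def field_simps)
  hence "t * C <= - (1 + A + abs (2 * B))" using C by simp
  hence "t * (t * C) <= t * (- (1 + A + abs (2 * B)))" using t1 by (intro mult_left_mono) auto
  moreover have "t * (2 * B) <= t * abs (2 * B)" using t1 by (intro mult_left_mono) auto
  moreover have "A <= t * A" using t1 A0 mult_right_mono[of 1 t A] by simp
  moreover have "A + 2 * t * B + t^2 * C = A + t * (2 * B) + t * (t * C)" by (simp add: power2_eq_square)
  moreover have "t * (- (1 + A + abs (2 * B))) = - t - t * A - t * abs (2 * B)" by (simp add: algebra_simps)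
  ultimately show False using assms[of t] t1 by linarith
 qed
 have "0 <= A + 2 * (- B / C) * B + (- B / C)^2 * C" by (rule assms)
 also have "... = A - B^2 / C" using `C > 0` by (simp add: power2_eq_square field_simps)
 finally show ?thesis using `C > 0` by (simp add: pos_divide_le_eq)
qed

text \<open>The weight is absorbed in a measure on [-1, 1]. With \<open>al = 0\<close> the same
  construction gives the unweighted space, up to the endpoints, where the density is 0.\<close>

definition wmeas :: "real => real measure" where
 "wmeas al = density (lebesgue_on II) (%x. ennreal (weight al x))"

locale wt =
 fixes al :: real
 assumes alpha0: "al >= 0"
begin

abbreviation "nu \<equiv> wmeas al"
abbreviation "w \<equiv> weight al"

lemma w_nonneg: "w x >= 0" by (simp add: weight_def)
lemma w_le1: "x : II ==> w x <= 1"
 unfolding weight_def using alpha0 by (intro powr_le1) (auto simp: abs_square_le_1 abs_le_iff)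

lemma sets_nu: "sets nu = sets (lebesgue_on II)" by (simp add: wmeas_def)
lemma space_nu: "space nu = II" by (simp add: wmeas_def)
lemma meas_nu: "borel_measurable nu = borel_measurable (lebesgue_on II)"
 by (rule measurable_cong_sets) (auto simp: sets_nu)

lemma w_meas: "w : borel_measurable (lebesgue_on II)"
 unfolding weight_def[abs_def] by (intro measurable_restrict_space1 measurable_completion) simp

lemma cont_meas: "contI f ==> f : borel_measurable nu"
 for f :: "real => 'b::euclidean_space"
 unfolding meas_nu by (rule continuous_imp_measurable_on_sets_lebesgue) auto

lemma nu_integral:
 fixes f :: "real => 'b::{banach, second_countable_topology}"
 assumes "f : borel_measurable nu"
 shows "(LINT x|nu. f x) = (LINT x|(lebesgue_on II). w x *\<^sub>R f x)"
  "integrable nu f \<longleftrightarrow> integrable (lebesgue_on II) (%x. w x *\<^sub>R f x)"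
 using assms w_meas unfolding meas_nu wmeas_def
 by (intro integral_density integrable_density; simp add: w_nonneg)+

lemma emeasure_nu: "emeasure nu (space nu) <= 2"
proof -
 have "emeasure nu (space nu) = (\<integral>\<^sup>+x. ennreal (w x) * chi x \<partial>lebesgue_on II)"
  using w_meas by (simp add: wmeas_def emeasure_density)
 also have "... <= (\<integral>\<^sup>+x. 1 \<partial>lebesgue_on {-1..1::real})"
  by (rule nn_integral_mono) (auto simp: w_le1 ennreal_le_1 indicator_def)
 also have "... = emeasure (lebesgue_on {-1..1::real}) II" by simp
 also have "... = 2" by (subst emeasure_restrict_space) auto
 finally show ?thesis .
qed

sublocale finite_measure nu
 by (rule finite_measureI) (use emeasure_nu in "auto simp: top_unique")

lemma measure_nu: "measure nu (space nu) <= 2"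
 using emeasure_nu unfolding emeasure_eq_measure by (simp flip: ennreal_numeral)

lemma integrable_bdd:
 fixes f :: "real => 'b::{banach, second_countable_topology}"
 assumes "f : borel_measurable nu" "!!x. x : II ==> norm (f x) <= B"
 shows "integrable nu f"
 by (rule integrable_const_bound[of _ B]) (use assms in "auto intro!: AE_I2 simp: space_nu")

lemma cont_bdd: assumes "continuous_on {-1..1::real} f"
 obtains B where "!!x. x : II ==> (abs (f x :: real)) <= B" "B >= 0"
proof -
 have "bounded (f ` II)"
  using assms by (intro compact_imp_bounded compact_continuous_image) auto
 then obtain B where B: "!!x. x : II ==> (abs (f x)) <= B" by (force simp: bounded_iff)
 show ?thesis using that[of B] B B[of 0] by force
qed

lemma integrable_cont: "contI f ==> integrable nu (f :: real => real)"
 using cont_bdd[of f] integrable_bdd[OF cont_meas, of f] by (metis real_norm_def)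

lemma bound_integral:
 assumes "integrable nu h" "!!x. x : II ==> (abs (g x)) <= B" "g : borel_measurable nu"
 shows "integrable nu (%x. g x * h x :: real)" "abs (LINT x|nu. g x * h x) <= B * (LINT x|nu. (abs (h x)))"
proof -
 have B0: "B >= 0" using assms(2)[of 0] by force
 show i: "integrable nu (%x. g x * h x)"
  by (rule integrable_dominated[where f = "%x. B * h x"])
    (use assms B0 in "auto intro!: AE_I2 mult_right_mono borel_measurable_integrable simp: space_nu abs_mult")
 have "abs (LINT x|nu. g x * h x) <= (LINT x|nu. (abs (g x * h x)))" by (rule integral_abs_bound)
 also have "... <= (LINT x|nu. B * abs (h x))"
  by (rule integral_mono) (use i assms in "auto simp: space_nu abs_mult[symmetric] intro!: integrable_abs", use assms in "auto simp: abs_mult space_nu intro!: mult_right_mono")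
 finally show "abs (LINT x|nu. g x * h x) <= B * (LINT x|nu. (abs (h x)))" by simp
qed

definition l2 :: "(real => real) => bool" where
 "l2 f \<longleftrightarrow> f : borel_measurable nu & integrable nu (%x. (f x)^2)"

definition ip :: "(real => real) => (real => real) => real" where
 "ip f g = (LINT x|nu. f x * g x)"

lemma l2_meas: "l2 f ==> f : borel_measurable nu" by (simp add: l2_def)

lemma l2_mult: assumes "l2 f" "l2 g" shows "integrable nu (%x. f x * g x)"
proof (rule integrable_dominated[where f = "%x. (f x)^2 + (g x)^2"])
 show "AE x in nu. norm (f x * g x) <= norm ((f x)^2 + (g x)^2)"
 proof (rule AE_I2)
  fix x
  have "2 * abs (f x * g x) <= (f x)^2 + (g x)^2" using sum_squares_bound[of "abs (f x)" "abs (g x)"] by (simp add: abs_mult)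
  thus "norm (f x * g x) <= norm ((f x)^2 + (g x)^2)" by simp
 qed
qed (use assms in "auto simp: l2_def")

lemma l2_add: assumes "l2 f" "l2 g" shows "l2 (%x. f x + g x)"
 unfolding l2_def power2_sum using assms l2_mult[OF assms] by (auto simp: l2_def mult.assoc)
lemma l2_cmult: "l2 f ==> l2 (%x. a * f x)" unfolding l2_def power_mult_distrib by auto
lemma l2_minus: "l2 f ==> l2 (%x. - f x)" unfolding l2_def by auto
lemma l2_diff: "l2 f ==> l2 g ==> l2 (%x. f x - g x)" using l2_add[OF _ l2_minus] by auto
lemma l2_0: "l2 (%x. 0)" by (simp add: l2_def)
lemma l2_sum: "(!!i. i : A ==> l2 (f i)) ==> l2 (%x. \<Sum>i\<in>A. f i x)"
 by (induction A rule: infinite_finite_induct) (auto simp: l2_0 intro!: l2_add)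
lemma l2_bdd: "f : borel_measurable nu ==> (!!x. x : II ==> (abs (f x)) <= B) ==> l2 f"
 unfolding l2_def
proof
 assume f: "f : borel_measurable nu" "!!x. x : II ==> (abs (f x)) <= B"
 show "integrable nu (%x. (f x)^2)"
 proof (rule integrable_bdd[where B = "B^2"])
  fix x :: real assume "x : II"
  hence "(abs (f x))^2 <= B^2" using f(2) by (intro power_mono) auto
  thus "norm ((f x)^2) <= B^2" by simp
 qed (use f(1) in measurable)
qed
lemma l2_cont: "contI f ==> l2 f"
 using cont_bdd[of f] l2_bdd[OF cont_meas, of f] by metis
lemma l2_integrable: "l2 f ==> integrable nu f"
 using l2_mult[of f "%_. 1"] l2_cont[of "%_. 1"] by simp

lemma ip_sym: "ip f g = ip g f" by (simp add: ip_def mult.commute)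
lemma ip_add: "l2 f ==> l2 g ==> l2 h ==> ip (%x. f x + g x) h = ip f h + ip g h"
 unfolding ip_def distrib_right by (intro Bochner_Integration.integral_add l2_mult)
lemma ip_diff: "l2 f ==> l2 g ==> l2 h ==> ip (%x. f x - g x) h = ip f h - ip g h"
 unfolding ip_def left_diff_distrib by (intro Bochner_Integration.integral_diff l2_mult)
lemma ip_cmult: "ip (%x. a * f x) h = a * ip f h" unfolding ip_def mult.assoc by simp
lemma ip_sum: "(!!i. i : A ==> l2 (f i)) ==> l2 h ==> ip (%x. \<Sum>i\<in>A. f i x) h = (\<Sum>i\<in>A. ip (f i) h)"
 unfolding ip_def sum_distrib_right by (rule Bochner_Integration.integral_sum) (auto intro: l2_mult)
lemma ip_add2: "l2 f ==> l2 g ==> l2 h ==> ip h (%x. f x + g x) = ip h f + ip h g"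
 using ip_add ip_sym by metis
lemma ip_cmult2: "ip h (%x. a * f x) = a * ip h f" using ip_cmult ip_sym by metis
lemma ip_nonneg: "ip f f >= 0" unfolding ip_def by simp
lemma ip_cong: "(!!x. x : II ==> f x = f' x) ==> (!!x. x : II ==> g x = g' x) ==> ip f g = ip f' g'"
 unfolding ip_def by (rule integral_eqI) (auto simp: space_nu)

lemma ip_square_expand:
 assumes "l2 f" "l2 g"
 shows "ip (%x. f x + t * g x) (%x. f x + t * g x) = ip f f + 2 * t * ip f g + t^2 * ip g g"
 using assms by (simp add: ip_add ip_add2 l2_add l2_cmult ip_cmult ip_cmult2 power2_eq_square ip_sym algebra_simps)

lemma cs: assumes "l2 f" "l2 g" shows "(ip f g)^2 <= ip f f * ip g g"
 by (rule discriminant_nonneg) (use ip_square_expand[OF assms] ip_nonneg in metis)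

definition nrm :: "(real => real) => real" where "nrm f = sqrt (ip f f)"

lemma nrm_nonneg: "nrm f >= 0" by (simp add: nrm_def ip_nonneg)
lemma nrm_sq: "(nrm f)^2 = ip f f" by (simp add: nrm_def ip_nonneg)
lemma cs_abs: assumes "l2 f" "l2 g" shows "abs (ip f g) <= nrm f * nrm g"
proof -
 have "sqrt ((ip f g)^2) <= sqrt (ip f f * ip g g)" using cs[OF assms] by (rule real_sqrt_le_mono)
 thus ?thesis by (simp add: nrm_def real_sqrt_mult)
qed
lemma nrm_triangle: assumes "l2 f" "l2 g" shows "nrm (%x. f x + g x) <= nrm f + nrm g"
proof (rule power2_le_imp_le)
 have "(nrm (%x. f x + g x))^2 = ip f f + 2 * ip f g + ip g g"
  using ip_square_expand[OF assms, of 1] by (simp add: nrm_sq)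
 also have "... <= ip f f + 2 * (nrm f * nrm g) + ip g g" using cs_abs[OF assms] by linarith
 also have "... = (nrm f + nrm g)^2" by (simp add: power2_sum nrm_sq)
 finally show "(nrm (%x. f x + g x))^2 <= (nrm f + nrm g)^2" .
qed (simp add: nrm_nonneg)

text \<open>The density vanishes at the endpoints, so an open set of positivity leads to a
  contradiction only inside the interval. The endpoints follow by continuity.\<close>

lemma integral_pos_of_cont:
 assumes f: "contI f" "!!x. x : II ==> f x >= 0" and z: "(LINT x|nu. f x) = (0::real)" and x: "x : II"
 shows "f x = 0"
proof -
 let ?A = "{-1<..<1} \<inter> f -` (- {0})"
 have ae: "AE x in nu. f x = 0"
  using z integral_nonneg_eq_0_iff_AE[OF integrable_cont[OF f(1)] AE_I2] f(2) by (auto simp: space_nu)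
 have "AE x in lebesgue_on II. ennreal (w x) ~= 0 --> f x = 0"
  using ae w_meas unfolding wmeas_def by (subst (asm) AE_density) (auto simp: ennreal_eq_0_iff less_le)
 hence "AE x in leb. x : II --> (ennreal (w x) ~= 0 --> f x = 0)"
  by (subst (asm) AE_restrict_space_iff) auto
 then obtain N where N: "N : null_sets leb" "{x. \<not> (x : II --> (ennreal (w x) ~= 0 --> f x = 0))} \<subseteq> N"
  by (auto elim!: AE_E2 AE_E3 simp: eventually_ae_filter)
 have z0: "f y = 0" if y: "y : {-1<..<1}" for y
 proof (rule ccontr)
  assume ny: "f y ~= 0"
  have "continuous_on {-1<..<1} f" using f(1) by (rule continuous_on_subset) auto
  hence op: "open ?A" by (intro continuous_open_preimage) auto
  have inn: "y : {-1<..<1} \<inter> f -` (- {0})" using y ny by simp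
  have "{-1<..<1} \<inter> f -` (- {0}) \<subseteq> N"
  proof
   fix u assume u: "u : {-1<..<1} \<inter> f -` (- {0})"
   have "u^2 < 1" using u by (auto simp: abs_square_less_1 abs_less_iff)
   hence "w u > 0" by (simp add: weight_def)
   thus "u : N" using u N(2) by (auto simp: subset_iff)
  qed
  hence "negligible ?A"
   using N(1) by (meson negligible_subset negligible_iff_null_sets)
  thus False using open_not_negligible[OF op] inn by blast
 qed
 have "{-1..1::real} \<subseteq> {x. f x = 0}" if "closed {x : II. f x = 0}"
 proof -
  have "closure {-1<..<1::real} \<subseteq> {x : II. f x = 0}"
   using z0 that by (intro closure_minimal) auto
  thus ?thesis by auto
 qed
 moreover have "closed {x : II. f x = 0}"
  using continuous_closed_preimage[OF f(1), of "{0}"] by (simp add: vimage_def Int_def)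
 ultimately show ?thesis using x by blast
qed

text \<open>The form of the fundamental theorem with interior derivatives: at the endpoints only
  continuity is asked, which suits functions containing (1 - x^2)^(al + 1).\<close>

lemma wt_ftc:
 assumes G: "contI G" and r: "contI r"
  and d: "!!y. y : {-1<..<1} ==> DERIV G y :> w y * r y"
 shows "(LINT x|nu. r x) = G 1 - G (-1)"
proof -
 have "((%y. w y * r y) has_integral G 1 - G (-1)) II"
  using d G by (intro fundamental_theorem_of_calculus_interior) (auto simp: has_real_derivative_iff_has_vector_derivative)
 moreover have i: "integrable (lebesgue_on II) (%x. w x *\<^sub>R r x)"
  using integrable_cont[OF r] nu_integral(2)[OF cont_meas[OF r]] by simp
 moreover have "(LINT x|nu. r x) = integral II (%x. w x * r x)"
  using nu_integral(1)[OF cont_meas[OF r]] lebesgue_integral_eq_integral[OF i] by simp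
 ultimately show ?thesis by (simp add: integral_unique)
qed

end

section \<open>The commuting differential operator\<close>

text \<open>Permits differentiation under the integral sign by an explicit second-order remainder,
  integrated against an arbitrary integrable function.\<close>

lemma DERIV_from_quadratic_bound:
 fixes F :: "real => real"
 assumes "!!d. (abs (F (x + d) - F x - d * D)) <= K * d^2"
 shows "DERIV F x :> D"
 unfolding DERIV_def
proof (rule LIM_zero_cancel, rule Lim_null_comparison)
 let ?A = "%h. (F (x + h) - F x) / h - D"
 show "\<forall>\<^sub>F h in at 0. norm (?A h) <= K * abs h"
 proof (rule eventually_at_topological[THEN iffD2], intro exI[of _ UNIV] conjI ballI impI)
  fix h :: real assume h: "h ~= 0"
  have "norm (?A h) = abs (F (x + h) - F x - h * D) / abs h"
   using h by (simp add: abs_divide[symmetric] diff_divide_distrib)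
  also have "... <= K * h^2 / abs h" using assms by (intro divide_right_mono) auto
  also have "... = K * abs h" using h by (simp add: power2_eq_square abs_if)
  finally show "norm (?A h) <= K * abs h" .
 qed auto
 show "((%h. K * abs h) ---> 0) (at 0)"
  by (rule tendsto_eq_intros refl | simp)+
qed

lemma cos_sin_remainder:
 fixes a d :: real
 shows "abs (cos (a + d) - cos a + d * sin a) <= d^2" "abs (sin (a + d) - sin a - d * cos a) <= d^2"
proof -
 let ?A = "iexp a * (iexp d - 1 - \<i> * d)"
 have "cmod (iexp d - (\<Sum>k\<le>1. (\<i> * d) ^ k / fact k)) <= (abs d) ^ Suc 1 / fact (Suc 1)" by (rule iexp_approx1)
 hence 1: "cmod (iexp d - 1 - \<i> * d) <= d^2 / 2" by (simp add: fact_numeral power2_eq_square algebra_simps)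
 have "cmod ?A <= d^2 / 2" using 1 by (simp add: norm_mult)
 hence z: "cmod ?A <= d^2" by (rule order_trans) simp
 have "Re ?A = cos (a + d) - cos a + d * sin a"
  by (simp add: Re_exp Im_exp cos_add algebra_simps)
 thus "abs (cos (a + d) - cos a + d * sin a) <= d^2" using order_trans[OF abs_Re_le_cmod z] by simp
 have "Im ?A = sin (a + d) - sin a - d * cos a"
  by (simp add: Re_exp Im_exp sin_add algebra_simps)
 thus "abs (sin (a + d) - sin a - d * cos a) <= d^2" using order_trans[OF abs_Im_le_cmod z] by simp
qed

section \<open>Cosine and sine parts of the finite Fourier transform\<close>

locale pf = wt +
 fixes c :: real
 assumes c0: "c > 0"
begin

text \<open>On real functions the finite Fourier transform is \<open>Cop\<close> + i
  \<open>Sop\<close>. Two real operators keep the whole spectral theory real; complex functions are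
  treated through their real and imaginary parts.\<close>

definition Cop :: "(real => real) => real => real" where "Cop h x = (LINT y|nu. cos (c * x * y) * h y)"
definition Sop :: "(real => real) => real => real" where "Sop h x = (LINT y|nu. sin (c * x * y) * h y)"

lemma trig_integrable:
 assumes "integrable nu h"
 shows "integrable nu (%y. cos (c * x * y) * h y)" "integrable nu (%y. sin (c * x * y) * h y)"
  "integrable nu (%y. c * y * h y)"
proof -
 show "integrable nu (%y. cos (c * x * y) * h y)" "integrable nu (%y. sin (c * x * y) * h y)"
  by (rule bound_integral(1)[OF assms, where B = 1]; auto intro!: cont_meas continuous_intros)+
 have "integrable nu (%y. (c * y) * h y)"
  by (rule bound_integral(1)[OF assms, where B = c]) (use c0 in "auto intro!: cont_meas continuous_intros simp: abs_mult")
 thus "integrable nu (%y. c * y * h y)" by simp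
qed

lemma trig_deriv:
 assumes "integrable nu h"
 shows "(Cop h has_real_derivative - Sop (%y. c * y * h y) x) (at x)"
  "(Sop h has_real_derivative Cop (%y. c * y * h y) x) (at x)"
proof -
 let ?A = "%d. LINT y|nu. (cos (c * x * y + c * d * y) - cos (c * x * y) + c * d * y * sin (c * x * y)) * h y"
 let ?B = "%d. LINT y|nu. (sin (c * x * y + c * d * y) - sin (c * x * y) - c * d * y * cos (c * x * y)) * h y"
 let ?C = "%y. c * y * h y"
 note i = trig_integrable[OF assms] trig_integrable[OF trig_integrable(3)[OF assms]]
 have b: "(c * d * y)^2 <= c^2 * d^2" if "y : II" for d y
 proof -
  have "y^2 <= 1" using that by (simp add: abs_square_le_1 abs_le_iff)
  thus ?thesis using mult_left_mono[of "y^2" 1 "c^2 * d^2"] by (simp add: power_mult_distrib)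
 qed
 have "abs (Cop h (x + d) - Cop h x - d * (- Sop ?C x)) <= c^2 * (LINT y|nu. (abs (h y))) * d^2" for d
 proof -
  have eq: "Cop h (x + d) - Cop h x - d * (- Sop ?C x) =
   (?A d)"
  proof -
   have "(?A d)
     = (LINT y|nu. (cos (c * (x + d) * y) * h y - cos (c * x * y) * h y) + d * (sin (c * x * y) * (c * y * h y)))"
    by (rule integral_eqI) (simp_all add: algebra_simps)
   thus ?thesis unfolding Cop_def Sop_def
    using i by (subst (asm) Bochner_Integration.integral_add) (auto simp: Bochner_Integration.integral_diff)
  qed
  show ?thesis unfolding eq
   by (rule order_trans[OF bound_integral(2)[OF assms, where B = "c^2 * d^2"]])
     (auto intro!: cont_meas continuous_intros order_trans[OF cos_sin_remainder(1) b] simp: mult_ac[of "integral\<^sup>L _ _"])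
 qed
 thus "(Cop h has_real_derivative - Sop ?C x) (at x)" by (rule DERIV_from_quadratic_bound)
 have "abs (Sop h (x + d) - Sop h x - d * (Cop ?C x)) <= c^2 * (LINT y|nu. (abs (h y))) * d^2" for d
 proof -
  have eq: "Sop h (x + d) - Sop h x - d * (Cop ?C x) =
   (?B d)"
  proof -
   have "(?B d)
     = (LINT y|nu. (sin (c * (x + d) * y) * h y - sin (c * x * y) * h y) - d * (cos (c * x * y) * (c * y * h y)))"
    by (rule integral_eqI) (simp_all add: algebra_simps)
   thus ?thesis unfolding Cop_def Sop_def
    using i by (subst (asm) Bochner_Integration.integral_diff) (auto simp: Bochner_Integration.integral_diff)
  qed
  show ?thesis unfolding eq
   by (rule order_trans[OF bound_integral(2)[OF assms, where B = "c^2 * d^2"]])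
     (auto intro!: cont_meas continuous_intros order_trans[OF cos_sin_remainder(2) b] simp: mult_ac[of "integral\<^sup>L _ _"])
 qed
 thus "(Sop h has_real_derivative Cop ?C x) (at x)" by (rule DERIV_from_quadratic_bound)
qed

lemma trig_cont: assumes "integrable nu h" shows "continuous_on S (Cop h)" "continuous_on S (Sop h)"
 using trig_deriv[OF assms] by (meson DERIV_isCont continuous_at_imp_continuous_on)+

lemma trig_bound: assumes "integrable nu h" shows "abs (Cop h x) <= (LINT y|nu. (abs (h y)))" "abs (Sop h x) <= (LINT y|nu. (abs (h y)))"
proof -
 have "abs (LINT y|nu. cos (c * x * y) * h y) <= 1 * (LINT y|nu. (abs (h y)))"
  by (rule bound_integral(2)[OF assms]) (auto intro!: cont_meas continuous_intros)
 thus "abs (Cop h x) <= (LINT y|nu. (abs (h y)))" by (simp add: Cop_def)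
 have "abs (LINT y|nu. sin (c * x * y) * h y) <= 1 * (LINT y|nu. (abs (h y)))"
  by (rule bound_integral(2)[OF assms]) (auto intro!: cont_meas continuous_intros)
 thus "abs (Sop h x) <= (LINT y|nu. (abs (h y)))" by (simp add: Sop_def)
qed

text \<open>\<open>sl phi phi' g\<close>: the derivative of \<open>phi\<close> is \<open>phi'\<close> and the commuting differential operator maps
  \<open>phi\<close> to \<open>g\<close>; written in divergence form, no second derivative at the endpoints is needed.\<close>

definition sl :: "(real => real) => (real => real) => (real => real) => bool" where
 "sl phi phi1 g \<longleftrightarrow> (ALL x:II. (phi has_real_derivative phi1 x) (at x within II)) &
   contI phi1 & contI g &
   (ALL x:{-1<..<1}. (DERIV (%x. (1 - x^2) powr (al + 1) * phi1 x) x :> w x * (g x + c^2 * x^2 * phi x)))"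

lemma slD:
 assumes "sl phi phi1 g"
 shows "x : {-1<..<1} ==> DERIV phi x :> phi1 x"
  "contI phi" "contI phi1" "contI g"
  "x : {-1<..<1} ==> DERIV (%x. (1 - x^2) powr (al + 1) * phi1 x) x :> w x * (g x + c^2 * x^2 * phi x)"
proof -
 show "contI phi" using assms unfolding sl_def
  by (meson DERIV_continuous_on)
 show "x : {-1<..<1} ==> DERIV phi x :> phi1 x"
  using assms unfolding sl_def by (metis at_within_Icc_at atLeastAtMost_iff greaterThanLessThan_iff less_imp_le)
qed (use assms in "auto simp: sl_def")

lemma contp: "continuous_on S (%x. (1 - x^2) powr (al + 1))" if "S \<subseteq> {-1..1::real}"
 using that alpha0 by (intro continuous_on_powr' continuous_intros) (auto simp: abs_square_le_1 abs_le_iff subset_iff)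

text \<open>The boundary terms carry the factor (1 - x^2)^(al + 1), which vanishes at both
  endpoints, and the contributions of c^2 x^2 cancel. The operator is thus symmetric without any
  boundary condition.\<close>

lemma green:
 assumes 1: "sl phi phi1 g" and 2: "sl \<chi>' \<chi>1 h"
 shows "ip g \<chi>' = ip phi h"
proof -
 let ?A = "%x. (1 - x^2) powr (al + 1) * phi1 x"
 note c1 = slD[OF 1] and c2 = slD[OF 2]
 have "(LINT x|nu. g x * \<chi>' x - phi x * h x) =
  (?A 1) * \<chi>' 1 - phi 1 * ((1 - 1^2) powr (al + 1) * \<chi>1 1)
  - ((?A (-1)) * \<chi>' (-1) - phi (-1) * ((1 - (-1)^2) powr (al + 1) * \<chi>1 (-1)))"
 proof (rule wt_ftc[where G = "%x. (?A x) * \<chi>' x - phi x * ((1 - x^2) powr (al + 1) * \<chi>1 x)"])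
  fix y :: real assume y: "y : {-1<..<1}"
  show "((%x. (?A x) * \<chi>' x - phi x * ((1 - x^2) powr (al + 1) * \<chi>1 x)) has_real_derivative
     w y * (g y * \<chi>' y - phi y * h y)) (at y)"
   by (rule DERIV_cong[OF DERIV_diff[OF DERIV_mult[OF c1(5)[OF y] c2(1)[OF y]] DERIV_mult[OF c1(1)[OF y] c2(5)[OF y]]]])
     (simp add: algebra_simps)
 qed (intro continuous_on_diff continuous_on_mult c1(2,3,4) c2(2,3,4) contp order_refl)+
 hence "(LINT x|nu. g x * \<chi>' x - phi x * h x) = 0" by simp
 moreover have "integrable nu (%x. g x * \<chi>' x)" "integrable nu (%x. phi x * h x)"
  by (intro integrable_cont continuous_on_mult c1(2,3,4) c2(2,3,4))+
 ultimately show ?thesis unfolding ip_def using Bochner_Integration.integral_diff by fastforce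
qed

lemma dp: assumes "x : {-1<..<1::real}"
 shows "DERIV (%x. (1 - x^2) powr (al + 1)) x :> - (2 * (al + 1) * x * w x)"
proof -
 have s: "1 - x^2 > 0" using assms by (auto simp: abs_square_less_1 abs_less_iff)
 have d: "DERIV (%x. 1 - x^2) x :> - (2 * x)" by (auto intro!: derivative_eq_intros)
 show ?thesis using DERIV_fun_powr[OF d s, of "al + 1"] by (simp add: weight_def algebra_simps)
qed

lemma p_eq: assumes "x : {-1<..<1::real}" shows "(1 - x^2) powr (al + 1) = w x * (1 - x^2)"
proof -
 have s: "1 - x^2 > 0" using assms by (auto simp: abs_square_less_1 abs_less_iff)
 thus ?thesis by (simp add: weight_def powr_add)
qed

lemma sl_smooth:
 assumes d1: "!!x. x : II ==> (phi has_real_derivative phi1 x) (at x within II)"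
  and d2: "!!x. x : II ==> (phi1 has_real_derivative phidd x) (at x within II)"
  and c2: "contI phidd"
  and g: "!!x. x : II ==> g x = (1 - x^2) * phidd x - (2 * al + 2) * x * phi1 x - c^2 * x^2 * phi x"
 shows "sl phi phi1 g"
 unfolding sl_def
proof (intro conjI ballI)
 show c1: "contI phi1" using d2 by (meson DERIV_continuous_on)
 have c: "contI phi" using d1 by (meson DERIV_continuous_on)
 have "contI (%x. (1 - x^2) * phidd x - (2 * al + 2) * x * phi1 x - c^2 * x^2 * phi x)"
  by (intro continuous_intros c1 c c2)
 thus "contI g" by (rule continuous_on_eq) (simp add: g)
 fix x :: real assume x: "x : {-1<..<1}"
 have d2x: "DERIV phi1 x :> phidd x"
  using d2[of x] x at_within_Icc_at[of "-1" x 1] by simp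
 show "DERIV (%x. (1 - x^2) powr (al + 1) * phi1 x) x :> w x * (g x + c^2 * x^2 * phi x)"
 proof (rule DERIV_cong[OF DERIV_mult[OF dp[OF x] d2x]])
  have gx: "g x = (1 - x^2) * phidd x - (2 * al + 2) * x * phi1 x - c^2 * x^2 * phi x" using g x by simp
  show "- (2 * (al + 1) * x * w x) * phi1 x + phidd x * (1 - x^2) powr (al + 1) = w x * (g x + c^2 * x^2 * phi x)"
   unfolding p_eq[OF x] gx by (simp add: algebra_simps)
 qed
qed (use d1 in auto)

text \<open>The operator gives the same result on cos(cxy) and sin(cxy) whether it acts in x or in
  y. \<open>green\<close> then moves it from the kernel to phi, which is the commutation with the
  transform.\<close>

lemma trig_ode:
 assumes "sl phi phi1 g"
 shows "(1 - x^2) * (- Cop (%y. c * y * (c * y * phi y)) x) - (2 * al + 2) * x * (- Sop (%y. c * y * phi y) x) - c^2 * x^2 * Cop phi x = Cop g x"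
  "(1 - x^2) * (- Sop (%y. c * y * (c * y * phi y)) x) - (2 * al + 2) * x * (Cop (%y. c * y * phi y) x) - c^2 * x^2 * Sop phi x = Sop g x"
proof -
 let ?A = "%y. c * y * (c * y * phi y)"
 let ?B = "%y. c * y * phi y"
 let ?C = "%y. cos (c * x * y)"
 let ?D = "%y. sin (c * x * y)"
 let ?E = "%y. (c * x) * cos (c * x * y)"
 note cs = slD[OF assms]
 have i: "integrable nu phi" by (rule integrable_cont[OF cs(2)])
 note ii = trig_integrable[OF i] trig_integrable[OF trig_integrable(3)[OF i]]
   trig_integrable[OF trig_integrable(3)[OF trig_integrable(3)[OF i]]]
 have "sl ?C (%y. - (c * x) * sin (c * x * y))
   (%y. (1 - y^2) * (- (c * x) * (?E y)) - (2 * al + 2) * y * (- (c * x) * sin (c * x * y)) - c^2 * y^2 * cos (c * x * y))"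
  by (rule sl_smooth[where phidd = "%y. - (c * x) * (?E y)"])
    (auto intro!: derivative_eq_intros continuous_intros)
 from green[OF assms this]
 have "ip g ?C = (LINT y|nu. (1 - x^2) * (- (cos (c * x * y) * (c * y * (c * y * phi y)))) + (2 * al + 2) * x * (sin (c * x * y) * (c * y * phi y)) - c^2 * x^2 * (cos (c * x * y) * phi y))"
  unfolding ip_def by (simp add: algebra_simps power2_eq_square)
 also have "... = (1 - x^2) * (- Cop ?A x) + (2 * al + 2) * x * (Sop ?B x) - c^2 * x^2 * Cop phi x"
  unfolding Cop_def Sop_def using ii by simp
 also have "ip g ?C = Cop g x" by (simp add: ip_def Cop_def mult.commute)
 finally show "(1 - x^2) * (- Cop ?A x) - (2 * al + 2) * x * (- Sop ?B x) - c^2 * x^2 * Cop phi x = Cop g x"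
  by simp
 have "sl ?D (%y. (c * x) * cos (c * x * y))
   (%y. (1 - y^2) * (- (c * x) * ((c * x) * sin (c * x * y))) - (2 * al + 2) * y * (?E y) - c^2 * y^2 * sin (c * x * y))"
  by (rule sl_smooth[where phidd = "%y. - (c * x) * ((c * x) * sin (c * x * y))"])
    (auto intro!: derivative_eq_intros continuous_intros)
 from green[OF assms this]
 have "ip g ?D = (LINT y|nu. (1 - x^2) * (- (sin (c * x * y) * (c * y * (c * y * phi y)))) - (2 * al + 2) * x * (cos (c * x * y) * (c * y * phi y)) - c^2 * x^2 * (sin (c * x * y) * phi y))"
  unfolding ip_def by (simp add: algebra_simps power2_eq_square)
 also have "... = (1 - x^2) * (- Sop ?A x) - (2 * al + 2) * x * (Cop ?B x) - c^2 * x^2 * Sop phi x"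
  unfolding Cop_def Sop_def using ii by simp
 also have "ip g ?D = Sop g x" by (simp add: ip_def Sop_def mult.commute)
 finally show "(1 - x^2) * (- Sop ?A x) - (2 * al + 2) * x * (Cop ?B x) - c^2 * x^2 * Sop phi x = Sop g x"
  by simp
qed

lemma sl_trig:
 assumes "sl phi phi1 g"
 shows "sl (Cop phi) (%x. - Sop (%y. c * y * phi y) x) (Cop g)" "sl (Sop phi) (%x. Cop (%y. c * y * phi y) x) (Sop g)"
proof -
 have i: "integrable nu phi" by (rule integrable_cont[OF slD(2)[OF assms]])
 note i1 = trig_integrable(3)[OF i]
 note i2 = trig_integrable(3)[OF i1]
 note td = trig_deriv[OF i] trig_deriv[OF i1]
 show "sl (Cop phi) (%x. - Sop (%y. c * y * phi y) x) (Cop g)"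
  by (rule sl_smooth[where phidd = "%x. - Cop (%y. c * y * (c * y * phi y)) x"])
    (use trig_ode[OF assms] td in "auto intro!: continuous_intros trig_cont i2 DERIV_minus intro: has_field_derivative_at_within")
 show "sl (Sop phi) (%x. Cop (%y. c * y * phi y) x) (Sop g)"
  by (rule sl_smooth[where phidd = "%x. - Sop (%y. c * y * (c * y * phi y)) x"])
    (use trig_ode[OF assms] td in "auto intro!: continuous_intros trig_cont i2 DERIV_minus intro: has_field_derivative_at_within")
qed

lemma sl_add: assumes "sl phi phi1 g" "sl phi' phi1' g'"
 shows "sl (%x. phi x + phi' x) (%x. phi1 x + phi1' x) (%x. g x + g' x)"
 unfolding sl_def
proof (intro conjI ballI)
 fix x :: real assume "x : {-1<..<1}"
 from DERIV_add[OF slD(5)[OF assms(1) this] slD(5)[OF assms(2) this]]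
 show "DERIV (%x. (1 - x^2) powr (al + 1) * (phi1 x + phi1' x)) x :> w x * (g x + g' x + c^2 * x^2 * (phi x + phi' x))"
  by (simp add: algebra_simps)
qed (use assms in "auto simp: sl_def intro!: continuous_intros derivative_intros")

lemma sl_cmult: assumes "sl phi phi1 g"
 shows "sl (%x. a * phi x) (%x. a * phi1 x) (%x. a * g x)"
 unfolding sl_def
proof (intro conjI ballI)
 fix x :: real assume "x : {-1<..<1}"
 from DERIV_cmult[OF slD(5)[OF assms(1) this], of a]
 show "DERIV (%x. (1 - x^2) powr (al + 1) * (a * phi1 x)) x :> w x * (a * g x + c^2 * x^2 * (a * phi x))"
  by (simp add: algebra_simps)
qed (use assms in "auto simp: sl_def intro!: continuous_intros DERIV_cmult")

lemma sl_sum: "finite A ==> (!!i. i : A ==> sl (phi i) (phi1 i) (g i)) ==>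
  sl (%x. \<Sum>i\<in>A. phi i x) (%x. \<Sum>i\<in>A. phi1 i x) (%x. \<Sum>i\<in>A. g i x)"
proof (induction A rule: finite_induct)
 case empty
 show ?case by (simp add: sl_def)
next
 case (insert a A)
 show ?case using sl_add[OF insert.prems[of a] insert.IH] insert by simp
qed

lemma sl_reflect: assumes "sl phi phi1 g"
 shows "sl (%x. phi (- x)) (%x. - phi1 (- x)) (%x. g (- x))"
 unfolding sl_def
proof (intro conjI ballI)
 fix x :: real
 { assume x: "x : II"
  have "(phi has_real_derivative phi1 (- x)) (at (- x) within (%x. - x) ` II)" using assms x by (auto simp: sl_def)
  from DERIV_image_chain[OF this DERIV_minus[OF DERIV_ident]]
  show "((%x. phi (- x)) has_real_derivative - phi1 (- x)) (at x within II)"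
   by (auto simp: o_def intro!: derivative_eq_intros) }
 assume x: "x : {-1<..<1}"
 hence "- x : {-1<..<1}" by auto
 from DERIV_minus[OF DERIV_chain2[OF slD(5)[OF assms this] DERIV_minus[OF DERIV_ident]]]
 show "DERIV (%x. (1 - x^2) powr (al + 1) * - phi1 (- x)) x :> w x * (g (- x) + c^2 * x^2 * phi (- x))"
  by (simp add: weight_def)
next
 have "continuous_on {-1..1::real} (%x. f (- x))" if "contI f" for f :: "real => real"
  by (rule continuous_on_compose2[OF that]) (auto intro!: continuous_intros)
 thus "contI (%x. - phi1 (- x))" "contI (%x. g (- x))"
  using slD[OF assms] by (auto intro!: continuous_intros)
qed

text \<open>The divergence form is integrated from x0 to 1, where the flux vanishes. The weight
  contributes (1 - y)^al, whose integral reproduces the factor (1 - x0)^(al + 1) of the flux; after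
  cancellation the bound does not degenerate at the endpoint.\<close>

lemma flux_bound:
 assumes s: "sl phi phi1 g" and x0: "-1 < x0" "x0 < 1" and M: "!!y. x0 <= y ==> y <= 1 ==> (abs (g y + c^2 * y^2 * phi y)) <= M"
 shows "(1 + x0) powr (al + 1) * abs (phi1 x0) <= M * 2 powr al"
proof -
 let ?A = "%y. g y + c^2 * y^2 * phi y"
 let ?B = "%M y. M * 2 powr al * (1 - y) powr al"
 have M0: "M >= 0" using M[of 1] x0 by simp
 define K where "K = M * 2 powr al / (al + 1)"
 define pp where "pp x = (1 - x^2) powr (al + 1) * phi1 x" for x
 have Kd: "DERIV (%y. K * (1 - y) powr (al + 1)) y :> - (?B M y)" if "y < 1" for y
  by (rule DERIV_cong[OF DERIV_cmult[OF DERIV_fun_powr[where m = "-1"]]])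
    (use that alpha0 in "auto intro!: derivative_eq_intros simp: K_def")
 have rhs: "abs (w y * (?A y)) <= M * 2 powr al * (1 - y) powr al" if y: "x0 < y" "y < 1" for y
 proof -
  have "w y = ((1 + y) * (1 - y)) powr al" by (simp add: weight_def power2_eq_square algebra_simps)
  also have "... = (1 + y) powr al * (1 - y) powr al" by (rule powr_mult)
  also have "... <= 2 powr al * (1 - y) powr al"
   using y x0 alpha0 by (intro mult_right_mono powr_mono2) auto
  finally have "w y * abs (?A y) <= (2 powr al * (1 - y) powr al) * M"
   using M[of y] y by (intro mult_mono) (auto simp: w_nonneg)
  thus ?thesis by (simp add: abs_mult w_nonneg mult_ac)
 qed
 have cpp: "continuous_on {x0..1} pp" unfolding pp_def
  using x0 by (intro continuous_on_mult contp continuous_on_subset[OF slD(3)[OF s]]) auto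
 have cK: "continuous_on {x0..1} (%y. K * (1 - y) powr (al + 1))"
  using alpha0 by (intro continuous_intros continuous_on_powr') auto
 have dpp: "DERIV pp y :> w y * (?A y)" if "x0 < y" "y < 1" for y
  using slD(5)[OF s, of y] that x0 by (simp add: pp_def[abs_def])
 have rhs1: "w y * (?A y) <= M * 2 powr al * (1 - y) powr al" "- (?B M y) <= w y * (?A y)"
  if "x0 < y" "y < 1" for y using rhs[OF that] by (simp_all only: abs_le_iff) linarith
 have "pp x0 - K * (1 - x0) powr (al + 1) <= pp 1 - K * (1 - 1) powr (al + 1)"
 proof (rule nondecreasing_from_deriv[where f = "%y. pp y - K * (1 - y) powr (al + 1)" and f' = "%y. w y * (?A y) - (- (?B M y))"])
  fix y assume y: "x0 < y" "y < 1"
  show "DERIV (%y. pp y - K * (1 - y) powr (al + 1)) y :> w y * (?A y) - (- (?B M y))"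
   by (rule DERIV_diff[OF dpp[OF y] Kd[OF y(2)]])
  show "0 <= w y * (?A y) - (- (?B M y))" using rhs1[OF y] by linarith
 qed (use x0 in "auto intro!: continuous_on_diff cpp cK")
 moreover have "pp 1 + K * (1 - 1) powr (al + 1) <= pp x0 + K * (1 - x0) powr (al + 1)"
 proof (rule nonincreasing_from_deriv[where f = "%y. pp y + K * (1 - y) powr (al + 1)" and f' = "%y. w y * (?A y) + (- (?B M y))"])
  fix y assume y: "x0 < y" "y < 1"
  show "DERIV (%y. pp y + K * (1 - y) powr (al + 1)) y :> w y * (?A y) + (- (?B M y))"
   by (rule DERIV_add[OF dpp[OF y] Kd[OF y(2)]])
  show "w y * (?A y) + (- (?B M y)) <= 0" using rhs1[OF y] by linarith
 qed (use x0 in "auto intro!: continuous_on_add cpp cK")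
 moreover have "pp 1 = 0" by (simp add: pp_def)
 ultimately have b: "abs (pp x0) <= K * (1 - x0) powr (al + 1)" by simp
 have K: "K <= M * 2 powr al"
 proof -
  have "M * 2 powr al / (al + 1) <= M * 2 powr al / 1" using M0 alpha0 by (intro divide_left_mono) auto
  thus ?thesis by (simp add: K_def)
 qed
 have "(1 - x0) powr (al + 1) * ((1 + x0) powr (al + 1) * abs (phi1 x0)) = abs (pp x0)"
 proof -
  have "1 - x0^2 = (1 - x0) * (1 + x0)" by (simp add: power2_eq_square algebra_simps)
  thus ?thesis by (simp add: pp_def abs_mult powr_mult)
 qed
 also have "... <= (1 - x0) powr (al + 1) * (M * 2 powr al)"
  using order_trans[OF b mult_right_mono[OF K powr_ge_zero]] by (simp add: mult.commute)
 finally show ?thesis using x0 by simp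
qed

text \<open>A Volterra argument from the singular endpoint: by \<open>flux_bound\<close> the
  derivative is controlled by phi to the right, so phi 1 = 0 determines the solution. In the norm
  with weight exp(- l (1 - x)) the estimate gains a factor 1/2 on [a, 1] for every a > -1. The point
  -1 follows by continuity.\<close>

lemma sl_unique:
 assumes s: "sl phi phi1 (%x. - ka * phi x)" and z: "phi 1 = 0" and x: "x : II"
 shows "phi x = 0"
proof -
 let ?A = "%Ga N l z. Ga * N * exp (l * (1 - z))"
 let ?B = "%l x0. - l * (1 - x0)"
 note cs = slD[OF s]
 have main: "phi y = 0" if a: "-1 < a" "a < 1" and y: "a <= y" "y <= 1" for a y
 proof -
  define Lam where "Lam = abs ka + c^2"
  define Ga where "Ga = Lam * 2 powr al / (1 + a) powr (al + 1)"
  define l where "l = 2 * Ga + 1"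
  have G0: "Lam >= 0" "Ga >= 0" by (auto simp: Lam_def Ga_def)
  have "l > 0" "Ga / l <= 1/2" using G0 by (auto simp: l_def divide_le_eq)
  note L0 = G0 this
  have "EX x0:{a..1}. ALL z:{a..1}. exp (?B l z) * abs (phi z) <= exp (?B l x0) * abs (phi x0)"
   using a cs(2) by (intro continuous_attains_sup continuous_intros) (auto intro: continuous_on_subset)
  then obtain x0 where x0: "a <= x0" "x0 <= 1" and max: "!!z. a <= z ==> z <= 1 ==> exp (?B l z) * abs (phi z) <= exp (?B l x0) * abs (phi x0)"
   by auto
  define N where "N = exp (?B l x0) * abs (phi x0)"
  have N0: "N >= 0" by (simp add: N_def)
  have bd: "abs (phi z) <= N * exp (l * (1 - z))" if "a <= z" "z <= 1" for z
  proof -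
   have "exp (l * (1 - z)) * (exp (?B l z) * abs (phi z)) <= exp (l * (1 - z)) * N"
    using max[OF that] by (intro mult_left_mono) (auto simp: N_def)
   moreover have "exp (l * (1 - z)) * exp (?B l z) = 1" by (simp flip: exp_add)
   hence "exp (l * (1 - z)) * (exp (?B l z) * abs (phi z)) = abs (phi z)"
    by (simp only: mult.assoc[symmetric] mult_1_left)
   ultimately show ?thesis by (simp only: mult.commute)
  qed
  have d1: "abs (phi1 z) <= Ga * N * exp (l * (1 - z))" if z: "a <= z" "z < 1" for z
  proof -
   have "(1 + z) powr (al + 1) * abs (phi1 z) <= (Lam * (N * exp (l * (1 - z)))) * 2 powr al"
   proof (rule flux_bound[OF s])
    fix t assume t: "z <= t" "t <= 1"
    have "t^2 <= 1" using t z a by (simp add: abs_square_le_1 abs_le_iff)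
    hence "abs (- ka + c^2 * t^2) <= Lam" unfolding Lam_def
     by (intro order_trans[OF abs_triangle_ineq] add_mono) (auto simp: mult_left_le)
    moreover have "abs (phi t) <= N * exp (l * (1 - z))"
     using order_trans[OF bd[of t] mult_left_mono[OF _ N0, of "exp (l * (1 - t))"]] t z L0 by auto
    ultimately have "abs (- ka + c^2 * t^2) * abs (phi t) <= Lam * (N * exp (l * (1 - z)))" using L0 by (intro mult_mono) auto
    moreover have "- ka * phi t + c^2 * t^2 * phi t = (- ka + c^2 * t^2) * phi t" by (simp add: algebra_simps)
    ultimately show "abs (- ka * phi t + c^2 * t^2 * phi t) <= Lam * (N * exp (l * (1 - z)))"
     by (simp only: abs_mult)
   qed (use a z in auto)
   moreover have "(1 + a) powr (al + 1) * abs (phi1 z) <= (1 + z) powr (al + 1) * abs (phi1 z)"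
    using a z alpha0 by (intro mult_right_mono powr_mono2) auto
   ultimately have "(1 + a) powr (al + 1) * abs (phi1 z) <= (Lam * (N * exp (l * (1 - z)))) * 2 powr al" by linarith
   thus ?thesis using a by (simp add: Ga_def field_simps)
  qed
  define E where "E z = Ga * N / l * (exp (l * (1 - z)) - 1)" for z
  have dE: "DERIV E z :> - (?A Ga N l z)" for z
   unfolding E_def[abs_def] using L0 by (auto intro!: derivative_eq_intros)
  have cE: "continuous_on S E" for S unfolding E_def[abs_def] by (intro continuous_intros)
  have cphi: "continuous_on {x0..1} phi" using cs(2) a x0 by (auto intro: continuous_on_subset)
  have d2: "phi1 z <= Ga * N * exp (l * (1 - z))" "- (?A Ga N l z) <= phi1 z" if "x0 < z" "z < 1" for z
  proof -
   have "abs (phi1 z) <= Ga * N * exp (l * (1 - z))" by (rule d1) (use that x0 in auto)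
   thus "phi1 z <= Ga * N * exp (l * (1 - z))" "- (?A Ga N l z) <= phi1 z" by linarith+
  qed
  have "phi x0 - E x0 <= phi 1 - E 1"
  proof (rule nondecreasing_from_deriv[where f = "%z. phi z - E z" and f' = "%z. phi1 z - (- (?A Ga N l z))"])
   fix z assume z: "x0 < z" "z < 1"
   show "DERIV (%z. phi z - E z) z :> phi1 z - (- (?A Ga N l z))"
    by (rule DERIV_diff[OF cs(1) dE]) (use z x0 a in auto)
   show "0 <= phi1 z - (- (?A Ga N l z))" using d2[OF z] by linarith
  qed (use x0 in "auto intro!: continuous_on_diff cphi cE")
  moreover have "phi 1 + E 1 <= phi x0 + E x0"
  proof (rule nonincreasing_from_deriv[where f = "%z. phi z + E z" and f' = "%z. phi1 z + (- (?A Ga N l z))"])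
   fix z assume z: "x0 < z" "z < 1"
   show "DERIV (%z. phi z + E z) z :> phi1 z + (- (?A Ga N l z))"
    by (rule DERIV_add[OF cs(1) dE]) (use z x0 a in auto)
   show "phi1 z + (- (?A Ga N l z)) <= 0" using d2[OF z] by linarith
  qed (use x0 in "auto intro!: continuous_on_add cphi cE")
  moreover have "E 1 = 0" by (simp add: E_def)
  ultimately have "abs (phi x0) <= E x0" using z by simp
  also have "... <= Ga * N / l * exp (l * (1 - x0))" unfolding E_def using L0 N0 by (intro mult_left_mono) auto
  finally have "exp (?B l x0) * abs (phi x0) <= exp (?B l x0) * (Ga * N / l * exp (l * (1 - x0)))"
   by (intro mult_left_mono) auto
  also have "... = Ga / l * N"
  proof -
   have "exp (?B l x0) * exp (l * (1 - x0)) = 1" by (simp flip: exp_add)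
   thus ?thesis by simp
  qed
  also have "... <= 1/2 * N" using L0 N0 by (intro mult_right_mono) auto
  finally have "N <= 1/2 * N" unfolding N_def .
  hence "N = 0" using N0 by simp
  thus ?thesis using bd[OF y] by simp
 qed
 show ?thesis
 proof (cases "x = -1")
  case False
  thus ?thesis using main[of "(x - 1) / 2" x] x main[of "0" x] by (cases "x = 1") (auto simp: z field_simps)
 next
  case True
  have "((%y. phi y) ---> phi (-1)) (at (-1) within II)"
   using cs(2) by (simp add: continuous_on_def)
  hence "(phi ---> phi (-1)) (at_right (-1))" by (simp add: at_within_Icc_at_right)
  moreover have "(phi ---> 0) (at_right (-1))"
  proof (rule tendsto_eventually)
   show "\<forall>\<^sub>F y in at_right (-1). phi y = 0"
    using eventually_at_right_real[of "-1" 1]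
    by (rule eventually_mono) (auto simp: field_simps intro!: main[of "(y - 1) / 2" y for y])
  qed
  ultimately show ?thesis using True tendsto_unique[OF trivial_limit_at_right_real] by blast
 qed
qed

end

lemma (in pf) sl_of_eigenpair:
 assumes "prolate_eigenpair al c ka phi"
 shows "sl phi (deriv_I phi) (%x. - ka * phi x)"
proof (rule sl_smooth[where phidd = "deriv_I (deriv_I phi)"])
 have C: "C2_I phi" and e: "!!x. x : II ==> - prolate_op al c phi x = ka * phi x"
  using assms by (auto simp: prolate_eigenpair_def)
 { fix x :: real assume x: "x : II"
  show "(phi has_real_derivative deriv_I phi x) (at x within II)"
   "(deriv_I phi has_real_derivative deriv_I (deriv_I phi) x) (at x within II)"
   using C x unfolding C2_I_def has_real_derivative_iff_has_vector_derivative
   by (auto simp: differentiable_on_def deriv_I_def[abs_def] vector_derivative_works)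
  show "- ka * phi x = (1 - x^2) * deriv_I (deriv_I phi) x - (2 * al + 2) * x * deriv_I phi x - c^2 * x^2 * phi x"
   using e[OF x] by (simp add: prolate_op_def) }
 show "contI (deriv_I (deriv_I phi))" using C by (simp add: C2_I_def)
qed

text \<open>The clause that \<open>ev\<close> lists all eigenvalues speaks about one-sided
  derivatives on [-1, 1]. This lemma brings solutions that are smooth on the whole line into that
  form.\<close>

lemma (in pf) eigenpair_of_smooth:
 assumes d1: "!!x. (DERIV phi x :> phi1 x)" and d2: "!!x. (DERIV phi1 x :> phidd x)"
  and c2: "contI phidd" and nz: "x0 : II" "phi x0 ~= 0"
  and e: "!!x. x : II ==> (1 - x^2) * phidd x - (2 * al + 2) * x * phi1 x - c^2 * x^2 * phi x = - ka * phi x"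
 shows "prolate_eigenpair al c ka phi"
proof -
 have I: "vector_derivative f (at x within II) = D"
  if "x : II" "(f has_real_derivative D) (at x within II)" for f :: "real => real" and D x
  using that vector_derivative_within_cbox[of "-1" "1::real" x f D] by (simp add: has_real_derivative_iff_has_vector_derivative)
 have D1: "deriv_I phi x = phi1 x" if "x : II" for x
  unfolding deriv_I_def using I[OF that] d1 has_field_derivative_at_within by blast
 have d2': "(deriv_I phi has_real_derivative phidd x) (at x within II)" if x: "x : II" for x
  by (rule has_field_derivative_transform_within[OF has_field_derivative_at_within[OF d2], of 1]) (use x D1 in auto)
 have D2: "deriv_I (deriv_I phi) x = phidd x" if "x : II" for x
  unfolding deriv_I_def[of "deriv_I phi"] using I[OF that d2'[OF that]] .
 show ?thesis unfolding prolate_eigenpair_def C2_I_def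
 proof (intro conjI ballI)
  show "phi differentiable_on II" "deriv_I phi differentiable_on II"
   unfolding differentiable_on_def using d1 d2'
   by (meson field_differentiable_imp_differentiable field_differentiable_def has_field_derivative_at_within)+
  show "contI (deriv_I (deriv_I phi))" by (rule continuous_on_eq[OF c2]) (simp add: D2)
  show "EX x:II. phi x ~= 0" using nz by blast
  fix x :: real assume x: "x : II"
  show "- prolate_op al c phi x = ka * phi x" unfolding prolate_op_def using e[OF x] by (simp add: D1[OF x] D2[OF x])
 qed
qed

section \<open>Symmetry, positivity and injectivity of the integral operators\<close>

context pf begin

lemma pair_nu: "pair_sigma_finite nu nu" by (intro pair_sigma_finite.intro sigma_finite_measure_axioms)

lemma trig_kernel_integrable:
 assumes f: "integrable nu f" and g: "integrable nu g"
  and k: "(%(x, y). k x y) : borel_measurable (nu \<Otimes>\<^sub>M nu)" "!!x y. x : II ==> y : II ==> (abs (k x y)) <= B"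
 shows "integrable (nu \<Otimes>\<^sub>M nu) (%(x, y). k x y * f x * g y :: real)"
proof -
 let ?A = "nu \<Otimes>\<^sub>M nu"
 interpret pair_sigma_finite nu nu by (rule pair_nu)
 have i: "integrable ?A (%(x, y). f x * g y)"
  by (rule Fubini_integrable) (use f g in "auto simp: abs_mult")
 have m: "(%x. f (fst x)) : borel_measurable ?A" "(%x. g (snd x)) : borel_measurable ?A"
  using f g by (auto intro!: measurable_compose[OF measurable_fst] measurable_compose[OF measurable_snd])
 have B0: "B >= 0" using k(2)[of 0 0] by force
 show ?thesis
  by (rule integrable_dominated[OF integrable_mult_right[OF i, of B]])
    (use k m B0 in "auto intro!: AE_I2 mult_right_mono simp: space_pair_measure space_nu abs_mult split_beta' mult.assoc")
qed

lemma cont2_meas: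
 assumes "continuous_on UNIV (%p :: real \<times> real. k (fst p) (snd p) :: real)"
 shows "(%(x, y). k x y) : borel_measurable (nu \<Otimes>\<^sub>M nu)"
proof -
 have "(%p. k (fst p) (snd p)) : borel_measurable (borel :: (real \<times> real) measure)" using assms by (rule borel_measurable_continuous_onI)
 moreover have "(%p. p) : (nu \<Otimes>\<^sub>M nu) \<rightarrow>\<^sub>M (borel :: (real \<times> real) measure)"
  unfolding borel_prod[symmetric]
  by (rule measurable_pair) (auto intro!: measurable_compose[OF measurable_fst] measurable_compose[OF measurable_snd] cont_meas continuous_intros simp: o_def)
 ultimately show ?thesis by (auto simp: split_beta' intro: measurable_compose)
qed

lemma Cop_sym: assumes f: "integrable nu f" and g: "integrable nu g"
 shows "(LINT x|nu. Cop f x * g x) = (LINT x|nu. f x * Cop g x)" "(LINT x|nu. Sop f x * g x) = (LINT x|nu. f x * Sop g x)"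
proof -
 interpret pair_sigma_finite nu nu by (rule pair_nu)
 have *: "(LINT x|nu. (LINT y|nu. k (c * x * y) * f y) * g x) = (LINT x|nu. f x * (LINT y|nu. k (c * x * y) * g y))"
  if k: "continuous_on UNIV k" "!!x. (abs (k x)) <= 1" for k :: "real => real"
 proof -
  have "integrable (nu \<Otimes>\<^sub>M nu) (%(x, y). k (c * x * y) * f x * g y)"
   by (rule trig_kernel_integrable[OF f g cont2_meas, where B = 1])
     (auto intro!: k(2) continuous_on_compose2[OF k(1)] continuous_intros)
  from Fubini_integral[OF this]
  have "(LINT y|nu. (LINT x|nu. k (c * x * y) * f x * g y)) = (LINT x|nu. (LINT y|nu. k (c * x * y) * f x * g y))" by simp
  moreover have "(LINT x|nu. k (c * x * y) * f x * g y) = (LINT x|nu. k (c * y * x) * f x) * g y" for y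
   unfolding Bochner_Integration.integral_mult_left_zero by (simp only: mult.assoc mult.commute[of y])
  moreover have "(LINT y|nu. k (c * x * y) * f x * g y) = f x * (LINT y|nu. k (c * x * y) * g y)" for x
  proof -
   have "(%y. k (c * x * y) * f x * g y) = (%y. f x * (k (c * x * y) * g y))" by (auto simp: mult_ac)
   thus ?thesis by (simp only: Bochner_Integration.integral_mult_right_zero)
  qed
  ultimately show ?thesis by (simp only:)
 qed
 show "(LINT x|nu. Cop f x * g x) = (LINT x|nu. f x * Cop g x)"
  using *[of cos] by (simp add: Cop_def continuous_on_cos)
 show "(LINT x|nu. Sop f x * g x) = (LINT x|nu. f x * Sop g x)"
  using *[of sin] by (simp add: Sop_def continuous_on_sin)
qed

lemma ip_Cop: "l2 f ==> l2 g ==> ip (Cop f) g = ip f (Cop g)" "l2 f ==> l2 g ==> ip (Sop f) g = ip f (Sop g)"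
 using Cop_sym[OF l2_integrable l2_integrable] by (auto simp: ip_def)

lemma l2_trig: "l2 h ==> l2 (Cop h)" "l2 h ==> l2 (Sop h)"
 by (auto intro!: l2_cont trig_cont l2_integrable)

text \<open>The real form of F* F: mixed products of \<open>Cop\<close> and \<open>Sop\<close>
  integrate an odd function of the middle variable and vanish.\<close>

definition Top :: "(real => real) => real => real" where "Top h x = Cop (Cop h) x + Sop (Sop h) x"

lemma Top_l2: "l2 h ==> l2 (Top h)" unfolding Top_def[abs_def] by (intro l2_add l2_trig)

lemma ip_Top: assumes "l2 f" "l2 g" shows "ip (Top f) g = ip (Cop f) (Cop g) + ip (Sop f) (Sop g)"
 unfolding Top_def[abs_def] using assms by (simp add: ip_add l2_trig ip_Cop)

lemma ip_Top_sym: assumes "l2 f" "l2 g" shows "ip (Top f) g = ip f (Top g)"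
 using ip_Top[OF assms] ip_Top[OF assms(2,1)] by (simp add: ip_sym)

lemma Cop_add: "integrable nu f ==> integrable nu g ==> Cop (%x. f x + g x) = (%x. Cop f x + Cop g x)"
 "integrable nu f ==> integrable nu g ==> Sop (%x. f x + g x) = (%x. Sop f x + Sop g x)"
 unfolding Cop_def Sop_def distrib_left using trig_integrable by (auto intro!: ext Bochner_Integration.integral_add)
lemma Cop_diff: "integrable nu f ==> integrable nu g ==> Cop (%x. f x - g x) = (%x. Cop f x - Cop g x)"
 "integrable nu f ==> integrable nu g ==> Sop (%x. f x - g x) = (%x. Sop f x - Sop g x)"
 unfolding Cop_def Sop_def right_diff_distrib using trig_integrable by (auto intro!: ext Bochner_Integration.integral_diff)
lemma Cop_cmult: "Cop (%x. a * f x) = (%x. a * Cop f x)" "Sop (%x. a * f x) = (%x. a * Sop f x)"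
proof -
 have "(LINT y|nu. k y * (a * f y)) = a * (LINT y|nu. k y * f y)" for k
  by (subst integral_mult_right_zero[symmetric]) (simp add: mult.left_commute)
 thus "Cop (%x. a * f x) = (%x. a * Cop f x)" "Sop (%x. a * f x) = (%x. a * Sop f x)" by (auto simp: Cop_def Sop_def)
qed
lemma Cop_cong: "(!!y. y : II ==> f y = g y) ==> Cop f = Cop g" "(!!y. y : II ==> f y = g y) ==> Sop f = Sop g"
 unfolding Cop_def Sop_def by (auto intro!: ext integral_eqI simp: space_nu)
lemma Top_add: "l2 f ==> l2 g ==> Top (%x. f x + g x) = (%x. Top f x + Top g x)"
 unfolding Top_def[abs_def] by (auto simp: Cop_add l2_integrable l2_trig)
lemma Top_diff: "l2 f ==> l2 g ==> Top (%x. f x - g x) = (%x. Top f x - Top g x)"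
 unfolding Top_def[abs_def] by (auto simp: Cop_diff l2_integrable l2_trig)
lemma Top_cmult: "Top (%x. a * f x) = (%x. a * Top f x)"
 unfolding Top_def[abs_def] by (simp add: Cop_cmult distrib_left)
lemma Top_cong: "(!!y. y : II ==> f y = g y) ==> Top f = Top g"
 unfolding Top_def[abs_def] using Cop_cong[of f g] by simp

lemma Cop_bound_nrm: assumes "l2 h" shows "abs (Cop h x) <= 2 * nrm h" "abs (Sop h x) <= 2 * nrm h"
proof -
 let ?A = "%y. (abs (h y))"
 have "(LINT y|nu. (abs (h y))) = ip ?A (%_. 1)" by (simp add: ip_def)
 also have "... <= nrm ?A * nrm (%_. 1)"
 proof -
  have "l2 ?A" using assms by (auto simp: l2_def)
  thus ?thesis using cs_abs[of "%y. (abs (h y))" "%_. 1"] l2_cont[of "%_. 1"] by simp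
 qed
 also have "nrm ?A = nrm h" by (simp add: nrm_def ip_def flip: power2_eq_square)
 also have "nrm h * nrm (%_. 1) <= nrm h * 2"
 proof (intro mult_left_mono nrm_nonneg)
  have "ip (%_. 1) (%_. 1) <= 4" using measure_nu by (simp add: ip_def)
  hence "sqrt (ip (%_. 1) (%_. 1)) <= sqrt 4" by (rule real_sqrt_le_mono)
  thus "nrm (%_. 1) <= 2" by (simp add: nrm_def)
 qed
 finally have "(LINT y|nu. (abs (h y))) <= 2 * nrm h" by simp
 thus "abs (Cop h x) <= 2 * nrm h" "abs (Sop h x) <= 2 * nrm h"
  using trig_bound[OF l2_integrable[OF assms], of x] by linarith+
qed

lemma nrm_const: "(!!x. x : II ==> (abs (h x)) <= B) ==> l2 h ==> B >= 0 ==> nrm h <= 2 * B"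
proof -
 assume h: "!!x. x : II ==> (abs (h x)) <= B" "l2 h" "B >= 0"
 have "ip h h <= (LINT x|nu. B^2)" unfolding ip_def
 proof (rule integral_mono)
  fix x assume "x : space nu"
  hence "(abs (h x))^2 <= B^2" using h by (intro power_mono) (auto simp: space_nu)
  thus "h x * h x <= B^2" by (simp add: power2_eq_square)
 qed (use h l2_mult in auto)
 also have "... = measure nu (space nu) * B^2" by simp
 also have "... <= 2 * B^2" using measure_nu by (intro mult_right_mono) auto
 also have "... <= (2 * B)^2" by (simp add: power_mult_distrib)
 finally have "(nrm h)^2 <= (2 * B)^2" by (simp add: nrm_sq)
 thus "nrm h <= 2 * B" using h(3) by (intro power2_le_imp_le[of "nrm h" "2 * B"]) auto
qed

lemma nrm_trig: assumes "l2 h" shows "nrm (Cop h) <= 4 * nrm h" "nrm (Sop h) <= 4 * nrm h"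
 using nrm_const[of "Cop h" "2 * nrm h"] nrm_const[of "Sop h" "2 * nrm h"] Cop_bound_nrm[OF assms] l2_trig[OF assms] nrm_nonneg[of h] by auto

lemma Top_bound: assumes "l2 h" shows "abs (Top h x) <= 16 * nrm h"
 unfolding Top_def using Cop_bound_nrm[OF l2_trig(1)[OF assms], of x] Cop_bound_nrm[OF l2_trig(2)[OF assms], of x] nrm_trig[OF assms] by linarith

text \<open>Differentiating the vanishing transforms shows that y^n h has vanishing transforms as
  well. At x = 0 this says that all moments of h vanish, and polynomial approximation makes its norm
  0.\<close>

lemma Cop_injective:
 assumes h: "contI h" and z: "!!x. x : II ==> Cop h x = 0" "!!x. x : II ==> Sop h x = 0"
  and x: "x : II"
 shows "h x = 0"
proof -
 let ?A = "LINT y|nu. (h y)^2"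
 have mom: "(ALL x:II. Cop (%y. y ^ n * h y) x = 0) & (ALL x:II. Sop (%y. y ^ n * h y) x = 0)" for n
 proof (induction n)
  case 0
  show ?case using z by simp
 next
  case (Suc n)
  have i: "integrable nu (%y. y ^ n * h y)" by (intro integrable_cont continuous_intros h)
  have e: "(%y. c * y * (y ^ n * h y)) = (%y. c * (y ^ Suc n * h y))" by (simp add: mult_ac)
  have int: "c * Sop (%y. y ^ Suc n * h y) x = 0 & c * Cop (%y. y ^ Suc n * h y) x = 0" if x: "x : {-1<..<1}" for x
  proof -
   have zd: "D = 0" if "DERIV F x :> D" "!!x. x : II ==> F x = 0" for F :: "real => real" and D
   proof -
    have "DERIV (%_. 0) x :> D"
     by (rule has_field_derivative_transform_within_open[OF that(1), of "{-1<..<1}"]) (use x that(2) in auto)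
    thus ?thesis using DERIV_unique[OF _ DERIV_const] by blast
   qed
   show ?thesis using zd[OF trig_deriv(1)[OF i, unfolded e Cop_cmult]] zd[OF trig_deriv(2)[OF i, unfolded e Cop_cmult]] Suc.IH by simp
  qed
  have ext: "F x = 0" if F: "contI F" "!!x. x : {-1<..<1} ==> F x = 0" and x: "x : II" for F :: "real => real" and x
   using continuous_constant_on_closure[of "{-1<..<1::real}" F 0 x] F x by simp
  have i': "integrable nu (%y. y ^ Suc n * h y)" by (intro integrable_cont continuous_intros h)
  show ?case using int c0 ext[OF trig_cont(1)[OF i']] ext[OF trig_cont(2)[OF i']] by auto
 qed
 have m0: "(LINT y|nu. y ^ n * h y) = 0" for n using mom[of n] by (auto simp: Cop_def dest: bspec[of _ _ 0])
 have poly: "(LINT y|nu. poly p y * h y) = 0" for p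
 proof -
  have "(LINT y|nu. poly p y * h y) = (LINT y|nu. (\<Sum>i\<le>degree p. coeff p i * (y ^ i * h y)))"
   by (simp add: poly_altdef sum_distrib_right mult.assoc)
  also have "... = (\<Sum>i\<le>degree p. (LINT y|nu. coeff p i * (y ^ i * h y)))"
   by (intro Bochner_Integration.integral_sum integrable_cont continuous_intros h)
  also have "... = 0" by (simp add: m0)
  finally show ?thesis .
 qed
 have "?A <= 0"
 proof (rule field_le_epsilon)
  fix e :: real assume e: "e > 0"
  obtain B where B: "!!x. x : II ==> (abs (h x)) <= B" "B >= 0" using cont_bdd[OF h] by blast
  define d where "d = e / (2 * (B + 1))"
  have d: "d > 0" using e B by (simp add: d_def)
  obtain g where g: "real_polynomial_function g" "!!x. x : II ==> (abs (h x - g x)) < d"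
   using Stone_Weierstrass_real_polynomial_function[OF compact_Icc h d] by blast
  obtain a n where gp: "g = (%x. \<Sum>i\<le>n. a i * x ^ i)" using real_polynomial_function_iff_sum g(1) by blast
  have gz: "(LINT y|nu. g y * h y) = 0"
  proof -
   have "(LINT y|nu. g y * h y) = (LINT y|nu. (\<Sum>i\<le>n. a i * (y ^ i * h y)))" by (simp add: gp sum_distrib_right mult.assoc)
   also have "... = (\<Sum>i\<le>n. (LINT y|nu. a i * (y ^ i * h y)))" by (intro Bochner_Integration.integral_sum integrable_cont continuous_intros h)
   finally show ?thesis by (simp add: m0)
  qed
  have gc: "contI g" unfolding gp by (intro continuous_intros)
  have "?A = (LINT y|nu. (h y - g y) * h y)"
   using gz by (simp add: left_diff_distrib power2_eq_square Bochner_Integration.integral_diff integrable_cont continuous_intros h gc)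
  also have "... <= (LINT y|nu. d * B)"
  proof (rule integral_mono)
   fix y assume "y : space nu"
   hence y: "y : II" by (simp add: space_nu)
   have "(h y - g y) * h y <= abs (h y - g y) * abs (h y)" by (simp add: abs_mult[symmetric])
   also have "... <= d * B" using g(2)[OF y] B(1)[OF y] d by (intro mult_mono) auto
   finally show "(h y - g y) * h y <= d * B" .
  qed (auto intro!: integrable_cont continuous_intros h gc)
  also have "... = measure nu (space nu) * (d * B)" by simp
  also have "... <= 2 * (d * B)" using measure_nu d B by (intro mult_right_mono) auto
  also have "... <= 2 * (d * (B + 1))" using d by (intro mult_left_mono) auto
  also have "... = e" using B by (simp add: d_def field_simps)
  finally show "?A <= 0 + e" by simp
 qed
 hence "?A = 0" by (simp add: antisym)
 from integral_pos_of_cont[OF _ _ this x] show ?thesis using h by (auto intro!: continuous_intros)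
qed

end

section \<open>The eigenfunctions\<close>

context wt begin

lemma set_integral_nu:
 fixes f :: "real => 'b::{banach, second_countable_topology}"
 assumes "f : borel_measurable nu"
 shows "(LINT x:II|leb. w x *\<^sub>R f x) = (LINT x|nu. f x)"
 unfolding nu_integral(1)[OF assms] set_lebesgue_integral_def
 by (subst integral_restrict_space) auto

end

context pf begin

text \<open>Integration by parts, with boundary terms killed by (1 - x^2)^(al + 1). This quadratic
  form gives the sign of the eigenvalues and is the link to the min-max argument.\<close>

lemma energy:
 assumes s: "sl phi phi1 g"
 shows "- ip g phi = (LINT x|nu. (1 - x^2) * (phi1 x)^2) + c^2 * (LINT x|nu. x^2 * (phi x)^2)"
proof -
 let ?A = "%x. (1 - x^2) powr (al + 1) * phi1 x"
 let ?B = "%x. g x + c^2 * x^2 * phi x"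
 note cs = slD[OF s]
 have "(LINT x|nu. (?B x) * phi x + (1 - x^2) * (phi1 x)^2) =
   (?A 1) * phi 1 - (?A (-1)) * phi (-1)"
 proof (rule wt_ftc[where G = "%x. (?A x) * phi x"])
  fix y :: real assume y: "y : {-1<..<1}"
  have "w y * (?B y) * phi y + phi1 y * (?A y)
    = w y * ((?B y) * phi y + (1 - y^2) * (phi1 y)^2)"
   unfolding p_eq[OF y] by (simp add: power2_eq_square algebra_simps)
  thus "((%x. (?A x) * phi x) has_real_derivative
     w y * ((?B y) * phi y + (1 - y^2) * (phi1 y)^2)) (at y)"
   by (rule DERIV_cong[OF DERIV_mult[OF cs(5)[OF y] cs(1)[OF y]]])
 qed (intro continuous_intros cs(2,3,4) contp order_refl)+
 moreover have "(%x. (?B x) * phi x + (1 - x^2) * (phi1 x)^2) =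
   (%x. g x * phi x + (c^2 * (x^2 * (phi x)^2) + (1 - x^2) * (phi1 x)^2))"
  by (auto simp: power2_eq_square algebra_simps)
 moreover have "integrable nu (%x. g x * phi x)" "integrable nu (%x. x^2 * (phi x)^2)" "integrable nu (%x. (1 - x^2) * (phi1 x)^2)"
  by (intro integrable_cont continuous_intros cs(2,3,4))+
 ultimately show ?thesis unfolding ip_def by simp
qed

end

locale gp = pf +
 fixes ev :: "nat => real" and psi :: "nat => real => real"
 assumes sys: "gpswf_system al c ev psi"
begin

lemma ev_mono: "m < n ==> ev m < ev n" "m <= n ==> ev m <= ev n"
 using sys by (auto simp: gpswf_system_def strict_mono_def strict_mono_less_eq)

lemma sl_psi: "sl (psi n) (deriv_I (psi n)) (%x. - ev n * psi n x)"
 using sys sl_of_eigenpair by (auto simp: gpswf_system_def)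

lemma ev_complete: "prolate_eigenpair al c ka phi ==> ka : range ev"
 using sys by (auto simp: gpswf_system_def)

lemma psi_cont: "contI (psi n)" by (rule slD(2)[OF sl_psi])
lemma psi_l2: "l2 (psi n)" by (rule l2_cont[OF psi_cont])
lemma psi_int: "integrable nu (psi n)" by (rule integrable_cont[OF psi_cont])

lemma psi_orthonormal: "ip (psi m) (psi n) = (if m = n then 1 else 0)"
proof (cases "m = n")
 case True
 have "(LINT x:II|leb. w x *\<^sub>R ((psi n x)^2)) = 1"
  using sys by (simp add: gpswf_system_def mult.commute)
 moreover have "(%x. (psi n x)^2) : borel_measurable nu" by (intro cont_meas continuous_intros psi_cont)
 ultimately show ?thesis using True set_integral_nu[of "%x. (psi n x)^2"] by (simp add: ip_def power2_eq_square)
next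
 case False
 have "- ev m * ip (psi m) (psi n) = - ev n * ip (psi m) (psi n)"
  using green[OF sl_psi sl_psi, of m n] by (simp only: ip_cmult ip_cmult2)
 moreover have "ev m ~= ev n" using False ev_mono(1)[of m n] ev_mono(1)[of n m] by (cases m n rule: linorder_cases) auto
 ultimately show ?thesis using False by simp
qed

lemma psi_nz: "EX x:II. psi n x ~= 0"
 using sys by (auto simp: gpswf_system_def prolate_eigenpair_def)

lemma psi1: "psi n 1 ~= 0" using sl_unique[OF sl_psi, of n] psi_nz by blast

text \<open>The difference from the multiple of \<open>psi n\<close> with the same value at 1
  vanishes at 1, so \<open>sl_unique\<close> makes it zero: eigenspaces are one-dimensional.\<close>

lemma sl_proportional:
 assumes s: "sl phi phi1 (%x. - ev n * phi x)" and x: "x : II"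
 shows "phi x = phi 1 / psi n 1 * psi n x"
proof -
 have "sl (%x. phi x + (- (phi 1 / psi n 1)) * psi n x) (%x. phi1 x + (- (phi 1 / psi n 1)) * deriv_I (psi n) x)
   (%x. - ev n * (phi x + (- (phi 1 / psi n 1)) * psi n x))"
  using sl_add[OF s sl_cmult[OF sl_psi, of "- (phi 1 / psi n 1)" n]] by (simp add: right_diff_distrib mult.left_commute)
 from sl_unique[OF this _ x] show ?thesis using psi1 by simp
qed

text \<open>Real and imaginary part of the eigenvalue mu_n, read off at x = 1, where
  \<open>psi n\<close> does not vanish. \<open>lam\<close> is |mu_n|^2; the factor c / (2 pi) of the
  concentration eigenvalue is kept apart.\<close>

definition mc :: "nat => real" where "mc n = Cop (psi n) 1 / psi n 1"
definition ms :: "nat => real" where "ms n = Sop (psi n) 1 / psi n 1"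
definition lam :: "nat => real" where "lam n = (mc n)^2 + (ms n)^2"

lemma Cop_psi: "x : II ==> Cop (psi n) x = mc n * psi n x" "x : II ==> Sop (psi n) x = ms n * psi n x"
 using sl_trig[OF sl_psi, of n] sl_proportional[of "Cop (psi n)" _ n x] sl_proportional[of "Sop (psi n)" _ n x]
 unfolding Cop_cmult mc_def ms_def by blast+

lemma lam_nonneg: "lam n >= 0" by (simp add: lam_def)

lemma lam_pos: "lam n > 0"
proof (rule ccontr)
 assume "\<not> lam n > 0"
 hence "mc n = 0" "ms n = 0" unfolding lam_def using sum_power2_gt_zero_iff by blast+
 hence "psi n 1 = 0" using Cop_injective[OF psi_cont, of n 1] Cop_psi[of _ n] by auto
 thus False using psi1 by blast
qed

text \<open>The outer integrals only see the inner transforms on [-1, 1], where they are multiples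
  of \<open>psi n\<close>. Hence the identity holds for every real x, also beyond the
  interval.\<close>

lemma Top_psi: "Top (psi n) x = mc n * Cop (psi n) x + ms n * Sop (psi n) x"
proof -
 have "Cop (Cop (psi n)) = (%x. mc n * Cop (psi n) x)" unfolding Cop_cmult[symmetric] by (rule Cop_cong) (rule Cop_psi)
 moreover have "Sop (Sop (psi n)) = (%x. ms n * Sop (psi n) x)" unfolding Cop_cmult[symmetric] by (rule Cop_cong) (rule Cop_psi)
 ultimately show ?thesis by (simp add: Top_def)
qed

lemma Top_psi_I: "x : II ==> Top (psi n) x = lam n * psi n x"
 by (simp add: Top_psi Cop_psi lam_def power2_eq_square algebra_simps)

lemma fourier_split:
 assumes f: "integrable nu f"
 shows "weighted_finite_fourier al c (%y. cor (f y)) x = Complex (Cop f x) (Sop f x)"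
proof -
 let ?A = "%x y. cos (c * x * y) * f y"
 let ?B = "%x y. sin (c * x * y) * f y"
 have mr: "(%x. cor (g x)) : borel_measurable nu" if "integrable nu g" for g
  using integrable_bounded_linear[OF bounded_linear_of_real that] by (rule borel_measurable_integrable)
 have e: "cexp (c * x * y) * cor (f y) =
   cor (?A x y) + \<i> * cor (?B x y)" for y
  by (simp add: complex_eq_iff Re_exp Im_exp)
 have "weighted_finite_fourier al c (%y. cor (f y)) x =
   (LINT y:II|leb. w y *\<^sub>R (cor (?A x y) + \<i> * cor (?B x y)))"
  unfolding weighted_finite_fourier_def e[symmetric] by (simp add: scaleR_conv_of_real mult.commute)
 also have "... = (LINT y|nu. cor (?A x y) + \<i> * cor (?B x y))"
  by (rule set_integral_nu, rule borel_measurable_add[OF mr borel_measurable_times[OF borel_measurable_const mr]]) (rule trig_integrable[OF f])+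
 also have "... = (LINT y|nu. cor (?A x y)) + \<i> * (LINT y|nu. cor (?B x y))"
  using Bochner_Integration.integral_add[OF integrable_bounded_linear[OF bounded_linear_of_real trig_integrable(1)[OF f, of x]]
   integrable_mult_right[OF integrable_bounded_linear[OF bounded_linear_of_real trig_integrable(2)[OF f, of x]], of \<i>]]
  by (simp only: integral_mult_right_zero)
 also have "... = Complex (Cop f x) (Sop f x)" unfolding integral_complex_of_real by (simp add: complex_eq_iff Cop_def Sop_def)
 finally show ?thesis .
qed

lemma fourier_eigenvalue_psi: "fourier_eigenvalue al c (psi n) = Complex (mc n) (ms n)"
 unfolding fourier_eigenvalue_def
proof (rule the_equality)
 show e: "ALL x:II. weighted_finite_fourier al c (%y. cor (psi n y)) x = Complex (mc n) (ms n) * cor (psi n x)"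
  by (simp add: fourier_split[OF psi_int] Cop_psi complex_eq_iff)
 fix m assume "ALL x:II. weighted_finite_fourier al c (%y. cor (psi n y)) x = m * cor (psi n x)"
 hence "m * cor (psi n 1) = Complex (mc n) (ms n) * cor (psi n 1)" using e by auto
 thus "m = Complex (mc n) (ms n)" using psi1 by simp
qed

lemma concentration_psi: "concentration_eigenvalue al c (psi n) = c / (2 * pi) * lam n"
 by (simp add: concentration_eigenvalue_def fourier_eigenvalue_psi lam_def cmod_power2)

lemma ip_sum_psi:
 assumes "finite A"
 shows "ip (%x. \<Sum>k\<in>A. a k * psi k x) (psi n) = (if n : A then a n else 0)"
  "ip (%x. \<Sum>k\<in>A. a k * psi k x) (%x. \<Sum>k\<in>A. b k * psi k x) = (\<Sum>k\<in>A. a k * b k)"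
proof -
 have 1: "ip (%x. \<Sum>k\<in>A. a k * psi k x) (psi n) = (if n : A then a n else 0)" for n
  using assms by (subst ip_sum) (auto simp: l2_cmult psi_l2 ip_cmult psi_orthonormal if_distrib sum.delta cong: if_cong)
 show "ip (%x. \<Sum>k\<in>A. a k * psi k x) (psi n) = (if n : A then a n else 0)" by (rule 1)
 have "ip (%x. \<Sum>k\<in>A. a k * psi k x) (%x. \<Sum>k\<in>A. b k * psi k x) = (\<Sum>n\<in>A. ip (%x. b n * psi n x) (%x. \<Sum>k\<in>A. a k * psi k x))"
  unfolding ip_sym[of "%x. \<Sum>k\<in>A. a k * psi k x"] by (rule ip_sum) (auto intro!: l2_cmult psi_l2 l2_sum)
 also have "... = (\<Sum>n\<in>A. b n * ip (%x. \<Sum>k\<in>A. a k * psi k x) (psi n))" by (simp add: ip_cmult ip_sym[of "psi _"])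
 also have "... = (\<Sum>k\<in>A. a k * b k)" by (rule sum.cong) (auto simp: 1)
 finally show "ip (%x. \<Sum>k\<in>A. a k * psi k x) (%x. \<Sum>k\<in>A. b k * psi k x) = (\<Sum>k\<in>A. a k * b k)" .
qed

lemma sl_comb:
 assumes "finite A"
 shows "sl (%x. \<Sum>k\<in>A. a k * psi k x) (%x. \<Sum>k\<in>A. a k * deriv_I (psi k) x) (%x. - (\<Sum>k\<in>A. a k * ev k * psi k x))"
 using sl_sum[OF assms, OF sl_cmult[OF sl_psi], of a] by (simp add: sum_negf mult.assoc)

lemma ev_nonneg: "ev n >= 0"
proof -
 have "ev n = - ip (%x. - ev n * psi n x) (psi n)" unfolding ip_cmult by (simp add: psi_orthonormal)
 also have "... = (LINT x|nu. (1 - x^2) * (deriv_I (psi n) x)^2) + c^2 * (LINT x|nu. x^2 * (psi n x)^2)" by (rule energy[OF sl_psi])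
 also have "... >= 0"
  by (intro add_nonneg_nonneg mult_nonneg_nonneg Bochner_Integration.integral_nonneg_AE AE_I2)
    (auto simp: space_nu abs_square_le_1 abs_le_iff)
 finally show ?thesis .
qed

end

section \<open>Pointwise bounds from weighted square norms\<close>

context wt begin

text \<open>For x0 in [0, 1] the window lies to the left of x0, with 1 - y >= de / 2 and 1 + y >=
  1/2 on it. So the weight is at least (de / 4)^al even when x0 is the endpoint 1.\<close>

lemma window_mass:
 assumes x0: "x0 : {0..1}" and d: "0 < de" "de <= 1/2"
 shows "de / 2 * (de / 4) powr al <= measure nu {x0 - de..x0 - de / 2}"
proof -
 let ?W = "{x0 - de..x0 - de / 2}"
 have sub: "?W \<subseteq> II" using x0 d by auto
 have W: "?W : sets nu" using sub by (simp add: sets_nu sets_restrict_space_iff)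
 have wl: "(de / 4) powr al <= w y" if y: "y : ?W" for y
 proof -
  have "de / 4 = (de / 2) * (1 / 2)" by simp
  also have "... <= (1 - y) * (1 + y)" using y x0 d by (intro mult_mono) auto
  also have "... = 1 - y^2" by (simp add: power2_eq_square algebra_simps)
  finally show ?thesis unfolding weight_def using alpha0 d by (intro powr_mono2) auto
 qed
 have "ennreal (de / 2 * (de / 4) powr al) = (\<integral>\<^sup>+y. ennreal ((de / 4) powr al) * indicator ?W y \<partial>lebesgue_on II)"
 proof -
  have "emeasure (lebesgue_on II) ?W = ennreal (de / 2)" using sub d by (subst emeasure_restrict_space) auto
  moreover have "?W : sets (lebesgue_on II)" using sub by (simp add: sets_restrict_space_iff)
  ultimately show ?thesis using d by (subst nn_integral_cmult_indicator) (auto simp: ennreal_mult[symmetric] mult.commute)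
 qed
 also have "... <= (\<integral>\<^sup>+y. ennreal (w y) * indicator ?W y \<partial>lebesgue_on II)"
  by (rule nn_integral_mono) (use wl in "auto simp: indicator_def intro!: ennreal_leI")
 also have "... = emeasure nu ?W" using W w_meas unfolding wmeas_def by (subst emeasure_density) (auto simp: sets_nu)
 finally show ?thesis by (simp add: emeasure_eq_measure)
qed

text \<open>If |H x0| exceeded the bound, the derivative bound would keep |H| large on the whole
  window, and the norm of H would be too large.\<close>

lemma window_bound_pos:
 assumes H: "!!x. x : {-1<..<1} ==> DERIV H x :> H' x" "contI H"
  and M: "!!x. x : {-1<..<1} ==> -1 / 2 < x ==> (abs (H' x)) <= M"
  and x0: "x0 : {0..1}" and d: "0 < de" "de <= 1/2"
 shows "abs (H x0) <= de * M + nrm H / sqrt (de / 2 * (de / 4) powr al)"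
proof (rule ccontr)
 assume "\<not> ?thesis"
 hence big: "de * M + nrm H / sqrt (de / 2 * (de / 4) powr al) < abs (H x0)" by simp
 define m where "m = de / 2 * (de / 4) powr al"
 have m: "m > 0" using d by (simp add: m_def)
 let ?W = "{x0 - de..x0 - de / 2}"
 define b where "b = abs (H x0) - de * M"
 have b: "nrm H / sqrt m < b" using big by (simp add: b_def m_def)
 have b0: "b > 0" using b divide_nonneg_pos[OF nrm_nonneg[of H] real_sqrt_gt_zero[OF m]] by linarith
 have M0: "M >= 0" using M[of 0] by force
 have low: "b <= abs (H y)" if y: "y : ?W" for y
 proof -
  have yx: "y < x0" "-1/2 <= y" "x0 - y <= de" using y d x0 by auto
  have "EX l z. y < z & z < x0 & (DERIV H z :> l) & H x0 - H y = (x0 - y) * l"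
  proof (rule MVT[OF yx(1)])
   show "continuous_on {y..x0} H" by (rule continuous_on_subset[OF H(2)]) (use yx x0 in auto)
   fix z assume "y < z" "z < x0"
   hence "z : {-1<..<1}" using yx x0 by auto
   thus "H differentiable (at z)" using H(1) real_differentiable_def by blast
  qed
  then obtain l z where z: "y < z" "z < x0" "DERIV H z :> l" "H x0 - H y = (x0 - y) * l" by blast
  have zz: "z : {-1<..<1}" "-1/2 < z" using z yx x0 by auto
  have "l = H' z" using DERIV_unique[OF z(3) H(1)[OF zz(1)]] .
  hence "abs l <= M" using M[OF zz] by simp
  hence "abs (x0 - y) * abs l <= de * M" using yx M0 by (intro mult_mono) auto
  hence "abs (H x0 - H y) <= de * M" by (simp add: z(4) abs_mult)
  thus ?thesis unfolding b_def by linarith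
 qed
 have sub: "?W \<subseteq> II" using x0 d by auto
 have W: "?W : sets nu" using sub by (simp add: sets_nu sets_restrict_space_iff)
 have "m * b^2 <= measure nu ?W * b^2" using window_mass[OF x0 d] by (intro mult_right_mono) (auto simp: m_def)
 also have "... = (LINT y|nu. b^2 * indicator ?W y)" using W by (simp add: mult.commute)
 also have "... <= (LINT y|nu. H y * H y)"
 proof (rule integral_mono)
  show "integrable nu (%y. H y * H y)" by (intro integrable_cont continuous_intros H(2))
  show "integrable nu (%y. b^2 * indicator ?W y)" using W by (intro integrable_mult_right integrable_real_indicator) (auto simp: emeasure_eq_measure)
  fix y show "b^2 * indicator ?W y <= H y * H y"
  proof (cases "y : ?W")
   case True
   have "b^2 <= (abs (H y))^2" using low[OF True] b0 by (intro power_mono) auto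
   thus ?thesis using True by (simp add: power2_eq_square)
  qed simp
 qed
 finally have "m * b^2 <= (nrm H)^2" by (simp add: nrm_sq ip_def)
 hence "sqrt (m * b^2) <= sqrt ((nrm H)^2)" by (rule real_sqrt_le_mono)
 hence "sqrt m * b <= nrm H" using b0 nrm_nonneg by (simp add: real_sqrt_mult)
 hence "b <= nrm H / sqrt m" using m by (simp add: pos_le_divide_eq mult.commute)
 thus False using b by simp
qed

lemma wmeas_reflect:
 fixes f :: "real => real"
 assumes f: "contI f"
 shows "(LINT x|nu. f (- x)) = (LINT x|nu. f x)"
proof -
 have fr: "contI (%x. f (- x))"
  by (rule continuous_on_compose2[OF f]) (auto intro!: continuous_intros)
 have L: "(LINT x|nu. g x) = integral II (%x. w x * g x)" if "contI g" for g :: "real => real"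
 proof -
  have i: "integrable (lebesgue_on II) (%x. w x *\<^sub>R g x)"
   using integrable_cont[OF that] nu_integral(2)[OF cont_meas[OF that]] by simp
  thus ?thesis using nu_integral(1)[OF cont_meas[OF that]] lebesgue_integral_eq_integral[OF i] by simp
 qed
 have "integral II (%x. w x * f (- x)) = integral II (%x. (%x. w x * f x) (- x))" by (simp add: weight_def)
 also have "... = integral II (%x. w x * f x)" using Henstock_Kurzweil_Integration.integral_reflect_real[where a = "-1" and b = 1 and f = "%x. w x * f x"] by (simp only: minus_minus)
 finally show ?thesis by (simp add: L f fr)
qed

lemma window_bound:
 assumes H: "!!x. x : {-1<..<1} ==> DERIV H x :> H' x" "contI H"
  and M: "!!x. x : {-1<..<1} ==> (abs (H' x)) <= M"
  and x0: "x0 : II" and d: "0 < de" "de <= 1/2"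
 shows "abs (H x0) <= de * M + nrm H / sqrt (de / 2 * (de / 4) powr al)"
proof (cases "x0 >= 0")
 case True
 thus ?thesis using window_bound_pos[OF H M _ d] x0 by auto
next
 case False
 have c: "contI (%x. H (- x))"
  by (rule continuous_on_compose2[OF H(2)]) (auto intro!: continuous_intros)
 have D: "DERIV (%x. H (- x)) x :> - H' (- x)" if "x : {-1<..<1}" for x
 proof -
  have "- x : {-1<..<1}" using that by auto
  from DERIV_chain2[OF H(1)[OF this] DERIV_minus[OF DERIV_ident]] show ?thesis by simp
 qed
 have "abs (H (- (- x0))) <= de * M + nrm (%x. H (- x)) / sqrt (de / 2 * (de / 4) powr al)"
  by (rule window_bound_pos[OF D c _ _ d]) (use x0 False M[of "- x" for x] in auto)
 moreover have "nrm (%x. H (- x)) = nrm H"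
  unfolding nrm_def ip_def using wmeas_reflect[of "%x. H x * H x"] H(2) by (simp add: continuous_intros)
 ultimately show ?thesis by simp
qed

end

context pf begin

text \<open>\<open>flux_bound\<close> for x >= 0, where (1 + x)^(al + 1) >= 1; reflection covers x <
  0.\<close>

lemma deriv_sup_bound:
 assumes s: "sl phi phi1 g" and M: "!!y. y : II ==> (abs (g y)) <= M1" "!!y. y : II ==> (abs (phi y)) <= M0" and x: "x : {-1<..<1}"
 shows "abs (phi1 x) <= 2 powr al * (M1 + c^2 * M0)"
proof -
 have *: "abs (phi1 x) <= 2 powr al * (M1 + c^2 * M0)"
  if s: "sl phi phi1 g" and M: "!!y. y : II ==> (abs (g y)) <= M1" "!!y. y : II ==> (abs (phi y)) <= M0" and x: "0 <= x" "x < 1"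
  for phi phi1 g and x :: real
 proof -
  have "(1 + x) powr (al + 1) * abs (phi1 x) <= (M1 + c^2 * M0) * 2 powr al"
  proof (rule flux_bound[OF s])
   fix y assume y: "x <= y" "y <= 1"
   have "y^2 <= 1" using x y by (simp add: abs_square_le_1 abs_le_iff)
   hence "y^2 * abs (phi y) <= 1 * M0" using M(2)[of y] x y by (intro mult_mono) auto
   hence "abs (c^2 * y^2 * phi y) <= c^2 * M0" by (simp add: abs_mult mult.assoc mult_left_mono)
   thus "abs (g y + c^2 * y^2 * phi y) <= M1 + c^2 * M0" using M(1)[of y] x y by (intro order_trans[OF abs_triangle_ineq] add_mono) auto
  qed (use x in auto)
  moreover have "1 * abs (phi1 x) <= (1 + x) powr (al + 1) * abs (phi1 x)"
   using x alpha0 by (intro mult_right_mono ge_one_powr_ge_zero) auto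
  ultimately show ?thesis by (simp add: mult.commute)
 qed
 show ?thesis
 proof (cases "x >= 0")
  case True
  thus ?thesis using *[OF s M] x by auto
 next
  case False
  thus ?thesis using *[OF sl_reflect[OF s], of "- x"] M x by auto
 qed
qed

end

context gp begin

text \<open>The factor 4 comes from the square of 2 Y in \<open>sup_bound\<close>, the other two
  from the mass of a window of length parameter de = 1 / (4 * 2^al * Lam).\<close>

definition sup_const :: real where "sup_const = 4 * (8 * 2 powr al) * (16 * 2 powr al) powr al"

text \<open>A Bernstein-type estimate. \<open>H j\<close> results from applying the operator j times
  and dividing by Lam^j; as ev k <= Lam, all these functions have norm at most N and a common crude
  bound S. The derivative of \<open>H j\<close> is controlled by the sup norms of \<open>H j\<close>
  and \<open>H (Suc j)\<close>, and \<open>window_bound\<close> gives s_j <= s_(j+1) / 3 + 4 Y / 3.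
  Iteration removes S.\<close>

lemma sup_bound:
 assumes A: "finite A" and L: "!!k. k : A ==> ev k <= Lam" "Lam >= 1" "Lam >= c^2" and x: "x : II"
 shows "(\<Sum>k\<in>A. a k * psi k x)^2 <= sup_const * Lam powr (al + 1) * (\<Sum>k\<in>A. (a k)^2)"
proof -
 let ?A = "%k j. a k * (ev k / Lam) ^ j"
 let ?B = "%de. de / 2 * (de / 4) powr al"
 define H where "H j x = (\<Sum>k\<in>A. (?A k j) * psi k x)" for j x
 define N where "N = sqrt (\<Sum>k\<in>A. (a k)^2)"
 define de where "de = 1 / (4 * 2 powr al * Lam)"
 define Y where "Y = N / sqrt (?B de)"
 have t1: "(2::real) powr al >= 1" using alpha0 by (simp add: ge_one_powr_ge_zero)
 have d: "0 < de" "de <= 1/2" "de * (2 powr al * Lam) = 1/4"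
 proof -
  have "1 * 1 <= 2 powr al * Lam" using t1 L by (intro mult_mono) auto
  thus "0 < de" "de <= 1/2" "de * (2 powr al * Lam) = 1/4" using L t1 by (auto simp: de_def field_simps)
 qed
 have N0: "N >= 0" by (simp add: N_def sum_nonneg)
 have Y0: "Y >= 0" using d N0 by (simp add: Y_def)
 have r: "0 <= ev k / Lam" "ev k / Lam <= 1" if "k : A" for k using L ev_nonneg[of k] that by (auto simp: divide_le_eq)
 have rp: "0 <= (ev k / Lam) ^ j" "(ev k / Lam) ^ j <= 1" if "k : A" for k j using r[OF that] by (auto intro: power_le_one)
 have nH: "nrm (H j) <= N" for j
 proof -
  have "ip (H j) (H j) = (\<Sum>k\<in>A. (a k)^2 * ((ev k / Lam) ^ j)^2)"
   unfolding H_def[abs_def] ip_sum_psi(2)[OF A] by (simp add: power2_eq_square mult_ac)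
  also have "... <= (\<Sum>k\<in>A. (a k)^2 * 1)" using power_le_one[OF rp] by (intro sum_mono mult_left_mono) (simp_all del: power_divide)
  finally show ?thesis unfolding nrm_def N_def by (simp add: real_sqrt_le_mono)
 qed
 have slH: "sl (H j) (%x. \<Sum>k\<in>A. (?A k j) * deriv_I (psi k) x) (%x. - (Lam * H (Suc j) x))" for j
 proof -
  have "(%x. - (Lam * H (Suc j) x)) = (%x. - (\<Sum>k\<in>A. (?A k j) * ev k * psi k x))"
  proof -
   have "Lam * ((a k * (ev k / Lam) ^ Suc j) * p) = (?A k j) * ev k * p" for k p
   proof -
    have e: "Lam * (ev k / Lam) = ev k" using L by simp
    have "Lam * ((a k * (r * q)) * p) = (a k * q) * (Lam * r) * p" for r q by (simp only: mult_ac)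
    from this[of "ev k / Lam" "(ev k / Lam) ^ j", unfolded e] show ?thesis by simp
   qed
   thus ?thesis by (simp only: H_def sum_distrib_left)
  qed
  thus ?thesis using sl_comb[OF A, of "%k. a k * (ev k / Lam) ^ j"] by (simp add: H_def[abs_def])
 qed
 have "ALL k:A. EX b. ALL x:II. (abs (psi k x)) <= b" using cont_bdd[OF psi_cont] by meson
 from bchoice[OF this] obtain B where B: "!!k x. k : A ==> x : II ==> (abs (psi k x)) <= B k" by blast
 define S where "S = (\<Sum>k\<in>A. (abs (a k)) * B k)"
 have HS: "abs (H j x) <= S" if x: "x : II" for j x
  unfolding H_def S_def
 proof (rule order_trans[OF sum_abs sum_mono])
  fix k assume k: "k : A"
  have "abs (a k) * (ev k / Lam) ^ j * abs (psi k x) <= abs (a k) * 1 * B k"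
   using rp[OF k, of j] B[OF k x] by (intro mult_mono) auto
  thus "abs (a k * (ev k / Lam) ^ j * psi k x) <= abs (a k) * B k" using rp[OF k, of j] by (simp add: abs_mult)
 qed
 have step: "(ALL x:II. (abs (H j x)) <= s' / 3 + 4 / 3 * Y)" if b: "!!x. x : II ==> (abs (H (Suc j) x)) <= s'" for j s'
 proof -
  have "EX x0:II. ALL y:II. (abs (H j y)) <= abs (H j x0)"
   using slD(2)[OF slH[of j]] by (intro continuous_attains_sup continuous_intros) auto
  then obtain x0 where x0: "x0 : II" "!!y. y : II ==> (abs (H j y)) <= abs (H j x0)" by blast
  define s where "s = abs (H j x0)"
  have s0: "s >= 0" "s' >= 0" using b[of 0] by (auto simp: s_def)
  have db: "abs (\<Sum>k\<in>A. (?A k j) * deriv_I (psi k) x) <= 2 powr al * Lam * (s' + s)" if "x : {-1<..<1}" for x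
  proof -
   have "abs (\<Sum>k\<in>A. (?A k j) * deriv_I (psi k) x) <= 2 powr al * (Lam * s' + c^2 * s)"
    by (rule deriv_sup_bound[OF slH _ _ that]) (use b x0(2) L in "auto simp: s_def abs_mult mult_left_mono")
   also have "... <= 2 powr al * (Lam * s' + Lam * s)" using L s0 by (intro mult_left_mono add_mono mult_right_mono) auto
   finally show ?thesis by (simp add: algebra_simps)
  qed
  have "abs (H j x0) <= de * (2 powr al * Lam * (s' + s)) + nrm (H j) / sqrt (?B de)"
   by (rule window_bound[OF slD(1)[OF slH] slD(2)[OF slH] db x0(1) d(1,2)])
  also have "de * (2 powr al * Lam * (s' + s)) = (s' + s) / 4" using d(3) by (simp add: mult.assoc[symmetric])
  also have "nrm (H j) / sqrt (?B de) <= Y" unfolding Y_def using nH d by (intro divide_right_mono) auto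
  finally have "s <= s' / 3 + 4 / 3 * Y" by (simp add: s_def field_simps)
  thus ?thesis using x0(2) unfolding s_def by force
 qed
 have it: "ALL x:II. (abs (H j x)) <= S / 3 ^ n + 2 * Y" for n j
 proof (induction n arbitrary: j)
  case 0
  show ?case
  proof
   fix x :: real assume "x : II"
   thus "abs (H j x) <= S / 3 ^ 0 + 2 * Y" using HS[of x j] Y0 by simp
  qed
 next
  case (Suc n)
  have "ALL x:II. (abs (H j x)) <= (S / 3 ^ n + 2 * Y) / 3 + 4 / 3 * Y" by (rule step) (use Suc in auto)
  moreover have "(S / 3 ^ n + 2 * Y) / 3 + 4 / 3 * Y = S / 3 ^ Suc n + 2 * Y" by (simp add: field_simps)
  ultimately show ?case by simp
 qed
 have "abs (H 0 x) <= 2 * Y"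
 proof (rule LIMSEQ_le_const)
  have "(%n. S * (1 / 3) ^ n + 2 * Y) ----> S * 0 + 2 * Y" by (intro tendsto_intros LIMSEQ_power_zero) auto
  thus "(%n. S / 3 ^ n + 2 * Y) ----> 2 * Y" by (simp add: power_one_over field_simps)
  show "EX N. ALL n>=N. (abs (H 0 x)) <= S / 3 ^ n + 2 * Y" using it x by blast
 qed
 hence "(abs (H 0 x))^2 <= (2 * Y)^2" by (rule power_mono) simp
 also have "(2 * Y)^2 = 4 * N^2 / (?B de)" using d by (simp add: Y_def power_mult_distrib power_divide)
 also have "... = sup_const * Lam powr (al + 1) * N^2"
 proof -
  have q: "1 / (4 * q * l) / 4 = inverse (16 * q * l)" "1 / (4 * q * l) / 2 = inverse (8 * q * l)" for q l :: real
   by (simp_all only: divide_divide_eq_left inverse_eq_divide)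
  have e: "de / 4 = inverse (16 * 2 powr al * Lam)" unfolding de_def by (rule q(1))
  have e1: "(de / 4) powr al = inverse ((16 * 2 powr al) powr al * Lam powr al)"
   unfolding e inverse_powr powr_mult[of "16 * 2 powr al" Lam al] ..
  have e2: "de / 2 = inverse (8 * 2 powr al * Lam)" unfolding de_def by (rule q(2))
  have e3: "Lam powr (al + 1) = Lam powr al * Lam" using L by (simp add: powr_add)
  have "4 * N^2 / (inverse X * inverse Z) = 4 * N^2 * X * Z" for X Z :: real by (simp add: divide_inverse)
  thus ?thesis unfolding e1 e2 e3 sup_const_def by (simp only: mult_ac)
 qed
 finally show ?thesis by (simp add: H_def N_def sum_nonneg)
qed

end

section \<open>Lower bound for the eigenvalues\<close>

lemma nontrivial_solution:
 fixes p :: "'k => 'z => real"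
 assumes "finite Z" "finite K" "card Z < card K"
 shows "EX a. (EX k:K. a k ~= 0) & (ALL z:Z. (\<Sum>k\<in>K. a k * p k z) = 0)"
 using assms
proof (induction Z arbitrary: K p rule: finite_induct)
 case empty
 hence "K ~= {}" by auto
 thus ?case by (intro exI[of _ "%_. 1"]) auto
next
 case (insert z Z)
 show ?case
 proof (cases "ALL k:K. p k z = 0")
  case True
  have "card Z < card K" using insert by simp
  from insert.IH[OF insert.prems(1) this, of p] obtain a
   where "EX k:K. a k ~= 0" "ALL z:Z. (\<Sum>k\<in>K. a k * p k z) = 0" by blast
  thus ?thesis using True by (intro exI[of _ a]) auto
 next
  case False
  then obtain k0 where k0: "k0 : K" "p k0 z ~= 0" by blast
  let ?q = "%k y. p k y - p k z / p k0 z * p k0 y"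
  have "card Z < card (K - {k0})" using insert k0 by simp
  from insert.IH[OF _ this, of ?q] insert.prems(1) obtain b
   where b: "EX k:K - {k0}. b k ~= 0" "ALL z:Z. (\<Sum>k\<in>K - {k0}. b k * ?q k z) = 0" by blast
  define t where "t = (\<Sum>k\<in>K - {k0}. b k * (p k z / p k0 z))"
  define a where "a = b(k0 := - t)"
  have e: "(\<Sum>k\<in>K. a k * p k y) = (\<Sum>k\<in>K - {k0}. b k * ?q k y)" for y
  proof -
   have "(\<Sum>k\<in>K. a k * p k y) = - t * p k0 y + (\<Sum>k\<in>K - {k0}. a k * p k y)"
    using k0 insert.prems(1) by (subst sum.remove[of K k0]) (auto simp: a_def)
   also have "(\<Sum>k\<in>K - {k0}. a k * p k y) = (\<Sum>k\<in>K - {k0}. b k * p k y)" by (rule sum.cong) (auto simp: a_def)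
   finally show ?thesis by (simp add: t_def right_diff_distrib sum_subtractf sum_distrib_right mult.assoc)
  qed
  have "(\<Sum>k\<in>K - {k0}. b k * ?q k z) = 0" using k0 by simp
  hence "ALL y:insert z Z. (\<Sum>k\<in>K. a k * p k y) = 0" using b(2) by (simp only: e) blast
  moreover have "EX k:K. a k ~= 0" using b(1) by (auto simp: a_def)
  ultimately show ?thesis by blast
 qed
qed

context wt begin

lemma w_cont: "x : {-1<..<1} ==> isCont w x"
 unfolding weight_def by (intro continuous_intros) (auto simp: abs_square_less_1 abs_less_iff power2_eq_1_iff)

lemma weighted_integrable_on:
 assumes "contI f" shows "(%x. w x * f x) integrable_on II"
  "(LINT x|nu. f x) = integral II (%x. w x * f x)"
proof -
 have i: "integrable (lebesgue_on II) (%x. w x *\<^sub>R f x)"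
  using integrable_cont[OF assms] nu_integral(2)[OF cont_meas[OF assms]] by simp
 show "(%x. w x * f x) integrable_on II" using integrable_on_lebesgue_on[OF i] by simp
 show "(LINT x|nu. f x) = integral II (%x. w x * f x)"
  using nu_integral(1)[OF cont_meas[OF assms]] lebesgue_integral_eq_integral[OF i] by simp
qed

text \<open>Picone's identity on the cells \<open>\<theta> \<in> [jh, (j + 1)h]\<close>, \<open>x = cos \<theta>\<close>, \<open>h = \<pi> / (2m)\<close>, compares with the
  constant coefficient equation of frequency \<open>\<surd>\<Lambda> = 1 / (2h)\<close>.\<close>

lemma picone_half:
 assumes d: "!!x. x : {-1<..<1} ==> DERIV phi x :> phi1 x"
  and c: "contI phi" "contI phi1"
  and m: "m >= 1" and z: "!!j. 1 <= j ==> j <= m ==> phi (cos (real j * (pi / (2 * real m)))) = 0"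
  and L: "Lam = (real m / pi)^2"
 shows "0 <= integral {0..1} (%x. w x * ((1 - x^2) * (phi1 x)^2 - Lam * (phi x)^2))"
proof -
 let ?A = "%y t q. - ((2 * al + 1) * y * t * (phi y)^2 / q) - (phi y)^2 + 2 * q * t * phi y * phi1 y"
 let ?B = "%y. (1 - y^2) powr (al + 1 / 2)"
 define r where "r x = (1 - x^2) * (phi1 x)^2 - Lam * (phi x)^2" for x
 define P where "P x = integral {0..x} (%x. w x * r x)" for x
 define h where "h = pi / (2 * real m)"
 define x where "x j = cos (real j * h)" for j
 have h: "h > 0" "4 * Lam * h^2 = 1" "real m * h = pi / 2" using m by (auto simp: h_def L field_simps)
 have L0: "Lam > 0" using m by (simp add: L)
 have cr: "contI r" unfolding r_def by (intro continuous_intros c)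
 have ir: "(%x. w x * r x) integrable_on {0..1}"
  by (rule integrable_on_subinterval[OF weighted_integrable_on(1)[OF cr]]) auto
 have cP: "continuous_on {0..1} P" unfolding P_def by (rule indefinite_integral_continuous_1[OF ir])
 have dP: "DERIV P y :> w y * r y" if y: "0 < y" "y < 1" for y
 proof -
  have "isCont r y" using continuous_on_interior[OF cr] y by auto
  hence "isCont (%x. w x * r x) y" using w_cont[of y] y by (intro continuous_intros) auto
  hence "((%u. integral {0..u} (%x. w x * r x)) has_vector_derivative w y * r y) (at y within {0..1})"
   using y integral_has_vector_derivative_continuous_at[OF ir, of y "{}"] by (auto simp: continuous_at_imp_continuous_at_within)
  thus ?thesis using y at_within_Icc_at[of 0 y 1] by (simp add: P_def[abs_def] has_real_derivative_iff_has_vector_derivative)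
 qed
 have th: "0 <= real j * h" "real j * h <= pi / 2" if "j <= m" for j
 proof -
  have "real j * h <= real m * h" using that h by (intro mult_right_mono) auto
  thus "real j * h <= pi / 2" using h by simp
 qed (use h in auto)
 have xr: "0 <= x j" "x j <= 1" "arccos (x j) = real j * h" if "j <= m" for j
  using th[OF that] by (auto simp: x_def intro!: cos_ge_zero arccos_cos)
 have step: "P (x (Suc j)) <= P (x j)" if j: "Suc j <= m" for j
 proof -
  \<comment> \<open>With t = arccos y - j h, the function 2 Lam t replaces sqrt Lam tan(sqrt Lam t)
    in Picone's identity: it satisfies 2 Lam >= Lam + (2 Lam t)^2 as long as 4 Lam t^2 <= 1, that
    is, for t <= h. G vanishes at one end of the cell since t = 0, and at the other since phi is
    zero there.\<close>
  define G where "G y = 2 * Lam * ((1 - y^2) powr (al + 1 / 2) * (arccos y - real j * h) * (phi y)^2)" for y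
  have lt: "x (Suc j) < x j" unfolding x_def using th[of "Suc j"] j h th[of j] pi_gt_zero
   by (intro cos_monotone_0_pi) (linarith | simp add: distrib_right)+
  have sub: "{x (Suc j)..x j} \<subseteq> {0..1}" using xr[of j] xr[of "Suc j"] j by auto
  have cpow: "continuous_on {x (Suc j)..x j} ?B"
  proof (rule continuous_on_powr')
   have "y^2 <= 1" if "y : {x (Suc j)..x j}" for y using that sub by (auto simp: abs_square_le_1 abs_le_iff subset_iff)
   thus "ALL y:{x (Suc j)..x j}. 0 <= 1 - y^2 & (1 - y^2 = 0 --> 0 < al + 1 / 2)" using alpha0 by auto
  qed (intro continuous_intros)+
  have carc: "continuous_on {x (Suc j)..x j} arccos" using continuous_on_subset[OF continuous_on_arccos' , of "{x (Suc j)..x j}"] sub by force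
  have cphi: "continuous_on {x (Suc j)..x j} phi" using c(1) by (rule continuous_on_subset) (use sub in force)
  have cG: "continuous_on {x (Suc j)..x j} G" unfolding G_def by (intro continuous_intros cpow carc cphi)
  define G' where "G' y = 2 * Lam * (((al + 1 / 2) * (1 - y^2) powr (al + 1 / 2 - 1) * (- (2 * y)) * (arccos y - real j * h)
    + (1 - y^2) powr (al + 1 / 2) * (inverse (- sqrt (1 - y^2)))) * (phi y)^2
    + (1 - y^2) powr (al + 1 / 2) * (arccos y - real j * h) * (2 * phi y * phi1 y))" for y
  have "P (x (Suc j)) - G (x (Suc j)) <= P (x j) - G (x j)"
  proof (rule nondecreasing_from_deriv[where f = "%y. P y - G y" and f' = "%y. w y * r y - G' y"])
   fix y assume y: "x (Suc j) < y" "y < x j"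
   have y01: "0 < y" "y < 1" using y xr[of j] xr[of "Suc j"] j by auto
   have s: "1 - y^2 > 0" using y01 by (simp add: abs_square_less_1)
   have dpw: "DERIV ?B y :> (al + 1 / 2) * (1 - y^2) powr (al + 1 / 2 - 1) * (- (2 * y))"
    by (rule DERIV_cong[OF DERIV_fun_powr[where g = "%y. 1 - y^2" and m = "- (2 * y)", OF _ s]]) (auto intro!: derivative_eq_intros)
   have dac: "DERIV (%y. arccos y - real j * h) y :> inverse (- sqrt (1 - y^2))"
    by (rule DERIV_cong[OF DERIV_diff[OF DERIV_arccos DERIV_const]]) (use y01 in auto)
   have dph: "DERIV (%y. (phi y)^2) y :> 2 * phi y * phi1 y"
    by (rule DERIV_cong[OF DERIV_power[OF d]]) (use y01 in auto)
   have "DERIV G y :> G' y"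
    unfolding G_def[abs_def] G'_def
    by (rule DERIV_cong[OF DERIV_cmult[OF DERIV_mult[OF DERIV_mult[OF dpw dac] dph]]]) (simp add: algebra_simps)
   thus "DERIV (%y. P y - G y) y :> w y * r y - G' y" by (rule DERIV_diff[OF dP[OF y01]])
   define q where "q = sqrt (1 - y^2)"
   define t where "t = arccos y - real j * h"
   have q: "q > 0" "q^2 = 1 - y^2" using s by (auto simp: q_def)
   have pw: "(1 - y^2) powr (al + 1 / 2) = w y * q" using s by (simp add: weight_def powr_add powr_half_sqrt q_def)
   have "al + 1 / 2 - 1 = al - 1 / 2" by simp
   hence pw2: "(1 - y^2) powr (al + 1 / 2 - 1) = w y / q" using s by (simp only: powr_diff) (simp add: weight_def powr_half_sqrt q_def)
   have t: "0 <= t" "t <= h"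
   proof -
    have "arccos (x j) <= arccos y" by (rule arccos_le_arccos) (use y y01 xr[of j] j in auto)
    thus "0 <= t" using xr(3)[of j] j by (simp add: t_def)
    have "arccos y <= arccos (x (Suc j))" by (rule arccos_le_arccos) (use y y01 xr[of "Suc j"] j in auto)
    thus "t <= h" using xr(3)[of "Suc j"] j by (simp add: t_def algebra_simps)
   qed
   have G'e: "G' y = w y * (2 * Lam * (?A y t q))"
    unfolding G'_def pw pw2 t_def[symmetric] q_def[symmetric] using q(1) by (simp add: field_simps power2_eq_square)
   have lt: "4 * Lam * t^2 <= 1"
   proof -
    have "t^2 <= h^2" using t by (intro power_mono) auto
    hence "4 * Lam * t^2 <= 4 * Lam * h^2" using L0 by (intro mult_left_mono) auto
    thus ?thesis using h by simp
   qed
   \<comment> \<open>The completed square. The last summand has the sign of y, which is why the two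
     halves of the interval are treated separately.\<close>
   have "0 <= (q * phi1 y - 2 * Lam * t * phi y)^2 + Lam * (1 - 4 * Lam * t^2) * (phi y)^2 + 2 * Lam * ((2 * al + 1) * y * t * (phi y)^2 / q)"
    using L0 lt y01 t q alpha0 by (intro add_nonneg_nonneg mult_nonneg_nonneg divide_nonneg_pos) auto
   also have "... = r y - 2 * Lam * (?A y t q)"
    unfolding r_def q(2)[symmetric] by (simp add: power2_eq_square algebra_simps)
   finally have "0 <= w y * (r y - 2 * Lam * (?A y t q))"
    by (rule mult_nonneg_nonneg[OF w_nonneg])
   thus "0 <= w y * r y - G' y" unfolding G'e by (simp add: right_diff_distrib)
  qed (use lt sub in "auto intro!: continuous_on_diff cG continuous_on_subset[OF cP]")
  moreover have "G (x (Suc j)) = 0" using z[of "Suc j"] j by (simp add: G_def x_def h_def)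
  moreover have "G (x j) = 0" using xr(3)[of j] j by (simp add: G_def)
  ultimately show ?thesis by simp
 qed
 have "P (x j) <= P (x 0)" if "j <= m" for j
  using that
 proof (induction j)
  case (Suc j)
  thus ?case using step[of j] by auto
 qed simp
 from this[of m] have "P 0 <= P 1" using h by (simp add: x_def)
 thus ?thesis by (simp add: P_def r_def)
qed

end

context gp begin

text \<open>Min-max: the points cos(j pi / (2m)) and their negatives are 2m - 1 <= N in number, as 0
  is counted once, so a nontrivial combination of \<open>psi 0\<close>, ..., \<open>psi N\<close>
  vanishes at all of them. By \<open>picone_half\<close> on both halves its quadratic form is at
  least \<open>Lam\<close> times its squared norm, and at most \<open>ev N\<close> times it.\<close>

lemma ev_lower:
 assumes N: "N >= 1"
 shows "(real N / (2 * pi))^2 <= ev N"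
proof -
 let ?A = "%a. \<Sum>k\<in>{0..N}. (a k)^2"
 define m where "m = (N + 1) div 2"
 have m: "m >= 1" "real N / 2 <= real m" "2 * m - 1 <= N" using N by (auto simp: m_def real_of_nat_div intro: order_trans)
 define Lam where "Lam = (real m / pi)^2"
 define x where "x j = cos (real j * (pi / (2 * real m)))" for j
 define Z where "Z = x ` {1..m} \<union> (%j. - x j) ` {1..m - 1}"
 have "card Z <= m + (m - 1)" unfolding Z_def
  by (rule order_trans[OF card_Un_le add_mono]) (auto intro: order_trans[OF card_image_le])
 hence cZ: "card Z < card {0..N}" using m by simp
 have fZ: "finite Z" by (simp add: Z_def)
 obtain a where a: "EX k:{0..N}. a k ~= 0" "!!z. z : Z ==> (\<Sum>k\<in>{0..N}. a k * psi k z) = 0"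
  using nontrivial_solution[OF fZ _ cZ, of psi] by auto
 define phi where "phi x = (\<Sum>k\<in>{0..N}. a k * psi k x)" for x
 define phi1 where "phi1 x = (\<Sum>k\<in>{0..N}. a k * deriv_I (psi k) x)" for x
 define g where "g x = - (\<Sum>k\<in>{0..N}. a k * ev k * psi k x)" for x
 have s: "sl phi phi1 g" unfolding phi_def[abs_def] phi1_def[abs_def] g_def[abs_def] by (rule sl_comb) simp
 have xm: "x m = 0" using m by (simp add: x_def)
 have z1: "phi (x j) = 0" if "1 <= j" "j <= m" for j using a(2)[of "x j"] that by (auto simp: Z_def phi_def)
 have z2: "phi (- x j) = 0" if "1 <= j" "j <= m" for j
 proof (cases "j = m")
  case True
  thus ?thesis using z1[of m] m xm by simp
 next
  case False
  thus ?thesis using a(2)[of "- x j"] that by (auto simp: Z_def phi_def)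
 qed
 define r where "r x = (1 - x^2) * (phi1 x)^2 - Lam * (phi x)^2" for x
 have cr: "contI r" unfolding r_def by (intro continuous_intros slD(2,3)[OF s])
 have p1: "0 <= integral {0..1} (%x. w x * r x)"
  unfolding r_def by (rule picone_half[OF slD(1,2,3)[OF s] m(1) z1[unfolded x_def] Lam_def])
 note sr = sl_reflect[OF s]
 have "0 <= integral {0..1} (%x. w x * ((1 - x^2) * (- phi1 (- x))^2 - Lam * (phi (- x))^2))"
  by (rule picone_half[OF slD(1,2,3)[OF sr] m(1) z2[unfolded x_def] Lam_def])
 also have "... = integral {0..1} (%x. (%x. w x * r x) (- x))" by (simp add: r_def weight_def)
 also have "... = integral {-1..0} (%x. w x * r x)"
  using Henstock_Kurzweil_Integration.integral_reflect_real[where a = "-1" and b = 0 and f = "%x. w x * r x"] by (simp only: minus_minus minus_zero)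
 finally have "0 <= integral {-1..0} (%x. w x * r x) + integral {0..1} (%x. w x * r x)" using p1 by simp
 also have "... = integral II (%x. w x * r x)"
  by (rule Henstock_Kurzweil_Integration.integral_combine) (auto intro: weighted_integrable_on(1)[OF cr])
 also have "... = (LINT x|nu. r x)" by (rule weighted_integrable_on(2)[OF cr, symmetric])
 also have "... = (LINT x|nu. (1 - x^2) * (phi1 x)^2) - Lam * (LINT x|nu. (phi x)^2)"
  unfolding r_def by (subst Bochner_Integration.integral_diff) (auto intro!: integrable_cont continuous_intros slD(2,3)[OF s])
 finally have 1: "Lam * ip phi phi <= (LINT x|nu. (1 - x^2) * (phi1 x)^2)" by (simp add: ip_def power2_eq_square)
 have "0 <= c^2 * (LINT x|nu. x^2 * (phi x)^2)" by simp
 hence 2: "Lam * ip phi phi <= - ip g phi" using 1 energy[OF s] by linarith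
 have gg: "g = (%x. \<Sum>k\<in>{0..N}. (- (a k * ev k)) * psi k x)" by (auto simp: g_def sum_negf)
 have "- ip g phi = (\<Sum>k\<in>{0..N}. ev k * (a k)^2)"
  unfolding gg phi_def[abs_def] by (subst ip_sum_psi(2)) (auto simp: power2_eq_square mult_ac sum_negf)
 also have "... <= (\<Sum>k\<in>{0..N}. ev N * (a k)^2)" by (intro sum_mono mult_right_mono ev_mono(2)) auto
 finally have "Lam * (?A a) <= ev N * (?A a)"
  using 2 unfolding phi_def[abs_def] by (subst (asm) ip_sum_psi(2)) (auto simp: power2_eq_square sum_distrib_left)
 moreover have "(?A a) > 0" using a(1) by (auto intro!: sum_pos2)
 ultimately have "Lam <= ev N" by simp
 moreover have "(real N / (2 * pi))^2 <= Lam" unfolding Lam_def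
  using m by (intro power_mono) (auto simp: field_simps)
 ultimately show ?thesis by linarith
qed

end

section \<open>Asymptotics at infinity\<close>

text \<open>F + K / x is nonincreasing and F - K / x nondecreasing, so F varies by at most K / x
  beyond x.\<close>

lemma limit_from_deriv_bound:
 fixes F :: "real => real"
 assumes d: "!!x. 1 <= x ==> DERIV F x :> F' x" and b: "!!x. 1 <= x ==> (abs (F' x)) <= K / x^2"
 obtains l where "(F ---> l) at_top"
proof -
 have K0: "K >= 0" using b[of 1] by force
 have dK: "DERIV (%x. K / x) x :> - (K / x^2)" if "1 <= x" for x
  using that by (auto intro!: derivative_eq_intros simp: power2_eq_square)
 have cF: "continuous_on {x..y} F" if "1 <= x" for x y
  using d that by (meson DERIV_isCont atLeastAtMost_iff continuous_at_imp_continuous_on order_trans)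
 have cK: "continuous_on {x..y} (%x. K / x)" if "1 <= x" for x y using that by (intro continuous_intros) auto
 have B: "abs (F y - F x) <= K / x" if xy: "1 <= x" "x <= y" for x y
 proof -
  have 1: "F y + K / y <= F x + K / x"
  proof (rule nonincreasing_from_deriv[where f = "%x. F x + K / x" and f' = "%x. F' x + - (K / x^2)"])
   fix z assume z: "x < z" "z < y"
   show "DERIV (%x. F x + K / x) z :> F' z + - (K / z^2)" by (rule DERIV_add[OF d dK]) (use z xy in auto)
   show "F' z + - (K / z^2) <= 0" using b[of z] z xy by linarith
  qed (use xy in "auto intro!: continuous_on_add cF cK")
  have 2: "F x - K / x <= F y - K / y"
  proof (rule nondecreasing_from_deriv[where f = "%x. F x - K / x" and f' = "%x. F' x - - (K / x^2)"])
   fix z assume z: "x < z" "z < y"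
   show "DERIV (%x. F x - K / x) z :> F' z - - (K / z^2)" by (rule DERIV_diff[OF d dK]) (use z xy in auto)
   show "0 <= F' z - - (K / z^2)" using b[of z] z xy by linarith
  qed (use xy in "auto intro!: continuous_on_diff cF cK")
  have "K / y >= 0" using K0 xy by simp
  thus ?thesis using 1 2 by linarith
 qed
 have Klim: "((%x. K / x) ---> 0) at_top" by (rule tendsto_divide_0[OF tendsto_const filterlim_at_top_imp_at_infinity[OF filterlim_ident]])
 have "Cauchy (%n. F (real n))"
 proof (rule metric_CauchyI)
  fix e :: real assume e: "e > 0"
  have "\<forall>\<^sub>F x in at_top. K / x < e / 2" using Klim e by (intro order_tendstoD(2)[of _ 0]) auto
  then obtain X where X: "!!x. x >= X ==> K / x < e / 2" by (auto simp: eventually_at_top_linorder)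
  obtain M where M: "real M >= max X 1" using real_arch_simple by blast
  show "EX M. ALL m>=M. ALL n>=M. dist (F (real m)) (F (real n)) < e"
  proof (intro exI[of _ M] allI impI)
   fix m n assume mn: "m >= M" "n >= M"
   have r: "1 <= real M" "X <= real M" "real M <= real m" "real M <= real n" using M mn by auto
   have "abs (F (real m) - F (real M)) < e / 2" "abs (F (real n) - F (real M)) < e / 2"
    using B[OF r(1,3)] B[OF r(1,4)] X[OF r(2)] by linarith+
   thus "dist (F (real m)) (F (real n)) < e" unfolding dist_real_def by linarith
  qed
 qed
 then obtain l where l: "(%n. F (real n)) ----> l" using Cauchy_convergent convergent_def by blast
 have "abs (F x - l) <= K / x" if x: "1 <= x" for x
 proof (rule LIMSEQ_le_const2)
  show "(%n. (abs (F x - F (real n)))) ----> (abs (F x - l))" by (intro tendsto_intros l)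
  obtain M where "real M >= x" using real_arch_simple by blast
  thus "EX N. ALL n>=N. (abs (F x - F (real n))) <= K / x"
   using B[OF x] by (intro exI[of _ M] allI impI) (simp add: abs_minus_commute[of "F x"])
 qed
 hence "\<forall>\<^sub>F x in at_top. norm (F x - l) <= K / x" by (intro eventually_mono[OF eventually_ge_at_top[of 1]]) auto
 hence "((%x. F x - l) ---> 0) at_top" by (rule Lim_null_comparison[OF _ Klim])
 thus ?thesis using that LIM_zero_cancel by blast
qed

context wt begin

text \<open>Up to a constant factor this is z^(-(al + 1/2)) J(z) with the Bessel function J of order
  al + 1/2, by Poisson's integral. \<open>bes1\<close> and \<open>bes2\<close> are minus its first
  and second derivatives.\<close>

definition bes :: "real => real" where "bes z = (LINT y|nu. cos (z * y))"
definition bes1 :: "real => real" where "bes1 z = (LINT y|nu. y * sin (z * y))"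
definition bes2 :: "real => real" where "bes2 z = (LINT y|nu. y^2 * cos (z * y))"

lemma bes_deriv: "DERIV bes z :> - bes1 z" "DERIV bes1 z :> bes2 z"
proof -
 interpret B: pf al 1 by unfold_locales (use alpha0 in auto)
 have i: "integrable nu (%_. 1 :: real)" "integrable nu (%y. y :: real)" by (intro integrable_cont continuous_intros)+
 show "DERIV bes z :> - bes1 z"
  using B.trig_deriv(1)[OF i(1), of z] unfolding B.Cop_def[abs_def] B.Sop_def bes_def[abs_def] bes1_def by (simp add: mult.commute)
 show "DERIV bes1 z :> bes2 z"
  using B.trig_deriv(2)[OF i(2), of z] unfolding B.Cop_def B.Sop_def[abs_def] bes1_def[abs_def] bes2_def by (simp add: mult.commute power2_eq_square)
qed

text \<open>Bessel's equation for \<open>bes\<close>, obtained by integrating the derivative of (1 -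
  y^2)^(al + 1) sin(z y), which vanishes at both endpoints.\<close>

lemma bes_ode: "z * (bes z - bes2 z) = 2 * (al + 1) * bes1 z"
proof -
 let ?A = "LINT y|nu. z * (cos (z * y) - y^2 * cos (z * y)) - 2 * (al + 1) * (y * sin (z * y))"
 interpret B: pf al 1 by unfold_locales (use alpha0 in auto)
 have "?A =
   (1 - 1^2) powr (al + 1) * sin (z * 1) - (1 - (-1)^2) powr (al + 1) * sin (z * (-1))"
 proof (rule wt_ftc[where G = "%y. (1 - y^2) powr (al + 1) * sin (z * y)"])
  fix y :: real assume y: "y : {-1<..<1}"
  have ds: "DERIV (%y. sin (z * y)) y :> cos (z * y) * z" by (auto intro!: derivative_eq_intros)
  show "DERIV (%y. (1 - y^2) powr (al + 1) * sin (z * y)) y :> w y * (z * (cos (z * y) - y^2 * cos (z * y)) - 2 * (al + 1) * (y * sin (z * y)))"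
   by (rule DERIV_cong[OF DERIV_mult[OF B.dp[OF y] ds]]) (unfold B.p_eq[OF y], simp add: algebra_simps)
 qed (intro continuous_intros B.contp order_refl)+
 also have "... = 0" by simp
 finally have "?A = 0" .
 moreover have "integrable nu (%y. cos (z * y))" "integrable nu (%y. y^2 * cos (z * y))" "integrable nu (%y. y * sin (z * y))"
  by (intro integrable_cont continuous_intros)+
 ultimately show ?thesis by (simp add: bes_def bes1_def bes2_def)
qed

text \<open>Excludes the trivial solution: the energy at z = 1 becomes positive, and with it the
  limiting amplitude A^2 + B^2.\<close>

lemma bes_1_pos: "bes 1 > 0"
proof -
 have p: "cos y > 0" if "y : II" for y :: real
  using that pi_gt3 by (intro cos_gt_zero_pi) (auto simp: field_simps)
 have "bes 1 >= 0" unfolding bes_def by (intro Bochner_Integration.integral_nonneg_AE AE_I2) (use p in "auto simp: space_nu intro: less_imp_le")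
 moreover have "bes 1 ~= 0"
 proof
  assume "bes 1 = 0"
  hence "(LINT y|nu. cos y) = 0" by (simp add: bes_def)
  from integral_pos_of_cont[OF _ _ this, of 0] p show False by (force intro!: continuous_intros)
 qed
 ultimately show ?thesis by simp
qed

text \<open>The function \<open>Z(z) = z powr (al + 1) bes z\<close> solves \<open>Z'' + (1 - al(al + 1)/z\<^sup>2) Z = 0\<close>, so its phase coordinates \<open>X, Y\<close> have
  integrable derivatives.\<close>

lemma bes_asymp:
 obtains A B where "A^2 + B^2 > 0"
  "((%z. z powr (al + 1) * bes z - (A * cos z + B * sin z)) ---> 0) at_top"
  "((%z. z powr (al + 1) * bes1 z - (A * sin z - B * cos z)) ---> 0) at_top"
proof -
 let ?A = "%a z. - (a / z^2) * exp (a / z)"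
 define Z where "Z z = z powr (al + 1) * bes z" for z
 define Zd where "Zd z = z powr (al + 1) * (- bes1 z + (al + 1) / z * bes z)" for z
 define a where "a = al * (al + 1)"
 have a0: "a >= 0" using alpha0 by (simp add: a_def)
 have dpow: "DERIV (%z. z powr (al + 1)) z :> (al + 1) / z * z powr (al + 1)" if "z >= 1" for z :: real
  using has_real_derivative_powr[of z "al + 1"] that by (simp add: powr_add divide_simps)
 have dZ: "DERIV Z z :> Zd z" if "z >= 1" for z
  unfolding Z_def[abs_def] Zd_def by (rule DERIV_cong[OF DERIV_mult[OF dpow[OF that] bes_deriv(1)]]) (simp add: algebra_simps)
 have dZd: "DERIV Zd z :> (a / z^2 - 1) * Z z" if z: "z >= 1" for z
 proof -
  have d1: "DERIV (%z. (al + 1) / z) z :> - ((al + 1) / z^2)"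
  proof -
   have "DERIV (%z. b / z) z :> - (b / z^2)" for b
    by (rule DERIV_cong[OF DERIV_divide[OF DERIV_const DERIV_ident]]) (use z in "auto simp: power2_eq_square")
   thus ?thesis .
  qed
  have o: "bes2 z = bes z - 2 * (al + 1) * bes1 z / z" using bes_ode[of z] z by (simp add: field_simps)
  show ?thesis unfolding Zd_def[abs_def]
   by (rule DERIV_cong[OF DERIV_mult[OF dpow[OF z] DERIV_add[OF DERIV_minus[OF bes_deriv(2)] DERIV_mult[OF d1 bes_deriv(1)]]]])
     (use z in "simp add: o Z_def a_def field_simps power2_eq_square")
 qed
 define En where "En z = (Z z)^2 + (Zd z)^2" for z
 have dE: "DERIV En z :> 2 * a / z^2 * Z z * Zd z" if z: "z >= 1" for z
  unfolding En_def[abs_def] by (rule DERIV_cong[OF DERIV_add[OF DERIV_power[OF dZ[OF z]] DERIV_power[OF dZd[OF z]]]]) (simp add: algebra_simps)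
 have cr: "abs (2 * a / z^2 * Z z * Zd z) <= a / z^2 * En z" if z: "z >= 1" for z
 proof -
  have "2 * abs (Z z * Zd z) <= En z" using sum_squares_bound[of "abs (Z z)" "abs (Zd z)"] by (simp add: abs_mult En_def)
  hence "a / z^2 * (2 * abs (Z z * Zd z)) <= a / z^2 * En z" using a0 by (intro mult_left_mono) auto
  thus ?thesis using a0 by (simp add: abs_mult mult_ac)
 qed
 have cr1: "2 * a / z^2 * Z z * Zd z <= a / z^2 * En z" "- (a / z^2 * En z) <= 2 * a / z^2 * Z z * Zd z" if "z >= 1" for z
  using cr[OF that] by linarith+
 have dexp: "DERIV (%z. exp (b / z)) z :> - (b / z^2) * exp (b / z)" if "z >= 1" for z b :: real
  by (rule DERIV_cong[OF DERIV_fun_exp[OF DERIV_divide[OF DERIV_const DERIV_ident]]]) (use that in "auto simp: power2_eq_square")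
 have cE: "continuous_on {1..y} En" for y
  using dE by (meson DERIV_isCont atLeastAtMost_iff continuous_at_imp_continuous_on)
 have cX: "continuous_on {1..y} (%z. En z * exp (b / z))" for y b :: real by (intro continuous_on_mult cE continuous_intros) auto
 have up: "En z <= En 1 * exp a" if z: "z >= 1" for z
 proof -
  have "En z * exp (a / z) <= En 1 * exp (a / 1)"
  proof (rule nonincreasing_from_deriv[where f = "%z. En z * exp (a / z)" and
     f' = "%z. 2 * a / z^2 * Z z * Zd z * exp (a / z) + (?A a z) * En z", OF z cX])
   fix t assume t: "1 < t" "t < z"
   show "DERIV (%z. En z * exp (a / z)) t :> 2 * a / t^2 * Z t * Zd t * exp (a / t) + (?A a t) * En t"
    by (rule DERIV_mult[OF dE dexp]) (use t in auto)
   have "(2 * a / t^2 * Z t * Zd t - a / t^2 * En t) * exp (a / t) <= 0"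
    by (rule mult_nonpos_nonneg) (use cr1(1)[of t] t in "linarith, simp")
   thus "2 * a / t^2 * Z t * Zd t * exp (a / t) + (?A a t) * En t <= 0" by (simp add: algebra_simps)
  qed
  moreover have "En z * 1 <= En z * exp (a / z)" using a0 z by (intro mult_left_mono) (auto simp: En_def)
  ultimately show ?thesis by simp
 qed
 have lo: "En 1 * exp (- a) <= En z" if z: "z >= 1" for z
 proof -
  have "En 1 * exp ((- a) / 1) <= En z * exp ((- a) / z)"
  proof (rule nondecreasing_from_deriv[where f = "%z. En z * exp ((- a) / z)" and
     f' = "%z. 2 * a / z^2 * Z z * Zd z * exp ((- a) / z) + (?A (- a) z) * En z", OF z cX])
   fix t assume t: "1 < t" "t < z"
   show "DERIV (%z. En z * exp ((- a) / z)) t :> 2 * a / t^2 * Z t * Zd t * exp ((- a) / t) + (?A (- a) t) * En t"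
    by (rule DERIV_mult[OF dE dexp]) (use t in auto)
   have "0 <= (2 * a / t^2 * Z t * Zd t + a / t^2 * En t) * exp ((- a) / t)"
    by (rule mult_nonneg_nonneg) (use cr1(2)[of t] t in "linarith, simp")
   thus "0 <= 2 * a / t^2 * Z t * Zd t * exp ((- a) / t) + (?A (- a) t) * En t" by (simp add: algebra_simps)
  qed
  moreover have "En z * exp ((- a) / z) <= En z * 1" using a0 z by (intro mult_left_mono) (auto simp: En_def)
  ultimately show ?thesis by simp
 qed
 define K where "K = sqrt (En 1 * exp a)"
 have Zb: "abs (Z z) <= K" if "z >= 1" for z
 proof -
  have "(Z z)^2 <= En 1 * exp a" using up[OF that] zero_le_power2[of "Zd z"] unfolding En_def by linarith
  thus ?thesis unfolding K_def by (simp add: real_le_rsqrt)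
 qed
 define X where "X z = Z z * cos z - Zd z * sin z" for z
 define Y where "Y z = Z z * sin z + Zd z * cos z" for z
 have dX: "DERIV X z :> - (a / z^2 * Z z * sin z)" if z: "z >= 1" for z
  unfolding X_def[abs_def] by (rule DERIV_cong[OF DERIV_diff[OF DERIV_mult[OF dZ[OF z] DERIV_cos] DERIV_mult[OF dZd[OF z] DERIV_sin]]]) (simp add: algebra_simps)
 have dY: "DERIV Y z :> a / z^2 * Z z * cos z" if z: "z >= 1" for z
  unfolding Y_def[abs_def] by (rule DERIV_cong[OF DERIV_add[OF DERIV_mult[OF dZ[OF z] DERIV_sin] DERIV_mult[OF dZd[OF z] DERIV_cos]]]) (simp add: algebra_simps)
 have bb: "abs (a / z^2 * Z z * t) <= a * K / z^2" if z: "z >= 1" "abs t <= 1" for z t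
 proof -
  have "a / z^2 * abs (Z z) * abs t <= a / z^2 * K * 1" using a0 Zb z by (intro mult_mono) (auto intro!: mult_nonneg_nonneg simp: K_def En_def)
  thus ?thesis using a0 by (simp add: abs_mult)
 qed
 obtain A where A: "(X ---> A) at_top"
  by (rule limit_from_deriv_bound[of X "%z. - (a / z^2 * Z z * sin z)" "a * K"]) (use dX bb in auto)
 obtain B where B: "(Y ---> B) at_top"
  by (rule limit_from_deriv_bound[of Y "%z. a / z^2 * Z z * cos z" "a * K"]) (use dY bb in auto)
 have rot: "(p * c - q * s)^2 + (p * s + q * c)^2 = (p^2 + q^2) * (s^2 + c^2)"
  "(p * c - q * s) * c + (p * s + q * c) * s = p * (s^2 + c^2)"
  "- ((p * c - q * s) * s) + (p * s + q * c) * c = q * (s^2 + c^2)" for p q s c :: real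
  by (simp_all add: power2_eq_square algebra_simps)
 have XY: "(X z)^2 + (Y z)^2 = En z" for z unfolding X_def Y_def rot by (simp add: En_def)
 have ZX: "Z z = X z * cos z + Y z * sin z" "Zd z = - (X z * sin z) + Y z * cos z" for z
  unfolding X_def Y_def rot by simp_all
 have bn: "((%z. g z * t z) ---> 0) at_top" if "(g ---> 0) at_top" "!!z. (abs (t z)) <= 1" for g t :: "real => real"
 proof (rule Lim_null_comparison[OF _ tendsto_rabs_zero[OF that(1)]])
  show "\<forall>\<^sub>F z in at_top. norm (g z * t z) <= abs (g z)" using that(2) by (auto simp: abs_mult mult_left_le)
 qed
 note X0 = LIM_zero[OF A] and Y0 = LIM_zero[OF B]
 have Zl: "((%z. Z z - (A * cos z + B * sin z)) ---> 0) at_top"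
 proof -
  have "((%z. (X z - A) * cos z + (Y z - B) * sin z) ---> 0 + 0) at_top" by (intro tendsto_add bn X0 Y0) auto
  thus ?thesis unfolding ZX(1) by (simp add: algebra_simps)
 qed
 have Zdl: "((%z. Zd z - (- (A * sin z) + B * cos z)) ---> 0) at_top"
 proof -
  have "((%z. (Y z - B) * cos z - (X z - A) * sin z) ---> 0 - 0) at_top" by (intro tendsto_diff bn X0 Y0) auto
  thus ?thesis unfolding ZX(2) by (simp add: algebra_simps)
 qed
 have iz: "((%z. 1 / z) ---> (0::real)) at_top" by (rule tendsto_divide_0[OF tendsto_const filterlim_at_top_imp_at_infinity[OF filterlim_ident]])
 have Zz: "((%z. (al + 1) * Z z / z) ---> 0) at_top"
 proof (rule Lim_null_comparison)
  show "((%z. (al + 1) * K * (1 / z)) ---> 0) at_top" using tendsto_mult_left[OF iz, of "(al + 1) * K"] by simp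
  show "\<forall>\<^sub>F z in at_top. norm ((al + 1) * Z z / z) <= (al + 1) * K * (1 / z)"
  proof (rule eventually_mono[OF eventually_ge_at_top[of 1]])
   fix z :: real assume z: "1 <= z"
   have "(al + 1) * abs (Z z) / z <= (al + 1) * K / z" using Zb[OF z] z alpha0 by (intro divide_right_mono mult_left_mono) auto
   thus "norm ((al + 1) * Z z / z) <= (al + 1) * K * (1 / z)" using z alpha0 by (simp add: abs_mult)
  qed
 qed
 have "((%z. z powr (al + 1) * bes1 z - (A * sin z - B * cos z)) ---> 0) at_top"
 proof (rule Lim_transform_eventually)
  show "((%z. - (Zd z - (- (A * sin z) + B * cos z)) + (al + 1) * Z z / z) ---> 0) at_top"
   using tendsto_add[OF tendsto_minus[OF Zdl] Zz] by simp
  show "\<forall>\<^sub>F z in at_top. - (Zd z - (- (A * sin z) + B * cos z)) + (al + 1) * Z z / z = z powr (al + 1) * bes1 z - (A * sin z - B * cos z)"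
   by (rule eventually_mono[OF eventually_ge_at_top[of 1]]) (simp add: Zd_def Z_def algebra_simps)
 qed
 moreover have "A^2 + B^2 > 0"
 proof -
  have "((%z. (X z)^2 + (Y z)^2) ---> A^2 + B^2) at_top" by (intro tendsto_intros A B)
  hence "((%z. En z) ---> A^2 + B^2) at_top" by (simp only: XY)
  hence "En 1 * exp (- a) <= A^2 + B^2"
   by (rule tendsto_lowerbound) (intro eventually_mono[OF eventually_ge_at_top[of 1]] lo, auto)
  moreover have "En 1 > 0" using bes_1_pos by (simp add: En_def Z_def sum_power2_gt_zero_iff)
  hence "En 1 * exp (- a) > 0" by simp
  ultimately show ?thesis by linarith
 qed
 ultimately show ?thesis using that Zl unfolding Z_def by blast
qed

end

lemma square_diff_null:
 fixes f F :: "real => real"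
 assumes d: "((%x. f x - F x) ---> 0) at_top" and b: "!!x. (abs (F x)) <= M"
 shows "((%x. (f x)^2 - (F x)^2) ---> 0) at_top"
proof -
 have "((%x. F x * (f x - F x)) ---> 0) at_top"
 proof (rule Lim_null_comparison)
  show "((%x. M * abs (f x - F x)) ---> 0) at_top" using tendsto_mult_left[OF tendsto_rabs_zero[OF d], of M] by simp
  show "\<forall>\<^sub>F x in at_top. norm (F x * (f x - F x)) <= M * abs (f x - F x)"
   using b by (auto simp: abs_mult intro!: always_eventually mult_right_mono)
 qed
 from tendsto_add[OF tendsto_power[OF d, of 2] tendsto_mult_left[OF this, of 2]]
 have "((%x. (f x - F x)^2 + 2 * (F x * (f x - F x))) ---> 0) at_top" by simp
 moreover have "(f x - F x)^2 + 2 * (F x * (f x - F x)) = (f x)^2 - (F x)^2" for x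
  by (simp add: power2_eq_square algebra_simps)
 ultimately show ?thesis by simp
qed

section \<open>The extension of the eigenfunctions to the real line\<close>

context pf begin

definition Top1 :: "(real => real) => real => real" where
 "Top1 h x = - Sop (%y. c * y * Cop h y) x + Cop (%y. c * y * Sop h y) x"
definition Top2 :: "(real => real) => real => real" where
 "Top2 h x = - Cop (%y. c * y * (c * y * Cop h y)) x - Sop (%y. c * y * (c * y * Sop h y)) x"

lemma Top_deriv:
 assumes "integrable nu h"
 shows "(Top h has_real_derivative Top1 h x) (at x)" "(Top1 h has_real_derivative Top2 h x) (at x)"
  "continuous_on S (Top h)" "continuous_on S (Top1 h)" "continuous_on S (Top2 h)"
proof -
 have i: "integrable nu (Cop h)" "integrable nu (Sop h)" by (intro integrable_cont trig_cont assms)+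
 note i1 = trig_integrable(3)[OF i(1)] trig_integrable(3)[OF i(2)]
 note i2 = trig_integrable(3)[OF i1(1)] trig_integrable(3)[OF i1(2)]
 show 1: "(Top h has_real_derivative Top1 h x) (at x)" for x
  unfolding Top_def[abs_def] Top1_def by (rule DERIV_add[OF trig_deriv(1)[OF i(1)] trig_deriv(2)[OF i(2)]])
 show 2: "(Top1 h has_real_derivative Top2 h x) (at x)" for x
  unfolding Top1_def[abs_def] Top2_def
  by (rule DERIV_cong[OF DERIV_add[OF DERIV_minus[OF trig_deriv(2)[OF i1(1)]] trig_deriv(1)[OF i1(2)]]]) simp
 show "continuous_on S (Top h)" "continuous_on S (Top1 h)"
  using 1 2 by (meson DERIV_isCont continuous_at_imp_continuous_on)+
 show "continuous_on S (Top2 h)" unfolding Top2_def by (intro continuous_intros trig_cont i2)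
qed

lemma Top_ode:
 assumes s: "sl phi phi1 g"
 shows "(1 - x^2) * Top2 phi x - (2 * al + 2) * x * Top1 phi x - c^2 * x^2 * Top phi x = Top g x"
 using trig_ode(1)[OF sl_trig(1)[OF s], of x] trig_ode(2)[OF sl_trig(2)[OF s], of x]
 unfolding Top_def Top1_def Top2_def by (simp add: algebra_simps)

text \<open>By the addition theorem for cos(a - b), F* F is a convolution with \<open>bes\<close>
  against the weighted measure. The behaviour of \<open>Top h\<close> at infinity is thus that of a
  shifted Bessel kernel.\<close>

lemma Top_kernel:
 assumes h: "integrable nu h"
 shows "Top h x = (LINT t|nu. bes (c * (x - t)) * h t)" "Top1 h x = - c * (LINT t|nu. bes1 (c * (x - t)) * h t)"
proof -
 let ?A = "LINT t|nu. bes1 (c * (x - t)) * h t"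
 let ?B = "LINT t|nu. bes (c * (x - t)) * h t"
 have ic: "integrable nu (%y. k y :: real)" if "contI k" for k by (rule integrable_cont[OF that])
 have itr: "integrable nu (%t. Cop k t * h t)" "integrable nu (%t. Sop k t * h t)" if "contI k" for k
 proof -
  have "l2 k" by (rule l2_cont[OF that])
  hence "abs (Cop k t) <= 2 * nrm k" "abs (Sop k t) <= 2 * nrm k" for t by (auto intro: Cop_bound_nrm)
  thus "integrable nu (%t. Cop k t * h t)" "integrable nu (%t. Sop k t * h t)"
   using bound_integral(1)[OF h _ cont_meas[OF trig_cont(1)[OF ic[OF that]]], of "2 * nrm k"]
    bound_integral(1)[OF h _ cont_meas[OF trig_cont(2)[OF ic[OF that]]], of "2 * nrm k"] by blast+
 qed
 let ?c = "%y. cos (c * x * y)" and ?s = "%y. sin (c * x * y)"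
 have cc: "contI ?c" "contI ?s" by (intro continuous_intros)+
 have cy: "contI (%y. c * (y * ?c y))" "contI (%y. c * (y * ?s y))" by (intro continuous_intros)+
 have "Top h x = (LINT y|nu. Cop h y * ?c y) + (LINT y|nu. Sop h y * ?s y)"
  unfolding Top_def Cop_def[of "Cop h"] Sop_def[of "Sop h"] by (simp only: mult.commute)
 also have "... = (LINT y|nu. h y * Cop ?c y) + (LINT y|nu. h y * Sop ?s y)"
  by (simp only: Cop_sym[OF h ic[OF cc(1)]] Cop_sym[OF h ic[OF cc(2)]])
 also have "... = (LINT y|nu. Cop ?c y * h y + Sop ?s y * h y)"
  using itr(1)[OF cc(1)] itr(2)[OF cc(2)] by (simp add: mult.commute)
 also have "... = ?B"
 proof -
  have "Cop ?c t + Sop ?s t = bes (c * (x - t))" for t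
  proof -
   have "Cop ?c t + Sop ?s t = (LINT y|nu. cos (c * t * y) * ?c y + sin (c * t * y) * ?s y)"
    unfolding Cop_def Sop_def by (subst Bochner_Integration.integral_add) (auto intro!: ic continuous_intros)
   also have "... = bes (c * (x - t))" unfolding bes_def
   proof (rule integral_eqI[OF refl])
    fix y
    have "c * (x - t) * y = c * x * y - c * t * y" by (simp add: algebra_simps)
    thus "cos (c * t * y) * ?c y + sin (c * t * y) * ?s y = cos (c * (x - t) * y)" by (simp add: cos_diff mult.commute)
   qed
   finally show ?thesis .
  qed
  thus ?thesis by (simp add: distrib_right[symmetric])
 qed
 finally show "Top h x = ?B" .
 have "Top1 h x = - (LINT y|nu. Cop h y * (c * (y * ?s y))) + (LINT y|nu. Sop h y * (c * (y * ?c y)))"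
  unfolding Top1_def Cop_def[of "%y. c * y * Sop h y"] Sop_def[of "%y. c * y * Cop h y"] by (simp only: mult_ac)
 also have "... = - (LINT y|nu. h y * Cop (%y. c * (y * ?s y)) y) + (LINT y|nu. h y * Sop (%y. c * (y * ?c y)) y)"
  by (simp only: Cop_sym[OF h ic[OF cy(2)]] Cop_sym[OF h ic[OF cy(1)]])
 also have "... = (LINT y|nu. - (Cop (%y. c * (y * ?s y)) y * h y) + Sop (%y. c * (y * ?c y)) y * h y)"
  using itr(1)[OF cy(2)] itr(2)[OF cy(1)] by (simp add: mult.commute)
 also have "... = (LINT t|nu. - c * (bes1 (c * (x - t)) * h t))"
 proof -
  have e: "- Cop (%y. c * (y * ?s y)) t + Sop (%y. c * (y * ?c y)) t = - c * bes1 (c * (x - t))" for t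
  proof -
   have "- Cop (%y. c * (y * ?s y)) t + Sop (%y. c * (y * ?c y)) t = (LINT y|nu. - (cos (c * t * y) * (c * (y * ?s y))) + sin (c * t * y) * (c * (y * ?c y)))"
    unfolding Cop_def Sop_def by (subst Bochner_Integration.integral_add) (auto intro!: ic continuous_intros)
   also have "... = (LINT y|nu. - c * (y * sin (c * (x - t) * y)))"
   proof (rule integral_eqI[OF refl])
    fix y
    have "c * (x - t) * y = c * x * y - c * t * y" by (simp add: algebra_simps)
    thus "- (cos (c * t * y) * (c * (y * ?s y))) + sin (c * t * y) * (c * (y * ?c y)) = - c * (y * sin (c * (x - t) * y))"
     by (simp add: sin_diff algebra_simps)
   qed
   also have "... = - c * bes1 (c * (x - t))" unfolding bes1_def by (rule integral_mult_right_zero)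
   finally show ?thesis .
  qed
  have "- (p * q) + r * q = - c * (m * q)" if "- p + r = - c * m" for p q r m :: real
  proof -
   have "- (p * q) + r * q = (- p + r) * q" by (simp add: algebra_simps)
   thus ?thesis unfolding that by (simp only: mult.assoc)
  qed
  from this[OF e] show ?thesis by presburger
 qed
 also have "... = - c * ?A" by (rule integral_mult_right_zero)
 finally show "Top1 h x = - c * ?A" .
qed

lemma uniform_integral_limit:
 fixes k v :: "real => real => real"
 assumes h: "integrable nu h"
  and k: "!!x. contI (k x)" "!!x. contI (v x)"
  and u: "!!e. e > 0 ==> \<forall>\<^sub>F x in at_top. ALL t:II. (abs (k x t - v x t)) <= e"
 shows "((%x::real. (LINT t|nu. k x t * h t) - (LINT t|nu. v x t * h t)) ---> 0) at_top"
proof -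
 let ?A = "%k x. LINT t|nu. (k x t - v x t) * h t"
 have cb: "integrable nu (%t. g t * h t)" if g: "contI g" for g :: "real => real"
 proof -
  obtain B where "!!x. x : II ==> (abs (g x)) <= B" using cont_bdd[OF g] by blast
  thus ?thesis by (rule bound_integral(1)[OF h _ cont_meas[OF g]])
 qed
 have eq: "(LINT t|nu. k x t * h t) - (LINT t|nu. v x t * h t) = (?A k x)" for x
  using cb[OF k(1)] cb[OF k(2)] by (simp add: left_diff_distrib)
 define I where "I = (LINT t|nu. (abs (h t)))"
 have I0: "I >= 0" by (simp add: I_def)
 show ?thesis unfolding eq
 proof (rule tendstoI)
  fix e :: real assume e: "e > 0"
  hence "e / (2 * (I + 1)) > 0" using I0 by simp
  from u[OF this] show "\<forall>\<^sub>F x in at_top. dist (?A k x) 0 < e"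
  proof (rule eventually_mono)
   fix x assume x: "ALL t:II. (abs (k x t - v x t)) <= e / (2 * (I + 1))"
   have "abs (?A k x) <= e / (2 * (I + 1)) * I" unfolding I_def
    by (rule bound_integral(2)[OF h]) (use x in "auto simp: I_def intro!: cont_meas continuous_on_diff k")
   also have "... <= e / (2 * (I + 1)) * (I + 1)" using I0 e by (intro mult_left_mono) auto
   also have "... < e"
   proof -
    have "0 < e + I * e" using I0 e by (intro add_pos_nonneg) auto
    thus ?thesis using I0 by (simp add: field_simps)
   qed
   finally show "dist (?A k x) 0 < e" by simp
  qed
 qed
qed

text \<open>The prefactor (c x)^(al + 1) is not the natural one for the argument c (x - t). The
  ratio x / (x - t) lies between x / (x + 1) and x / (x - 1), so it tends to 1 uniformly in
  t.\<close>

lemma shifted_kernel_uniform: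
 assumes W: "((%z. z powr (al + 1) * b z - V z) ---> 0) at_top" and V: "!!z. (abs (V z)) <= M" and e: "e > 0"
 shows "\<forall>\<^sub>F x in at_top. ALL t:II. (abs ((c * x) powr (al + 1) * b (c * (x - t)) - V (c * (x - t)))) <= e"
proof -
 have M0: "M >= 0" using V[of 0] by force
 define d where "d = min 1 (e / (M + 2))"
 have d: "0 < d" "d <= 1" using e M0 by (auto simp: d_def)
 have "d * (M + 2) <= e / (M + 2) * (M + 2)" using M0 by (intro mult_right_mono) (auto simp: d_def)
 hence d2: "d * (M + 2) <= e" using M0 by simp
 have "\<forall>\<^sub>F z in at_top. (abs (z powr (al + 1) * b z - V z)) < d" using tendstoD[OF W d(1)] by simp
 then obtain z0 where z0: "!!z. z >= z0 ==> (abs (z powr (al + 1) * b z - V z)) < d" by (auto simp: eventually_at_top_linorder)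
 have l1: "((%x. (x / (x - 1)) powr (al + 1)) ---> 1 powr (al + 1)) at_top"
 proof (rule tendsto_powr[OF _ tendsto_const])
  show "((%x::real. x / (x - 1)) ---> 1) at_top" by real_asymp
 qed simp
 have l2: "((%x. (x / (x + 1)) powr (al + 1)) ---> 1 powr (al + 1)) at_top"
 proof (rule tendsto_powr[OF _ tendsto_const])
  show "((%x::real. x / (x + 1)) ---> 1) at_top" by real_asymp
 qed simp
 have "\<forall>\<^sub>F x in at_top. (x / (x - 1)) powr (al + 1) < 1 + d" using order_tendstoD(2)[OF l1, of "1 + d"] d by simp
 moreover have "\<forall>\<^sub>F x in at_top. 1 - d < (x / (x + 1)) powr (al + 1)" using order_tendstoD(1)[OF l2, of "1 - d"] d by simp
 ultimately show ?thesis using eventually_ge_at_top[of "max 2 (z0 / c + 1)"]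
 proof eventually_elim
  case (elim x)
  show ?case
  proof
   fix t :: real assume t: "t : II"
   have x2: "x >= 2" "z0 / c + 1 <= x" using elim by auto
   define z where "z = c * (x - t)"
   define \<rho> where "\<rho> = (x / (x - t)) powr (al + 1)"
   have "z0 / c <= x - t" using x2 t by auto
   hence zz: "z0 <= z" using c0 by (simp add: z_def pos_divide_le_eq mult.commute)
   have "\<rho> <= (x / (x - 1)) powr (al + 1)" unfolding \<rho>_def using x2 t alpha0 by (intro powr_mono2 divide_left_mono) auto
   moreover have "(x / (x + 1)) powr (al + 1) <= \<rho>" unfolding \<rho>_def using x2 t alpha0 by (intro powr_mono2 divide_left_mono) auto
   ultimately have \<rho>: "abs (\<rho> - 1) <= d" using elim by linarith
   have cx: "(c * x) powr (al + 1) = \<rho> * z powr (al + 1)"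
   proof -
    have "c * x = x / (x - t) * z" using x2 t by (simp add: z_def)
    thus ?thesis unfolding \<rho>_def by (simp only: powr_mult)
   qed
   define W' where "W' = z powr (al + 1) * b z"
   have w1: "abs (W' - V z) <= d" using z0[OF zz] by (simp add: W'_def)
   have w2: "abs W' <= M + 1" using w1 V[of z] d by linarith
   have "abs ((\<rho> - 1) * W') <= d * (M + 1)" unfolding abs_mult using \<rho> w2 d by (intro mult_mono) auto
   moreover have "\<rho> * W' - V z = (\<rho> - 1) * W' + (W' - V z)" by (simp add: algebra_simps)
   ultimately have "abs (\<rho> * W' - V z) <= d * (M + 1) + d" using w1 by linarith
   also have "... <= e" using d2 by (simp add: algebra_simps)
   finally show "abs ((c * x) powr (al + 1) * b (c * (x - t)) - V (c * (x - t))) <= e"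
    by (simp add: cx W'_def z_def[symmetric] mult.assoc)
  qed
 qed
qed

end

context gp begin

text \<open>On [-1, 1] one has \<open>Top (psi n) = lam n * psi n\<close>. This is therefore the
  extension of \<open>psi n\<close> with value 1 at the point 1, as \<open>outer_sol\<close>
  demands.\<close>

definition outU :: "nat => real => real" where "outU n x = Top (psi n) x / (lam n * psi n 1)"
definition outU1 :: "nat => real => real" where "outU1 n x = Top1 (psi n) x / (lam n * psi n 1)"

lemma psi_ode_T:
 "(1 - x^2) * Top2 (psi n) x - (2 * al + 2) * x * Top1 (psi n) x - c^2 * x^2 * Top (psi n) x = - ev n * Top (psi n) x"
 using Top_ode[OF sl_psi, of x n] by (simp only: Top_cmult)

text \<open>At infinity (c x)^(al + 1) \<open>Top (psi n) x\<close> behaves like P cos(cx) + Q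
  sin(cx), where (P, Q) arises from (A, B) by a rotation and a dilation with the transforms of
  \<open>psi n\<close> at 1. Hence P^2 + Q^2 = (A^2 + B^2) \<open>lam n\<close>
  (\<open>psi n 1\<close>)^2, and division by (\<open>lam n * psi n 1\<close>)^2 leaves a constant
  over \<open>lam n\<close>.\<close>

lemma outer_sol_psi: "EX K>0. ALL n. outer_sol al c (ev n) (outU n) (outU1 n) (K / lam n)"
proof -
 let ?A = "%A z B. A * sin z - B * cos z"
 let ?B = "%A z B. A * cos z + B * sin z"
 let ?C = "%n x. liouville_deriv al (outU n) (outU1 n) x"
 let ?D = "%n x. (ev n - c^2 * x^2) * outU n x - (2 * al + 2) * x * outU1 n x"
 let ?E = "1 powr ((al + 1) / 2) * c powr - (al + 1)"
 let ?F = "%x n P Q. (c * x) powr (al + 1) * Top1 (psi n) x - (- c) * (?A P (c * x) Q)"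
 obtain A B where AB: "A^2 + B^2 > 0"
  and b0: "((%z. z powr (al + 1) * bes z - (?B A z B)) ---> 0) at_top"
  and b1: "((%z. z powr (al + 1) * bes1 z - (?A A z B)) ---> 0) at_top"
  using bes_asymp by blast
 define M where "M = abs A + abs B"
 have trigb: "abs (?B p z q) <= abs p + abs q" "abs (?A p z q) <= abs p + abs q" for p q z :: real
 proof -
  have "abs (p * cos z) <= abs p" "abs (q * sin z) <= abs q" "abs (p * sin z) <= abs p" "abs (q * cos z) <= abs q"
   by (auto simp: abs_mult mult_left_le)
  thus "abs (?B p z q) <= abs p + abs q" "abs (?A p z q) <= abs p + abs q" by linarith+
 qed
 define K where "K = (A^2 + B^2) * (c powr - (al + 1))^2"
 have K0: "K > 0" using AB c0 by (simp add: K_def)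
 have "outer_sol al c (ev n) (outU n) (outU1 n) (K / lam n)" for n
 proof
  note i = psi_int[of n]
  show "al >= 0" "c > 0" by (fact alpha0, fact c0)
  define D where "D = lam n * psi n 1"
  have D0: "D ~= 0" using lam_pos[of n] psi1[of n] by (simp add: D_def)
  show "outU n 1 = 1" using D0 Top_psi_I[of 1 n] by (simp add: outU_def D_def)
  show dU: "(outU n has_real_derivative outU1 n x) (at x)" for x
   unfolding outU_def[abs_def] outU1_def by (rule DERIV_cdivide[OF Top_deriv(1)[OF i]])
  show "continuous_on {1..} (outU1 n)" unfolding outU1_def[abs_def] D_def[symmetric] by (intro continuous_intros Top_deriv(4)[OF i]) (use D0 in auto)
  show "(outU1 n has_real_derivative (?D n x) / (x^2 - 1)) (at x)" if x: "1 < x" for x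
  proof -
   have s: "x^2 - 1 ~= 0" using one_less_power[OF x, of 2] by simp
   have "Top2 (psi n) x * (x^2 - 1) = (ev n - c^2 * x^2) * Top (psi n) x - (2 * al + 2) * x * Top1 (psi n) x"
    using psi_ode_T[of x n] by (simp add: algebra_simps)
   hence "Top2 (psi n) x / D = (((ev n - c^2 * x^2) * Top (psi n) x - (2 * al + 2) * x * Top1 (psi n) x) / (x^2 - 1)) / D"
    using s by (simp add: eq_divide_eq)
   also have "... = (?D n x) / (x^2 - 1)"
    unfolding outU_def outU1_def D_def[symmetric] by (simp add: diff_divide_distrib mult.commute)
   finally show ?thesis
    unfolding outU1_def[abs_def] D_def[symmetric] by (intro DERIV_cong[OF DERIV_cdivide[OF Top_deriv(2)[OF i]]])
  qed
  define C1 S1 where "C1 = Cop (psi n) 1" "S1 = Sop (psi n) 1"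
  define P Q where "P = A * C1 - B * S1" "Q = A * S1 + B * C1"
  have PQ: "P^2 + Q^2 = (A^2 + B^2) * (D * psi n 1)"
  proof -
   have "P^2 + Q^2 = (A^2 + B^2) * (C1^2 + S1^2)" by (simp add: P_Q_def power2_eq_square algebra_simps)
   moreover have "C1^2 + S1^2 = D * psi n 1" by (simp add: C1_S1_def D_def lam_def Cop_psi power2_eq_square algebra_simps)
   ultimately show ?thesis by simp
  qed
  have ci: "integrable nu (%t. cos (c * t) * psi n t)" "integrable nu (%t. sin (c * t) * psi n t)"
   using trig_integrable(1,2)[OF i, of 1] by simp_all
  have ang: "c * (x - t) = c * x - c * t" for x t by (simp add: algebra_simps)
  have lin: "(LINT t|nu. (?B p (c * t) q) * psi n t) = p * C1 + q * S1" for p q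
  proof -
   have "(LINT t|nu. (?B p (c * t) q) * psi n t) = (LINT t|nu. p * (cos (c * t) * psi n t) + q * (sin (c * t) * psi n t))"
    by (simp add: algebra_simps)
   also have "... = p * C1 + q * S1" using ci by (simp add: C1_S1_def Cop_def Sop_def)
   finally show ?thesis .
  qed
  have e0: "(LINT t|nu. (?B A (c * (x - t)) B) * psi n t) = P * cos (c * x) + Q * sin (c * x)" for x
  proof -
   have "A * cos (c * (x - t)) + B * sin (c * (x - t)) = (?B A (c * x) B) * cos (c * t) + (?A A (c * x) B) * sin (c * t)" for t
    unfolding ang cos_diff sin_diff by (simp add: algebra_simps)
   thus ?thesis by (simp only: lin) (simp add: P_Q_def algebra_simps)
  qed
  have e1: "(LINT t|nu. (?A A (c * (x - t)) B) * psi n t) = P * sin (c * x) - Q * cos (c * x)" for x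
  proof -
   have "A * sin (c * (x - t)) - B * cos (c * (x - t)) = (?A A (c * x) B) * cos (c * t) + (- A * cos (c * x) - B * sin (c * x)) * sin (c * t)" for t
    unfolding ang cos_diff sin_diff by (simp add: algebra_simps)
   thus ?thesis by (simp only: lin) (simp add: P_Q_def algebra_simps)
  qed
  have contb: "continuous_on S (%t. bes (c * (x - t)))" "continuous_on S (%t. bes1 (c * (x - t)))" for S x
   by (rule continuous_on_compose2[of UNIV]; use bes_deriv in "auto intro!: continuous_intros continuous_at_imp_continuous_on intro: DERIV_isCont")+
  have f0: "((%x. (c * x) powr (al + 1) * Top (psi n) x - (?B P (c * x) Q)) ---> 0) at_top"
  proof -
   have "((%x. (LINT t|nu. (c * x) powr (al + 1) * bes (c * (x - t)) * psi n t) - (LINT t|nu. (?B A (c * (x - t)) B) * psi n t)) ---> 0) at_top"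
    by (rule uniform_integral_limit[OF i _ _ shifted_kernel_uniform[OF b0 trigb(1)]]) (intro continuous_intros contb)+
   thus ?thesis unfolding e0 Top_kernel(1)[OF i] by (simp only: mult.assoc integral_mult_right_zero)
  qed
  have f1: "((%x. (c * x) powr (al + 1) * Top1 (psi n) x - (- c) * (?A P (c * x) Q)) ---> (- c) * 0) at_top"
  proof -
   have "((%x. (LINT t|nu. (c * x) powr (al + 1) * bes1 (c * (x - t)) * psi n t) - (LINT t|nu. (?A A (c * (x - t)) B) * psi n t)) ---> 0) at_top"
    by (rule uniform_integral_limit[OF i _ _ shifted_kernel_uniform[OF b1 trigb(2)]]) (intro continuous_intros contb)+
   from tendsto_mult_left[OF this, of "- c"] show ?thesis
    unfolding e1 Top_kernel(2)[OF i] by (simp only: mult.assoc integral_mult_right_zero right_diff_distrib mult.left_commute)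
  qed
  define F where "F x = (?B P (c * x) Q) / D" for x
  define G where "G x = - (?A P (c * x) Q) / D" for x
  have FG: "(F x)^2 + (G x)^2 = (P^2 + Q^2) / D^2" for x
  proof -
   have "(p * u + q * v)^2 + (- (p * v - q * u))^2 = (p^2 + q^2) * (v^2 + u^2)" for p q u v :: real by (simp add: power2_eq_square algebra_simps)
   thus ?thesis unfolding F_def G_def power_divide add_divide_distrib[symmetric] by simp
  qed
  have Fb: "abs (F x) <= (abs P + abs Q) / abs D" "abs (G x) <= (abs P + abs Q) / abs D" for x
   unfolding F_def G_def abs_divide abs_minus_cancel by (intro divide_right_mono trigb; simp)+
  define u where "u x = (c * x) powr (al + 1) * outU n x" for x
  define u1 where "u1 x = ((c * x) powr (al + 1) * outU1 n x + (al + 1) * x / (x^2 - 1) * u x) / c" for x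
  have uF: "((%x. u x - F x) ---> 0) at_top"
   using tendsto_divide[OF f0 tendsto_const[of D] D0] unfolding u_def F_def outU_def D_def[symmetric] by (simp add: diff_divide_distrib)
  have u1a: "((%x. (c * x) powr (al + 1) * outU1 n x / c - G x) ---> 0) at_top"
  proof -
   have "((%x. (?F x n P Q) / (D * c)) ---> (- c) * 0 / (D * c)) at_top"
    by (rule tendsto_divide[OF f1 tendsto_const]) (use D0 c0 in auto)
   moreover have "(?F x n P Q) / (D * c) = (c * x) powr (al + 1) * outU1 n x / c - G x" for x
    unfolding outU1_def G_def D_def[symmetric] using D0 c0 by (simp add: field_simps)
   ultimately show ?thesis by simp
  qed
  have "((%x. (al + 1) * x / (x^2 - 1) * u x / c) ---> 0) at_top"
  proof -
   have q: "((%x. (al + 1) * x / (x^2 - 1) / c) ---> 0) at_top"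
   proof -
    have "((%x::real. x / (x^2 - 1)) ---> 0) at_top" by real_asymp
    from tendsto_mult_left[OF this, of "(al + 1) / c"] show ?thesis by (simp add: mult_ac)
   qed
   have "((%x. (al + 1) * x / (x^2 - 1) / c * (u x - F x) + (al + 1) * x / (x^2 - 1) / c * F x) ---> 0 * 0 + 0) at_top"
   proof (intro tendsto_add tendsto_mult q uF)
    show "((%x. (al + 1) * x / (x^2 - 1) / c * F x) ---> 0) at_top"
    proof (rule Lim_null_comparison)
     show "((%x. (abs ((al + 1) * x / (x^2 - 1) / c)) * ((abs P + abs Q) / abs D)) ---> 0) at_top"
      using tendsto_mult_right[OF tendsto_rabs_zero[OF q], of "(abs P + abs Q) / abs D"] by simp
     show "\<forall>\<^sub>F x in at_top. norm ((al + 1) * x / (x^2 - 1) / c * F x) <= abs ((al + 1) * x / (x^2 - 1) / c) * ((abs P + abs Q) / abs D)"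
      unfolding real_norm_def abs_mult[of _ "F _"] by (intro always_eventually allI mult_left_mono Fb) simp
    qed
   qed
   moreover have "(al + 1) * x / (x^2 - 1) / c * (u x - F x) + (al + 1) * x / (x^2 - 1) / c * F x = (al + 1) * x / (x^2 - 1) * u x / c" for x
   proof -
    have "p / c * (r - s) + p / c * s = p * r / c" for p r s :: real by (simp add: right_diff_distrib)
    thus ?thesis .
   qed
   ultimately show ?thesis by simp
  qed
  from tendsto_add[OF u1a this] have u1G: "((%x. u1 x - G x) ---> 0) at_top"
   unfolding u1_def add_divide_distrib by (simp add: algebra_simps)
  have "((%x. ((u x)^2 - (F x)^2) + ((u1 x)^2 - (G x)^2) + (P^2 + Q^2) / D^2) ---> 0 + 0 + (P^2 + Q^2) / D^2) at_top"
   by (intro tendsto_add square_diff_null[OF uF Fb(1)] square_diff_null[OF u1G Fb(2)] tendsto_const)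
  moreover have "((u x)^2 - (F x)^2) + ((u1 x)^2 - (G x)^2) + (P^2 + Q^2) / D^2 = (u x)^2 + (u1 x)^2" for x
   using FG[of x] by linarith
  ultimately have lim1: "((%x. (u x)^2 + (u1 x)^2) ---> (P^2 + Q^2) / D^2) at_top" by simp
  \<comment> \<open>Converts the power (c x)^(al + 1) of the asymptotics into the power of x^2 - 1
    used in the normal form; its limit explains the power of c in K.\<close>
  define R where "R x = (1 - 1 / x^2) powr ((al + 1) / 2) * c powr - (al + 1)" for x
  have "((%x. R x) ---> 1 powr ((al + 1) / 2) * c powr - (al + 1)) at_top"
  proof -
   have "((%x::real. 1 - 1 / x^2) ---> 1) at_top" by real_asymp
   thus ?thesis unfolding R_def by (intro tendsto_mult tendsto_powr tendsto_const) auto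
  qed
  hence "((%x. (R x)^2 * ((u x)^2 + (u1 x)^2)) ---> ?E^2 * ((P^2 + Q^2) / D^2)) at_top"
   by (intro tendsto_mult tendsto_power lim1)
  moreover have "?E^2 * ((P^2 + Q^2) / D^2) = K / lam n"
  proof -
   have "(P^2 + Q^2) / D^2 = (A^2 + B^2) * (D * psi n 1 / (D * D))" unfolding PQ power2_eq_square[of D] by simp
   also have "D * psi n 1 / (D * D) = psi n 1 / D" using D0 by simp
   also have "psi n 1 / D = 1 / lam n" using psi1[of n] by (simp add: D_def)
   finally show ?thesis by (simp add: K_def)
  qed
  ultimately have lim2: "((%x. (R x)^2 * ((u x)^2 + (u1 x)^2)) ---> K / lam n) at_top" by simp
  show "((%x. (liouville al (outU n) x)^2 + (?C n x)^2 / c^2) ---> K / lam n) at_top"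
  proof (rule Lim_transform_eventually[OF lim2])
   show "\<forall>\<^sub>F x in at_top. (R x)^2 * ((u x)^2 + (u1 x)^2) = (liouville al (outU n) x)^2 + (?C n x)^2 / c^2"
   proof (rule eventually_mono[OF eventually_gt_at_top[of 1]])
    fix x :: real assume x: "1 < x"
    have Rx: "R x * (c * x) powr (al + 1) = (x^2 - 1) powr ((al + 1) / 2)"
    proof -
     have "x^2 - 1 = (1 - 1 / x^2) * x^2" using x by (simp add: field_simps)
     hence "(x^2 - 1) powr ((al + 1) / 2) = (1 - 1 / x^2) powr ((al + 1) / 2) * (x^2) powr ((al + 1) / 2)" by (simp only: powr_mult)
     also have "(x^2) powr ((al + 1) / 2) = x powr (al + 1)"
     proof -
      have "x^2 = x powr 2" using x by simp
      hence "(x^2) powr ((al + 1) / 2) = x powr (2 * ((al + 1) / 2))" by (simp only: powr_powr)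
      moreover have "2 * ((al + 1) / 2) = al + 1" by simp
      ultimately show ?thesis by (simp only:)
     qed
     finally have 1: "(x^2 - 1) powr ((al + 1) / 2) = (1 - 1 / x^2) powr ((al + 1) / 2) * x powr (al + 1)" .
     have 2: "c powr - (al + 1) * c powr (al + 1) = 1" using c0 by (simp add: powr_add[symmetric])
     have "R x * (c * x) powr (al + 1) = (1 - 1 / x^2) powr ((al + 1) / 2) * x powr (al + 1) * (c powr - (al + 1) * c powr (al + 1))"
      unfolding R_def powr_mult[of c x] by (simp only: mult_ac)
     thus ?thesis unfolding 1 2 by simp
    qed
    have "liouville al (outU n) x = R x * u x" unfolding liouville_def u_def Rx[symmetric] by (simp only: mult.assoc)
    moreover have "liouville_deriv al (outU n) (outU1 n) x = R x * (c * u1 x)"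
    proof -
     have "c * u1 x = (c * x) powr (al + 1) * outU1 n x + (al + 1) * x / (x^2 - 1) * ((c * x) powr (al + 1) * outU n x)"
      using c0 by (simp add: u1_def u_def)
     moreover have "r * q * (p + k * m) = r * (q * p + k * (q * m))" for r q p k m :: real by (simp add: algebra_simps)
     ultimately show ?thesis unfolding liouville_deriv_def Rx[symmetric] by (simp only:)
    qed
    ultimately show "(R x)^2 * ((u x)^2 + (u1 x)^2) = (liouville al (outU n) x)^2 + (?C n x)^2 / c^2"
     using c0 by (simp add: power_mult_distrib distrib_left)
   qed
  qed
 qed
 thus ?thesis using K0 by blast
qed

text \<open>The amplitudes are K / \<open>lam k\<close> and K / \<open>lam N\<close>, so
  multiplication by \<open>lam N * lam k / K\<close> turns the comparison of amplitudes, with k in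
  the role of the larger parameter, into one of eigenvalues.\<close>

lemma lam_decay:
 assumes c0: "0 < c0"
  and C: "!!ka1 ka2 U1 U1' a1 U2 U2' a2.
   outer_sol al c ka1 U1 U1' a1 ==> outer_sol al c ka2 U2 U2' a2 ==> ka2 < ka1 ==>
   c0 <= ka2 ==> c0 * c^2 <= ka2 ==> a1 >= 0 ==>
   a2 * (ka1 / ka2) powr (al + 1) <= C * ka2 * a1"
  and N: "c0 <= ev N" "c0 * c^2 <= ev N" and k: "N < k"
 shows "lam k * (ev k / ev N) powr (al + 1) <= C * ev N * lam N"
proof -
 obtain K where K: "K > 0" "!!n. outer_sol al c (ev n) (outU n) (outU1 n) (K / lam n)" using outer_sol_psi by blast
 note l = lam_pos[of k] lam_pos[of N]
 have "K / lam N * (ev k / ev N) powr (al + 1) <= C * ev N * (K / lam k)"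
  by (rule C[OF K(2) K(2) ev_mono(1)[OF k] N]) (use K l in simp)
 hence "K / lam N * (ev k / ev N) powr (al + 1) * (lam N * lam k / K) <= C * ev N * (K / lam k) * (lam N * lam k / K)"
  using K l by (intro mult_right_mono) auto
 thus ?thesis using K l by (simp add: field_simps)
qed

end

section \<open>Completeness\<close>

lemma arzela_ascoli_lipschitz:
 fixes F :: "nat => real => real"
 assumes "!!n x. x : II ==> (abs (F n x)) <= M"
  and L: "!!n x y. x : II ==> y : II ==> (abs (F n x - F n y)) <= L * abs (x - y)"
 obtains g r where "contI g" "strict_mono (r :: nat => nat)"
  "!!e. e > 0 ==> \<forall>\<^sub>F n in sequentially. ALL x:II. (abs (F (r n) x - g x)) < e"
proof (rule Arzela_Ascoli[of "{-1..1::real}" F M])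
 fix x e :: real assume x: "x : II" and e: "0 < e"
 show "EX d. 0 < d & (ALL n y. y : II & norm (x - y) < d --> norm (F n x - F n y) < e)"
 proof (intro exI[of _ "e / (abs L + 1)"] conjI allI impI)
  fix n y assume y: "y : II & norm (x - y) < e / (abs L + 1)"
  have "abs (F n x - F n y) <= L * abs (x - y)" using L x y by blast
  also have "... <= (abs L + 1) * abs (x - y)" by (intro mult_right_mono) auto
  also have "... < e" using y by (simp add: pos_less_divide_eq mult.commute)
  finally show "norm (F n x - F n y) < e" by simp
 qed (use e in simp)
next
 fix g and k :: "nat => nat"
 assume g: "contI g" "strict_mono k"
  and u: "!!e. 0 < e ==> EX N. ALL n x. N <= n & x : II --> norm (F (k n) x - g x) < e"
 show thesis
 proof (rule that[OF g])
  fix e :: real assume "e > 0"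
  from u[OF this] obtain N where "ALL n x. N <= n & x : II --> norm (F (k n) x - g x) < e" by blast
  thus "\<forall>\<^sub>F n in sequentially. ALL x:II. (abs (F (k n) x - g x)) < e"
   unfolding eventually_sequentially real_norm_def by blast
 qed
qed (use assms in auto)

context wt begin

text \<open>V is merely closed under the linear combinations shown, so a maximizer need not exist
  and approximate eigenvectors are produced instead. The form ka <u, v> - <A u, v> is nonnegative;
  its Cauchy-Schwarz inequality bounds the norm of A h - ka h by its value at h, which tends to 0
  along a maximizing sequence.\<close>

lemma near_maximizer:
 assumes V: "!!u. u : V ==> l2 u" and lin: "!!u v t. u : V ==> v : V ==> (%x. u x + t * v x) : V"
  and AV: "!!u. u : V ==> A u : V"
  and Alin: "!!u v w t. u : V ==> v : V ==> w : V ==> ip (A (%x. u x + t * v x)) w = ip (A u) w + t * ip (A v) w"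
  and sym: "!!u v. u : V ==> v : V ==> ip (A u) v = ip u (A v)"
  and pos: "!!u. u : V ==> ip (A u) u >= 0" and bdd: "!!u. u : V ==> ip (A u) u <= M * ip u u"
  and v0: "v0 : V" "nrm v0 = 1"
 obtains ka h where "ip (A v0) v0 <= ka" "!!u. u : V ==> ip (A u) u <= ka * ip u u"
  "!!n::nat. h n : V" "!!n. nrm (h n) = 1" "(%n. nrm (%x. A (h n) x + (- ka) * h n x)) ----> 0"
proof -
 define S where "S = {ip (A u) u | u. u : V & nrm u = 1}"
 define ka where "ka = Sup S"
 have ne: "S ~= {}" using v0 by (auto simp: S_def)
 have ipn: "ip u u = 1" if "nrm u = 1" for u using nrm_sq[of u] that by simp
 have bS: "bdd_above S" unfolding S_def using bdd ipn by (intro bdd_aboveI[of _ M]) force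
 have up: "ip (A u) u <= ka" if "u : V" "nrm u = 1" for u
  unfolding ka_def using that by (intro cSup_upper bS) (auto simp: S_def)
 have k0: "ka >= 0" using up[OF v0] pos[OF v0(1)] by linarith
 have le: "ip (A u) u <= ka * ip u u" if u: "u : V" for u
 proof (cases "ip u u = 0")
  case True
  thus ?thesis using bdd[OF u] by simp
 next
  case False
  hence n: "nrm u > 0" using nrm_sq[of u] nrm_nonneg[of u] by (cases "nrm u = 0") auto
  \<comment> \<open>Normalization in the form u + s u with 1 + s = 1 / nrm u, because this is the
    only kind of combination that V is known to contain.\<close>
  define s where "s = 1 / nrm u - 1"
  define u' where "u' = (%x. u x + s * u x)"
  have u': "u' : V" unfolding u'_def by (rule lin[OF u u])
  have s1: "1 + s = 1 / nrm u" by (simp add: s_def)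
  have us: "u' = (%x. (1 + s) * u x)" by (auto simp: u'_def algebra_simps)
  have i1: "ip (A u') u' = (1 + s)^2 * ip (A u) u"
  proof -
   have "ip (A u') u' = ip (A u) u' + s * ip (A u) u'" unfolding u'_def by (rule Alin[OF u u lin[OF u u]])
   also have "... = (1 + s) * ip (A u) u'" by (simp add: distrib_right)
   also have "ip (A u) u' = (1 + s) * ip (A u) u" unfolding us by (rule ip_cmult2)
   finally show ?thesis by (simp add: power2_eq_square)
  qed
  have i2: "ip u' u' = (1 + s)^2 * ip u u" unfolding us ip_cmult ip_cmult2 by (simp add: power2_eq_square)
  have i3: "(1 + s)^2 * ip u u = 1" unfolding s1 nrm_sq[symmetric] using n by (simp add: power_divide)
  have "nrm u' = 1" using i2 i3 by (simp add: nrm_def)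
  from up[OF u' this] have "ip (A u) u * (1 + s)^2 <= ka" by (simp add: i1 mult.commute)
  hence "ip (A u) u * (1 + s)^2 <= (ka * ip u u) * (1 + s)^2" using i3 by (simp add: mult_ac)
  moreover have "(1 + s)^2 > 0" using s1 n by simp
  ultimately show ?thesis by (meson mult_right_le_imp_le)
 qed
 define q where "q u v = ka * ip u v - ip (A u) v" for u v
 have qcs: "(q u v)^2 <= q u u * q v v" if u: "u : V" and v: "v : V" for u v
 proof (rule discriminant_nonneg)
  fix t
  note l = V[OF u] V[OF v] V[OF AV[OF u]] V[OF AV[OF v]]
  let ?z = "%x. u x + t * v x"
  have z: "?z : V" by (rule lin[OF u v])
  have "ip (A ?z) ?z = ip (A u) ?z + t * ip (A v) ?z" by (rule Alin[OF u v z])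
  also have "ip (A u) ?z = ip (A u) u + t * ip (A u) v" using l by (simp add: ip_add2 l2_cmult ip_cmult2)
  also have "ip (A v) ?z = ip (A u) v + t * ip (A v) v"
   using l sym[OF v u] by (simp add: ip_add2 l2_cmult ip_cmult2 ip_sym[of v])
  finally have "ip (A ?z) ?z = ip (A u) u + 2 * t * ip (A u) v + t^2 * ip (A v) v" by (simp add: power2_eq_square algebra_simps)
  moreover have "ip ?z ?z = ip u u + 2 * t * ip u v + t^2 * ip v v" by (rule ip_square_expand[OF l(1,2)])
  ultimately have "q u u + 2 * t * q u v + t^2 * q v v = ka * ip ?z ?z - ip (A ?z) ?z" by (simp add: q_def algebra_simps)
  thus "0 <= q u u + 2 * t * q u v + t^2 * q v v" using le[OF z] by simp
 qed
 have "EX u. u : V & nrm u = 1 & ka - 1 / real (Suc n) < ip (A u) u" for n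
 proof -
  have "ka - 1 / real (Suc n) < Sup S" by (simp add: ka_def)
  then obtain y where "y : S" "ka - 1 / real (Suc n) < y" using less_cSupE[OF _ ne] by blast
  thus ?thesis by (auto simp: S_def)
 qed
 then obtain h where h: "!!n. h n : V" "!!n. nrm (h n) = 1" "!!n. ka - 1 / real (Suc n) < ip (A (h n)) (h n)" by metis
 have vb: "nrm (%x. A (h n) x + (- ka) * h n x) <= sqrt (ka * (1 / real (Suc n)))" for n
 proof -
  define v where "v = (%x. A (h n) x + (- ka) * h n x)"
  have v: "v : V" unfolding v_def by (rule lin[OF AV[OF h(1)] h(1)])
  note l = V[OF h(1)[of n]] V[OF AV[OF h(1)[of n]]] V[OF v]
  have "ip v v = ip (A (h n)) v + (- ka) * ip (h n) v"
   using ip_add[OF l(2) l2_cmult[OF l(1), of "- ka"] l(3)] unfolding ip_cmult by (simp only: v_def)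
  hence qv: "q (h n) v = - ip v v" by (simp add: q_def)
  have "q v v <= ka * ip v v" using pos[OF v] by (simp add: q_def)
  moreover have "q (h n) (h n) >= 0" using le[OF h(1)[of n]] by (simp add: q_def)
  ultimately have "q (h n) (h n) * q v v <= q (h n) (h n) * (ka * ip v v)" by (intro mult_left_mono)
  moreover have "(ip v v)^2 <= q (h n) (h n) * q v v" using qcs[OF h(1)[of n] v] by (simp add: qv)
  ultimately have 1: "ip v v * ip v v <= (ka * q (h n) (h n)) * ip v v" by (simp add: power2_eq_square mult_ac)
  have "ip v v <= ka * q (h n) (h n)"
  proof (cases "ip v v = 0")
   case True
   thus ?thesis using k0 `q (h n) (h n) >= 0` by simp
  next
   case False
   hence "ip v v > 0" using ip_nonneg[of v] by simp
   thus ?thesis using 1 by (meson mult_right_le_imp_le)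
  qed
  also have "... <= ka * (1 / real (Suc n))"
   using h(3)[of n] ipn[OF h(2)[of n]] k0 by (intro mult_left_mono) (simp_all add: q_def)
  finally show ?thesis unfolding v_def[symmetric] nrm_def by (rule real_sqrt_le_mono)
 qed
 have "(%n. sqrt (ka * (1 / real (Suc n)))) ----> sqrt (ka * 0)"
  by (intro tendsto_real_sqrt tendsto_mult_left LIMSEQ_Suc[OF lim_1_over_n])
 hence l0: "(%n. sqrt (ka * (1 / real (Suc n)))) ----> 0" by simp
 have lim: "(%n. nrm (%x. A (h n) x + (- ka) * h n x)) ----> 0"
  by (rule Lim_null_comparison[OF always_eventually l0], unfold real_norm_def abs_of_nonneg[OF nrm_nonneg]) (intro allI vb)
 show ?thesis by (rule that[of ka h]) (fact up[OF v0] | rule le, assumption | fact h(1) h(2) lim)+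
qed

lemma nrm_cmult: "nrm (%x. a * f x) = abs a * nrm f"
 by (simp add: nrm_def ip_cmult ip_cmult2 real_sqrt_mult mult.assoc[symmetric])

lemma nrm_cong: "(!!x. x : II ==> f x = g x) ==> nrm f = nrm g"
 unfolding nrm_def using ip_cong[of f g f g] by simp

end

context pf begin

lemma Top1_bound: assumes "l2 h" shows "abs (Top1 h x) <= 16 * c * nrm h" "abs (Top2 h x) <= 16 * c^2 * nrm h"
proof -
 let ?A = "%y. c * y * (c * y * Cop h y)"
 let ?B = "%y. c * y * (c * y * Sop h y)"
 let ?C = "c * (2 * nrm h)"
 let ?D = "%y. c * y * Cop h y"
 let ?E = "%y. c * y * Sop h y"
 have y: "abs (c * y * t) <= c * s" if "y : II" "abs t <= s" for y t s
 proof -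
  have "abs y * abs t <= 1 * s" using that by (intro mult_mono) auto
  hence "c * (abs y * abs t) <= c * (1 * s)" using c0 by (intro mult_left_mono) auto
  thus ?thesis using c0 by (simp add: abs_mult mult.assoc)
 qed
 have cc: "contI (Cop h)" "contI (Sop h)" by (intro trig_cont l2_integrable assms)+
 have l: "l2 ?D" "l2 ?E" "l2 ?A" "l2 ?B"
  by (intro l2_cont continuous_intros cc)+
 have n1: "nrm ?D <= 2 * ?C" "nrm ?E <= 2 * ?C"
  by (rule nrm_const[OF y l(1)], simp, rule Cop_bound_nrm[OF assms], use c0 nrm_nonneg[of h] in simp,
    rule nrm_const[OF y l(2)], simp, rule Cop_bound_nrm[OF assms], use c0 nrm_nonneg[of h] in simp)
 have n2: "nrm ?A <= 2 * (c * ?C)" "nrm ?B <= 2 * (c * ?C)"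
  by (rule nrm_const[OF y l(3)], simp, rule y, simp, rule Cop_bound_nrm[OF assms], use c0 nrm_nonneg[of h] in simp,
    rule nrm_const[OF y l(4)], simp, rule y, simp, rule Cop_bound_nrm[OF assms], use c0 nrm_nonneg[of h] in simp)
 have "abs (Top1 h x) <= 2 * nrm ?D + 2 * nrm ?E"
  unfolding Top1_def using Cop_bound_nrm(2)[OF l(1), of x] Cop_bound_nrm(1)[OF l(2), of x] by linarith
 thus "abs (Top1 h x) <= 16 * c * nrm h" using n1 by simp
 have "abs (Top2 h x) <= 2 * nrm ?A + 2 * nrm ?B"
  unfolding Top2_def using Cop_bound_nrm(1)[OF l(3), of x] Cop_bound_nrm(2)[OF l(4), of x] by linarith
 thus "abs (Top2 h x) <= 16 * c^2 * nrm h" using n2 by (simp add: power2_eq_square)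
qed

lemma Top_lipschitz: assumes "l2 h" shows "abs (Top h x - Top h y) <= 16 * c * nrm h * abs (x - y)"
 using field_differentiable_bound[of UNIV "Top h" "Top1 h" "16 * c * nrm h" x y] Top_deriv(1)[OF l2_integrable[OF assms]] Top1_bound(1)[OF assms]
 by simp

lemma Top_lin: assumes "l2 f" "l2 g"
 shows "Top (%x. f x + t * g x) = (%x. Top f x + t * Top g x)"
  "Top1 (%x. f x + t * g x) = (%x. Top1 f x + t * Top1 g x)"
  "Top2 (%x. f x + t * g x) = (%x. Top2 f x + t * Top2 g x)"
proof -
 let ?A = "%f g. %x. f x + t * g x"
 have C: "Cop (?A f g) = (%x. Cop f x + t * Cop g x)" "Sop (?A f g) = (%x. Sop f x + t * Sop g x)"
  if "integrable nu f" "integrable nu g" for f g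
  using Cop_add[OF that(1), of "%x. t * g x"] that(2) by (simp_all add: Cop_cmult)
 have ii: "integrable nu (Cop f)" "integrable nu (Sop f)" if "l2 f" for f
  by (intro integrable_cont trig_cont l2_integrable that)+
 note j = l2_integrable[OF assms(1)] l2_integrable[OF assms(2)]
 note k = ii[OF assms(1)] ii[OF assms(2)]
 show "Top (?A f g) = (%x. Top f x + t * Top g x)"
  using Top_add[OF assms(1) l2_cmult[OF assms(2)], of t] by (simp add: Top_cmult)
 have d: "c * y * (p + t * r) = c * y * p + t * (c * y * r)" for y p r by (simp add: algebra_simps)
 note i1 = trig_integrable(3)[OF k(1)] trig_integrable(3)[OF k(2)] trig_integrable(3)[OF k(3)] trig_integrable(3)[OF k(4)]
 note i2 = trig_integrable(3)[OF i1(1)] trig_integrable(3)[OF i1(2)] trig_integrable(3)[OF i1(3)] trig_integrable(3)[OF i1(4)]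
 show "Top1 (?A f g) = (%x. Top1 f x + t * Top1 g x)"
  unfolding Top1_def[abs_def] C[OF j] d C[OF i1(1,3)] C[OF i1(2,4)] by (auto simp: algebra_simps)
 show "Top2 (?A f g) = (%x. Top2 f x + t * Top2 g x)"
  unfolding Top2_def[abs_def] C[OF j] d C[OF i2(1,3)] C[OF i2(2,4)] by (auto simp: algebra_simps)
qed

lemma Top_scale: assumes "!!y. y : II ==> f y = a * g y"
 shows "Top f = (%x. a * Top g x)" "Top1 f = (%x. a * Top1 g x)" "Top2 f = (%x. a * Top2 g x)"
proof -
 have C: "Cop f = (%x. a * Cop g x)" "Sop f = (%x. a * Sop g x)"
  using Cop_cong[of f "%x. a * g x"] assms by (simp_all add: Cop_cmult)
 have d: "c * y * (a * r) = a * (c * y * r)" for y r by simp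
 show "Top f = (%x. a * Top g x)" using Top_cong[of f "%x. a * g x"] assms by (simp add: Top_cmult)
 show "Top1 f = (%x. a * Top1 g x)" unfolding Top1_def[abs_def] C d Cop_cmult by (simp add: algebra_simps)
 show "Top2 f = (%x. a * Top2 g x)" unfolding Top2_def[abs_def] C d Cop_cmult by (simp add: algebra_simps)
qed

text \<open>The differential operator applied to \<open>Top g\<close>. As \<open>Top\<close> is
  smoothing, this is defined and bounded for every square-integrable g, although the operator itself
  is unbounded.\<close>

definition LT :: "(real => real) => real => real" where
 "LT g x = (1 - x^2) * Top2 g x - (2 * al + 2) * x * Top1 g x - c^2 * x^2 * Top g x"

lemma sl_Top: assumes "l2 g" shows "sl (Top g) (Top1 g) (LT g)"
proof (rule sl_smooth[where phidd = "Top2 g"])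
 note T = Top_deriv[OF l2_integrable[OF assms]]
 show "(Top g has_real_derivative Top1 g x) (at x within II)" "(Top1 g has_real_derivative Top2 g x) (at x within II)" for x
  by (rule has_field_derivative_at_within[OF T(1)], rule has_field_derivative_at_within[OF T(2)])
qed (use Top_deriv[OF l2_integrable[OF assms]] in "auto simp: LT_def")

lemma LT_cont: "l2 g ==> contI (LT g)" by (rule slD(4)[OF sl_Top])

lemma LT_bound: assumes g: "l2 g" and x: "x : II"
 shows "abs (LT g x) <= (16 * c^2 + (2 * al + 2) * (16 * c) + c^2 * 16) * nrm g"
proof -
 have x2: "x^2 <= 1" using x by (simp add: abs_square_le_1 abs_le_iff)
 have "abs (1 - x^2) * abs (Top2 g x) <= 1 * (16 * c^2 * nrm g)" using x2 Top1_bound(2)[OF g] by (intro mult_mono) auto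
 moreover have "abs ((2 * al + 2) * x) * abs (Top1 g x) <= (2 * al + 2) * (16 * c * nrm g)"
  using x alpha0 Top1_bound(1)[OF g] by (intro mult_mono) (auto simp: abs_mult intro!: mult_left_le)
 moreover have "abs (c^2 * x^2) * abs (Top g x) <= c^2 * (16 * nrm g)" using x2 Top_bound[OF g] by (intro mult_mono) (auto intro!: mult_left_le)
 ultimately have "abs (LT g x) <= 1 * (16 * c^2 * nrm g) + (2 * al + 2) * (16 * c * nrm g) + c^2 * (16 * nrm g)"
  unfolding LT_def abs_mult[symmetric] by linarith
 thus ?thesis by (simp add: algebra_simps)
qed

end

context gp begin

definition orth :: "nat => (real => real) => bool" where
 "orth K g \<longleftrightarrow> l2 g & (ALL j<=K. ip g (psi j) = 0)"

lemma ip_Top_psi: "l2 h ==> ip (Top h) (psi j) = lam j * ip h (psi j)"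
 using ip_Top_sym[OF _ psi_l2, of h j] ip_cong[of h h "Top (psi j)" "%x. lam j * psi j x"] Top_psi_I[of _ j] by (simp add: ip_cmult2)

lemma orth_lin: "orth K u ==> orth K v ==> orth K (%x. u x + t * v x)"
 by (simp add: orth_def l2_add l2_cmult ip_add psi_l2 ip_cmult)

lemma orth_Top: "orth K u ==> orth K (Top u)"
 by (simp add: orth_def Top_l2 ip_Top_psi)

lemma ip_Top_nonneg: "l2 u ==> ip (Top u) u >= 0" by (simp add: ip_Top ip_nonneg)

lemma nrm_Top: "l2 u ==> nrm (Top u) <= 32 * nrm u"
 using nrm_const[of "Top u" "16 * nrm u"] Top_bound[of u] Top_l2[of u] nrm_nonneg[of u] by simp

lemma nrm_uniform_limit:
 assumes g: "contI g" and F: "!!n. l2 (F n)"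
  and u: "!!e. e > 0 ==> \<forall>\<^sub>F n in sequentially. ALL x:II. (abs (F n x - g x)) < e"
 shows "(%n. nrm (%x. F n x - g x)) ----> 0"
proof (rule tendstoI)
 fix e :: real assume e: "e > 0"
 hence "e / 4 > 0" by simp
 from u[OF this] show "\<forall>\<^sub>F n in sequentially. dist (nrm (%x. F n x - g x)) 0 < e"
 proof (rule eventually_mono)
  fix n assume n: "ALL x:II. (abs (F n x - g x)) < e / 4"
  have "nrm (%x. F n x - g x) <= 2 * (e / 4)"
   by (rule nrm_const) (use n e F l2_cont[OF g] in "auto intro: l2_diff less_imp_le")
  thus "dist (nrm (%x. F n x - g x)) 0 < e" using e nrm_nonneg[of "%x. F n x - g x"] by simp
 qed
qed

lemma null_imp_eq:
 fixes a b C :: real and e :: "nat => real"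
 assumes "e ----> 0" "!!n. (abs (a - b)) <= C * e n"
 shows "a = b"
proof -
 have "(%n. C * e n) ----> C * 0" by (intro tendsto_intros assms)
 hence "abs (a - b) <= C * 0" by (rule LIMSEQ_le_const) (use assms in auto)
 thus ?thesis by simp
qed

lemma nrm_diff_le: "l2 f ==> l2 g ==> (abs (nrm f - nrm g)) <= nrm (%x. f x - g x)"
 using nrm_triangle[of "%x. f x - g x" g] nrm_triangle[of "%x. g x - f x" f] nrm_cmult[of "-1" "%x. f x - g x"]
 by (simp add: l2_diff)

lemma limit_orth:
 assumes G: "l2 G" and h: "!!n. orth K (h n)" "!!n. nrm (h n) = 1" and l: "(%n. nrm (%x. h n x - G x)) ----> 0"
 shows "orth K G" "nrm G = 1"
proof -
 have lh: "l2 (h n)" for n using h(1) by (simp add: orth_def)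
 show "nrm G = 1"
  by (rule null_imp_eq[OF l, of _ _ 1]) (use nrm_diff_le[OF lh G] h(2) in "simp add: abs_minus_commute")
 show "orth K G" unfolding orth_def
 proof (intro conjI G allI impI)
  fix j assume j: "j <= K"
  show "ip G (psi j) = 0"
  proof (rule null_imp_eq[OF l, of _ _ 1])
   fix n
   have "ip (%x. h n x - G x) (psi j) = - ip G (psi j)" using h(1)[of n] j by (simp add: ip_diff lh G psi_l2 orth_def)
   moreover have "nrm (psi j) = 1" by (simp add: nrm_def psi_orthonormal)
   ultimately show "abs (ip G (psi j) - 0) <= 1 * nrm (%x. h n x - G x)"
    using cs_abs[OF l2_diff[OF lh G] psi_l2, of n j] by simp
  qed
 qed
qed

text \<open>\<open>Top\<close> sends norm-bounded sequences to uniformly bounded, equi-Lipschitz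
  ones. Along a subsequence \<open>Top (h n)\<close> converges uniformly; since the norm of Top h -
  B h tends to 0, the functions h n converge in norm to a multiple of the limit, which is the
  eigenfunction.\<close>

lemma Top_maximizer:
 obtains B G where "B > 0" "contI G" "orth K G" "nrm G = 1" "!!x. x : II ==> Top G x = B * G x"
  "!!u. orth K u ==> ip (Top u) u <= B * ip u u"
proof -
 let ?A = "%h r n G. %x. h (r n) x - G x"
 let ?B = "%h n B. %x. Top (h n) x + (- B) * h n x"
 have v0: "orth K (psi (Suc K))" "nrm (psi (Suc K)) = 1" by (auto simp: orth_def psi_l2 psi_orthonormal nrm_def)
 obtain B h where B: "ip (Top (psi (Suc K))) (psi (Suc K)) <= B" "!!u. u : Collect (orth K) ==> ip (Top u) u <= B * ip u u"
  and h: "!!n::nat. h n : Collect (orth K)" "!!n. nrm (h n) = 1" and lim: "(%n. nrm (?B h n B)) ----> 0"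
 proof (rule near_maximizer[of "Collect (orth K)" Top 32 "psi (Suc K)"])
  fix u v w t assume u: "u : Collect (orth K)"
  hence lu: "l2 u" by (simp add: orth_def)
  show "l2 u" by (rule lu)
  show "Top u : Collect (orth K)" using u orth_Top by simp
  show "0 <= ip (Top u) u" by (rule ip_Top_nonneg[OF lu])
  have "abs (ip (Top u) u) <= nrm (Top u) * nrm u" by (rule cs_abs[OF Top_l2[OF lu] lu])
  also have "... <= 32 * nrm u * nrm u" by (intro mult_right_mono nrm_Top lu nrm_nonneg)
  also have "... = 32 * ip u u" using nrm_sq[of u] by (simp add: power2_eq_square)
  finally show "ip (Top u) u <= 32 * ip u u" by simp
  assume v: "v : Collect (orth K)"
  hence lv: "l2 v" by (simp add: orth_def)
  show "(%x. u x + t * v x) : Collect (orth K)" using orth_lin u v by simp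
  show "ip (Top u) v = ip u (Top v)" by (rule ip_Top_sym[OF lu lv])
  assume w: "w : Collect (orth K)"
  show "ip (Top (%x. u x + t * v x)) w = ip (Top u) w + t * ip (Top v) w"
   unfolding Top_lin(1)[OF lu lv] using w by (simp add: ip_add Top_l2 lu lv l2_cmult ip_cmult orth_def)
 qed (use v0 in auto)
 have lh: "l2 (h n)" and oh: "orth K (h n)" for n using h(1)[of n] by (auto simp: orth_def)
 \<comment> \<open>\<open>psi (Suc K)\<close> is admissible with a positive value, so B > 0 and
   division by B is possible below.\<close>
 have "ip (Top (psi (Suc K))) (psi (Suc K)) = lam (Suc K)" by (simp add: ip_Top_psi psi_l2 psi_orthonormal)
 hence B0: "B > 0" using B(1) lam_pos[of "Suc K"] by linarith
 obtain g r where g: "contI g" and r: "strict_mono (r :: nat => nat)"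
  and u: "!!e. e > 0 ==> \<forall>\<^sub>F n in sequentially. ALL x:II. (abs (Top (h (r n)) x - g x)) < e"
  by (rule arzela_ascoli_lipschitz[of "%n. Top (h n)" 16 "16 * c"]) (use Top_bound[OF lh] Top_lipschitz[OF lh] h(2) in auto)
 define G where "G x = g x / B" for x
 have cG: "contI G" unfolding G_def using B0 by (intro continuous_intros g) auto
 note lG = l2_cont[OF cG] and lg = l2_cont[OF g]
 define d where "d n = nrm (?A Top h (r n) g)" for n
 define d' where "d' n = nrm (?B h (r n) B)" for n
 have d: "d ----> 0" unfolding d_def by (rule nrm_uniform_limit[OF g Top_l2[OF lh] u])
 have d': "d' ----> 0" using LIMSEQ_subseq_LIMSEQ[OF lim r] by (simp add: d'_def[abs_def] o_def)
 have hb: "nrm (?A h r n G) <= 1 / B * (d n + d' n)" for n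
 proof -
  have e: "(?A h r n G) = (%x. 1 / B * ((Top (h (r n)) x - g x) + (- 1) * (Top (h (r n)) x + (- B) * h (r n) x)))"
   using B0 by (auto simp: G_def field_simps)
  have l: "l2 (?A Top h (r n) g)" "l2 (?B h (r n) B)"
   by (intro l2_diff l2_add l2_cmult Top_l2 lh lg)+
  have "nrm (%x. (Top (h (r n)) x - g x) + (- 1) * (Top (h (r n)) x + (- B) * h (r n) x)) <= d n + d' n"
   using nrm_triangle[OF l(1) l2_cmult[OF l(2), of "-1"]] unfolding nrm_cmult d_def d'_def by simp
  thus ?thesis unfolding e nrm_cmult using B0 by (simp add: divide_right_mono)
 qed
 have hl: "(%n. nrm (?A h r n G)) ----> 0"
 proof (rule Lim_null_comparison[OF always_eventually])
  have "(%n. 1 / B * (d n + d' n)) ----> 1 / B * (0 + 0)" by (intro tendsto_intros d d')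
  thus "(%n. 1 / B * (d n + d' n)) ----> 0" by simp
  show "ALL n. norm (nrm (?A h r n G)) <= 1 / B * (d n + d' n)" using hb nrm_nonneg by simp
 qed
 have TG: "Top G x = B * G x" if x: "x : II" for x
 proof -
  have Tl: "(%n. Top (h (r n)) x) ----> g x"
  proof (rule tendstoI)
   fix e :: real assume "e > 0"
   from u[OF this] show "\<forall>\<^sub>F n in sequentially. dist (Top (h (r n)) x) (g x) < e"
    by (rule eventually_mono) (use x in "auto simp: dist_real_def")
  qed
  have "(%n. Top (h (r n)) x) ----> Top G x"
  proof (rule LIM_zero_cancel, rule Lim_null_comparison[OF always_eventually])
   show "(%n. 16 * nrm (?A h r n G)) ----> 0" using tendsto_mult_left[OF hl, of 16] by simp
   show "ALL n. norm (Top (h (r n)) x - Top G x) <= 16 * nrm (?A h r n G)"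
    using Top_bound[OF l2_diff[OF lh lG]] Top_diff[OF lh lG] by (simp add: fun_eq_iff)
  qed
  hence "Top G x = g x" using LIMSEQ_unique Tl by blast
  thus ?thesis using B0 by (simp add: G_def)
 qed
 have "orth K G" "nrm G = 1" by (rule limit_orth[OF lG oh h(2) hl], rule limit_orth[OF lG oh h(2) hl])
 thus ?thesis using that[OF B0 cG _ _ TG] B(2) by simp
qed

text \<open>The eigenspace of the integral operator is invariant under the commuting differential operator,
  so it contains one of the \<open>\<psi>\<^sub>n\<close>.\<close>

lemma Top_le_lam: "EX n>K. ALL u. orth K u --> ip (Top u) u <= lam n * ip u u"
proof -
 let ?A = "%A h n ka. %x. A (h n) x + (- ka) * h n x"
 let ?B = "16 * c^2 + (2 * al + 2) * (16 * c) + c^2 * 16"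
 let ?C = "%B A g. %x. (- B) * A g x"
 obtain B G where B0: "B > 0" and G: "contI G" "orth K G" "nrm G = 1" "!!x. x : II ==> Top G x = B * G x"
  and Bm: "!!u. orth K u ==> ip (Top u) u <= B * ip u u" using Top_maximizer[of K] by blast
 define E where "E = {g. contI g & orth K g & (ALL x:II. Top g x = B * g x)}"
 \<comment> \<open>On the eigenspace E, where Top g = B g, this is minus the differential operator
   itself. Written through \<open>LT\<close> it is bounded in the weighted norm.\<close>
 define A where "A g x = - (1 / B) * LT g x" for g x
 define Ca where "Ca = 1 / B * ?B"
 have Ca0: "Ca >= 0" using B0 c0 alpha0 by (simp add: Ca_def)
 have El: "l2 g" if "g : E" for g using that by (simp add: E_def orth_def)
 have ET: "Top g x = B * g x" if "g : E" "x : II" for g x using that by (simp add: E_def)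
 have LTA: "LT g = (?C B A g)" for g using B0 by (auto simp: A_def)
 have slT: "sl (Top g) (Top1 g) (?C B A g)" if "l2 g" for g using sl_Top[OF that] by (simp only: LTA)
 have cA: "contI (A g)" if "l2 g" for g unfolding A_def[abs_def] by (intro continuous_intros LT_cont that)
 have lA: "l2 (A g)" if "l2 g" for g by (rule l2_cont[OF cA[OF that]])
 have Ab: "abs (A g x) <= Ca * nrm g" if "l2 g" "x : II" for g x
 proof -
  have "abs (A g x) = 1 / B * abs (LT g x)" using B0 by (simp add: A_def abs_mult)
  also have "... <= 1 / B * (?B * nrm g)"
   using B0 by (intro mult_left_mono LT_bound that) auto
  finally show ?thesis by (simp only: Ca_def mult.assoc)
 qed
 have Alin: "A (%x. u x + t * v x) = (%x. A u x + t * A v x)" if "l2 u" "l2 v" for u v t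
  unfolding A_def[abs_def] LT_def Top_lin[OF that] by (auto simp: algebra_simps)
 have ipT: "ip f (Top g) = B * ip f g" if "g : E" for f g
  using ip_cong[of f f "Top g" "%x. B * g x"] ET[OF that] by (simp add: ip_cmult2)
 have sym: "ip (A u) v = ip u (A v)" if u: "u : E" and v: "v : E" for u v
 proof -
  have "ip (?C B A u) (Top v) = ip (Top u) (?C B A v)" by (rule green[OF slT[OF El[OF u]] slT[OF El[OF v]]])
  hence "(- B) * (B * ip (A u) v) = (- B) * (B * ip (A v) u)"
   unfolding ip_cmult ip_cmult2 ip_sym[of "Top u"] ipT[OF u] ipT[OF v] .
  thus ?thesis using B0 by (simp add: ip_sym[of u])
 qed
 have pos: "ip (A u) u >= 0" if u: "u : E" for u
 proof -
  have "- ip (?C B A u) (Top u) >= 0"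
   unfolding energy[OF slT[OF El[OF u]]]
   by (intro add_nonneg_nonneg mult_nonneg_nonneg Bochner_Integration.integral_nonneg_AE AE_I2)
     (auto simp: space_nu abs_square_le_1 abs_le_iff)
  hence "0 <= B * (B * ip (A u) u)" unfolding ip_cmult ipT[OF u] by simp
  thus ?thesis using B0 by (simp add: zero_le_mult_iff)
 qed
 have lin: "(%x. u x + t * v x) : E" if "u : E" "v : E" for u v t
  using that El[OF that(1)] El[OF that(2)] orth_lin[of K u v t]
  by (auto simp: E_def Top_lin algebra_simps intro!: continuous_intros)
 have AE: "A u : E" if u: "u : E" for u
 proof -
  note lu = El[OF u]
  have o: "ip (A u) (psi j) = 0" if "j <= K" for j
  proof -
   have "ip (?C B A u) (psi j) = ip (Top u) (%x. - ev j * psi j x)" by (rule green[OF slT[OF lu] sl_psi])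
   hence "(- B) * ip (A u) (psi j) = - ev j * ip (Top u) (psi j)" unfolding ip_cmult ip_cmult2 .
   also have "ip (Top u) (psi j) = 0" using u that lu by (simp add: ip_Top_psi E_def orth_def)
   finally show ?thesis using B0 by simp
  qed
  have "Top (A u) x = B * A u x" if x: "x : II" for x
  proof -
   have sc: "Top (Top u) = (%x. B * Top u x)" "Top1 (Top u) = (%x. B * Top1 u x)" "Top2 (Top u) = (%x. B * Top2 u x)"
    by (rule Top_scale, rule ET[OF u], assumption)+
   have "LT (Top u) x = Top (?C B A u) x" using Top_ode[OF slT[OF lu], of x] by (simp add: LT_def)
   hence a: "LT (Top u) x = (- B) * Top (A u) x" by (simp only: Top_cmult)
   have b: "LT (Top u) x = B * LT u x" unfolding LT_def sc by (simp add: algebra_simps)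
   have "LT u x = (- B) * A u x" by (simp only: LTA)
   from trans[OF a[symmetric] trans[OF b arg_cong[OF this, of "%t. B * t"]]] show ?thesis using B0 by simp
  qed
  thus ?thesis using o cA[OF lu] lA[OF lu] by (simp add: E_def orth_def)
 qed
 have GE: "G : E" using G by (simp add: E_def)
 \<comment> \<open>On [-1, 1] elements of E equal \<open>Top h\<close> / B, so normalized sequences
   in E are uniformly bounded and equi-Lipschitz. A maximizing sequence for A on E thus has a
   uniform limit, which is a joint eigenfunction of \<open>Top\<close> and of the differential
   operator.\<close>
 obtain ka h where h: "!!n::nat. h n : E" "!!n. nrm (h n) = 1" and lim: "(%n. nrm (?A A h n ka)) ----> 0"
 proof (rule near_maximizer[of E A "2 * Ca" G])
  fix u v w t assume u: "u : E"
  note lu = El[OF u]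
  show "l2 u" "A u : E" "0 <= ip (A u) u" by (fact lu, fact AE[OF u], fact pos[OF u])
  have n: "nrm (A u) <= 2 * (Ca * nrm u)" by (rule nrm_const[OF Ab[OF lu] lA[OF lu]]) (use Ca0 nrm_nonneg[of u] in auto)
  have "abs (ip (A u) u) <= nrm (A u) * nrm u" by (rule cs_abs[OF lA[OF lu] lu])
  also have "... <= 2 * (Ca * nrm u) * nrm u" by (intro mult_right_mono n nrm_nonneg)
  also have "... = 2 * Ca * ip u u" using nrm_sq[of u] by (simp add: power2_eq_square)
  finally show "ip (A u) u <= 2 * Ca * ip u u" by simp
  assume v: "v : E"
  note lv = El[OF v]
  show "(%x. u x + t * v x) : E" "ip (A u) v = ip u (A v)" by (fact lin[OF u v], fact sym[OF u v])
  assume w: "w : E"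
  show "ip (A (%x. u x + t * v x)) w = ip (A u) w + t * ip (A v) w"
   unfolding Alin[OF lu lv] using El[OF w] by (simp add: ip_add lA lu lv l2_cmult ip_cmult)
 qed (use GE G(3) in auto)
 note lh = El[OF h(1)]
 have hT: "h n x = 1 / B * Top (h n) x" if "x : II" for n x using ET[OF h(1) that] B0 by simp
 have hb: "abs (h n x) <= 1 / B * 16" if x: "x : II" for n x
 proof -
  have "1 / B * abs (Top (h n) x) <= 1 / B * 16" using Top_bound[OF lh, of n x] h(2) B0 by (intro mult_left_mono) auto
  thus ?thesis using hT[OF x] B0 by (simp add: abs_mult)
 qed
 have hlip: "abs (h n x - h n y) <= 1 / B * (16 * c) * abs (x - y)" if x: "x : II" and y: "y : II" for n x y
 proof -
  have "1 / B * abs (Top (h n) x - Top (h n) y) <= 1 / B * (16 * c * abs (x - y))" using Top_lipschitz[OF lh, of n x y] h(2) B0 by (intro mult_left_mono) auto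
  moreover have "abs (h n x - h n y) = 1 / B * abs (Top (h n) x - Top (h n) y)"
   unfolding hT[OF x] hT[OF y] right_diff_distrib[symmetric] abs_mult using B0 by simp
  ultimately show ?thesis by (simp only: mult.assoc)
 qed
 obtain g r where g: "contI g" and r: "strict_mono (r :: nat => nat)"
  and u: "!!e. e > 0 ==> \<forall>\<^sub>F n in sequentially. ALL x:II. (abs (h (r n) x - g x)) < e"
  by (rule arzela_ascoli_lipschitz[of h "1 / B * 16" "1 / B * (16 * c)"]) (rule hb hlip | assumption | blast)+
 note lg = l2_cont[OF g]
 have hl: "(%n. nrm (%x. h (r n) x - g x)) ----> 0" by (rule nrm_uniform_limit[OF g lh u])
 have oh: "orth K (h n)" for n using h(1)[of n] by (simp add: E_def)
 have og: "orth K g" "nrm g = 1" by (rule limit_orth[OF lg oh h(2) hl], rule limit_orth[OF lg oh h(2) hl])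
 have hx: "(%n. h (r n) x) ----> g x" if x: "x : II" for x
 proof (rule tendstoI)
  fix e :: real assume "e > 0"
  from u[OF this] show "\<forall>\<^sub>F n in sequentially. dist (h (r n) x) (g x) < e"
   by (rule eventually_mono) (use x in "auto simp: dist_real_def")
 qed
 have TG: "Top g x = B * g x" if x: "x : II" for x
 proof -
  have "(%n. Top (h (r n)) x) ----> Top g x"
  proof (rule LIM_zero_cancel, rule Lim_null_comparison[OF always_eventually])
   show "(%n. 16 * nrm (%x. h (r n) x - g x)) ----> 0" using tendsto_mult_left[OF hl, of 16] by simp
   show "ALL n. norm (Top (h (r n)) x - Top g x) <= 16 * nrm (%x. h (r n) x - g x)"
    using Top_bound[OF l2_diff[OF lh lg]] Top_diff[OF lh lg] by (simp add: fun_eq_iff)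
  qed
  moreover have "(%n. Top (h (r n)) x) ----> B * g x" unfolding ET[OF h(1) x] by (intro tendsto_intros hx x)
  ultimately show ?thesis using LIMSEQ_unique by blast
 qed
 define D where "D = (%x. A g x + (- ka) * g x)"
 have cD: "contI D" unfolding D_def by (intro continuous_intros cA lg g)
 have "nrm D = 0"
 proof (rule null_imp_eq)
  have "(%n. nrm (?A A h (r n) ka)) ----> 0"
   using LIMSEQ_subseq_LIMSEQ[OF lim r] by (simp add: o_def)
  from tendsto_add[OF this tendsto_mult_left[OF hl, of "2 * Ca + abs ka"]]
  show "(%n. nrm (?A A h (r n) ka) + (2 * Ca + abs ka) * nrm (%x. h (r n) x - g x)) ----> 0" by simp
  fix n
  define b where "b = (%x. h (r n) x - g x)"
  define a where "a = (?A A h (r n) ka)"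
  have lb: "l2 b" unfolding b_def by (rule l2_diff[OF lh lg])
  have la: "l2 a" unfolding a_def by (intro l2_add l2_cmult lA lh)
  have Ab': "A b = (%x. A (h (r n)) x - A g x)" using Alin[OF lh lg, of "r n" "-1"] by (simp add: b_def)
  have De: "D = (%x. a x + (- 1 * A b x + ka * b x))" by (rule ext) (simp only: D_def Ab' a_def, simp add: b_def algebra_simps)
  have "nrm D <= nrm a + nrm (%x. - 1 * A b x + ka * b x)" unfolding De by (intro nrm_triangle la l2_add l2_cmult lA lb)
  also have "nrm (%x. - 1 * A b x + ka * b x) <= nrm (%x. - 1 * A b x) + nrm (%x. ka * b x)" by (intro nrm_triangle l2_cmult lA lb)
  also have "... = nrm (A b) + abs ka * nrm b" unfolding nrm_cmult by simp
  also have "nrm (A b) <= 2 * (Ca * nrm b)" by (rule nrm_const[OF Ab[OF lb] lA[OF lb]]) (use Ca0 nrm_nonneg[of b] in auto)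
  finally have "nrm D <= nrm a + (2 * (Ca * nrm b) + abs ka * nrm b)" by simp
  thus "abs (nrm D - 0) <= 1 * (nrm (?A A h (r n) ka) + (2 * Ca + abs ka) * nrm (%x. h (r n) x - g x))"
   using nrm_nonneg[of D] unfolding a_def[symmetric] b_def[symmetric] by (simp add: distrib_right)
 qed
 hence D0: "(LINT x|nu. (D x)^2) = 0" using nrm_sq[of D] by (simp add: ip_def power2_eq_square)
 have "A g x = ka * g x" if x: "x : II" for x
  using integral_pos_of_cont[OF _ _ D0 x] cD by (simp add: continuous_intros D_def)
 hence LTg: "LT g x = - ka * Top g x" if "x : II" for x using that TG[OF that] by (simp add: LTA)
 have "EX x:II. Top g x ~= 0"
 proof (rule ccontr)
  assume "\<not> ?thesis"
  hence "g x = 0" if "x : II" for x using TG[OF that] that B0 by auto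
  hence "nrm g = nrm (%_. 0)" by (intro nrm_cong) auto
  thus False using og by (simp add: nrm_def ip_def)
 qed
 then obtain x0 where x0: "x0 : II" "Top g x0 ~= 0" by blast
 note Td = Top_deriv[OF l2_integrable[OF lg]]
 have "prolate_eigenpair al c ka (Top g)"
  by (rule eigenpair_of_smooth[OF Td(1) Td(2) Td(5) x0]) (use LTg in "simp add: LT_def")
 then obtain n where n: "ka = ev n" using ev_complete by blast
 have "sl (Top g) (Top1 g) (%x. - ev n * Top g x)"
 proof (rule sl_smooth[where phidd = "Top2 g"])
  show "- ev n * Top g x = (1 - x^2) * Top2 g x - (2 * al + 2) * x * Top1 g x - c^2 * x^2 * Top g x" if "x : II" for x
   using LTg[OF that] n by (simp add: LT_def)
 qed (use Td in "auto intro: has_field_derivative_at_within")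
 define s where "s = Top g 1 / psi n 1 / B"
 have gs: "g x = s * psi n x" if x: "x : II" for x
 proof -
  have "g x = Top g x / B" using TG[OF x] B0 by simp
  also have "... = Top g 1 / psi n 1 * psi n x / B"
   by (rule arg_cong[OF sl_proportional[OF `sl (Top g) (Top1 g) (%x. - ev n * Top g x)` x]])
  finally show ?thesis by (simp add: s_def)
 qed
 have s0: "s ~= 0"
 proof
  assume "s = 0"
  hence "g x0 = 0" using gs[OF x0(1)] by simp
  thus False using TG[OF x0(1)] x0(2) by simp
 qed
 \<comment> \<open>If n <= K, then g would be orthogonal to \<open>psi n\<close>, although it is a
   nonzero multiple of it.\<close>
 have nK: "n > K"
 proof (rule ccontr)
  assume "\<not> n > K"
  hence "ip g (psi n) = 0" using og by (simp add: orth_def)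
  moreover have "ip g (psi n) = ip (%x. s * psi n x) (psi n)" by (rule ip_cong) (use gs in auto)
  ultimately show False using s0 by (simp add: ip_cmult psi_orthonormal)
 qed
 have "lam n = B"
 proof -
  have "Top g 1 = s * Top (psi n) 1" using Top_scale(1)[of g s "psi n", OF gs] by simp
  also have "... = s * (lam n * psi n 1)" by (simp add: Top_psi_I)
  finally have "Top g 1 = s * (lam n * psi n 1)" .
  moreover have "Top g 1 = B * g 1" "g 1 = s * psi n 1" by (rule TG, simp, rule gs, simp)
  ultimately have "B * (s * psi n 1) = s * (lam n * psi n 1)" by (simp only:)
  hence "(s * psi n 1) * lam n = (s * psi n 1) * B" by (simp only: mult_ac)
  moreover have "s * psi n 1 ~= 0" using s0 psi1[of n] by simp
  ultimately show ?thesis using mult_left_cancel by blast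
 qed
 thus ?thesis using nK Bm by blast
qed

end

section \<open>Plancherel\<close>

lemma sigma_finite_lebesgue: "sigma_finite_measure (leb :: real measure)"
proof
 let ?A = "%n. {- real n..real n}"
 show "EX A. countable A & A \<subseteq> sets leb & \<Union>A = space (leb :: real measure) & (ALL a:A. emeasure leb a ~= \<infinity>)"
 proof (intro exI[of _ "range ?A"] conjI ballI)
  have "x : \<Union>(range ?A)" for x :: real
  proof -
   obtain n where "real n >= abs x" using real_arch_simple by blast
   hence "x : {- real n..real n}" by auto
   thus ?thesis by blast
  qed
  thus "\<Union>(range ?A) = space (leb :: real measure)" by auto
 qed auto
qed

lemma pair_sigma_finite_lebesgue: "pair_sigma_finite (leb :: real measure) (leb :: real measure)"
 by (intro pair_sigma_finite.intro sigma_finite_lebesgue)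

lemma borel_imp_lebesgue_measurable: "f : borel_measurable borel ==> (f :: real => _) : Lmeas"
 by (rule measurable_completion) simp

text \<open>Valid without integrability, since the Bochner integral is then 0. This saves
  integrability proofs in the estimates below.\<close>

lemma norm_integral_le_nn_integral:
 "ennreal (norm (integral\<^sup>L M f)) <= (\<integral>\<^sup>+x. ennreal (norm (f x)) \<partial>M)" for f :: "_ => 'b::{banach, second_countable_topology}"
 by (cases "integrable M f") (simp_all add: integral_norm_bound_ennreal not_integrable_integral_eq)

lemma continuous2_measurable:
 fixes k :: "real => real => 'b::topological_space"
 assumes "continuous_on UNIV (%p :: real \<times> real. k (fst p) (snd p))"
 shows "(%(x, y). k x y) : Lmeas2"
proof -
 have "(%p. k (fst p) (snd p)) : borel_measurable (borel :: (real \<times> real) measure)" using assms by (rule borel_measurable_continuous_onI)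
 moreover have "(%p. p) : leb2 \<rightarrow>\<^sub>M (borel :: (real \<times> real) measure)"
 proof -
  have i: "(%x. x) : (leb :: real measure) \<rightarrow>\<^sub>M borel" by (rule measurable_completion) simp
  show ?thesis unfolding borel_prod[symmetric]
   by (rule measurable_pair) (auto intro!: measurable_compose[OF measurable_fst i] measurable_compose[OF measurable_snd i] simp: o_def)
 qed
 ultimately show ?thesis by (auto simp: split_beta' intro: measurable_compose)
qed

lemma kernel_swap:
 fixes k :: "real => real => complex"
 assumes a: "Lint a" and b: "Lint b"
  and k: "continuous_on UNIV (%p :: real \<times> real. k (fst p) (snd p))" "!!x y. norm (k x y) <= 1"
 shows "(LINT om|leb. a om * (LINT x|leb. k x om * b x)) = (LINT x|leb. b x * (LINT om|leb. k x om * a om))"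
proof -
 interpret pair_sigma_finite "leb :: real measure" "leb :: real measure" by (rule pair_sigma_finite_lebesgue)
 have i: "integrable leb2 (%(x, om). b x * a om)"
  by (rule Fubini_integrable) (use a b in "auto simp: norm_mult")
 have "integrable leb2 (%p. case p of (x, om) => a om * (k x om * b x))"
 proof (rule integrable_dominated[OF i])
  have m: "(%p. b (fst p)) : Lmeas2" "(%p. a (snd p)) : Lmeas2"
   using a b by (auto intro!: measurable_compose[OF measurable_fst] measurable_compose[OF measurable_snd])
  show "(%p. case p of (x, om) => a om * (k x om * b x)) : Lmeas2"
   using m continuous2_measurable[OF k(1)] by (simp only: split_beta') (intro borel_measurable_times)
  have "norm (a om) * (norm (k x om) * norm (b x)) <= norm (b x) * norm (a om)" for x om
   using mult_right_mono[OF k(2)[of x om], of "norm (a om) * norm (b x)"] by (simp add: mult_ac)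
  thus "AE p in leb2. norm (case p of (x, om) => a om * (k x om * b x)) <= norm (case p of (x, om) => b x * a om)"
   by (intro AE_I2) (auto simp: norm_mult split_beta')
 qed
 from Fubini_integral[OF this]
 have "(LINT om|leb. (LINT x|leb. a om * (k x om * b x))) = (LINT x|leb. (LINT om|leb. a om * (k x om * b x)))" .
 moreover have "(LINT om|leb. a om * (k x om * b x)) = b x * (LINT om|leb. k x om * a om)" for x
 proof -
  have "(%om. a om * (k x om * b x)) = (%om. b x * (k x om * a om))" by (simp only: mult_ac)
  thus ?thesis by (simp only: integral_mult_right_zero)
 qed
 moreover have "(LINT x|leb. a om * (k x om * b x)) = a om * (LINT x|leb. k x om * b x)" for om
  by (rule integral_mult_right_zero)
 ultimately show ?thesis by (simp only:)
qed

definition ft :: "(real => complex) => real => complex" where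
 "ft u om = (LINT x|leb. cexq (x * om) * u x)"

lemma ft_bound: "Lint u ==> norm (ft u om) <= (LINT x|leb. norm (u x))"
 unfolding ft_def by (rule order_trans[OF integral_norm_bound]) (simp add: norm_mult)

lemma ft_measurable: assumes u: "u : Lmeas" shows "ft u : Lmeas"
 unfolding ft_def[abs_def]
proof (rule sigma_finite_measure.borel_measurable_lebesgue_integral[OF sigma_finite_lebesgue])
 have "(%(om, x). cexq (x * om)) : Lmeas2"
  by (rule continuous2_measurable) (intro continuous_intros)
 moreover have "(%p. u (snd p)) : Lmeas2" using u by (rule measurable_compose[OF measurable_snd])
 ultimately show "(%(om, x). cexq (x * om) * u x) : Lmeas2"
  by (simp only: split_beta') (intro borel_measurable_times)
qed

text \<open>A Gaussian cut-off in frequency; \<open>Gam\<close> is its Fourier transform, 2 pi times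
  an approximate identity as s tends to 0.\<close>

definition gam :: "real => real => real" where "gam s om = exp (- (s * om)\<^sup>2 / 2)"
definition Gam :: "real => real => real" where "Gam s t = 2 * pi * normal_density 0 s t"

text \<open>Reduced by scaling to the characteristic function of the standard normal
  distribution.\<close>

lemma gauss_ft:
 assumes s: "s > 0"
 shows "(LINT om|leb. cexq (t * om) * cor (gam s om)) = cor (Gam s t)"
  "Lint (gam s)"
proof -
 let ?A = "LINT x|lborel. cexq (t * x) * cor (gam s x)"
 let ?B = "- (t / s)\<^sup>2 / 2"
 let ?C = "1 / sqrt (2 * pi)"
 let ?D = "s / sqrt (2 * pi)"
 define f where "f x = std_normal_density x *\<^sub>R iexp (- (t / s) * x)" for x
 have "char std_normal_distribution (- (t / s)) = (LINT x|lborel. f x)"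
  unfolding char_def f_def by (subst integral_density) auto
 also have "... = abs s *\<^sub>R (LINT x|lborel. f (0 + s * x))" by (rule lborel_integral_real_affine) (use s in simp)
 also have "(%x. f (0 + s * x)) = (%x. cor ?C * (cexq (t * x) * cor (gam s x)))"
  using s by (intro ext) (simp add: f_def std_normal_density_def gam_def scaleR_conv_of_real mult_ac)
 also have "(LINT x|lborel. cor ?C * (cexq (t * x) * cor (gam s x)))
   = cor ?C * ?A"
  by (rule integral_mult_right_zero)
 also have "?A =
   (LINT x|leb. cexq (t * x) * cor (gam s x))" (is "_ = ?I")
  by (rule integral_completion[symmetric]) (simp add: gam_def)
 finally have e: "cor (exp ?B) = cor ?D * ?I"
  unfolding char_std_normal_distribution using s by (simp add: scaleR_conv_of_real)
 have "Gam s t = sqrt (2 * pi) / s * exp ?B"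
 proof -
  define q where "q = sqrt (2 * pi)"
  have q: "q > 0" "2 * pi = q * q" by (simp_all add: q_def)
  have "sqrt (2 * pi * s^2) = q * s" using s by (simp add: real_sqrt_mult q_def)
  hence "Gam s t = q * q * (1 / (q * s) * exp (- (t - 0)\<^sup>2 / (2 * s^2)))" by (simp add: Gam_def normal_density_def q(2)[symmetric])
  also have "- (t - 0)\<^sup>2 / (2 * s^2) = - (t / s)\<^sup>2 / 2" by (simp add: power_divide)
  finally show ?thesis using q by (simp add: q_def[symmetric])
 qed
 hence "cor (Gam s t) = cor (sqrt (2 * pi) / s) * cor (exp ?B)" by simp
 also have "... = cor (sqrt (2 * pi) / s * ?D) * ?I" unfolding e by (simp only: of_real_mult mult.assoc)
 also have "sqrt (2 * pi) / s * ?D = 1" using s by simp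
 finally show "?I = cor (Gam s t)" by simp
 have "integrable lborel (%x. sqrt (2 * pi) * std_normal_density (0 + s * x))"
  using s by (intro integrable_mult_right lborel_integrable_real_affine) auto
 hence "integrable lborel (gam s)" by (simp add: std_normal_density_def gam_def[abs_def])
 thus "Lint (gam s)" by (subst integrable_completion) (auto simp: gam_def[abs_def])
qed

lemma Gam_nonneg: "Gam s t >= 0" by (simp add: Gam_def)

lemma Gam_shift: "Gam s (x - y) = 2 * pi * normal_density y s x" "Gam s (x - y) = 2 * pi * normal_density x s y"
 by (auto simp: Gam_def normal_density_def power2_commute)

lemma Gam_nn: assumes s: "s > 0"
 shows "(\<integral>\<^sup>+x. ennreal (Gam s (x - y)) \<partial>leb) = ennreal (2 * pi)" "(\<integral>\<^sup>+y. ennreal (Gam s (x - y)) \<partial>leb) = ennreal (2 * pi)"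
proof -
 have "(\<integral>\<^sup>+x. ennreal (2 * pi * normal_density z s x) \<partial>lborel) = ennreal (2 * pi)" for z
  using s by (subst nn_integral_eq_integral) (auto intro!: integrable_mult_right)
 note * = this
 show "(\<integral>\<^sup>+x. ennreal (Gam s (x - y)) \<partial>leb) = ennreal (2 * pi)" unfolding nn_integral_completion Gam_shift(1) by (rule *)
 show "(\<integral>\<^sup>+y. ennreal (Gam s (x - y)) \<partial>leb) = ennreal (2 * pi)" unfolding nn_integral_completion Gam_shift(2) by (rule *)
qed

text \<open>The Gaussian factor makes the iterated integrals absolutely convergent, so both
  transforms can be unfolded by Fubini; the frequency integral then produces
  \<open>Gam\<close>.\<close>

lemma gauss_parseval:
 assumes u: "Lint u" and v: "Lint v" and s: "s > 0"
 shows "(LINT om|leb. (cnj (ft v om) * cor (gam s om)) * ft u om) =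
   (LINT x|leb. u x * (LINT y|leb. cnj (v y) * cor (Gam s (x - y))))"
  "Lint (%om. (cnj (ft v om) * cor (gam s om)) * ft u om)"
proof -
 let ?A = "%v om s. cnj (ft v om) * cor (gam s om)"
 let ?B = "%x v s. LINT om|leb. cexq (x * om) * (?A v om s)"
 note gi = gauss_ft(2)[OF s]
 have um: "u : Lmeas" "v : Lmeas" using u v by auto
 have mv: "ft v : Lmeas" "ft u : Lmeas" by (intro ft_measurable um)+
 have gc: "Lint (%om. cor (gam s om))" using gi by (rule integrable_bounded_linear[OF bounded_linear_of_real])
 have cm: "(%om. cnj (ft v om)) : Lmeas"
  by (rule measurable_compose[OF mv(1)]) (intro borel_measurable_continuous_onI continuous_intros)
 define Bv where "Bv = (LINT x|leb. norm (v x))"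
 define Bu where "Bu = (LINT x|leb. norm (u x))"
 have B0: "Bv >= 0" "Bu >= 0" by (auto simp: Bv_def Bu_def)
 have gg: "gam s om >= 0" for om by (simp add: gam_def)
 have ia: "Lint (%om. cnj (ft v om) * cor (gam s om))"
  by (rule integrable_dominated[OF integrable_mult_right[OF gi, of Bv]])
    (use ft_bound[OF v] borel_measurable_times[OF cm borel_measurable_integrable[OF gc]] B0 gg in "auto intro!: AE_I2 mult_right_mono simp: norm_mult Bv_def")
 show "Lint (%om. (?A v om s) * ft u om)"
 proof (rule integrable_dominated[OF integrable_mult_right[OF integrable_norm[OF ia], of Bu]])
  show "(%om. (?A v om s) * ft u om) : Lmeas" by (intro borel_measurable_times cm mv borel_measurable_integrable[OF gc])
  show "AE om in leb. norm ((?A v om s) * ft u om) <= norm (Bu * norm (?A v om s))"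
  proof (intro AE_I2)
   fix om
   have "norm (ft u om) * norm (?A v om s) <= Bu * norm (?A v om s)"
    using ft_bound[OF u] by (intro mult_right_mono) (auto simp: Bu_def)
   thus "norm ((?A v om s) * ft u om) <= norm (Bu * norm (?A v om s))"
    using B0 by (simp add: norm_mult mult_ac)
  qed
 qed
 have cv: "cnj (ft v om) = (LINT y|leb. cexp (y * om) * cnj (v y))" for om
  unfolding ft_def by (subst Bochner_Integration.integral_cnj[symmetric]) (simp add: exp_cnj)
 have "(LINT om|leb. (?A v om s) * ft u om) =
   (LINT x|leb. u x * (?B x v s))"
  unfolding ft_def[of u] by (rule kernel_swap[OF ia u]) (auto intro!: continuous_intros)
 moreover have "(?B x v s) =
   (LINT y|leb. cnj (v y) * cor (Gam s (x - y)))" for x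
 proof -
  have ia2: "Lint (%om. cexq (x * om) * cor (gam s om))"
  proof (rule integrable_dominated[OF gi])
   have "(%om. cexq (x * om)) : Lmeas"
    by (intro borel_imp_lebesgue_measurable borel_measurable_continuous_onI continuous_intros)
   thus "(%om. cexq (x * om) * cor (gam s om)) : Lmeas"
    by (intro borel_measurable_times borel_measurable_integrable[OF gc])
  qed (use gg in "auto simp: norm_mult")
  have "(?B x v s) =
   (LINT om|leb. (cexq (x * om) * cor (gam s om)) * (LINT y|leb. cexp (y * om) * cnj (v y)))"
   unfolding cv by (simp only: mult_ac)
  also have "... = (LINT y|leb. cnj (v y) * (LINT om|leb. cexp (y * om) * (cexq (x * om) * cor (gam s om))))"
   by (rule kernel_swap[OF ia2]) (use v in "auto intro!: continuous_intros")
  moreover have "cexp (y * om) * (cexq (x * om) * cor (gam s om)) =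
    cexq ((x - y) * om) * cor (gam s om)" for y om
  proof -
   have "\<i> * cor (y * om) + - (\<i> * cor (x * om)) = - (\<i> * cor ((x - y) * om))" by (simp add: algebra_simps)
   thus ?thesis by (simp only: mult.assoc[symmetric] exp_add[symmetric])
  qed
  ultimately show ?thesis by (simp only: gauss_ft(1)[OF s])
 qed
 ultimately show "(LINT om|leb. (?A v om s) * ft u om) =
   (LINT x|leb. u x * (LINT y|leb. cnj (v y) * cor (Gam s (x - y))))" by (simp only:)
qed

text \<open>Schur's test for the Gaussian kernel, whose integral is \<open>2\<pi>\<close> in each variable.\<close>

lemma ft_L2:
 assumes u: "Lint u" "isq leb u"
 shows "isq leb (ft u)" "nsq leb (ft u) <= 2 * pi * nsq leb u"
proof -
 let ?A = "%s x. \<integral>\<^sup>+y. ennreal (norm (u y) * Gam s (x - y)) \<partial>leb"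
 let ?B = "%x s. \<integral>\<^sup>+y. ennreal ((norm (u x))^2 / 2 * Gam s (x - y)) + ennreal ((norm (u y))^2 / 2 * Gam s (x - y)) \<partial>leb"
 let ?C = "%P x. \<integral>\<^sup>+y. P x y \<partial>leb"
 let ?D = "%om. norm (ft u om)"
 let ?E = "%s x. LINT y|leb. cnj (u y) * cor (Gam s (x - y))"
 let ?F = "%om n. (?D om)^2 * gam (1 / real (Suc n)) om"
 let ?G = "%P. \<integral>\<^sup>+x. (?C P x) \<partial>leb"
 let ?H = "\<integral>\<^sup>+om. ennreal ((?D om)^2) \<partial>leb"
 let ?K = "%s. \<integral>\<^sup>+om. ennreal ((?D om)^2 * gam s om) \<partial>leb"
 let ?M = "%x. (norm (u x))^2 / 2 * (2 * pi)"
 let ?P = "%s. %p. (norm (u (fst p)))^2 / 2 * Gam s (fst p - snd p)"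
 let ?Q = "%s. %p. (norm (u (snd p)))^2 / 2 * Gam s (fst p - snd p)"
 interpret pair_sigma_finite "leb :: real measure" "leb :: real measure" by (rule pair_sigma_finite_lebesgue)
 define I where "I = nsq leb u"
 have I0: "I >= 0" by (simp add: I_def)
 have um: "u : Lmeas" using u by auto
 note fm = ft_measurable[OF um]
 have Gm: "(%(x, y). Gam s (x - y)) : Lmeas2" if "s > 0" for s
  unfolding Gam_def normal_density_def using that by (intro continuous2_measurable continuous_intros) auto
 have Gx: "(%y. Gam s (x - y)) : Lmeas" "(%x. Gam s (x - y)) : Lmeas" if "s > 0" for s x y
  unfolding Gam_def by (intro borel_imp_lebesgue_measurable; measurable)+
 have g1: "(?K s) <= ennreal (2 * pi * I)" if s: "s > 0" for s
 proof -
  have e: "(cnj (ft u om) * cor (gam s om)) * ft u om = cor ((?D om)^2 * gam s om)" for om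
  proof -
   have "cnj (ft u om) * ft u om = cor ((?D om)^2)" by (simp only: mult.commute[of "cnj _"] complex_norm_square)
   thus ?thesis by (simp only: of_real_mult mult_ac) (simp add: mult_ac)
  qed
  note gp = gauss_parseval[OF u(1) u(1) s, unfolded e]
  have gint: "Lint (%om. (?D om)^2 * gam s om)" using gp(2) by (simp only: complex_of_real_integrable_eq)
  have pos: "0 <= (?D om)^2 * gam s om" for om by (simp add: gam_def)
  have "(?K s) = ennreal (norm (cor (LINT om|leb. (?D om)^2 * gam s om)))"
   by (subst nn_integral_eq_integral[OF gint AE_I2[OF pos]]) (simp add: Bochner_Integration.integral_nonneg pos)
  also have "cor (LINT om|leb. (?D om)^2 * gam s om) = (LINT x|leb. u x * (?E s x))"
   using gp(1) by (simp only: integral_complex_of_real)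
  also have "ennreal (norm (LINT x|leb. u x * (?E s x)))
    <= (\<integral>\<^sup>+x. ennreal (norm (u x * (?E s x))) \<partial>leb)"
   by (rule norm_integral_le_nn_integral)
  also have "... <= (\<integral>\<^sup>+x. ennreal (norm (u x)) * (?A s x) \<partial>leb)"
  proof (rule nn_integral_mono)
   fix x
   have "ennreal (norm (?E s x)) <= (?A s x)"
    using norm_integral_le_nn_integral[of leb "%y. cnj (u y) * cor (Gam s (x - y))"] by (simp add: norm_mult Gam_nonneg)
   thus "ennreal (norm (u x * (?E s x))) <= ennreal (norm (u x)) * (?A s x)"
    by (simp add: norm_mult ennreal_mult mult_left_mono)
  qed
  also have "... <= (\<integral>\<^sup>+x. (?B x s) \<partial>leb)"
  proof (rule nn_integral_mono)
   fix x
   have "(%y. norm (u y) * Gam s (x - y)) : Lmeas"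
    by (intro borel_measurable_times Gx[OF s]) (use um in simp)
   hence "ennreal (norm (u x)) * (?A s x) = (\<integral>\<^sup>+y. ennreal (norm (u x)) * ennreal (norm (u y) * Gam s (x - y)) \<partial>leb)"
    by (subst nn_integral_cmult) auto
   also have "... <= (?B x s)"
   proof (rule nn_integral_mono)
    fix y
    have "norm (u x) * norm (u y) <= (norm (u x))^2 / 2 + (norm (u y))^2 / 2" using sum_squares_bound[of "norm (u x)" "norm (u y)"] by simp
    hence "norm (u x) * norm (u y) * Gam s (x - y) <= ((norm (u x))^2 / 2 + (norm (u y))^2 / 2) * Gam s (x - y)" by (intro mult_right_mono Gam_nonneg)
    thus "ennreal (norm (u x)) * ennreal (norm (u y) * Gam s (x - y)) <= ennreal ((norm (u x))^2 / 2 * Gam s (x - y)) + ennreal ((norm (u y))^2 / 2 * Gam s (x - y))"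
     by (simp add: ennreal_mult[symmetric] ennreal_plus[symmetric] Gam_nonneg distrib_right mult.assoc del: ennreal_plus)
   qed
   finally show "ennreal (norm (u x)) * (?A s x) <= (?B x s)" .
  qed
  also have "... = ennreal (2 * pi * I)"
  proof -
   define P Q where "P x y = ennreal ((norm (u x))^2 / 2 * Gam s (x - y))" and "Q x y = ennreal ((norm (u y))^2 / 2 * Gam s (x - y))" for x y
   have up: "(%p. u (fst p)) : Lmeas2" "(%p. u (snd p)) : Lmeas2"
    using um by (auto intro: measurable_compose[OF measurable_fst] measurable_compose[OF measurable_snd])
   have mP: "case_prod P : Lmeas2" "case_prod Q : Lmeas2"
   proof -
    have "(?P s) : Lmeas2"
     "(?Q s) : Lmeas2"
    proof -
     have n2: "(%z::complex. (norm z)^2 / 2) : borel_measurable borel" by (intro borel_measurable_continuous_onI continuous_intros) auto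
     have G: "(%p. Gam s (fst p - snd p)) : Lmeas2" using Gm[OF s] by (simp only: split_beta')
     show "(?P s) : Lmeas2"
      "(?Q s) : Lmeas2"
      by (intro borel_measurable_times G measurable_compose[OF up(1) n2] measurable_compose[OF up(2) n2])+
    qed
    from measurable_compose[OF this(1) measurable_ennreal] measurable_compose[OF this(2) measurable_ennreal]
    show "case_prod P : Lmeas2" "case_prod Q : Lmeas2"
     by (simp_all only: P_def Q_def split_beta')
   qed
   have half: "(\<integral>\<^sup>+x. ennreal (?M x) \<partial>leb) = ennreal (pi * I)"
   proof -
    have "(\<integral>\<^sup>+x. ennreal (pi * (norm (u x))^2) \<partial>leb) = ennreal (LINT x|leb. pi * (norm (u x))^2)"
     using u(2) by (intro nn_integral_eq_integral) auto
    thus ?thesis by (simp add: I_def mult.commute)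
   qed
   have m1: "P x : Lmeas" "Q x : Lmeas" for x
    using measurable_compose[OF measurable_Pair1' mP(1)] measurable_compose[OF measurable_Pair1' mP(2)] by auto
   have cG: "(\<integral>\<^sup>+z. ennreal (a * G z) \<partial>leb) = ennreal (a * (2 * pi))"
    if "a >= 0" "G : Lmeas" "!!z. G z >= 0" "(\<integral>\<^sup>+z. ennreal (G z) \<partial>leb) = ennreal (2 * pi)" for a and G :: "real => real"
   proof -
    have "(\<integral>\<^sup>+z. ennreal (a * G z) \<partial>leb) = (\<integral>\<^sup>+z. ennreal a * ennreal (G z) \<partial>leb)" using that by (simp add: ennreal_mult)
    also have "... = ennreal a * ennreal (2 * pi)"
     using measurable_compose[OF that(2) measurable_ennreal] by (subst nn_integral_cmult) (simp_all only: that(4))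
    also have "... = ennreal (a * (2 * pi))" using that(1) by (intro ennreal_mult[symmetric]) auto
    finally show ?thesis .
   qed
   have iP: "(?C P x) = ennreal (?M x)" for x
    unfolding P_def by (rule cG[OF _ Gx(1)[OF s] Gam_nonneg Gam_nn(2)[OF s]]) simp
   have iQ: "(\<integral>\<^sup>+x. Q x y \<partial>leb) = ennreal (?M y)" for y
    unfolding Q_def by (rule cG[OF _ Gx(2)[OF s] Gam_nonneg Gam_nn(1)[OF s]]) simp
   have "(\<integral>\<^sup>+x. (\<integral>\<^sup>+y. P x y + Q x y \<partial>leb) \<partial>leb) = (\<integral>\<^sup>+x. (?C P x) + (?C Q x) \<partial>leb)"
    by (simp add: nn_integral_add m1)
   also have "... = (?G P) + (?G Q)"
    by (rule nn_integral_add; rule sigma_finite_measure.borel_measurable_nn_integral[OF sigma_finite_lebesgue]; fact mP)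
   also have "(?G Q) = (\<integral>\<^sup>+y. (\<integral>\<^sup>+x. Q x y \<partial>leb) \<partial>leb)" by (rule Fubini'[OF mP(2), symmetric])
   finally show ?thesis unfolding iP iQ half P_def[symmetric] Q_def[symmetric] using I0 by (simp add: ennreal_plus[symmetric] del: ennreal_plus)
  qed
  finally show ?thesis .
 qed
 \<comment> \<open>The Gaussian is removed by Fatou's lemma, which is sufficient since the bound 2
   pi I does not depend on s.\<close>
 have "?H <= (\<integral>\<^sup>+om. liminf (%n. ennreal (?F om n)) \<partial>leb)"
 proof (rule nn_integral_mono)
  fix om
  have "(%n. (?D om)^2 * gam (1 / real (Suc n)) om) ----> (?D om)^2 * exp (- (0 * om)\<^sup>2 / 2)"
   unfolding gam_def by (intro tendsto_intros LIMSEQ_Suc[OF lim_1_over_n]) auto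
  hence "(%n. ennreal (?F om n)) ----> ennreal ((?D om)^2)"
   by (intro tendsto_ennrealI) simp
  from lim_imp_Liminf[OF _ this]
  show "ennreal ((?D om)^2) <= liminf (%n. ennreal (?F om n))" by simp
 qed
 also have "... <= liminf (%n. \<integral>\<^sup>+om. ennreal (?F om n) \<partial>leb)"
 proof (rule nn_integral_liminf)
  fix n
  have "gam (1 / real (Suc n)) : Lmeas" using gauss_ft(2)[of "1 / real (Suc n)"] by auto
  thus "(%om. ennreal (?F om n)) : Lmeas" using fm by auto
 qed
 also have "... <= liminf (%n. ennreal (2 * pi * I))" by (rule Liminf_mono) (auto intro!: always_eventually g1)
 also have "... = ennreal (2 * pi * I)" by (simp add: Liminf_const)
 finally have fin: "?H <= ennreal (2 * pi * I)" .
 show int: "isq leb (ft u)"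
  by (rule integrableI_bounded) (use fm fin in "auto simp: le_less_trans[OF _ ennreal_less_top]")
 have "ennreal (nsq leb (ft u)) <= ennreal (2 * pi * I)" using fin nn_integral_eq_integral[OF int] by simp
 thus "nsq leb (ft u) <= 2 * pi * nsq leb u"
  using I0 by (subst (asm) ennreal_le_iff) (auto simp: I_def)
qed

lemma integrable_mult_L2:
 fixes a b :: "'a => complex"
 assumes "a : borel_measurable M" "b : borel_measurable M"
  and "isq M a" "isq M b"
 shows "integrable M (%x. a x * b x)"
  "norm (LINT x|M. a x * b x) <= sqrt (nsq M a) * sqrt (nsq M b)"
proof -
 let ?A = "LINT x|M. norm (a x) * norm (b x)"
 have p: "norm (a x) * norm (b x) <= (norm (a x))^2 + (norm (b x))^2" for x
  using sum_squares_bound[of "norm (a x)" "norm (b x)"] mult_nonneg_nonneg[OF norm_ge_zero norm_ge_zero, of "a x" "b x"] by linarith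
 show i: "integrable M (%x. a x * b x)"
  by (rule integrable_dominated[OF Bochner_Integration.integrable_add[OF assms(3,4)]])
    (use assms p in "auto simp: norm_mult intro!: AE_I2 borel_measurable_times")
 hence ni: "integrable M (%x. norm (a x) * norm (b x))" using integrable_norm[OF i] by (simp add: norm_mult)
 have "?A^2 <= nsq M a * nsq M b"
 proof (rule discriminant_nonneg)
  fix t
  have "0 <= (LINT x|M. (norm (a x) + t * norm (b x))^2)" by simp
  also have "(%x. (norm (a x) + t * norm (b x))^2) = (%x. (norm (a x))^2 + (2 * t) * (norm (a x) * norm (b x)) + t^2 * (norm (b x))^2)"
   by (auto simp: power2_eq_square algebra_simps)
  also have "(LINT x|M. (norm (a x))^2 + (2 * t) * (norm (a x) * norm (b x)) + t^2 * (norm (b x))^2)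
    = nsq M a + 2 * t * ?A + t^2 * nsq M b"
   using assms(3,4) ni by simp
  finally show "0 <= nsq M a + 2 * t * ?A + t^2 * nsq M b" .
 qed
 hence "sqrt (?A^2) <= sqrt ((nsq M a) * (nsq M b))" by (rule real_sqrt_le_mono)
 hence "?A <= sqrt (nsq M a) * sqrt (nsq M b)"
  by (simp add: real_sqrt_mult Bochner_Integration.integral_nonneg)
 moreover have "norm (LINT x|M. a x * b x) <= ?A"
  using integral_norm_bound[of M "%x. a x * b x"] by (simp add: norm_mult)
 ultimately show "norm (LINT x|M. a x * b x) <= sqrt (nsq M a) * sqrt (nsq M b)" by linarith
qed

lemma integrable_indicator_Icc: "Lint (indicator {a..b} :: real => real)"
proof -
 have "integrable lborel (indicator {a..b} :: real => real)"
  by (rule integrable_real_indicator) (auto simp: emeasure_lborel_Icc_eq)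
 thus ?thesis by (subst integrable_completion) (rule borel_measurable_indicator, simp, assumption)
qed

lemma integrable_indicator_I: "Lint (%x::real. K * chi x)" for K :: real
 by (rule integrable_mult_right[OF integrable_indicator_Icc])

section \<open>Parseval's formula against functions cut off to the interval\<close>

definition cut_I :: "(real => complex) => real => complex" where
 "cut_I phi x = chi x *\<^sub>R phi x"

lemma cut_facts:
 assumes c: "continuous_on UNIV phi"
 obtains B where "!!x. norm (cut_I phi x) <= B" "B >= 0" "cut_I phi : borel_measurable borel" "cut_I phi : Lmeas"
  "Lint (cut_I phi)" "Lint (%x. (norm (cut_I phi x))^2)"
proof -
 have "bounded (phi ` II)" using c by (intro compact_imp_bounded compact_continuous_image continuous_on_subset[OF c]) auto
 then obtain B where B: "!!x. x : II ==> norm (phi x) <= B" by (force simp: bounded_iff)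
 have B0: "B >= 0" using B[of 0] norm_ge_zero[of "phi 0"] by (simp add: order_trans[OF norm_ge_zero])
 have b: "norm (cut_I phi x) <= B" for x using B[of x] B0 by (simp add: cut_I_def indicator_def)
 have m: "cut_I phi : borel_measurable borel" unfolding cut_I_def[abs_def]
  by (intro borel_measurable_scaleR borel_measurable_indicator borel_measurable_continuous_onI[OF c]) simp
 note ml = borel_imp_lebesgue_measurable[OF m]
 have ii: "Lint (%x::real. K * chi x)" for K :: real
  by (rule integrable_indicator_I)
 have i1: "Lint (cut_I phi)"
 proof (rule integrable_dominated[OF ii[of B] ml], intro AE_I2)
  fix x show "norm (cut_I phi x) <= norm (B * chi x)" using B[of x] B0 by (simp add: cut_I_def indicator_def)
 qed
 have i2: "Lint (%x. (norm (cut_I phi x))^2)"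
 proof (rule integrable_dominated[OF ii[of "B^2"]], goal_cases)
  case 2
  show ?case
  proof (intro AE_I2)
   fix x show "norm ((norm (cut_I phi x))^2) <= norm (B^2 * chi x)" using B[of x] B0 by (simp add: cut_I_def indicator_def power_mono)
  qed
 qed (use ml in simp)
 show ?thesis by (rule that[OF b B0 m ml i1 i2])
qed

text \<open>Away from the two jumps the cut-off function is continuous. The substitution y = x + s z
  makes the Gaussian independent of s, and dominated convergence applies.\<close>

lemma Gam_conv_limit:
 assumes c: "continuous_on UNIV phi" and x: "x ~= 1" "x ~= -1"
 shows "(%n. (LINT y|leb. cnj (cut_I phi y) * cor (Gam (1 / real (Suc n)) (x - y)))) ----> cor (2 * pi) * cnj (cut_I phi x)"
proof -
 let ?A = "%z. 2 * pi * std_normal_density z"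
 let ?B = "%x s n z. cut_I phi (x + s n * z)"
 let ?C = "%x s n. LINT z|lborel. cnj (?B x s n z) * cor (?A z)"
 let ?D = "%x. LINT z|lborel. cnj (cut_I phi x) * cor (?A z)"
 let ?E = "%s n x. LINT y|leb. cnj (cut_I phi y) * cor (Gam (s n) (x - y))"
 obtain B where B: "!!x. norm (cut_I phi x) <= B" "B >= 0" "cut_I phi : borel_measurable borel"
  using cut_facts[OF c] by metis
 define s where "s n = 1 / real (Suc n)" for n
 have s0: "s n > 0" for n by (simp add: s_def)
 have sl: "s ----> 0" unfolding s_def by (rule LIMSEQ_Suc[OF lim_1_over_n])
 have cm: "(%y. cnj (cut_I phi y)) : borel_measurable borel"
  by (rule measurable_compose[OF B(3)]) (intro borel_measurable_continuous_onI continuous_intros)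
 have eq: "(?E s n x) =
    (?C x s n)" for n
 proof -
  have m: "(%y. cnj (cut_I phi y) * cor (Gam (s n) (x - y))) : borel_measurable lborel"
  proof -
   have "(%y. Gam (s n) (x - y)) : borel_measurable borel" unfolding Gam_def by measurable
   thus ?thesis using cm by (auto intro!: borel_measurable_times)
  qed
  have "(?E s n x) = (LINT y|lborel. cnj (cut_I phi y) * cor (Gam (s n) (x - y)))"
   by (rule integral_completion[OF m])
  also have "... = abs (s n) *\<^sub>R (LINT z|lborel. cnj (?B x s n z) * cor (Gam (s n) (x - (x + s n * z))))"
   by (rule lborel_integral_real_affine) (use s0[of n] in simp)
  also have "... = (LINT z|lborel. s n *\<^sub>R (cnj (?B x s n z) * cor (Gam (s n) (x - (x + s n * z)))))"
   using s0[of n] by (subst integral_scaleR_right) simp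
  also have "... = (?C x s n)"
  proof (rule integral_eqI[OF refl])
   fix z
   have "s n * Gam (s n) (x - (x + s n * z)) = 2 * pi * std_normal_density z"
    using s0[of n] by (simp add: Gam_def normal_density_def real_sqrt_mult power_mult_distrib)
   thus "s n *\<^sub>R (cnj (?B x s n z) * cor (Gam (s n) (x - (x + s n * z)))) = cnj (?B x s n z) * cor (?A z)"
    by (simp only: scaleR_conv_of_real mult.left_commute[of "cor (s n)"] of_real_mult[symmetric])
  qed
  finally show ?thesis .
 qed
 have cc: "isCont (cut_I phi) x"
 proof -
  have "EX S. open S & x : S & ((ALL y:S. cut_I phi y = phi y) \<or> (ALL y:S. cut_I phi y = 0))"
  proof -
   consider "x < -1" | "-1 < x" "x < 1" | "x > 1" using x by linarith
   thus ?thesis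
   proof cases
    case 1
    thus ?thesis by (intro exI[of _ "{..<-1}"]) (auto simp: cut_I_def)
   next
    case 2
    thus ?thesis by (intro exI[of _ "{-1<..<1}"]) (auto simp: cut_I_def)
   next
    case 3
    thus ?thesis by (intro exI[of _ "{1<..}"]) (auto simp: cut_I_def)
   qed
  qed
  then obtain S where S: "open S" "x : S" "(ALL y:S. cut_I phi y = phi y) \<or> (ALL y:S. cut_I phi y = 0)" by blast
  have "continuous_on S (cut_I phi)" using S(3)
  proof
   assume "ALL y:S. cut_I phi y = phi y"
   thus ?thesis using continuous_on_subset[OF c, of S] by (auto cong: continuous_on_cong)
  next
   assume "ALL y:S. cut_I phi y = 0"
   thus ?thesis by (auto cong: continuous_on_cong)
  qed
  thus ?thesis using S continuous_on_eq_continuous_at by blast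
 qed
 have "(%n. (?C x s n)) ---->
   (?D x)"
 proof (rule integral_dominated_convergence[where w = "%z. B * (?A z)"])
  show "integrable lborel (%z. B * (?A z))" by (intro integrable_mult_right) auto
  show "AE z in lborel. (%n. cnj (?B x s n z) * cor (?A z)) ----> cnj (cut_I phi x) * cor (?A z)"
  proof (intro AE_I2 tendsto_mult tendsto_const tendsto_cnj)
   fix z
   have "(%n. x + s n * z) ----> x + 0 * z" by (intro tendsto_intros sl)
   thus "(%n. cut_I phi (x + s n * z)) ----> cut_I phi x" using isCont_tendsto_compose[OF cc] by simp
  qed
  show "AE z in lborel. norm (cnj (?B x s n z) * cor (?A z)) <= B * (?A z)" for n
  proof (intro AE_I2)
   fix z
   have "norm (?B x s n z) * (?A z) <= B * (?A z)" by (intro mult_right_mono B) auto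
   thus "norm (cnj (?B x s n z) * cor (?A z)) <= B * (?A z)"
    unfolding norm_mult complex_mod_cnj norm_of_real by simp
  qed
  have sm: "(%z. cor (?A z)) : borel_measurable lborel" by measurable
  show "(%z. cnj (cut_I phi x) * cor (?A z)) : borel_measurable lborel"
   by (intro borel_measurable_times sm) simp
  show "(%z. cnj (?B x s n z) * cor (?A z)) : borel_measurable lborel" for n
  proof (intro borel_measurable_times sm)
   have "(%z. x + s n * z) : borel_measurable borel" by measurable
   from measurable_compose[OF this cm] show "(%z. cnj (?B x s n z)) : borel_measurable lborel" by simp
  qed
 qed
 moreover have "(?D x) = cor (2 * pi) * cnj (cut_I phi x)"
 proof -
  have "(LINT z|lborel. cor (?A z)) = cor (2 * pi)"
   unfolding integral_complex_of_real by simp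
  thus ?thesis by (simp only: integral_mult_right_zero mult.commute)
 qed
 ultimately show ?thesis by (simp only: eq[symmetric]) (simp only: s_def)
qed

text \<open>The limit s to 0 in \<open>gauss_parseval\<close>. On the left the product of two
  square-integrable transforms dominates, by \<open>ft_L2\<close>; on the right the Gaussian
  averages are bounded by 2 pi B, and the two exceptional points form a null set.\<close>

lemma parseval_cut:
 assumes u: "Lint u" "isq leb u" and c: "continuous_on UNIV phi"
 shows "(LINT om|leb. cnj (ft (cut_I phi) om) * ft u om) = cor (2 * pi) * (LINT x|leb. u x * cnj (cut_I phi x))"
proof -
 let ?A = "%s n x. LINT y|leb. cnj (cut_I phi y) * cor (Gam (s n) (x - y))"
 let ?B = "%om. ft (cut_I phi) om"
 let ?C = "%om s n. cnj (?B om) * cor (gam (s n) om)"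
 let ?D = "%x. cor (2 * pi) * cnj (cut_I phi x)"
 let ?E = "%om. cnj (?B om) * ft u om"
 let ?F = "LINT om|leb. cnj (?B om) * ft u om"
 obtain B where B: "!!x. norm (cut_I phi x) <= B" "B >= 0" "cut_I phi : borel_measurable borel" "cut_I phi : Lmeas"
  "Lint (cut_I phi)" "Lint (%x. (norm (cut_I phi x))^2)"
  by (rule cut_facts[OF c]) blast
 have um: "u : Lmeas" using u by auto
 define s where "s n = 1 / real (Suc n)" for n
 have s0: "s n > 0" for n by (simp add: s_def)
 have sl: "s ----> 0" unfolding s_def by (rule LIMSEQ_Suc[OF lim_1_over_n])
 have mf: "ft u : Lmeas" "ft (cut_I phi) : Lmeas" by (intro ft_measurable um B)+
 have cm: "(%om. cnj (?B om)) : Lmeas"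
  by (rule measurable_compose[OF mf(2)]) (intro borel_measurable_continuous_onI continuous_intros)
 have cl2: "Lint (%om. (norm (cnj (?B om)))^2)" using ft_L2(1)[OF B(5,6)] by simp
 have iprod: "Lint (%om. cnj (?B om) * ft u om)"
  by (rule integrable_mult_L2(1)[OF cm mf(1) cl2 ft_L2(1)[OF u]])
 have "(%n. (LINT om|leb. (?C om s n) * ft u om)) ----> ?F"
 proof (rule integral_dominated_convergence[where w = "%om. norm (?E om)"])
  show "Lint (%om. norm (?E om))" using iprod by (rule integrable_norm)
  show "(%om. cnj (?B om) * ft u om) : Lmeas" using iprod by auto
  show "(%om. (?C om s n) * ft u om) : Lmeas" for n
   using gauss_parseval(2)[OF u(1) B(5) s0[of n]] by auto
  show "AE om in leb. (%n. (?C om s n) * ft u om) ----> cnj (?B om) * ft u om"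
  proof (intro AE_I2)
   fix om
   have "(%n. (?C om s n) * ft u om) ----> (cnj (?B om) * cor (exp (- (0 * om)\<^sup>2 / 2))) * ft u om"
    unfolding gam_def by (intro tendsto_intros sl) auto
   thus "(%n. (?C om s n) * ft u om) ----> cnj (?B om) * ft u om" by simp
  qed
  show "AE om in leb. norm ((?C om s n) * ft u om) <= norm (?E om)" for n
  proof (intro AE_I2)
   fix om
   have g: "0 <= gam (s n) om" "gam (s n) om <= 1" by (auto simp: gam_def)
   have "norm (?B om) * gam (s n) om * norm (ft u om) <= norm (?B om) * 1 * norm (ft u om)"
    using g by (intro mult_right_mono mult_left_mono) auto
   thus "norm ((?C om s n) * ft u om) <= norm (?E om)"
    using g by (simp add: norm_mult)
  qed
 qed
 moreover have "(%n. (LINT x|leb. u x * (?A s n x))) ----> (LINT x|leb. u x * (?D x))"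
 proof (rule integral_dominated_convergence[where w = "%x. norm (u x) * (2 * pi * B)"])
  show "Lint (%x. norm (u x) * (2 * pi * B))" using u by auto
  have cB: "(%x. cnj (cut_I phi x)) : Lmeas"
   by (rule measurable_compose[OF B(4)]) (intro borel_measurable_continuous_onI continuous_intros)
  show "(%x. u x * (?D x)) : Lmeas"
   by (intro borel_measurable_times um cB borel_measurable_const)
  show "(%x. u x * (?A s n x)) : Lmeas" for n
  proof (intro borel_measurable_times um sigma_finite_measure.borel_measurable_lebesgue_integral[OF sigma_finite_lebesgue])
   have "(%(x, y). cor (Gam (s n) (x - y))) : Lmeas2"
    unfolding Gam_def normal_density_def using s0[of n] by (intro continuous2_measurable continuous_intros) auto
   moreover have "(%p. cnj (cut_I phi (snd p))) : Lmeas2" by (rule measurable_compose[OF measurable_snd cB])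
   ultimately show "(%(x, y). cnj (cut_I phi y) * cor (Gam (s n) (x - y))) : Lmeas2"
    by (simp only: split_beta') (intro borel_measurable_times)
  qed
  show "AE x in leb. (%n. u x * (?A s n x)) ----> u x * (?D x)"
  proof (rule AE_I'[of "{1, -1}"])
   show "{1, -1 :: real} : null_sets leb" by (intro null_sets_completionI countable_imp_null_set_lborel) auto
   show "{x : space leb. \<not> (%n. u x * (?A s n x)) ----> u x * (?D x)} \<subseteq> {1, -1}"
    using tendsto_mult_left[OF Gam_conv_limit[OF c, folded s_def]] by blast
  qed
  show "AE x in leb. norm (u x * (?A s n x)) <= norm (u x) * (2 * pi * B)" for n
  proof (intro AE_I2)
   fix x
   have "ennreal (norm (?A s n x)) <= (\<integral>\<^sup>+y. ennreal (norm (cnj (cut_I phi y) * cor (Gam (s n) (x - y)))) \<partial>leb)"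
    by (rule norm_integral_le_nn_integral)
   also have "... <= (\<integral>\<^sup>+y. ennreal B * ennreal (Gam (s n) (x - y)) \<partial>leb)"
   proof (rule nn_integral_mono)
    fix y
    have "norm (cut_I phi y) * Gam (s n) (x - y) <= B * Gam (s n) (x - y)" by (intro mult_right_mono B Gam_nonneg)
    thus "ennreal (norm (cnj (cut_I phi y) * cor (Gam (s n) (x - y)))) <= ennreal B * ennreal (Gam (s n) (x - y))"
     using B(2) by (simp add: norm_mult ennreal_mult[symmetric] Gam_nonneg ennreal_leI)
   qed
   also have "... = ennreal B * ennreal (2 * pi)"
   proof (subst nn_integral_cmult)
    have "(%y. Gam (s n) (x - y)) : Lmeas" unfolding Gam_def by (intro borel_imp_lebesgue_measurable) measurable
    thus "(%y. ennreal (Gam (s n) (x - y))) : Lmeas" by (rule measurable_compose[OF _ measurable_ennreal])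
   qed (simp only: Gam_nn(2)[OF s0])
   also have "... = ennreal (2 * pi * B)" using B(2) by (subst ennreal_mult[symmetric]) (auto simp: mult.commute)
   finally have "norm (?A s n x) <= 2 * pi * B"
    using B(2) by (subst (asm) ennreal_le_iff) auto
   thus "norm (u x * (?A s n x)) <= norm (u x) * (2 * pi * B)"
    unfolding norm_mult by (intro mult_left_mono) auto
  qed
 qed
 ultimately have "?F = (LINT x|leb. u x * (?D x))"
  unfolding gauss_parseval(1)[OF u(1) B(5) s0] by (rule LIMSEQ_unique)
 also have "... = (LINT x|leb. cor (2 * pi) * (u x * cnj (cut_I phi x)))" by (simp only: mult.left_commute)
 also have "... = cor (2 * pi) * (LINT x|leb. u x * cnj (cut_I phi x))" by (rule integral_mult_right_zero)
 finally show ?thesis .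
qed

text \<open>The norm of r is recovered from pairings with cut-off continuous functions. A measurable
  r is almost everywhere a limit of continuous functions; truncating these at height K gives bounded
  test functions that converge to the truncation of r, and finally K tends to infinity.\<close>

lemma L2_dual_bound:
 assumes r: "r : Lmeas" "!!x. x \<notin> II ==> r x = 0" "isq leb r" and e0: "\<epsilon> >= 0"
  and e: "!!phi. continuous_on UNIV phi ==> norm (LINT x|leb. r x * cnj (cut_I phi x)) <= \<epsilon> * sqrt (LINT x|leb. (norm (cut_I phi x))^2)"
 shows "nsq leb r <= \<epsilon>^2"
proof -
 let ?A = "%T n x. norm (T (real (Suc n)) (r x))"
 let ?B = "%K. LINT x|leb. K / max K (norm (r x)) * (norm (r x))^2"
 let ?C = "%T K F n. %x. T K (F n x)"
 let ?D = "%T K F n x. cut_I (?C T K F n) x"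
 let ?E = "%K z. K / max K (norm z) * (norm z)^2"
 let ?F = "%T K. LINT x|leb. r x * cnj (T K (r x))"
 let ?G = "%T K. LINT x|leb. (norm (T K (r x)))^2"
 let ?H = "%K. %x. K / max K (norm (r x)) * (norm (r x))^2"
 have "r measurable_on UNIV" by (rule lebesgue_measurable_imp_measurable_on[OF r(1)]) simp
 then obtain N F where N: "negligible N" and F: "!!n. continuous_on UNIV (F n)" "!!x. x \<notin> N ==> (%n::nat. F n x) ----> r x"
  unfolding measurable_on_def by auto
 have N0: "N : null_sets leb" using N negligible_iff_null_sets by blast
 \<comment> \<open>Radial truncation: z itself for |z| <= K, and K z / |z| otherwise. It is
   continuous, so it preserves continuity of the approximants.\<close>
 define T where "T K z = (K / max K (norm z)) *\<^sub>R z" for K :: real and z :: complex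
 have Tc: "continuous_on UNIV (T K)" if "K > 0" for K unfolding T_def using that by (intro continuous_intros) (auto simp: max_def)
 have Tb: "norm (T K z) <= K" "norm (T K z) <= norm z" if "K > 0" for K z
  using that by (auto simp: T_def max_def field_simps mult_left_mono divide_le_eq)
 have T0: "T K 0 = 0" for K by (simp add: T_def)
 \<comment> \<open>The pairing of r with its truncation is real and dominates the squared modulus of
   the truncation, which leads to X <= eps sqrt X for X its integral.\<close>
 have Tr: "z * cnj (T K z) = cor (?E K z)" for K z
  by (simp only: T_def scaleR_conv_of_real complex_cnj_mult complex_cnj_complex_of_real of_real_mult complex_norm_square mult.left_commute)
 have Tsq: "(norm (T K z))^2 <= K / max K (norm z) * (norm z)^2" if "K > 0" for K z
 proof -
  define q where "q = K / max K (norm z)"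
  have q: "0 <= q" "q <= 1" using that by (auto simp: q_def divide_le_eq)
  have "norm (T K z) = q * norm z" using q by (simp add: T_def q_def[symmetric])
  hence "(norm (T K z))^2 = q * (q * (norm z)^2)" by (simp add: power2_eq_square)
  also have "... <= 1 * (q * (norm z)^2)" using q by (intro mult_right_mono) auto
  finally show ?thesis by (simp add: q_def)
 qed
 have ii: "Lint (%x::real. K * chi x)" for K :: real
  by (rule integrable_indicator_I)
 have Tm: "(%x. T K (r x)) : Lmeas" if "K > 0" for K
  by (rule measurable_compose[OF r(1) borel_measurable_continuous_onI[OF Tc[OF that]]])
 have main: "(?G T K) <= \<epsilon>^2" if K: "K > 0" for K
 proof -
  have Fc: "continuous_on UNIV (?C T K F n)" for n by (rule continuous_on_compose2[OF Tc[OF K] F(1)]) auto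
  have cb: "norm (?D T K F n x) <= K * chi x" for n x using Tb(1)[OF K] by (simp add: cut_I_def indicator_def)
  have cl: "(%n. cut_I (?C T K F n) x) ----> T K (r x)" if x: "x \<notin> N" for x
  proof (cases "x : II")
   case True
   have "isCont (T K) (r x)" using Tc[OF K] by (simp add: continuous_on_eq_continuous_at)
   thus ?thesis using True isCont_tendsto_compose[OF _ F(2)[OF x]] by (simp add: cut_I_def)
  next
   case False
   thus ?thesis using r(2)[OF False] T0 by (simp add: cut_I_def)
  qed
  have cm: "cut_I (?C T K F n) : Lmeas" for n using cut_facts[OF Fc[of n]] by metis
  have cn: "cnj : borel_measurable borel" by (intro borel_measurable_continuous_onI continuous_intros)
  have l1: "(%n. (LINT x|leb. r x * cnj (?D T K F n x))) ----> (?F T K)"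
  proof (rule integral_dominated_convergence[where w = "%x. (norm (r x))^2 + K^2 * chi x"])
   show "Lint (%x. (norm (r x))^2 + K^2 * chi x)" by (intro Bochner_Integration.integrable_add r(3) ii)
   show "(%x. r x * cnj (T K (r x))) : Lmeas"
    by (intro borel_measurable_times r(1) measurable_compose[OF Tm[OF K] cn])
   show "(%x. r x * cnj (?D T K F n x)) : Lmeas" for n
    by (intro borel_measurable_times r(1) measurable_compose[OF cm cn])
   show "AE x in leb. (%n. r x * cnj (?D T K F n x)) ----> r x * cnj (T K (r x))"
    by (rule AE_I'[OF N0]) (use cl in "auto intro!: tendsto_intros")
   show "AE x in leb. norm (r x * cnj (?D T K F n x)) <= (norm (r x))^2 + K^2 * chi x" for n
   proof (intro AE_I2)
    fix x
    have "norm (r x) * norm (?D T K F n x) <= norm (r x) * (K * chi x)" by (intro mult_left_mono cb) auto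
    also have "... <= (norm (r x))^2 + (K * chi x)^2"
    proof -
     have "0 <= norm (r x) * (K * chi x)" using K by (intro mult_nonneg_nonneg) (auto simp: indicator_def)
     thus ?thesis using sum_squares_bound[of "norm (r x)" "K * chi x"] by linarith
    qed
    also have "(K * chi x)^2 = K^2 * chi x" by (simp add: indicator_def)
    finally show "norm (r x * cnj (?D T K F n x)) <= (norm (r x))^2 + K^2 * chi x" by (simp add: norm_mult)
   qed
  qed
  have l2: "(%n. (LINT x|leb. (norm (?D T K F n x))^2)) ----> (?G T K)"
  proof (rule integral_dominated_convergence[where w = "%x. K^2 * chi x"])
   show "(%x. (norm (T K (r x)))^2) : Lmeas" using Tm[OF K] by simp
   show "(%x. (norm (?D T K F n x))^2) : Lmeas" for n using cm[of n] by simp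
   show "AE x in leb. (%n. (norm (?D T K F n x))^2) ----> (norm (T K (r x)))^2"
    by (rule AE_I'[OF N0]) (use cl in "auto intro!: tendsto_intros")
   show "AE x in leb. norm ((norm (?D T K F n x))^2) <= K^2 * chi x" for n
   proof (intro AE_I2)
    fix x
    have "(norm (?D T K F n x))^2 <= (K * chi x)^2" by (intro power_mono cb) auto
    also have "(K * chi x)^2 = K^2 * chi x" by (simp add: indicator_def)
    finally show "norm ((norm (?D T K F n x))^2) <= K^2 * chi x" by (simp only: real_norm_def abs_of_nonneg[OF zero_le_power2])
   qed
  qed (rule ii)
  define X where "X = (?G T K)"
  have X0: "X >= 0" by (simp add: X_def)
  have le: "norm (?F T K) <= \<epsilon> * sqrt X"
   unfolding X_def by (rule tendsto_le[OF _ tendsto_mult_left[OF tendsto_real_sqrt[OF l2]] tendsto_norm[OF l1]]) (use e[OF Fc] in auto)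
  have qi: "Lint (?H K)"
  proof (rule integrable_dominated[OF r(3)])
   have "continuous_on UNIV (%z::complex. K / max K (norm z) * (norm z)^2)" using K by (intro continuous_intros) (auto simp: max_def)
   from measurable_compose[OF r(1) borel_measurable_continuous_onI[OF this]]
   show "(?H K) : Lmeas" .
   show "AE x in leb. norm (?E K (r x)) <= norm ((norm (r x))^2)"
   proof (intro AE_I2)
    fix x
    have "0 <= K / max K (norm (r x))" "K / max K (norm (r x)) <= 1" using K by (auto simp: divide_le_eq)
    hence "K / max K (norm (r x)) * (norm (r x))^2 <= 1 * (norm (r x))^2" "0 <= K / max K (norm (r x)) * (norm (r x))^2"
     using mult_right_mono[OF _ zero_le_power2] mult_nonneg_nonneg[OF _ zero_le_power2] by blast+
    thus "norm (?E K (r x)) <= norm ((norm (r x))^2)" by (simp del: times_divide_eq_left)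
   qed
  qed
  have "X <= (?B K)" unfolding X_def
  proof (rule integral_mono[OF _ qi Tsq[OF K]])
   show "Lint (%x. (norm (T K (r x)))^2)"
    by (rule integrable_dominated[OF r(3)]) (use Tm[OF K] Tb(2)[OF K] in "auto intro!: AE_I2 power_mono")
  qed
  also have "... <= norm (cor (?B K))" by simp
  also have "cor (?B K) = (?F T K)"
   unfolding Tr by (rule integral_complex_of_real[symmetric])
  finally have "X <= \<epsilon> * sqrt X" using le by linarith
  hence "sqrt X * sqrt X <= \<epsilon> * sqrt X" using X0 by simp
  have "sqrt X <= \<epsilon>"
  proof (cases "X = 0")
   case False
   hence "sqrt X > 0" using X0 by simp
   with `sqrt X * sqrt X <= \<epsilon> * sqrt X` show ?thesis by (rule mult_right_le_imp_le)
  qed (use e0 in simp)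
  hence "(sqrt X)^2 <= \<epsilon>^2" using X0 by (intro power_mono) auto
  thus ?thesis using X0 by (simp add: X_def[symmetric])
 qed
 have "(%n. (LINT x|leb. (?A T n x)^2)) ----> (nsq leb r)"
 proof (rule integral_dominated_convergence[OF _ _ r(3)])
  show "(%x. (norm (r x))^2) : Lmeas" using r(1) by simp
  show "(%x. (?A T n x)^2) : Lmeas" for n using Tm[of "real (Suc n)"] by simp
  show "AE x in leb. norm ((?A T n x)^2) <= (norm (r x))^2" for n
   using Tb(2)[of "real (Suc n)"] by (auto intro!: AE_I2 power_mono)
  show "AE x in leb. (%n. (?A T n x)^2) ----> (norm (r x))^2"
  proof (intro AE_I2 tendsto_eventually)
   fix x
   obtain M where M: "norm (r x) <= real M" using real_arch_simple by blast
   show "\<forall>\<^sub>F n in sequentially. (?A T n x)^2 = (norm (r x))^2"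
   proof (rule eventually_mono[OF eventually_ge_at_top[of M]])
    fix n assume "M <= n"
    hence "norm (r x) <= real (Suc n)" using M by (simp add: order_trans)
    hence "max (real (Suc n)) (norm (r x)) = real (Suc n)" by (simp add: max_absorb1)
    thus "(?A T n x)^2 = (norm (r x))^2" by (simp add: T_def)
   qed
  qed
 qed
 thus ?thesis by (rule LIMSEQ_le_const2) (use main in auto)
qed

lemma L2_diff:
 fixes a b :: "'a => complex"
 assumes "a : borel_measurable M" "b : borel_measurable M"
  and "isq M a" "isq M b"
 shows "integrable M (%x. (norm (a x - b x))^2)"
proof (rule integrable_dominated[OF Bochner_Integration.integrable_add[OF integrable_mult_right[OF assms(3), of 2] integrable_mult_right[OF assms(4), of 2]]])
 show "AE x in M. norm ((norm (a x - b x))^2) <= norm (2 * (norm (a x))^2 + 2 * (norm (b x))^2)"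
 proof (intro AE_I2)
  fix x
  have "(norm (a x - b x))^2 <= (norm (a x) + norm (b x))^2" by (intro power_mono norm_triangle_ineq4) simp
  also have "... <= 2 * (norm (a x))^2 + 2 * (norm (b x))^2" using sum_squares_bound[of "norm (a x)" "norm (b x)"] by (simp add: power2_sum)
  finally show "norm ((norm (a x - b x))^2) <= norm (2 * (norm (a x))^2 + 2 * (norm (b x))^2)" by simp
 qed
qed (use assms in simp)

lemma L2_triangle:
 fixes a b :: "'a => complex"
 assumes "a : borel_measurable M" "b : borel_measurable M"
  and "isq M a" "isq M b"
 shows "sqrt (LINT x|M. (norm (a x - b x))^2) <= sqrt (nsq M a) + sqrt (nsq M b)"
proof (rule real_le_lsqrt)
 let ?A = "LINT x|M. norm (a x) * norm (b x)"
 let ?B = "%x. norm (a x) * norm (b x)"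
 let ?C = "sqrt (nsq M a) + sqrt (nsq M b)"
 let ?D = "LINT x|M. (norm (a x - b x))^2"
 define na where "na x = cor (norm (a x))" for x
 define nb where "nb x = cor (norm (b x))" for x
 have m: "na : borel_measurable M" "nb : borel_measurable M" using assms(1,2) by (simp_all add: na_def[abs_def] nb_def[abs_def])
 have i: "isq M na" "isq M nb" using assms(3,4) by (simp_all add: na_def nb_def)
 note c = integrable_mult_L2[OF m i]
 have e: "na x * nb x = cor (?B x)" for x by (simp add: na_def nb_def)
 have ir: "integrable M (%x. norm (a x) * norm (b x))" using c(1) unfolding e by (simp only: complex_of_real_integrable_eq)
 have "norm (LINT x|M. na x * nb x) = abs ?A" unfolding e integral_complex_of_real by simp
 hence cs: "?A <= sqrt (nsq M a) * sqrt (nsq M b)"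
  using c(2) by (simp add: na_def nb_def)
 have "?D <= (LINT x|M. (norm (a x))^2 + 2 * (?B x) + (norm (b x))^2)"
 proof (rule integral_mono[OF L2_diff[OF assms]])
  show "integrable M (%x. (norm (a x))^2 + 2 * (?B x) + (norm (b x))^2)" using assms(3,4) ir by simp
  fix x
  have "(norm (a x - b x))^2 <= (norm (a x) + norm (b x))^2" by (intro power_mono norm_triangle_ineq4) simp
  thus "(norm (a x - b x))^2 <= (norm (a x))^2 + 2 * (?B x) + (norm (b x))^2" by (simp add: power2_sum)
 qed
 also have "... = nsq M a + 2 * ?A + nsq M b" using assms(3,4) ir by simp
 also have "... <= ?C^2"
  using cs by (simp add: power2_sum Bochner_Integration.integral_nonneg)
 finally show "?D <= ?C^2" .
qed (simp add: Bochner_Integration.integral_nonneg)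

lemma L2_interval:
 fixes f :: "real => complex"
 assumes f: "f : Lmeas" "isq leb f"
 shows "Lint (%x. indicator {-R..R} x *\<^sub>R f x)" "Lint (%x. (norm (indicator {-R..R} x *\<^sub>R f x))^2)"
  "(LINT x|leb. (norm (indicator {-R..R} x *\<^sub>R f x))^2) <= nsq leb f"
  "(%x. indicator {-R..R} x *\<^sub>R f x) : Lmeas"
proof -
 let ?A = "%x. indicator {-R..R} x *\<^sub>R f x"
 let ?B = "%x. indicator {-R..R} x *\<^sub>R f x"
 have im: "(%x. indicator {-R..R} x :: real) : Lmeas" by (rule borel_imp_lebesgue_measurable) simp
 show m: "?B : Lmeas" by (intro borel_measurable_scaleR im f(1))
 have i0: "Lint (%x. indicator {-R..R} x :: real)" by (rule integrable_indicator_Icc)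
 show "Lint ?B"
 proof (rule integrable_dominated[OF Bochner_Integration.integrable_add[OF i0 f(2)] m], intro AE_I2)
  fix x
  have "norm (f x) <= 1 + (norm (f x))^2" using sum_squares_bound[of "norm (f x)" 1] norm_ge_zero[of "f x"] unfolding one_power2 by linarith
  thus "norm (?A x) <= norm (indicator {-R..R} x + (norm (f x))^2)" by (simp add: indicator_def)
 qed
 have le: "(norm (?A x))^2 <= (norm (f x))^2" for x by (simp add: indicator_def)
 show i2: "Lint (%x. (norm (?A x))^2)"
  by (rule integrable_dominated[OF f(2)]) (use m le in "auto intro!: AE_I2 simp del: norm_scaleR")
 show "(LINT x|leb. (norm (?A x))^2) <= nsq leb f" by (rule integral_mono[OF i2 f(2) le])
qed

lemma kernel_measurable:
 fixes k :: "real => real => complex"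
 assumes k: "continuous_on UNIV (%p :: real \<times> real. k (fst p) (snd p))" and u: "u : Lmeas"
 shows "(%om. (LINT x|leb. k om x * u x)) : Lmeas"
proof (rule sigma_finite_measure.borel_measurable_lebesgue_integral[OF sigma_finite_lebesgue])
 have "(%p. u (snd p)) : Lmeas2" using u by (rule measurable_compose[OF measurable_snd])
 thus "(%(om, x). k om x * u x) : Lmeas2"
  using continuous2_measurable[OF k] by (simp only: split_beta') (intro borel_measurable_times)
qed

text \<open>The inverse transform of g restricted to [-c, c]: the band-limited part of f when g
  represents the transform of f.\<close>

definition synth :: "real => (real => complex) => real => complex" where
 "synth c g x = cor (1 / (2 * pi)) * (LINT om|leb. cexp (x * om) * (indicator {-c..c} om *\<^sub>R g om))"

text \<open>The norm of g is bounded through \<open>ft_L2\<close> applied to truncations of f. The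
  distance of f from its band-limited part on [-1, 1] is estimated by duality: paired with a cut-off
  continuous function it becomes an integral over |om| > c of g times a transform, and the
  hypothesis bounds g there.\<close>

lemma band_limited_approx:
 assumes "eps_band_limited \<epsilon> c f" and e0: "\<epsilon> >= 0"
 obtains g where "g : Lmeas" "isq leb g"
  "nsq leb g <= 2 * pi * nsq leb f"
  "(LINT x|leb. (norm (chi x *\<^sub>R (f x - synth c g x)))^2) <= \<epsilon>^2"
  "Lint (%x. (norm (chi x *\<^sub>R (f x - synth c g x)))^2)"
  "synth c g : Lmeas" "!!x. norm (synth c g x) <= (LINT om|leb. norm (indicator {-c..c} om *\<^sub>R g om))"
proof -
 let ?A = "2 * pi * (nsq leb f)"
 let ?B = "%V g. LINT om|leb. V om * g om"
 let ?C = "%x gc. LINT om|leb. cexp (x * om) * gc om"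
 let ?D = "%r phi. LINT x|leb. r x * cnj (cut_I phi x)"
 let ?E = "%gc. LINT om|leb. norm (gc om)"
 let ?F = "%phi. LINT x|leb. (norm (cut_I phi x))^2"
 let ?G = "%g gc. LINT om|leb. (norm (g om - gc om))^2"
 let ?H = "%g. LINT om:{om. (abs om) > c}|leb. (cmod (g om))^2"
 let ?K = "%V g gc. LINT om|leb. V om * (g om - gc om)"
 obtain g where fg: "is_L2_fourier f g" and ge: "1 / (2 * pi) * (?H g) <= \<epsilon>^2"
  using assms by (auto simp: eps_band_limited_def)
 have f: "f : Lmeas" "isq leb f"
  and g: "g : Lmeas" "isq leb g"
  using fg by (auto simp: is_L2_fourier_def L2_line_def)
 define fR where "fR R x = indicator {-R..R} x *\<^sub>R f x" for R x
 note fRi = L2_interval[OF f, folded fR_def]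
 have tf: "truncated_fourier R f = ft (fR R)" for R
  unfolding truncated_fourier_def[abs_def] set_lebesgue_integral_def ft_def fR_def by (simp add: scaleR_conv_of_real mult.left_commute)
 note ftm = ft_measurable[OF fRi(4)]
 note ftl = ft_L2[OF fRi(1,2)]
 define d where "d R = (LINT om|leb. (norm (ft (fR R) om - g om))^2)" for R
 have di: "Lint (%om. (norm (ft (fR R) om - g om))^2)" for R by (rule L2_diff[OF ftm g(1) ftl(1) g(2)])
 have "((%R. ennreal (d R)) ---> ennreal 0) at_top"
 proof -
  have "(\<integral>\<^sup>+om. ennreal ((norm (ft (fR R) om - g om))^2) \<partial>leb) = ennreal (d R)" for R
   unfolding d_def by (rule nn_integral_eq_integral[OF di]) simp
  thus ?thesis using fg by (simp add: is_L2_fourier_def tf)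
 qed
 hence "(d ---> 0) at_top" by (subst (asm) tendsto_ennreal_iff) (auto simp: d_def intro!: always_eventually)
 hence dn: "(%n. d (real n)) ----> 0" by (rule filterlim_compose[OF _ filterlim_real_sequentially])
 have sd: "(%n. sqrt (d (real n))) ----> 0" using tendsto_real_sqrt[OF dn] by simp
 have gb: "sqrt (nsq leb g) <= sqrt ?A"
 proof (rule LIMSEQ_le_const)
  have "(%n. sqrt ?A + sqrt (d (real n))) ----> sqrt ?A + 0"
   by (intro tendsto_intros sd)
  thus "(%n. sqrt ?A + sqrt (d (real n))) ----> sqrt ?A" by simp
  have "sqrt (nsq leb g) <= sqrt ?A + sqrt (d (real n))" for n
  proof -
   have t: "sqrt (LINT x|leb. (norm (ft (fR n) x - (ft (fR n) x - g x)))^2) <= sqrt (nsq leb (ft (fR n))) + sqrt (d n)"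
    unfolding d_def by (rule L2_triangle[OF ftm _ ftl(1) di]) (intro borel_measurable_diff ftm g)
   have e: "(%x. (norm (ft (fR n) x - (ft (fR n) x - g x)))^2) = (%x. (norm (g x))^2)" by simp
   have "sqrt (nsq leb (ft (fR n))) <= sqrt ?A"
    by (intro real_sqrt_le_mono order_trans[OF ftl(2) mult_left_mono[OF fRi(3)]]) simp
   thus ?thesis using t[unfolded e] by linarith
  qed
  thus "EX N. ALL n>=N. sqrt (nsq leb g) <= sqrt ?A + sqrt (d (real n))" by blast
 qed
 hence gb': "nsq leb g <= 2 * pi * nsq leb f" by simp
 define gc where "gc om = indicator {-c..c} om *\<^sub>R g om" for om
 note gci = L2_interval[OF g, of c, folded gc_def]
 have kc: "continuous_on UNIV (%p :: real \<times> real. cexp (fst p * snd p))" by (intro continuous_intros)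
 have km: "(%x. (?C x gc)) : Lmeas"
  by (rule kernel_measurable[OF kc gci(4)])
 have fcm: "synth c g : Lmeas"
  unfolding synth_def[abs_def] gc_def[symmetric] by (intro borel_measurable_times km borel_measurable_const)
 have fcb: "norm (synth c g x) <= (?E gc)" for x
 proof -
  have "norm (?C x gc) <= (?E gc)"
   by (rule order_trans[OF integral_norm_bound]) (simp add: norm_mult)
  hence "1 / (2 * pi) * norm (?C x gc) <= 1 * (?E gc)"
   using pi_ge_two by (intro mult_mono) auto
  thus ?thesis unfolding synth_def gc_def[symmetric] norm_mult norm_of_real by simp
 qed
 define r where "r x = chi x *\<^sub>R (f x - synth c g x)" for x
 have fI: "Lint (%x. (norm (chi x *\<^sub>R f x))^2)" "(%x. chi x *\<^sub>R f x) : Lmeas"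
  using L2_interval[OF f, of 1] by simp_all
 have im: "(%x::real. chi x :: real) : Lmeas" by (rule borel_imp_lebesgue_measurable) simp
 have cI: "(%x. chi x *\<^sub>R synth c g x) : Lmeas" by (intro borel_measurable_scaleR im fcm)
 have cI2: "Lint (%x. (norm (chi x *\<^sub>R synth c g x))^2)"
 proof (rule integrable_dominated[OF integrable_indicator_I[of "(?E gc)^2"]], goal_cases)
  case 2
  show ?case
  proof (intro AE_I2)
   fix x
   have "(norm (synth c g x))^2 <= (?E gc)^2" by (intro power_mono fcb) simp
   thus "norm ((norm (chi x *\<^sub>R synth c g x))^2) <= norm ((?E gc)^2 * chi x)" by (simp add: indicator_def)
  qed
 next
  case 1
  show ?case by (rule measurable_compose[OF cI]) (intro borel_measurable_continuous_onI continuous_intros)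
 qed
 have re: "r x = chi x *\<^sub>R f x - chi x *\<^sub>R synth c g x" for x by (simp add: r_def scaleR_diff_right)
 have r2: "isq leb r" unfolding re by (rule L2_diff[OF fI(2) cI fI(1) cI2])
 have rm: "r : Lmeas" unfolding re[abs_def] by (intro borel_measurable_diff fI cI)
 have "nsq leb r <= \<epsilon>^2"
 proof (rule L2_dual_bound[OF rm _ r2 e0])
  show "r x = 0" if "x \<notin> II" for x using that by (simp add: r_def)
  fix phi :: "real => complex" assume cphi: "continuous_on UNIV phi"
  obtain B where v: "cut_I phi : Lmeas"
   "Lint (cut_I phi)" "Lint (%x. (norm (cut_I phi x))^2)"
   by (rule cut_facts[OF cphi]) blast
  define V where "V om = cnj (ft (cut_I phi) om)" for om
  have cnm: "cnj : borel_measurable borel" by (intro borel_measurable_continuous_onI continuous_intros)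
  have Vm: "V : Lmeas" unfolding V_def[abs_def] by (rule measurable_compose[OF ft_measurable[OF v(1)] cnm])
  have cvm: "(%x. cnj (cut_I phi x)) : Lmeas" by (rule measurable_compose[OF v(1) cnm])
  have V2: "isq leb V" using ft_L2(1)[OF v(2,3)] by (simp add: V_def)
  have Vb: "nsq leb V <= 2 * pi * (?F phi)" using ft_L2(2)[OF v(2,3)] by (simp add: V_def)
  have Ve: "(LINT x|leb. cexp (x * om) * cnj (cut_I phi x)) = V om" for om
   unfolding V_def ft_def by (subst Bochner_Integration.integral_cnj[symmetric]) (simp add: exp_cnj)
  define If where "If = (?D f phi)"
  have Vg: "Lint (%om. V om * g om)" by (rule integrable_mult_L2(1)[OF Vm g(1) V2 g(2)])
  have 1: "(?B V g) = cor (2 * pi) * If"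
  proof -
   \<comment> \<open>Parseval is available for the truncations of f. For n >= 1 the truncation does
     not affect the pairing with a function supported in [-1, 1].\<close>
   have b: "norm (cor (2 * pi) * If - (?B V g)) <= sqrt (nsq leb V) * sqrt (d (real n))" if n: "n >= 1" for n
   proof -
    have e: "(%x. fR (real n) x * cnj (cut_I phi x)) = (%x. f x * cnj (cut_I phi x))" using n by (auto simp: fR_def cut_I_def indicator_def)
    have "(LINT om|leb. V om * ft (fR (real n)) om) = cor (2 * pi) * If"
     using parseval_cut[OF fRi(1,2) cphi, of "real n"] unfolding e V_def If_def .
    moreover have "(LINT om|leb. V om * ft (fR (real n)) om) - (?B V g) = (LINT om|leb. V om * (ft (fR (real n)) om - g om))"
     using integrable_mult_L2(1)[OF Vm ftm V2 ftl(1)] Vg by (simp add: right_diff_distrib)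
    moreover have "norm (LINT om|leb. V om * (ft (fR (real n)) om - g om)) <= sqrt (nsq leb V) * sqrt (d (real n))"
     unfolding d_def by (rule integrable_mult_L2(2)[OF Vm _ V2 di]) (intro borel_measurable_diff ftm g)
    ultimately show ?thesis by simp
   qed
   have "norm (cor (2 * pi) * If - (?B V g)) <= sqrt (nsq leb V) * 0"
    by (rule LIMSEQ_le_const[OF tendsto_mult_left[OF sd]]) (use b in blast)
   thus ?thesis by simp
  qed
  have cvi: "Lint (%x. cnj (cut_I phi x))" using v(2) by simp
  have 2: "(LINT x|leb. synth c g x * cnj (cut_I phi x)) = cor (1 / (2 * pi)) * (?B V gc)"
  proof -
   have "(LINT x|leb. cnj (cut_I phi x) * (?C x gc)) = (LINT om|leb. gc om * (LINT x|leb. cexp (x * om) * cnj (cut_I phi x)))"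
    by (rule kernel_swap[OF cvi gci(1)]) (auto intro!: continuous_intros)
   moreover have "(?B gc V) = (?B V gc)" by (simp only: mult.commute)
   moreover have "synth c g x * cnj (cut_I phi x) = cor (1 / (2 * pi)) * (cnj (cut_I phi x) * (?C x gc))" for x
   proof -
    have "p * q * r = p * (r * q)" for p q r :: complex by (simp only: mult_ac)
    thus ?thesis unfolding synth_def gc_def[symmetric] .
   qed
   ultimately show ?thesis by (simp only: integral_mult_right_zero Ve)
  qed
  have gd: "(%om. g om - gc om) : Lmeas" by (intro borel_measurable_diff g gci)
  have gd2: "Lint (%om. (norm (g om - gc om))^2)" by (rule L2_diff[OF g(1) gci(4) g(2) gci(2)])
  have gde: "(?G g gc) <= 2 * pi * \<epsilon>^2"
  proof -
   have "(norm (g om - gc om))^2 = indicator {om. (abs om) > c} om *\<^sub>R (cmod (g om))^2" for om by (auto simp: gc_def indicator_def abs_if)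
   hence "(?G g gc) = (?H g)" by (simp only: set_lebesgue_integral_def)
   thus ?thesis using ge by (simp add: field_simps)
  qed
  have Vgc: "Lint (%om. V om * gc om)" by (rule integrable_mult_L2(1)[OF Vm gci(4) V2 gci(2)])
  have "(?D r phi) = If - (LINT x|leb. synth c g x * cnj (cut_I phi x))"
  proof -
   have a: "chi x *\<^sub>R h x * cnj (cut_I phi x) = h x * cnj (cut_I phi x)" for h :: "real => complex" and x by (simp add: cut_I_def indicator_def)
   have cv2: "Lint (%x. (norm (cnj (cut_I phi x)))^2)" using v(3) by simp
   show ?thesis unfolding re left_diff_distrib If_def
    using integrable_mult_L2(1)[OF fI(2) cvm fI(1) cv2] integrable_mult_L2(1)[OF cI cvm cI2 cv2]
    by (simp only: a Bochner_Integration.integral_diff)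
  qed
  also have "... = cor (1 / (2 * pi)) * (?K V g gc)"
  proof -
   have "If = cor (1 / (2 * pi)) * (?B V g)" unfolding 1 by simp
   thus ?thesis unfolding 2 right_diff_distrib using Vg Vgc by (simp add: right_diff_distrib)
  qed
  finally have e: "(?D r phi) = cor (1 / (2 * pi)) * (?K V g gc)" .
  have "norm (?D r phi) = 1 / (2 * pi) * norm (?K V g gc)"
   unfolding e norm_mult norm_of_real by simp
  also have "... <= 1 / (2 * pi) * (sqrt (nsq leb V) * sqrt (?G g gc))"
   by (intro mult_left_mono integrable_mult_L2(2)[OF Vm gd V2 gd2]) auto
  also have "... <= 1 / (2 * pi) * (sqrt (2 * pi * (?F phi)) * sqrt (2 * pi * \<epsilon>^2))"
   by (intro mult_left_mono mult_mono real_sqrt_le_mono Vb gde) auto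
  also have "... = \<epsilon> * sqrt (?F phi)"
  proof -
   define q where "q = sqrt (2 * pi)"
   have q: "q > 0" "2 * pi = q * q" by (simp_all add: q_def)
   have "sqrt (q * q * X) = q * sqrt X" "sqrt (q * q * \<epsilon>^2) = q * \<epsilon>" for X using q(1) e0 by (simp_all add: real_sqrt_mult)
   thus ?thesis unfolding q(2) using q(1) by simp
  qed
  finally show "norm (?D r phi) <= \<epsilon> * sqrt (?F phi)" .
 qed
 from that[OF g gb' this[unfolded r_def] r2[unfolded r_def] fcm fcb[unfolded gc_def]] show ?thesis .
qed

section \<open>The approximation error\<close>

context wt begin

lemma nrm_sum: "finite T ==> (!!j. j : T ==> l2 (f j)) ==> nrm (%x. \<Sum>j\<in>T. f j x) <= (\<Sum>j\<in>T. nrm (f j))"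
proof (induction T rule: finite_induct)
 case empty
 show ?case by (simp add: nrm_def ip_def)
next
 case (insert j T)
 have "nrm (%x. f j x + (\<Sum>j\<in>T. f j x)) <= nrm (f j) + nrm (%x. \<Sum>j\<in>T. f j x)"
  by (rule nrm_triangle) (use insert in "auto intro!: l2_sum")
 thus ?case using insert by simp
qed

lemma nrm_bound: assumes "!!x. x : II ==> (abs (h x)) <= B" "contI h" "B >= 0" shows "nrm h <= 2 * B"
proof -
 have "ip h h <= (LINT x|nu. B^2)" unfolding ip_def
 proof (rule integral_mono)
  fix x assume "x : space nu"
  hence "(abs (h x))^2 <= B^2" using assms by (intro power_mono) (auto simp: space_nu)
  thus "h x * h x <= B^2" by (simp add: power2_eq_square)
 qed (use assms in "auto intro!: integrable_cont continuous_intros")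
 also have "... = measure nu (space nu) * B^2" by simp
 also have "... <= 2 * B^2" using measure_nu by (intro mult_right_mono) auto
 also have "... <= (2 * B)^2" by (simp add: power_mult_distrib)
 finally have "nrm h <= sqrt ((2 * B)^2)" unfolding nrm_def by (rule real_sqrt_le_mono)
 moreover have "sqrt ((2 * B)^2) = 2 * B" using assms(3) by (simp only: real_sqrt_abs)
 ultimately show ?thesis by linarith
qed

lemma interval_mass:
 assumes "-1 <= a" "a <= b" "b <= 1"
 shows "measure nu {a..b} <= b - a" "{a..b} : sets nu"
proof -
 have sub: "{a..b} \<subseteq> II" using assms by auto
 show W: "{a..b} : sets nu" using sub by (simp add: sets_nu sets_restrict_space_iff)
 have "emeasure nu {a..b} = (\<integral>\<^sup>+y. ennreal (w y) * indicator {a..b} y \<partial>lebesgue_on II)"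
  using W w_meas unfolding wmeas_def by (subst emeasure_density) (auto simp: sets_nu)
 also have "... <= (\<integral>\<^sup>+y. indicator {a..b} y \<partial>lebesgue_on II)"
  by (rule nn_integral_mono) (use w_le1 in "auto simp: indicator_def ennreal_le_1")
 also have "... = emeasure (lebesgue_on II) {a..b}" using sub by (intro nn_integral_indicator) (simp add: sets_restrict_space_iff)
 also have "... = ennreal (b - a)" using sub assms by (subst emeasure_restrict_space) auto
 finally show "measure nu {a..b} <= b - a" using assms by (simp add: emeasure_eq_measure)
qed

end

section \<open>Eigenfunction blocks in the unweighted norm\<close>

context gp begin

text \<open>The same construction with exponent 0, so \<open>z.nrm\<close> is the unweighted norm on
  [-1, 1].\<close>

interpretation z: wt 0 by unfold_locales simp

text \<open>At distance at least 1 / Lam from the endpoints the weight is at least Lam^(-al). The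
  two remaining intervals have length 1 / Lam each, and the pointwise bound of order Lam^(al + 1)
  from \<open>sup_bound\<close> again costs Lam^al there.\<close>

lemma dy_bound:
 assumes A: "finite A" and L: "!!k. k : A ==> ev k <= Lam" "Lam >= 1" "Lam >= c^2"
 shows "z.ip (%x. \<Sum>k\<in>A. a k * psi k x) (%x. \<Sum>k\<in>A. a k * psi k x) <= (1 + 2 * sup_const) * Lam powr al * (\<Sum>k\<in>A. (a k)^2)"
proof -
 define H where "H x = (\<Sum>k\<in>A. a k * psi k x)" for x
 define S where "S = (\<Sum>k\<in>A. (a k)^2)"
 define de where "de = 1 / Lam"
 have S0: "S >= 0" by (simp add: S_def sum_nonneg)
 have sc0: "sup_const >= 0" by (simp add: sup_const_def)
 have d: "0 < de" "de <= 1" "Lam * de = 1" using L by (auto simp: de_def)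
 have cH: "contI H" unfolding H_def by (intro continuous_intros psi_cont)
 define Q where "Q = sup_const * Lam powr (al + 1) * S"
 have Q0: "Q >= 0" using S0 sc0 by (simp add: Q_def)
 have Hb: "(H y)^2 <= Q" if "y : II" for y unfolding H_def Q_def S_def by (rule sup_bound[OF A L that])
 have pw: "H y * H y <= Lam powr al * (w y * (H y)^2) + (Q * indicator {-1..-1 + de} y + Q * indicator {1 - de..1} y)" if y: "y : II" for y
 proof (cases "abs y <= 1 - de")
  case True
  have "de * 1 <= (1 - abs y) * (1 + abs y)" using True d by (intro mult_mono) auto
  hence "de <= 1 - y^2" by (simp add: power2_eq_square algebra_simps)
  hence "de powr al <= w y" unfolding weight_def using alpha0 d by (intro powr_mono2) auto
  hence "Lam powr al * de powr al * (H y)^2 <= Lam powr al * w y * (H y)^2" by (intro mult_right_mono mult_left_mono) auto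
  moreover have "Lam powr al * de powr al = 1" unfolding powr_mult[symmetric] d(3) by simp
  moreover have "0 <= Q * indicator {-1..-1 + de} y + Q * indicator {1 - de..1} y" using Q0 by (simp add: indicator_def)
  ultimately show ?thesis by (simp add: power2_eq_square mult.assoc)
 next
  case False
  hence "Q <= Q * indicator {-1..-1 + de} y + Q * indicator {1 - de..1} y" using y Q0 by (auto simp: indicator_def)
  moreover have "0 <= Lam powr al * (w y * (H y)^2)" by (simp add: w_nonneg)
  moreover have "H y * H y <= Q" using Hb[OF y] by (simp add: power2_eq_square)
  ultimately show ?thesis by linarith
 qed
 have mw: "(%y. w y * (H y)^2) : borel_measurable (lebesgue_on II)"
  using w_meas cont_meas[of "%y. (H y)^2"] cH unfolding meas_nu by (intro borel_measurable_times) (auto intro!: continuous_intros)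
 have iw: "integrable (wmeas 0) (%y. w y * (H y)^2)"
 proof (rule z.integrable_bdd[where B = Q])
  show "(%y. w y * (H y)^2) : borel_measurable (wmeas 0)" unfolding z.meas_nu by (rule mw)
  fix y :: real assume y: "y : II"
  have "w y * (H y)^2 <= 1 * Q" using w_le1[OF y] Hb[OF y] by (intro mult_mono) (auto simp: w_nonneg)
  thus "norm (w y * (H y)^2) <= Q" by (simp add: w_nonneg)
 qed
 have ew: "(LINT y|(wmeas 0). w y * (H y)^2) = S"
 proof -
  have "(LINT y|(wmeas 0). w y * (H y)^2) = (LINT y|(lebesgue_on II). weight 0 y *\<^sub>R (w y * (H y)^2))"
   by (rule z.nu_integral(1)) (unfold z.meas_nu, rule mw)
  also have "(%y. weight 0 y *\<^sub>R (w y * (H y)^2)) = (%y. w y *\<^sub>R (H y)^2)" by (auto simp: weight_def)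
  also have "(LINT y|(lebesgue_on II). w y *\<^sub>R (H y)^2) = (LINT y|nu. (H y)^2)"
   by (rule nu_integral(1)[symmetric]) (intro cont_meas continuous_intros cH)
  also have "... = ip H H" by (simp add: ip_def power2_eq_square)
  also have "... = S" unfolding H_def[abs_def] S_def ip_sum_psi(2)[OF A] by (simp add: power2_eq_square)
  finally show ?thesis .
 qed
 note m1 = z.interval_mass[of "-1" "-1 + de"] and m2 = z.interval_mass[of "1 - de" 1]
 have i1: "integrable (wmeas 0) (%y. Q * indicator {-1..-1 + de} y)" "integrable (wmeas 0) (%y. Q * indicator {1 - de..1} y)"
  using m1 m2 d by (auto intro!: integrable_mult_right integrable_real_indicator simp: z.emeasure_eq_measure)
 have e1: "(LINT y|(wmeas 0). Q * indicator {-1..-1 + de} y) <= Q * de" "(LINT y|(wmeas 0). Q * indicator {1 - de..1} y) <= Q * de"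
  using m1 m2 d Q0 by (auto intro!: mult_left_mono)
 have "z.ip H H <= (LINT y|(wmeas 0). Lam powr al * (w y * (H y)^2) + (Q * indicator {-1..-1 + de} y + Q * indicator {1 - de..1} y))"
  unfolding z.ip_def
 proof (rule integral_mono)
  show "integrable (wmeas 0) (%y. H y * H y)" by (intro z.integrable_cont continuous_intros cH)
  show "integrable (wmeas 0) (%y. Lam powr al * (w y * (H y)^2) + (Q * indicator {-1..-1 + de} y + Q * indicator {1 - de..1} y))"
   by (intro Bochner_Integration.integrable_add integrable_mult_right iw i1)
 qed (use pw in "simp add: z.space_nu")
 also have "... = Lam powr al * (LINT y|(wmeas 0). w y * (H y)^2) + ((LINT y|(wmeas 0). Q * indicator {-1..-1 + de} y) + (LINT y|(wmeas 0). Q * indicator {1 - de..1} y))"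
  using iw i1 by (subst Bochner_Integration.integral_add) auto
 also have "... <= Lam powr al * S + (Q * de + Q * de)" unfolding ew using e1 by (intro add_mono) auto
 also have "Q * de = sup_const * Lam powr al * S"
 proof -
  have "Q * de = sup_const * Lam powr al * S * (Lam * de)" using L by (simp add: Q_def powr_add)
  thus ?thesis by (simp add: d(3))
 qed
 finally show ?thesis unfolding H_def[abs_def] S_def by (simp add: algebra_simps)
qed

text \<open>pi^4 (N / (2 pi))^2 = (pi N / 2)^2, and N >= 2c / pi says exactly that pi N / 2 >= c.
  This is the origin of the constant pi^4.\<close>

lemma ev_ge:
 assumes N: "N >= 1" "real N >= 2 * c / pi"
 shows "ev N > 0" "pi ^ 4 * ev N >= 1" "pi ^ 4 * ev N >= c^2" "1 / pi ^ 4 <= ev N" "1 / pi ^ 4 * c^2 <= ev N"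
proof -
 let ?A = "pi * real N / 2"
 note lo = ev_lower[OF N(1)]
 have "(real N / (2 * pi))^2 > 0" using N by simp
 thus "ev N > 0" using lo by linarith
 have e: "pi ^ 4 * (real N / (2 * pi))^2 = ?A^2" by (simp add: power2_eq_square power4_eq_xxxx)
 have le: "?A^2 <= pi ^ 4 * ev N" unfolding e[symmetric] using lo by (intro mult_left_mono) auto
 have "2 * 1 <= pi * real N" using N pi_ge_two by (intro mult_mono) auto
 hence "1^2 <= ?A^2" by (intro power_mono) auto
 thus 1: "pi ^ 4 * ev N >= 1" using le by simp
 have "c <= pi * real N / 2" using N(2) by (simp add: field_simps)
 hence "c^2 <= ?A^2" using c0 by (intro power_mono) auto
 thus 2: "pi ^ 4 * ev N >= c^2" using le by linarith
 have p: "pi ^ 4 > 0" by simp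
 show "1 / pi ^ 4 <= ev N" "1 / pi ^ 4 * c^2 <= ev N" using 1 2 p by (simp_all add: pos_divide_le_eq mult.commute)
qed

text \<open>Block i contains the k with ev k between 16^i ev N and 16^(i+1) ev N; b stands for
  \<open>mc\<close> or \<open>ms\<close>. \<open>dy_bound\<close> costs the power al of 16^i and the
  decay gains the power al + 1, so the norm of block i carries a factor 4^(-i), and the geometric
  series is at most 2.\<close>

lemma block_bound:
 assumes N: "N >= 1" "real N >= 2 * c / pi" and C: "C > 0"
  and dec: "!!k. N < k ==> lam k * (ev k / ev N) powr (al + 1) <= C * ev N * lam N"
  and b: "!!k. (b k)^2 <= lam k"
 shows "z.nrm (%x. \<Sum>k\<in>{N<..M}. a k * b k * psi k x) <=
   2 * sqrt ((1 + 2 * sup_const) * (16 * pi ^ 4) powr al * C * ev N powr (al + 1) * lam N) * sqrt (\<Sum>k\<in>{N<..M}. (a k)^2)"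
proof -
 let ?B = "1 + 2 * sup_const"
 let ?C = "%C. C * ev N * lam N"
 let ?D = "?B * (16 * pi ^ 4) powr al * ev N powr al"
 note eN = ev_ge[OF N]
 define D where "D = ?B * (16 * pi ^ 4) powr al * C * ev N powr (al + 1) * lam N"
 define S where "S = (\<Sum>k\<in>{N<..M}. (a k)^2)"
 have sc0: "sup_const >= 0" by (simp add: sup_const_def)
 have D0: "D >= 0" using sc0 C lam_nonneg[of N] by (simp add: D_def)
 have S0: "S >= 0" by (simp add: S_def sum_nonneg)
 define j where "j k = (LEAST j. ev k <= 16 ^ Suc j * ev N)" for k
 have ex: "EX i. ev k <= 16 ^ Suc i * ev N" for k
 proof -
  obtain n where n: "ev k / ev N < 16 ^ n" using real_arch_pow[of 16 "ev k / ev N"] by auto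
  have "(16::real) ^ n <= 16 ^ Suc n" by simp
  hence "ev k / ev N <= 16 ^ Suc n" using n by linarith
  thus ?thesis using eN(1) by (auto simp: pos_divide_le_eq)
 qed
 have ju: "ev k <= 16 ^ Suc (j k) * ev N" for k unfolding j_def by (rule LeastI_ex[OF ex])
 have jl: "16 ^ j k * ev N <= ev k" if "N < k" for k
 proof (cases "j k")
  case 0
  thus ?thesis using ev_mono(2)[of N k] that by simp
 next
  case (Suc i)
  hence "\<not> ev k <= 16 ^ Suc i * ev N" unfolding j_def using not_less_Least[of i "%j. ev k <= 16 ^ Suc j * ev N"] by simp
  thus ?thesis using Suc by simp
 qed
 define T where "T = j ` {N<..M}"
 have fT: "finite T" by (simp add: T_def)
 define Hb where "Hb i x = (\<Sum>k\<in>{k. k : {N<..M} & j k = i}. a k * b k * psi k x)" for i x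
 have cHb: "contI (Hb i)" for i unfolding Hb_def by (intro continuous_intros psi_cont)
 have bl: "z.nrm (Hb i) <= sqrt D * (1 / 4) ^ i * sqrt S" for i
 proof -
  let ?A = "{k. k : {N<..M} & j k = i}"
  have fA: "finite ?A" by simp
  define q where "q = (16::real) ^ i"
  have q1: "q >= 1" by (simp add: q_def)
  \<comment> \<open>The factor pi^4 makes Lam at least 1 and at least c^2, as
    \<open>dy_bound\<close> requires; 16 q ev N alone is the upper end of the block.\<close>
  define Lam where "Lam = (16 * pi ^ 4) * q * ev N"
  have base: "pi ^ 4 * ev N * 1 <= pi ^ 4 * ev N * (16 * q)" using q1 eN(1) by (intro mult_left_mono) auto
  have pi1: "(1::real) <= pi ^ 4" using pi_ge_two by (intro one_le_power) auto
  have L: "ev k <= Lam" if "k : ?A" for k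
  proof -
   have "ev k <= 16 * q * ev N * 1" using ju[of k] that by (simp add: q_def)
   also have "... <= 16 * q * ev N * pi ^ 4" using pi1 q1 eN(1) by (intro mult_left_mono) auto
   finally show ?thesis by (simp add: Lam_def mult_ac)
  qed
  have L1: "Lam >= 1" "Lam >= c^2" using base eN(2,3) by (simp_all add: Lam_def mult_ac)
  have lk: "lam k * q powr (al + 1) <= C * ev N * lam N" if "k : ?A" for k
  proof -
   have "q <= ev k / ev N" using jl[of k] that eN(1) by (simp add: q_def pos_le_divide_eq)
   hence "lam k * q powr (al + 1) <= lam k * (ev k / ev N) powr (al + 1)"
    using q1 alpha0 lam_nonneg by (intro mult_left_mono powr_mono2) auto
   thus ?thesis using dec[of k] that by simp
  qed
  have "(\<Sum>k\<in>?A. (a k * b k)^2) * q powr (al + 1) <= (\<Sum>k\<in>?A. (a k)^2 * (?C C))"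
   unfolding sum_distrib_right
  proof (rule sum_mono)
   fix k assume k: "k : ?A"
   have "(b k)^2 * q powr (al + 1) <= lam k * q powr (al + 1)" by (intro mult_right_mono b) simp
   hence "(b k)^2 * q powr (al + 1) <= C * ev N * lam N" using lk[OF k] by linarith
   hence "(a k)^2 * ((b k)^2 * q powr (al + 1)) <= (a k)^2 * (?C C)" by (intro mult_left_mono) auto
   thus "(a k * b k)^2 * q powr (al + 1) <= (a k)^2 * (?C C)" by (simp add: power_mult_distrib mult.assoc)
  qed
  also have "... = (\<Sum>k\<in>?A. (a k)^2) * (?C C)" by (simp add: sum_distrib_right)
  also have "... <= S * (?C C)" unfolding S_def
   using C eN(1) lam_nonneg by (intro mult_right_mono sum_mono2) auto
  finally have sb: "(\<Sum>k\<in>?A. (a k * b k)^2) * q powr (al + 1) <= S * (?C C)" .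
  have q2: "q powr (al + 1) = q powr al * q" using q1 by (simp add: powr_add)
  have "z.ip (Hb i) (Hb i) <= ?B * Lam powr al * (\<Sum>k\<in>?A. (a k * b k)^2)"
   unfolding Hb_def[abs_def] by (rule dy_bound[OF fA L L1])
  also have "Lam powr al = (16 * pi ^ 4) powr al * q powr al * ev N powr al" unfolding Lam_def powr_mult ..
  finally have "z.ip (Hb i) (Hb i) * q <= (?B * ((16 * pi ^ 4) powr al * q powr al * ev N powr al) * (\<Sum>k\<in>?A. (a k * b k)^2)) * q"
   using q1 by (intro mult_right_mono) auto
  also have "... = ?D * ((\<Sum>k\<in>?A. (a k * b k)^2) * q powr (al + 1))"
   unfolding q2 by (simp only: mult_ac)
  also have "... <= ?D * (S * (?C C))"
   using sc0 by (intro mult_left_mono sb mult_nonneg_nonneg) auto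
  also have "... = D * S"
  proof -
   have "ev N powr (al + 1) = ev N powr al * ev N" using eN(1) by (simp add: powr_add)
   thus ?thesis unfolding D_def by (simp only: mult_ac)
  qed
  finally have "z.ip (Hb i) (Hb i) <= D * S / q" using q1 by (simp add: pos_le_divide_eq)
  hence "z.nrm (Hb i) <= sqrt (D * S / q)" unfolding z.nrm_def by (rule real_sqrt_le_mono)
  also have "sqrt (D * S / q) = sqrt D * sqrt S / sqrt q" by (simp add: real_sqrt_mult real_sqrt_divide)
  also have "sqrt q = 4 ^ i"
  proof -
   have "q = (4 ^ i)^2" by (simp add: q_def power_mult[symmetric] mult.commute[of i] power_mult)
   thus ?thesis by simp
  qed
  finally show ?thesis by (simp add: power_one_over field_simps)
 qed
 have "(%x. \<Sum>k\<in>{N<..M}. a k * b k * psi k x) = (%x. \<Sum>i\<in>T. Hb i x)"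
  unfolding Hb_def T_def by (intro ext sum.group[symmetric]) auto
 hence "z.nrm (%x. \<Sum>k\<in>{N<..M}. a k * b k * psi k x) <= (\<Sum>i\<in>T. z.nrm (Hb i))"
  using z.nrm_sum[OF fT, of Hb] z.l2_cont[OF cHb] by simp
 also have "... <= (\<Sum>i\<in>T. sqrt D * (1 / 4) ^ i * sqrt S)" by (intro sum_mono bl)
 also have "... = sqrt D * sqrt S * (\<Sum>i\<in>T. (1 / 4) ^ i)" by (simp add: sum_distrib_left mult_ac)
 also have "... <= sqrt D * sqrt S * 2"
 proof (intro mult_left_mono)
  have "(\<Sum>i\<in>T. (1 / 4 :: real) ^ i) <= (\<Sum>i. (1 / 4) ^ i)" by (rule sum_le_suminf[OF summable_geometric fT]) auto
  also have "... = 1 / (1 - 1 / 4)" by (rule suminf_geometric) simp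
  finally show "(\<Sum>i\<in>T. (1 / 4 :: real) ^ i) <= 2" by simp
 qed (use D0 S0 in simp)
 finally show ?thesis unfolding D_def S_def by (simp add: mult_ac)
qed

section \<open>Spectral projections and tails\<close>

definition coef :: "(real => real) => nat => real" where "coef h k = ip h (psi k)"
definition proj :: "nat => (real => real) => real => real" where "proj M h x = (\<Sum>k\<in>{0..M}. coef h k * psi k x)"
definition rest :: "nat => (real => real) => real => real" where "rest M h x = h x - proj M h x"

lemma proj_l2: "l2 (proj M h)" unfolding proj_def[abs_def] by (intro l2_sum l2_cmult psi_l2)

lemma rest_facts:
 assumes h: "l2 h"
 shows "orth M (rest M h)" "l2 (rest M h)" "ip (rest M h) (proj M h) = 0" "ip h h = ip (rest M h) (rest M h) + (\<Sum>k\<in>{0..M}. (coef h k)^2)"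
  "nrm (rest M h) <= nrm h" "ip (rest M h) h = ip (rest M h) (rest M h)"
proof -
 let ?A = "%x. rest M h x + proj M h x"
 let ?B = "\<Sum>k\<in>{0..M}. (coef h k)^2"
 show l: "l2 (rest M h)" unfolding rest_def[abs_def] by (intro l2_diff h proj_l2)
 have o: "ip (rest M h) (psi j) = 0" if "j <= M" for j
 proof -
  have "ip (proj M h) (psi j) = coef h j" unfolding proj_def[abs_def] by (subst ip_sum_psi(1)) (use that in auto)
  thus ?thesis unfolding rest_def[abs_def] by (simp add: ip_diff h proj_l2 psi_l2 coef_def)
 qed
 show "orth M (rest M h)" using l o by (simp add: orth_def)
 have "ip (proj M h) (rest M h) = (\<Sum>k\<in>{0..M}. ip (%x. coef h k * psi k x) (rest M h))"
  unfolding proj_def[abs_def] by (rule ip_sum) (auto intro: l2_cmult psi_l2 l)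
 also have "... = 0" by (intro sum.neutral ballI) (simp add: ip_cmult ip_sym[of "psi _"] o)
 finally show rp: "ip (rest M h) (proj M h) = 0" by (simp add: ip_sym)
 have pp: "ip (proj M h) (proj M h) = ?B"
  unfolding proj_def[abs_def] by (subst ip_sum_psi(2)) (auto simp: power2_eq_square)
 have he: "h = ?A" by (auto simp: rest_def)
 have rh: "ip (rest M h) ?A = ip (rest M h) (rest M h)" by (simp add: ip_add2 l proj_l2 rp)
 thus "ip (rest M h) h = ip (rest M h) (rest M h)" using he by simp
 have "ip ?A ?A = ip (rest M h) (rest M h) + ?B"
  using ip_square_expand[OF l proj_l2[of M h], of 1] by (simp add: rp pp)
 thus e: "ip h h = ip (rest M h) (rest M h) + ?B" using he by simp
 have "ip (rest M h) (rest M h) <= ip h h" using e by (simp add: sum_nonneg)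
 thus "nrm (rest M h) <= nrm h" unfolding nrm_def by (rule real_sqrt_le_mono)
qed

text \<open>One power of the decay estimate already bounds lam n * ev n, and ev n grows at least
  like n^2 by \<open>ev_lower\<close>.\<close>

lemma lam_small:
 assumes N: "ev N > 0" and C: "C > 0" and dec: "!!k. N < k ==> lam k * (ev k / ev N) powr (al + 1) <= C * ev N * lam N" and e: "\<eta> > 0"
 shows "EX M>=N. ALL n>M. lam n <= \<eta>"
proof -
 define Q where "Q = C * ev N * lam N * ev N * (2 * pi)^2"
 obtain M0 where M0: "real M0 >= Q / \<eta>" using real_arch_simple by blast
 show ?thesis
 proof (intro exI[of _ "max N (max 1 M0)"] conjI allI impI)
  fix n assume n: "max N (max 1 M0) < n"
  have r1: "ev n / ev N >= 1" using ev_mono(2)[of N n] n N by simp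
  have "(ev n / ev N) powr 1 <= (ev n / ev N) powr (al + 1)" using r1 alpha0 by (intro powr_mono) auto
  moreover have "(ev n / ev N) powr 1 = ev n / ev N" by (rule powr_one) (use r1 in linarith)
  ultimately have "ev n / ev N <= (ev n / ev N) powr (al + 1)" by linarith
  hence "lam n * (ev n / ev N) <= lam n * (ev n / ev N) powr (al + 1)" using lam_nonneg by (intro mult_left_mono) auto
  hence "lam n * (ev n / ev N) <= C * ev N * lam N" using dec[of n] n by simp
  hence 1: "lam n * ev n <= C * ev N * lam N * ev N" using N by (simp add: pos_divide_le_eq)
  have "lam n * (real n / (2 * pi))^2 <= lam n * ev n" using ev_lower[of n] n lam_nonneg by (intro mult_left_mono) auto
  hence "lam n * (real n / (2 * pi))^2 * (2 * pi)^2 <= C * ev N * lam N * ev N * (2 * pi)^2" using 1 by (intro mult_right_mono) auto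
  hence 2: "lam n * (real n)^2 <= Q" by (simp add: Q_def power_divide)
  have "real n * 1 <= real n * real n" using n by (intro mult_left_mono) auto
  hence "lam n * real n <= lam n * (real n)^2" using lam_nonneg by (intro mult_left_mono) (auto simp: power2_eq_square)
  hence "lam n * real n <= Q" using 2 by linarith
  also have "Q <= \<eta> * real M0" using M0 e by (simp add: pos_divide_le_eq mult.commute)
  also have "... <= \<eta> * real n" using e n by (intro mult_left_mono) auto
  finally show "lam n <= \<eta>" using n by simp
 qed simp
qed

text \<open>For r orthogonal to \<open>psi 0\<close>, ..., \<open>psi M\<close> the squared norms of
  \<open>Cop r\<close> and \<open>Sop r\<close> add up to <Top r, r>, which
  \<open>Top_le_lam\<close> bounds by a small eigenvalue times ||r||^2. Weighted smallness does not
  control the unweighted norm, so \<open>window_bound\<close> upgrades it to uniform smallness by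
  means of a derivative bound independent of M.\<close>

lemma trig_tail:
 assumes N: "ev N > 0" and C: "C > 0" and dec: "!!k. N < k ==> lam k * (ev k / ev N) powr (al + 1) <= C * ev N * lam N"
  and h: "l2 h" and e: "e > 0"
 shows "EX M>=N. ALL x:II. (abs (Cop (rest M h) x)) <= e & (abs (Sop (rest M h) x)) <= e"
proof -
 let ?A = "%r. %y. c * y * r y"
 define D where "D = 2 * (c * nrm h)"
 have D0: "D >= 0" using c0 nrm_nonneg[of h] by (simp add: D_def)
 \<comment> \<open>de makes the contribution of the derivative at most e / 2; t is then chosen to do
   the same for the contribution of the norm.\<close>
 define de where "de = min (1 / 2) (e / (2 * (D + 1)))"
 have d: "0 < de" "de <= 1 / 2"
 proof -
  show "0 < de" using e D0 by (simp add: de_def)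
  show "de <= 1 / 2" unfolding de_def by (rule min.cobounded1)
 qed
 have canc: "p / (2 * k) * k = p / 2" if "k > 0" for p k :: real using that by simp
 have dD: "de * D <= e / 2"
 proof -
  have "de * D <= e / (2 * (D + 1)) * (D + 1)" using D0 e by (intro mult_mono) (auto simp: de_def)
  also have "... = e / 2" by (rule canc) (use D0 in linarith)
  finally show ?thesis .
 qed
 define q where "q = sqrt (de / 2 * (de / 4) powr al)"
 have q: "q > 0" using d by (simp add: q_def)
 define t where "t = e * q / (2 * (nrm h + 1))"
 have t: "t > 0" using e q nrm_nonneg[of h] by (simp add: t_def)
 obtain M where M: "M >= N" "!!n. n > M ==> lam n <= t^2" using lam_small[OF N C dec, of "t^2"] t by auto
 define r where "r = rest M h"
 note rf = rest_facts[OF h, of M, folded r_def]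
 obtain n where n: "n > M" "ip (Top r) r <= lam n * ip r r" using Top_le_lam[of M] rf(1) by blast
 have "ip (Top r) r <= t^2 * (nrm h)^2"
 proof -
  have "lam n * ip r r <= t^2 * (nrm h)^2"
   using M(2)[OF n(1)] rf(5) nrm_nonneg[of r] unfolding nrm_sq[symmetric] by (intro mult_mono power_mono) auto
  thus ?thesis using n(2) by linarith
 qed
 hence "ip (Cop r) (Cop r) + ip (Sop r) (Sop r) <= (t * nrm h)^2" using ip_Top[OF rf(2,2)] by (simp add: power_mult_distrib)
 hence "ip (Cop r) (Cop r) <= (t * nrm h)^2" "ip (Sop r) (Sop r) <= (t * nrm h)^2" using ip_nonneg[of "Cop r"] ip_nonneg[of "Sop r"] by linarith+
 hence "nrm (Cop r) <= sqrt ((t * nrm h)^2)" "nrm (Sop r) <= sqrt ((t * nrm h)^2)" unfolding nrm_def by (intro real_sqrt_le_mono; simp)+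
 hence nb: "nrm (Cop r) <= t * nrm h" "nrm (Sop r) <= t * nrm h" using t nrm_nonneg[of h] by simp_all
 have tq: "t * nrm h / q <= e / 2"
 proof -
  have "t * nrm h <= t * (nrm h + 1)" using t by (intro mult_left_mono) auto
  also have "... = e * q / 2"
   unfolding t_def by (rule canc) (use nrm_nonneg[of h] in linarith)
  finally show ?thesis using q by (simp add: pos_divide_le_eq)
 qed
 have ri: "integrable nu r" by (rule l2_integrable[OF rf(2)])
 have ly: "l2 (?A r)"
 proof -
  have m: "(?A r) : borel_measurable nu" using trig_integrable(3)[OF ri] by auto
  have "integrable nu (%y. (c^2 * y^2) * (r y)^2)"
   by (rule bound_integral(1)[where B = "c^2"]) (use rf(2) in "auto simp: l2_def abs_square_le_1 abs_le_iff intro!: cont_meas continuous_intros mult_left_le")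
  thus ?thesis using m by (simp add: l2_def power_mult_distrib)
 qed
 have ny: "nrm (?A r) <= c * nrm h"
 proof -
  have "ip (?A r) (?A r) <= ip (%y. c * r y) (%y. c * r y)" unfolding ip_def
  proof (rule integral_mono[OF l2_mult[OF ly ly] l2_mult[OF l2_cmult[OF rf(2)] l2_cmult[OF rf(2)]]])
   fix y assume "y : space nu"
   hence "y^2 <= 1" by (simp add: space_nu abs_square_le_1 abs_le_iff)
   hence "y^2 * (c * r y)^2 <= 1 * (c * r y)^2" by (intro mult_right_mono) auto
   thus "c * y * r y * (c * y * r y) <= c * r y * (c * r y)" by (simp add: power2_eq_square mult_ac)
  qed
  hence "nrm (?A r) <= nrm (%y. c * r y)" unfolding nrm_def by (rule real_sqrt_le_mono)
  also have "... <= c * nrm h" unfolding nrm_cmult using rf(5) c0 by simp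
  finally show ?thesis .
 qed
 have db: "abs (- Sop (?A r) x) <= D" "abs (Cop (?A r) x) <= D" for x
  using Cop_bound_nrm[OF ly, of x] ny unfolding D_def by linarith+
 have fin: "de * D + m / q <= e" if "m <= t * nrm h" for m
  using dD tq divide_right_mono[OF that, of q] q by linarith
 have "abs (Cop r x) <= e" "abs (Sop r x) <= e" if x: "x : II" for x
  using window_bound[OF trig_deriv(1)[OF ri] trig_cont(1)[OF ri] db(1) x d, folded q_def] fin[OF nb(1)]
   window_bound[OF trig_deriv(2)[OF ri] trig_cont(2)[OF ri] db(2) x d, folded q_def] fin[OF nb(2)] by linarith+
 thus ?thesis using M(1) unfolding r_def by blast
qed

text \<open>h is split into its expansion up to M and the rest. \<open>block_bound\<close> treats
  the first part with a constant independent of M, \<open>trig_tail\<close> makes the second one as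
  small as desired.\<close>

lemma dy_trig_bound:
 assumes N: "N >= 1" "real N >= 2 * c / pi" and C: "C > 0"
  and dec: "!!k. N < k ==> lam k * (ev k / ev N) powr (al + 1) <= C * ev N * lam N"
  and h: "orth N h"
 shows "z.nrm (Cop h) <= 2 * sqrt ((1 + 2 * sup_const) * (16 * pi ^ 4) powr al * C * ev N powr (al + 1) * lam N) * nrm h"
  "z.nrm (Sop h) <= 2 * sqrt ((1 + 2 * sup_const) * (16 * pi ^ 4) powr al * C * ev N powr (al + 1) * lam N) * nrm h"
proof -
 let ?A = "%C. (1 + 2 * sup_const) * (16 * pi ^ 4) powr al * C * ev N powr (al + 1) * lam N"
 let ?B = "%M h b x. \<Sum>k\<in>{N<..M}. coef h k * b k * psi k x"
 let ?C = "%M h. \<Sum>k\<in>{N<..M}. (coef h k)^2"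
 define P where "P = sqrt (?A C)"
 have sc0: "sup_const >= 0" by (simp add: sup_const_def)
 have P0: "P >= 0" using sc0 C lam_nonneg[of N] by (simp add: P_def)
 have hl: "l2 h" using h by (simp add: orth_def)
 have *: "z.nrm (Cop h) <= 2 * P * nrm h + e & z.nrm (Sop h) <= 2 * P * nrm h + e" if e: "e > 0" for e
 proof -
  obtain M where M: "M >= N" "!!x. x : II ==> (abs (Cop (rest M h) x)) <= e / 2" "!!x. x : II ==> (abs (Sop (rest M h) x)) <= e / 2"
   using trig_tail[OF ev_ge(1)[OF N] C dec hl, of "e / 2"] e by auto
  note rf = rest_facts[OF hl, of M]
  have z0: "coef h k = 0" if "k <= N" for k using h that by (simp add: orth_def coef_def)
  have pr: "proj M h = (%x. \<Sum>k\<in>{N<..M}. coef h k * psi k x)"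
  proof
   fix x
   show "proj M h x = (\<Sum>k\<in>{N<..M}. coef h k * psi k x)" unfolding proj_def
    by (rule sum.mono_neutral_right) (use z0 in auto)
  qed
  have sumC: "Cop (proj M h) x = (?B M h mc x)" "Sop (proj M h) x = (?B M h ms x)" if x: "x : II" for x
  proof -
   have i: "integrable nu (%y. cos (c * x * y) * (coef h k * psi k y))" "integrable nu (%y. sin (c * x * y) * (coef h k * psi k y))" for k
    by (intro trig_integrable integrable_mult_right psi_int)+
   have "Cop (proj M h) x = (\<Sum>k\<in>{N<..M}. Cop (%y. coef h k * psi k y) x)" "Sop (proj M h) x = (\<Sum>k\<in>{N<..M}. Sop (%y. coef h k * psi k y) x)"
    unfolding pr Cop_def Sop_def sum_distrib_left by (intro Bochner_Integration.integral_sum i)+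
   thus "Cop (proj M h) x = (?B M h mc x)" "Sop (proj M h) x = (?B M h ms x)"
    unfolding Cop_cmult using x by (simp_all add: Cop_psi mult.assoc)
  qed
  have Sle: "sqrt (?C M h) <= nrm h"
  proof -
   have "(?C M h) <= (\<Sum>k\<in>{0..M}. (coef h k)^2)" by (intro sum_mono2) auto
   also have "... <= ip h h" using rf(4) ip_nonneg[of "rest M h"] by linarith
   finally show ?thesis unfolding nrm_def by (rule real_sqrt_le_mono)
  qed
  have pi: "integrable nu (proj M h)" "integrable nu (rest M h)" by (intro l2_integrable proj_l2 rf(2))+
  have split: "Cop h = (%x. Cop (proj M h) x + Cop (rest M h) x)" "Sop h = (%x. Sop (proj M h) x + Sop (rest M h) x)"
   using Cop_add[OF pi] by (simp_all add: rest_def)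
  have fin: "z.nrm F <= 2 * P * nrm h + e"
   if F: "!!x. F x = U x + V x" and U: "!!x. x : II ==> U x = (?B M h b x)" and b: "!!k. (b k)^2 <= lam k"
    and V: "!!x. x : II ==> (abs (V x)) <= e / 2" and c: "contI U" "contI V" for F U V b
  proof -
   have "F = (%x. U x + V x)" using F by auto
   hence "z.nrm F <= z.nrm U + z.nrm V" using z.nrm_triangle[OF z.l2_cont[OF c(1)] z.l2_cont[OF c(2)]] by simp
   moreover have "z.nrm V <= 2 * (e / 2)" by (rule z.nrm_bound[OF V c(2)]) (use e in auto)
   moreover have "z.nrm U = z.nrm (%x. \<Sum>k\<in>{N<..M}. coef h k * b k * psi k x)" by (rule z.nrm_cong) (rule U)
   moreover have "z.nrm (%x. \<Sum>k\<in>{N<..M}. coef h k * b k * psi k x) <= 2 * P * sqrt (?C M h)"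
    unfolding P_def by (rule block_bound[OF N C dec b])
   moreover have "2 * P * sqrt (?C M h) <= 2 * P * nrm h" using P0 Sle by (intro mult_left_mono) auto
   ultimately show ?thesis by linarith
  qed
  have "z.nrm (Cop h) <= 2 * P * nrm h + e"
   by (rule fin[of _ "Cop (proj M h)" "Cop (rest M h)" mc]) (use split(1) sumC(1) M(2) trig_cont(1)[OF pi(1)] trig_cont(1)[OF pi(2)] in "auto simp: lam_def fun_eq_iff")
  moreover have "z.nrm (Sop h) <= 2 * P * nrm h + e"
   by (rule fin[of _ "Sop (proj M h)" "Sop (rest M h)" ms]) (use split(2) sumC(2) M(3) trig_cont(2)[OF pi(1)] trig_cont(2)[OF pi(2)] in "auto simp: lam_def fun_eq_iff")
  ultimately show ?thesis by blast
 qed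
 show "z.nrm (Cop h) <= 2 * sqrt (?A C) * nrm h"
  unfolding P_def[symmetric] by (rule field_le_epsilon) (use * in blast)
 show "z.nrm (Sop h) <= 2 * sqrt (?A C) * nrm h"
  unfolding P_def[symmetric] by (rule field_le_epsilon) (use * in blast)
qed

end

section \<open>Passage between real and complex functions\<close>

context wt begin

lemma nu_lebesgue:
 fixes f :: "real => 'b::{banach, second_countable_topology}"
 assumes "f : borel_measurable nu"
 shows "(LINT x|nu. f x) = (LINT x|leb. chi x *\<^sub>R (w x *\<^sub>R f x))"
  "integrable nu f \<longleftrightarrow> Lint (%x. chi x *\<^sub>R (w x *\<^sub>R f x))"
 unfolding nu_integral[OF assms] by (subst integral_restrict_space integrable_restrict_space; simp)+

lemma complex_nu_integral:
 assumes "integrable nu p" "integrable nu q"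
 shows "(LINT x|nu. Complex (p x) (q x)) = Complex (LINT x|nu. p x) (LINT x|nu. q x)" "integrable nu (%x. Complex (p x) (q x))"
proof -
 let ?A = "LINT x|nu. Complex (p x) (q x)"
 have e: "(%x. Complex (p x) (q x)) = (%x. cor (p x) + \<i> * cor (q x))" by (auto simp: complex_eq_iff)
 have i: "integrable nu (%x. cor (p x))" "integrable nu (%x. \<i> * cor (q x))"
  using assms by (auto intro!: integrable_mult_right integrable_bounded_linear[OF bounded_linear_of_real])
 show "integrable nu (%x. Complex (p x) (q x))" unfolding e by (rule Bochner_Integration.integrable_add[OF i])
 have "?A = (LINT x|nu. cor (p x)) + \<i> * (LINT x|nu. cor (q x))"
  unfolding e by (simp only: Bochner_Integration.integral_add[OF i] integral_mult_right_zero)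
 thus "?A = Complex (LINT x|nu. p x) (LINT x|nu. q x)"
  unfolding integral_complex_of_real by (simp add: complex_eq_iff)
qed

text \<open>The weight is at most 1 because al >= 0, so the unweighted norm over [-1, 1] dominates.
  This is how the error epsilon passes to the weighted norm with factor 1.\<close>

lemma l2_parts:
 assumes F: "F : Lmeas" "Lint (%x. (norm (chi x *\<^sub>R F x))^2)"
 shows "l2 (%x. Re (F x))" "l2 (%x. Im (F x))"
  "ip (%x. Re (F x)) (%x. Re (F x)) + ip (%x. Im (F x)) (%x. Im (F x)) <= (LINT x|leb. (norm (chi x *\<^sub>R F x))^2)"
proof -
 let ?A = "%x. w x *\<^sub>R (Re (F x))^2"
 let ?B = "%x. w x *\<^sub>R (Im (F x))^2"
 let ?C = "%x. norm (chi x *\<^sub>R F x)"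
 let ?D = "%x. chi x *\<^sub>R (?A x)"
 let ?E = "%x. chi x *\<^sub>R (?B x)"
 have "F : borel_measurable (lebesgue_on II)" using F(1) by (rule measurable_restrict_space1)
 hence m: "(%x. Re (F x)) : borel_measurable nu" "(%x. Im (F x)) : borel_measurable nu" unfolding meas_nu by simp_all
 have m2: "(%x. (Re (F x))^2) : borel_measurable nu" "(%x. (Im (F x))^2) : borel_measurable nu" using m by simp_all
 have pw: "chi x *\<^sub>R (?A x) + chi x *\<^sub>R (?B x) <= (?C x)^2" for x
 proof (cases "x : II")
  case True
  have "w x * ((Re (F x))^2 + (Im (F x))^2) <= 1 * ((Re (F x))^2 + (Im (F x))^2)" using w_le1[OF True] by (intro mult_right_mono) auto
  thus ?thesis using True by (simp add: cmod_power2 distrib_left)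
 qed simp
 have p0: "0 <= chi x *\<^sub>R (w x *\<^sub>R (t::real)^2)" for x t by (simp add: w_nonneg indicator_def)
 have im: "(%x::real. chi x :: real) : Lmeas" "w : Lmeas"
  by (rule borel_imp_lebesgue_measurable, simp) (simp add: weight_def[abs_def] borel_imp_lebesgue_measurable)
 have i: "Lint ?D" "Lint ?E"
 proof -
  show "Lint ?D"
  proof (rule integrable_dominated[OF F(2)])
   show "?D : Lmeas" using F(1) by (intro borel_measurable_scaleR im) simp
   show "AE x in leb. norm (chi x *\<^sub>R (?A x)) <= norm ((?C x)^2)"
    unfolding real_norm_def abs_of_nonneg[OF p0] abs_of_nonneg[OF zero_le_power2]
   proof (intro AE_I2)
    fix x show "chi x *\<^sub>R (?A x) <= (?C x)^2" using pw[of x] p0[of x "Im (F x)"] by linarith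
   qed
  qed
  show "Lint ?E"
  proof (rule integrable_dominated[OF F(2)])
   show "?E : Lmeas" using F(1) by (intro borel_measurable_scaleR im) simp
   show "AE x in leb. norm (chi x *\<^sub>R (?B x)) <= norm ((?C x)^2)"
    unfolding real_norm_def abs_of_nonneg[OF p0] abs_of_nonneg[OF zero_le_power2]
   proof (intro AE_I2)
    fix x show "chi x *\<^sub>R (?B x) <= (?C x)^2" using pw[of x] p0[of x "Re (F x)"] by linarith
   qed
  qed
 qed
 show "l2 (%x. Re (F x))" "l2 (%x. Im (F x))" unfolding l2_def nu_lebesgue(2)[OF m2(1)] nu_lebesgue(2)[OF m2(2)] using m i by auto
 have "ip (%x. Re (F x)) (%x. Re (F x)) + ip (%x. Im (F x)) (%x. Im (F x)) = (LINT x|nu. (Re (F x))^2) + (LINT x|nu. (Im (F x))^2)"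
  by (simp add: ip_def power2_eq_square)
 also have "... = (LINT x|leb. chi x *\<^sub>R (?A x) + chi x *\<^sub>R (?B x))"
  unfolding nu_lebesgue(1)[OF m2(1)] nu_lebesgue(1)[OF m2(2)] by (rule Bochner_Integration.integral_add[OF i, symmetric])
 also have "... <= (LINT x|leb. (?C x)^2)"
  by (rule integral_mono[OF Bochner_Integration.integrable_add[OF i] F(2) pw])
 finally show "ip (%x. Re (F x)) (%x. Re (F x)) + ip (%x. Im (F x)) (%x. Im (F x)) <= (LINT x|leb. (?C x)^2)" .
qed

lemma weighted_norm_parts:
 assumes "l2 (%x. Re (F x))" "l2 (%x. Im (F x))"
 shows "weighted_norm al F = sqrt ((nrm (%x. Re (F x)))^2 + (nrm (%x. Im (F x)))^2)"
proof -
 have m: "(%x. (cmod (F x))^2) : borel_measurable nu" unfolding cmod_power2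
  by (intro borel_measurable_add borel_measurable_power l2_meas assms)
 have "(LINT x:II|leb. (cmod (F x))^2 * w x) = (LINT x:II|leb. w x *\<^sub>R (cmod (F x))^2)" by (simp add: mult.commute)
 also have "... = (LINT x|nu. (cmod (F x))^2)" by (rule set_integral_nu[OF m])
 also have "... = (nrm (%x. Re (F x)))^2 + (nrm (%x. Im (F x)))^2"
  using assms unfolding cmod_power2 nrm_sq ip_def l2_def by (simp add: power2_eq_square)
 finally show ?thesis by (simp add: weighted_norm_def)
qed

end

lemma unit_weight_integral:
 fixes u :: "real => real"
 assumes u: "contI u"
 shows "(LINT x|(wmeas 0). u x) = (LINT x|lborel. chi x *\<^sub>R u x)"
proof -
 interpret z: wt 0 by unfold_locales simp
 have "(LINT x|(wmeas 0). u x) = integral II (%x. weight 0 x * u x)" by (rule z.weighted_integrable_on(2)[OF u])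
 also have "... = integral II u"
  by (rule integral_spike[of "{1, -1}"]) (auto simp: weight_def power2_eq_1_iff)
 also have "... = (LINT x:II|lborel. u x)"
  by (rule set_borel_integral_eq_integral(2)[symmetric]) (rule borel_integrable_atLeastAtMost', rule u)
 finally show ?thesis by (simp add: set_lebesgue_integral_def)
qed

context gp begin

interpretation z: wt 0 by unfold_locales simp

lemma partial_sum_proj:
 assumes f: "l2 (%x. Re (f x))" "l2 (%x. Im (f x))"
 shows "gpswf_partial_sum al psi N f x = Complex (proj N (%x. Re (f x)) x) (proj N (%x. Im (f x)) x)"
proof -
 have "weighted_inner al f (%y. cor (psi k y)) = Complex (coef (%x. Re (f x)) k) (coef (%x. Im (f x)) k)" for k
 proof -
  note i = l2_mult[OF f(1) psi_l2[of k]] l2_mult[OF f(2) psi_l2[of k]]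
  have e: "f x * cnj (cor (psi k x)) * cor (w x) = w x *\<^sub>R Complex (Re (f x) * psi k x) (Im (f x) * psi k x)" for x
   by (simp add: complex_eq_iff)
  have "weighted_inner al f (%y. cor (psi k y)) = (LINT x|nu. Complex (Re (f x) * psi k x) (Im (f x) * psi k x))"
   unfolding weighted_inner_def e by (rule set_integral_nu[OF borel_measurable_integrable[OF complex_nu_integral(2)[OF i]]])
  thus ?thesis unfolding complex_nu_integral(1)[OF i] coef_def ip_def .
 qed
 thus ?thesis unfolding gpswf_partial_sum_def proj_def by (simp add: complex_eq_iff Re_sum Im_sum)
qed

text \<open>Exchanging integrals turns the pairing into one of g with the finite Fourier transform
  of h at om / c, |om| <= c. The substitution om = c y gives the factor c and the unweighted norm of
  that transform: frequency space carries no weight, so this norm is unavoidable.\<close>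

lemma synth_pairing:
 assumes g: "g : Lmeas" "isq leb g" and h: "l2 h"
  and sm: "synth c g : Lmeas" and sb: "!!x. norm (synth c g x) <= B"
 shows "abs (ip h (%x. Re (synth c g x))) <= 1 / (2 * pi) * (sqrt (nsq leb g) * sqrt (c * ((z.nrm (Cop h))^2 + (z.nrm (Sop h))^2)))" (is "_ <= ?R")
  "abs (ip h (%x. Im (synth c g x))) <= 1 / (2 * pi) * (sqrt (nsq leb g) * sqrt (c * ((z.nrm (Cop h))^2 + (z.nrm (Sop h))^2)))"
proof -
 let ?A = "%x. Re (synth c g x)"
 let ?B = "%x. Im (synth c g x)"
 let ?C = "%x om h. w x *\<^sub>R Complex (cos (c * (om / c) * x) * h x) (sin (c * (om / c) * x) * h x)"
 let ?D = "%om a. LINT x|leb. cexp (x * om) * a x"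
 have hi: "integrable nu h" by (rule l2_integrable[OF h])
 have hm: "h : borel_measurable nu" using h by (simp add: l2_def)
 define ar where "ar x = chi x *\<^sub>R (w x *\<^sub>R h x)" for x
 define a where "a x = cor (ar x)" for x
 have ari: "Lint ar" using hi nu_lebesgue(2)[OF hm] by (simp add: ar_def[abs_def])
 have ai: "Lint a" unfolding a_def[abs_def] by (rule integrable_bounded_linear[OF bounded_linear_of_real ari])
 have B0: "B >= 0" using sb[of 0] norm_ge_zero[of "synth c g 0"] by linarith
 have asi: "Lint (%x. a x * synth c g x)"
 proof (rule integrable_dominated[OF integrable_mult_right[OF integrable_norm[OF ai], of B]])
  show "(%x. a x * synth c g x) : Lmeas" using ai sm by (intro borel_measurable_times) auto
  show "AE x in leb. norm (a x * synth c g x) <= norm (B * norm (a x))"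
  proof (intro AE_I2)
   fix x
   have "norm (synth c g x) * norm (a x) <= B * norm (a x)" by (intro mult_right_mono sb) simp
   thus "norm (a x * synth c g x) <= norm (B * norm (a x))" using B0 by (simp add: norm_mult mult.commute)
  qed
 qed
 have smn: "?A : borel_measurable nu" "?B : borel_measurable nu"
  using measurable_restrict_space1[OF sm] unfolding meas_nu by simp_all
 define I where "I = (LINT x|leb. a x * synth c g x)"
 have RI: "ip h ?A = Re I" "ip h ?B = Im I"
 proof -
  have "ip h ?A = (LINT x|leb. Re (a x * synth c g x))"
   unfolding ip_def by (subst nu_lebesgue(1)) (use hm smn in "simp_all add: a_def ar_def mult.assoc")
  thus "ip h ?A = Re I" unfolding I_def using integral_Re[OF asi] by simp
  have "ip h ?B = (LINT x|leb. Im (a x * synth c g x))"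
   unfolding ip_def by (subst nu_lebesgue(1)) (use hm smn in "simp_all add: a_def ar_def mult.assoc")
  thus "ip h ?B = Im I" unfolding I_def using integral_Im[OF asi] by simp
 qed
 define gc where "gc om = indicator {-c..c} om *\<^sub>R g om" for om
 note gci = L2_interval[OF g, of c, folded gc_def]
 define \<Phi> where "\<Phi> om = Complex (Cop h (om / c)) (Sop h (om / c))" for om
 have Pe: "(?D om a) = \<Phi> om" for om
 proof -
  note ti = trig_integrable(1,2)[OF hi, of "om / c"]
  have "\<Phi> om = (LINT x|nu. Complex (cos (c * (om / c) * x) * h x) (sin (c * (om / c) * x) * h x))"
   unfolding complex_nu_integral(1)[OF ti] \<Phi>_def Cop_def Sop_def ..
  also have "... = (LINT x|leb. chi x *\<^sub>R (?C x om h))"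
   by (rule nu_lebesgue(1)[OF borel_measurable_integrable[OF complex_nu_integral(2)[OF ti]]])
  also have "... = (?D om a)"
  proof (rule integral_eqI[OF refl])
   fix x
   have e: "c * (om / c) * x = x * om" using c0 by simp
   show "chi x *\<^sub>R (?C x om h) = cexp (x * om) * a x"
    unfolding e by (simp add: complex_eq_iff a_def ar_def Re_exp Im_exp)
  qed
  finally show ?thesis by simp
 qed
 have "I = cor (1 / (2 * pi)) * (LINT om|leb. gc om * \<Phi> om)"
 proof -
  have "(LINT x|leb. a x * (LINT om|leb. cexp (x * om) * gc om)) = (LINT om|leb. gc om * (?D om a))"
   by (rule kernel_swap[OF ai gci(1)]) (auto intro!: continuous_intros)
  moreover have "a x * synth c g x = cor (1 / (2 * pi)) * (a x * (LINT om|leb. cexp (x * om) * gc om))" for x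
   unfolding synth_def gc_def[symmetric] by (rule mult.left_commute)
  ultimately show ?thesis unfolding I_def by (simp only: integral_mult_right_zero Pe)
 qed
 moreover have "gc om * \<Phi> om = g om * (indicator {-c..c} om *\<^sub>R \<Phi> om)" for om by (simp add: gc_def)
 ultimately have Ie: "I = cor (1 / (2 * pi)) * (LINT om|leb. g om * (indicator {-c..c} om *\<^sub>R \<Phi> om))" by (simp only:)
 define u where "u y = (Cop h y)^2 + (Sop h y)^2" for y
 have cu: "continuous_on S u" for S unfolding u_def by (intro continuous_intros trig_cont hi)
 have cP: "continuous_on UNIV \<Phi>"
 proof -
  have "\<Phi> = (%om. cor (Cop h (om / c)) + \<i> * cor (Sop h (om / c)))" by (auto simp: \<Phi>_def complex_eq_iff)
  moreover have "continuous_on UNIV (%om. Cop h (om / c))" "continuous_on UNIV (%om. Sop h (om / c))"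
   by (rule continuous_on_compose2[OF trig_cont(1)[OF hi, of UNIV]], use c0 in "auto intro!: continuous_intros",
     rule continuous_on_compose2[OF trig_cont(2)[OF hi, of UNIV]], use c0 in "auto intro!: continuous_intros")
  ultimately show ?thesis by (simp add: continuous_intros)
 qed
 have Pm: "(%om. indicator {-c..c} om *\<^sub>R \<Phi> om) : borel_measurable borel"
  by (intro borel_measurable_scaleR borel_measurable_indicator borel_measurable_continuous_onI[OF cP]) simp
 note Pml = borel_imp_lebesgue_measurable[OF Pm]
 have Pn: "(norm (indicator {-c..c} om *\<^sub>R \<Phi> om))^2 = indicator {-c..c} om * u (om / c)" for om
  by (simp add: \<Phi>_def u_def indicator_def cmod_power2)
 have P2: "Lint (%om. (norm (indicator {-c..c} om *\<^sub>R \<Phi> om))^2)"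
 proof -
  obtain Bu where Bu: "!!y. y : II ==> (abs (u y)) <= Bu" using cont_bdd[OF cu[of "II"]] by blast
  show ?thesis
  proof (rule integrable_dominated[OF integrable_mult_right[OF integrable_indicator_Icc[of "-c" c], of Bu]])
   show "(%om. (norm (indicator {-c..c} om *\<^sub>R \<Phi> om))^2) : Lmeas"
    by (rule measurable_compose[OF Pml]) (intro borel_measurable_continuous_onI continuous_intros)
   show "AE om in leb. norm ((norm (indicator {-c..c} om *\<^sub>R \<Phi> om))^2) <= norm (Bu * indicator {-c..c} om)"
    unfolding Pn
   proof (intro AE_I2)
    fix om
    show "norm (indicator {-c..c} om * u (om / c)) <= norm (Bu * indicator {-c..c} om)"
    proof (cases "om : {-c..c}")
     case True
     hence "om / c : II" using c0 by (auto simp: field_simps)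
     thus ?thesis using Bu[of "om / c"] True by (auto intro: order_trans)
    qed simp
   qed
  qed
 qed
 have P3: "(LINT om|leb. (norm (indicator {-c..c} om *\<^sub>R \<Phi> om))^2) = c * ((z.nrm (Cop h))^2 + (z.nrm (Sop h))^2)"
 proof -
  have m: "(%om. (norm (indicator {-c..c} om *\<^sub>R \<Phi> om))^2) : borel_measurable lborel"
   using measurable_compose[OF Pm, of "%z. (norm z)^2" borel] by (simp add: borel_measurable_continuous_onI continuous_intros)
  have "(LINT om|leb. (norm (indicator {-c..c} om *\<^sub>R \<Phi> om))^2) = (LINT om|lborel. (norm (indicator {-c..c} om *\<^sub>R \<Phi> om))^2)" by (rule integral_completion[OF m])
  also have "... = (LINT om|lborel. indicator {-c..c} om * u (om / c))" unfolding Pn ..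
  also have "... = abs c *\<^sub>R (LINT x|lborel. indicator {-c..c} (0 + c * x) * u ((0 + c * x) / c))" by (rule lborel_integral_real_affine) (use c0 in simp)
  also have "(%x. indicator {-c..c} (0 + c * x) * u ((0 + c * x) / c)) = (%x. chi x *\<^sub>R u x)"
  proof
   fix x
   have "c * x : {-c..c} \<longleftrightarrow> x : II"
    using c0 mult_le_cancel_left_pos[OF c0, of "-1" x] mult_le_cancel_left_pos[OF c0, of x 1] by simp
   thus "indicator {-c..c} (0 + c * x) * u ((0 + c * x) / c) = chi x *\<^sub>R u x" using c0 by (simp add: indicator_def)
  qed
  also have "(LINT x|lborel. chi x *\<^sub>R u x) = (LINT x|(wmeas 0). u x)" by (rule unit_weight_integral[OF cu, symmetric])
  also have "... = (z.nrm (Cop h))^2 + (z.nrm (Sop h))^2"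
   unfolding u_def z.nrm_sq z.ip_def unfolding power2_eq_square
   by (intro Bochner_Integration.integral_add z.integrable_cont continuous_intros trig_cont hi)
  finally show ?thesis using c0 by simp
 qed
 have "norm I <= ?R"
 proof -
  have n: "norm (cor (1 / (2 * pi))) = 1 / (2 * pi)" by (simp only: norm_of_real) simp
  show ?thesis unfolding Ie norm_mult[of "cor (1 / (2 * pi))"] n P3[symmetric]
   by (rule mult_left_mono[OF integrable_mult_L2(2)[OF g(1) Pml g(2) P2]]) simp
 qed
 thus "abs (ip h ?A) <= ?R" "abs (ip h ?B) <= ?R"
  unfolding RI using order_trans[OF abs_Re_le_cmod] order_trans[OF abs_Im_le_cmod] by blast+
qed

lemma rest_add: assumes "l2 p" "l2 q" shows "rest N (%x. p x + q x) = (%x. rest N p x + rest N q x)"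
 using assms by (auto simp: rest_def proj_def coef_def ip_add psi_l2 distrib_right sum.distrib)

text \<open>For q the real or imaginary part of the band-limited part, h = \<open>rest N q\<close>
  is orthogonal to q - h, hence ||h||^2 = <h, q>. By \<open>synth_pairing\<close> and
  \<open>dy_trig_bound\<close> the right side is at most Dd ||h||, and one factor ||h||
  cancels.\<close>

lemma approximation_error:
 assumes N: "N >= 1" "real N >= 2 * c / pi" and C: "C > 0"
  and dec: "!!k. N < k ==> lam k * (ev k / ev N) powr (al + 1) <= C * ev N * lam N"
  and f: "L2_line f" "eps_band_limited \<epsilon> c f" "\<epsilon> >= 0"
 shows "weighted_norm al (%t. f t - gpswf_partial_sum al psi N f t) <=
   \<epsilon> + 12 * sqrt ((1 + 2 * sup_const) * (16 * pi ^ 4) powr al * C) * sqrt (concentration_eigenvalue al c (psi N))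
    * ev N powr ((1 + al) / 2) * L2_line_norm f"
proof -
 let ?A = "%h. c * ((z.nrm (Cop h))^2 + (z.nrm (Sop h))^2)"
 let ?B = "concentration_eigenvalue al c (psi N)"
 let ?C = "ev N powr (al + 1)"
 let ?D = "%r. (nrm (%x. Re (r x)))^2 + (nrm (%x. Im (r x)))^2"
 define K where "K = (1 + 2 * sup_const) * (16 * pi ^ 4) powr al * C"
 have K0: "K >= 0" using C by (simp add: K_def sup_const_def)
 define P where "P = sqrt (K * ev N powr (al + 1) * lam N)"
 have P0: "P >= 0" using K0 lam_nonneg[of N] by (simp add: P_def)
 have fm: "f : Lmeas" "isq leb f" using f(1) by (auto simp: L2_line_def)
 obtain g where g: "g : Lmeas" "isq leb g"
  "nsq leb g <= 2 * pi * nsq leb f"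
  "(LINT x|leb. (norm (chi x *\<^sub>R (f x - synth c g x)))^2) <= \<epsilon>^2"
  "Lint (%x. (norm (chi x *\<^sub>R (f x - synth c g x)))^2)"
  and sm: "synth c g : Lmeas" and sb: "!!x. norm (synth c g x) <= (LINT om|leb. norm (indicator {-c..c} om *\<^sub>R g om))"
  by (rule band_limited_approx[OF f(2,3)]) blast
 define F where "F = sqrt (nsq leb f)"
 have F0: "F >= 0" by (simp add: F_def)
 define r where "r x = f x - synth c g x" for x
 have rm: "r : Lmeas" unfolding r_def[abs_def] by (intro borel_measurable_diff fm sm)
 note fl = l2_parts[OF fm(1) L2_interval(2)[OF fm, of 1]]
 have rl: "l2 (%x. Re (r x))" "l2 (%x. Im (r x))" "ip (%x. Re (r x)) (%x. Re (r x)) + ip (%x. Im (r x)) (%x. Im (r x)) <= \<epsilon>^2"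
  using l2_parts[OF rm g(5)[folded r_def]] g(4)[folded r_def] by auto
 have sl: "l2 (%x. Re (synth c g x))" "l2 (%x. Im (synth c g x))"
  using l2_diff[OF fl(1) rl(1)] l2_diff[OF fl(2) rl(2)] by (simp_all add: r_def)
 \<comment> \<open>The 3 bounds sqrt 8, from the cosine and the sine part with 2 P each. Combining
   real and imaginary parts costs sqrt 2, estimated by 4 below, which makes up the constant
   12.\<close>
 define Dd where "Dd = 3 * P * (sqrt (c / (2 * pi)) * F)"
 have Dd0: "Dd >= 0" using P0 F0 c0 by (simp add: Dd_def)
 have core: "nrm (rest N q) <= Dd" if q: "l2 q" and pair: "!!h. l2 h ==> (abs (ip h q)) <= 1 / (2 * pi) * (sqrt (nsq leb g) * sqrt (?A h))" for q
 proof -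
  define h where "h = rest N q"
  note hf = rest_facts[OF q, of N, folded h_def]
  have zb: "z.nrm (Cop h) <= 2 * P * nrm h" "z.nrm (Sop h) <= 2 * P * nrm h"
   using dy_trig_bound[OF N C dec hf(1)] unfolding P_def K_def by auto
  have n0: "0 <= nrm h" by (rule nrm_nonneg)
  have "(z.nrm (Cop h))^2 + (z.nrm (Sop h))^2 <= (2 * P * nrm h)^2 + (2 * P * nrm h)^2"
   using zb by (intro add_mono power_mono z.nrm_nonneg)
  also have "... <= (3 * P * nrm h)^2" by (simp add: power_mult_distrib)
  finally have "sqrt (?A h) <= sqrt (c * (3 * P * nrm h)^2)"
   using c0 by (intro real_sqrt_le_mono mult_left_mono) auto
  also have "... = sqrt c * (3 * P * nrm h)" using P0 n0 by (simp add: real_sqrt_mult)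
  finally have s1: "sqrt (?A h) <= sqrt c * (3 * P * nrm h)" .
  have s2: "sqrt (nsq leb g) <= sqrt (2 * pi) * F"
   unfolding F_def real_sqrt_mult[symmetric] by (rule real_sqrt_le_mono[OF g(3)])
  have "nrm h * nrm h = ip h q" using nrm_sq[of h] hf(6) by (simp add: power2_eq_square)
  also have "... <= 1 / (2 * pi) * (sqrt (nsq leb g) * sqrt (?A h))"
   using pair[OF hf(2)] by linarith
  also have "... <= 1 / (2 * pi) * ((sqrt (2 * pi) * F) * (sqrt c * (3 * P * nrm h)))"
   using s1 s2 F0 c0 by (intro mult_left_mono mult_mono) auto
  also have "... = Dd * nrm h"
  proof -
   define t where "t = sqrt (2 * pi)"
   have t: "t > 0" "2 * pi = t * t" by (simp_all add: t_def)
   have "sqrt (c / (2 * pi)) = sqrt c / t" by (simp add: t_def real_sqrt_divide)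
   moreover have "1 / (t * t) * ((t * F) * (sqrt c * (3 * P * nrm h))) = 3 * P * (sqrt c / t * F) * nrm h" using t(1) by (simp add: field_simps)
   ultimately show ?thesis unfolding Dd_def t_def[symmetric] by (simp only: t(2))
  qed
  finally have le: "nrm h * nrm h <= Dd * nrm h" .
  show "nrm (rest N q) <= Dd"
  proof (cases "nrm h = 0")
   case False
   hence "nrm h > 0" using n0 by simp
   with le show ?thesis unfolding h_def[symmetric] by (rule mult_right_le_imp_le)
  qed (use Dd0 h_def in simp)
 qed
 have cR: "nrm (rest N (%x. Re (synth c g x))) <= Dd" "nrm (rest N (%x. Im (synth c g x))) <= Dd"
  by (rule core[OF sl(1)], rule synth_pairing(1)[OF g(1,2) _ sm sb], assumption,
    rule core[OF sl(2)], rule synth_pairing(2)[OF g(1,2) _ sm sb], assumption)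
 have tri: "nrm (rest N (%x. p x + q x)) <= nrm p + Dd" if "l2 p" "l2 q" "nrm (rest N q) <= Dd" for p q
  unfolding rest_add[OF that(1,2)]
  using nrm_triangle[OF rest_facts(2)[OF that(1), of N] rest_facts(2)[OF that(2), of N]] rest_facts(5)[OF that(1), of N] that(3) by linarith
 have sp: "(%x. Re (f x)) = (%x. Re (r x) + Re (synth c g x))" "(%x. Im (f x)) = (%x. Im (r x) + Im (synth c g x))" by (auto simp: r_def)
 have b: "nrm (rest N (%x. Re (f x))) <= nrm (%x. Re (r x)) + Dd" "nrm (rest N (%x. Im (f x))) <= nrm (%x. Im (r x)) + Dd"
  unfolding sp by (intro tri rl sl cR)+
 have G: "(%x. Re (f x - gpswf_partial_sum al psi N f x)) = rest N (%x. Re (f x))" "(%x. Im (f x - gpswf_partial_sum al psi N f x)) = rest N (%x. Im (f x))"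
  unfolding partial_sum_proj[OF fl(1,2)] by (auto simp: rest_def)
 have "weighted_norm al (%t. f t - gpswf_partial_sum al psi N f t) = sqrt ((nrm (rest N (%x. Re (f x))))^2 + (nrm (rest N (%x. Im (f x))))^2)"
  using weighted_norm_parts[of "%t. f t - gpswf_partial_sum al psi N f t"] unfolding G using rest_facts(2)[OF fl(1)] rest_facts(2)[OF fl(2)] by simp
 also have "... <= sqrt ((nrm (%x. Re (r x)) + Dd)^2 + (nrm (%x. Im (r x)) + Dd)^2)"
  by (intro real_sqrt_le_mono add_mono power_mono b nrm_nonneg)
 \<comment> \<open>Minkowski's inequality in the plane separates the two errors, so that epsilon
   keeps the coefficient 1.\<close>
 also have "... <= sqrt (?D r) + sqrt (Dd^2 + Dd^2)" by (rule real_sqrt_sum_squares_triangle_ineq)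
 also have "sqrt (?D r) <= \<epsilon>"
  using rl(3) f(3) by (intro real_le_lsqrt) (simp_all add: nrm_sq)
 also have "sqrt (Dd^2 + Dd^2) <= 4 * Dd" using Dd0 by (intro real_le_lsqrt) (auto simp: power_mult_distrib)
 also have "4 * Dd = 12 * sqrt K * sqrt ?B * ev N powr ((1 + al) / 2) * F"
 proof -
  have "sqrt ?C = ev N powr ((1 + al) / 2)"
  proof -
   have "sqrt ?C = ?C powr (1 / 2)" by (simp add: powr_half_sqrt)
   also have "... = ev N powr ((al + 1) * (1 / 2))" by (rule powr_powr)
   also have "(al + 1) * (1 / 2) = (1 + al) / 2" by simp
   finally show ?thesis .
  qed
  hence P: "P = sqrt K * ev N powr ((1 + al) / 2) * sqrt (lam N)" unfolding P_def real_sqrt_mult by simp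
  have "sqrt ?B = sqrt (c / (2 * pi)) * sqrt (lam N)" unfolding concentration_psi by (rule real_sqrt_mult)
  thus ?thesis unfolding Dd_def P by (simp only:) (simp add: mult_ac)
 qed
 finally show ?thesis unfolding K_def F_def L2_line_norm_def by simp
qed

end

theorem corollary2:
  fixes \<alpha> :: real
  assumes "\<alpha> \<ge> 0"
  shows "\<exists>C1::real. \<forall>(c::real) (ev :: nat \<Rightarrow> real) (\<psi> :: nat \<Rightarrow> real \<Rightarrow> real)
            (\<epsilon>::real) (f :: real \<Rightarrow> complex) (N::nat).
           c > 0 \<longrightarrow> gpswf_system \<alpha> c ev \<psi> \<longrightarrow>
           \<epsilon> \<ge> 0 \<longrightarrow> L2_line f \<longrightarrow> eps_band_limited \<epsilon> c f \<longrightarrow>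
           N \<ge> 1 \<longrightarrow> real N \<ge> 2 * c / pi \<longrightarrow>
           weighted_norm \<alpha> (\<lambda>t. f t - gpswf_partial_sum \<alpha> \<psi> N f t)
             \<le> \<epsilon> + C1 * sqrt (concentration_eigenvalue \<alpha> c (\<psi> N))
                     * (ev N) powr ((1 + \<alpha>) / 2) * L2_line_norm f"
proof -
  have p: "0 < 1 / pi ^ 4" by simp
  obtain C where C: "C > 0" "\<And>c \<kappa>1 \<kappa>2 U1 U1' a1 U2 U2' a2.
     outer_sol \<alpha> c \<kappa>1 U1 U1' a1 \<Longrightarrow> outer_sol \<alpha> c \<kappa>2 U2 U2' a2 \<Longrightarrow> \<kappa>2 < \<kappa>1 \<Longrightarrow>
     1 / pi ^ 4 \<le> \<kappa>2 \<Longrightarrow> 1 / pi ^ 4 * c\<^sup>2 \<le> \<kappa>2 \<Longrightarrow> a1 \<ge> 0 \<Longrightarrow>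
     a2 * (\<kappa>1 / \<kappa>2) powr (\<alpha> + 1) \<le> C * \<kappa>2 * a1"
    by (rule amp_ratio[OF assms p]) blast
  show ?thesis
  \<comment> \<open>The witness depends on alpha alone: \<open>gp.sup_const\<close> takes no other
    parameter, and C was obtained before c and the eigenfunctions were fixed.\<close>
  proof (intro exI[of _ "12 * sqrt ((1 + 2 * gp.sup_const \<alpha>) * (16 * pi ^ 4) powr \<alpha> * C)"] allI impI)
    fix c \<epsilon> :: real and ev :: "nat \<Rightarrow> real" and \<psi> :: "nat \<Rightarrow> real \<Rightarrow> real" and f :: "real \<Rightarrow> complex" and N :: nat
    assume a: "c > 0" "gpswf_system \<alpha> c ev \<psi>" "\<epsilon> \<ge> 0" "L2_line f" "eps_band_limited \<epsilon> c f" "N \<ge> 1" "real N \<ge> 2 * c / pi"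
    interpret gp \<alpha> c ev \<psi> by unfold_locales (use assms a in auto)
    have dec: "lam k * (ev k / ev N) powr (\<alpha> + 1) \<le> C * ev N * lam N" if k: "N < k" for k
      by (rule lam_decay[OF p C(2) ev_ge(4,5)[OF a(6,7)] k])
    show "weighted_norm \<alpha> (\<lambda>t. f t - gpswf_partial_sum \<alpha> \<psi> N f t)
             \<le> \<epsilon> + 12 * sqrt ((1 + 2 * sup_const) * (16 * pi ^ 4) powr \<alpha> * C) * sqrt (concentration_eigenvalue \<alpha> c (\<psi> N))
                     * (ev N) powr ((1 + \<alpha>) / 2) * L2_line_norm f"
      by (rule approximation_error[OF a(6,7) C(1) dec a(4,5,3)])
  qed
qed

end
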